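(* Assume the setting in the context. Let $X>5$ and let $t_1,t_2\in\mathbb{R}$ (in either order) both satisfy $(t+\Im(\mu_j))^2\ge(5/2+\Re(\mu_j))^2+X^2$ for all $j=1,\dots,r$. Set $$c_\theta:=\log Z_\theta(3/2)+\int_{3/2}^\infty\log\frac{Z_\theta(\sigma)}{z_\theta(\sigma)}\,d\sigma-\int_{3/2}^{5/2}\log z_\theta(\sigma)\,d\sigma+(\log4)\frac{z_\theta'}{z_\theta}(3/2).$$ Then $$\pi\int_{t_1}^{t_2}S(t)\,dt\le\frac14\log\left|Q\!\left(\tfrac32+it_2\right)\right|+\left(\log2-\tfrac12\right)\log\left|Q\!\left(\tfrac32+it_1\right)\right|+c_\theta r+\frac{r}{\sqrt2(X-5)}.$$
   Context: Let $r\ge1$ and $L(s)=\prod_{p}\prod_{j=1}^r(1-\alpha_{p,j}p^{-s})^{-1}$ (product over primes), absolutely convergent for $\Re(s)>1$, with complex $\alpha_{p,j}$ satisfying $|\alpha_{p,j}|\le p^{1/2}$; for all but finitely many $p$ there is a pairing $\alpha\mapsto\alpha'$ of the $\alpha_{p,j}$ with $|\alpha_{p,j}\alpha_{p,j}'|=1$, and for the exceptional $p$ such a pairing exists on a subset of the $\alpha_{p,j}$ with the remaining ones satisfying $|\alpha_{p,j}|\le1$. Let $\Gamma_{\mathbb{R}}(s)=\pi^{-s/2}\Gamma(s/2)$, $\gamma(s)=\epsilon N^{\frac12(s-\frac12)}\prod_{j=1}^r\Gamma_{\mathbb{R}}(s+\mu_j)$ with $|\epsilon|=1$, $N$ a positive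 integer, $\mu_j\in\mathbb{C}$ with $\Re(\mu_j)\ge-\frac12$, and $\Lambda(s)=\gamma(s)L(s)$. For a function $f$ write $\overline{f}(s)=\overline{f(\bar s)}$. Assume $\Lambda$ continues meromorphically to $\mathbb{C}$ as a ratio of entire functions of order $1$ and $\Lambda(s)=\overline{\Lambda}(1-s)$. Define $Q(s)=N\prod_{j=1}^r\frac{s+\mu_j}{2\pi}$. Assume $L$ has only finitely many poles, all on $\Re(s)=1$, at $1+\lambda_k$ with $\lambda_k\in i\mathbb{R}$, $k=1,\dots,m$ (with multiplicity), so that $P(s)P(s-1)\Lambda(s)$ is entire where $P(s)=\prod_{k=1}^m(s-\lambda_k)$. Assume there is $0\le\theta<\frac12$ with $|\alpha_{p,j}|\le p^\theta$ and $\Re(\mu_j)\ge-\theta$ for all $p,j$. For $\sigma>\theta+1$, $z_\theta(\sigma)=\left(\frac{\zeta(2\sigma+2\theta)\zeta(2\sigma-2\theta)}{\zeta(\sigma+\theta)\zeta(\sigma-\theta)}\right)^{1/2}$ and $Z_\theta(\sigma)=(\zeta(\sigma+\theta)\zeta(\sigma-\theta))^{1/2}$, $\zeta$ the Riemann zeta function. For $t$ not the ordinate of a zero or pole of $\Lambda$, $S(t)=\frac1\pi\Im\int_\infty^{1/2}\frac{L'}{L}(\sigma+it)\,d\sigma$ (integral along the horizontal line from $\infty+it$ to $\frac12+it$, i.e. by continuous variation of the argument), and at ordinates of zeros or poles $S(t)=\lim_{\varepsilon\to0^+}S(t+\varepsilon)$. *)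

theory Defs
  imports
    "HOL-Complex_Analysis.Complex_Analysis"
    "HOL-Computational_Algebra.Primes"
    "HOL-Library.Landau_Symbols"
begin

section \<open>Order of an entire function\<close>

definition entire_order :: "(complex \<Rightarrow> complex) \<Rightarrow> ereal" where
  "entire_order f =
     (INF a \<in> {a::real. 0 < a \<and> (\<lambda>z. norm (f z)) \<in> O[at_infinity](\<lambda>z. exp (norm z powr a))}. ereal a)"

definition ratio_of_entire_order_1 :: "(complex \<Rightarrow> complex) \<Rightarrow> bool" where
  "ratio_of_entire_order_1 F \<longleftrightarrow>
     (\<exists>f g. f holomorphic_on UNIV \<and> entire_order f = 1 \<and>
            g holomorphic_on UNIV \<and> entire_order g = 1 \<and>
            (\<forall>s. g s \<noteq> 0 \<longrightarrow> F s = f s / g s))"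

definition conj_fun :: "(complex \<Rightarrow> complex) \<Rightarrow> complex \<Rightarrow> complex" where
  "conj_fun f s = cnj (f (cnj s))"

section \<open>The Euler product and the completed function\<close>

definition euler_factor :: "nat \<Rightarrow> (nat \<Rightarrow> nat \<Rightarrow> complex) \<Rightarrow> complex \<Rightarrow> nat \<Rightarrow> complex" where
  "euler_factor r \<alpha> s p =
     (if prime p then \<Prod>j=1..r. inverse (1 - \<alpha> p j * of_nat p powr (-s)) else 1)"

text \<open>
  A pairing of the parameters at \<open>p\<close> with indices in \<open>J\<close> is an involution of \<open>J\<close>.
  Fixed points are allowed (they force absolute value 1), as they must be when \<open>r\<close> is odd.
\<close>

definition unitary_pairing :: "(nat \<Rightarrow> nat \<Rightarrow> complex) \<Rightarrow> nat \<Rightarrow> nat set \<Rightarrow> bool" where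
  "unitary_pairing \<alpha> p J \<longleftrightarrow>
     (\<exists>\<pi>. \<forall>j\<in>J. \<pi> j \<in> J \<and> \<pi> (\<pi> j) = j \<and> norm (\<alpha> p j * \<alpha> p (\<pi> j)) = 1)"

definition Gamma_R :: "complex \<Rightarrow> complex" where
  "Gamma_R s = of_real pi powr (- s / 2) * Gamma (s / 2)"

definition gamma_factor :: "nat \<Rightarrow> complex \<Rightarrow> nat \<Rightarrow> (nat \<Rightarrow> complex) \<Rightarrow> complex \<Rightarrow> complex" where
  "gamma_factor r \<epsilon> N \<mu> s =
     \<epsilon> * of_nat N powr ((s - 1/2) / 2) * (\<Prod>j=1..r. Gamma_R (s + \<mu> j))"

text \<open>
  The product of the gamma factor and \<open>L\<close> as a meromorphic function. The pointwise product is
  wrong where a pole of one meets a zero of the other (\<^const>\<open>Gamma\<close> is \<open>0\<close> at its poles);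
  \<^const>\<open>remove_sings\<close> fills in the limit there and gives the value \<open>0\<close> at genuine poles.
\<close>

definition completed_L ::
  "nat \<Rightarrow> complex \<Rightarrow> nat \<Rightarrow> (nat \<Rightarrow> complex) \<Rightarrow> (complex \<Rightarrow> complex) \<Rightarrow> complex \<Rightarrow> complex" where
  "completed_L r \<epsilon> N \<mu> L = remove_sings (\<lambda>s. gamma_factor r \<epsilon> N \<mu> s * L s)"

definition Q_fun :: "nat \<Rightarrow> nat \<Rightarrow> (nat \<Rightarrow> complex) \<Rightarrow> complex \<Rightarrow> complex" where
  "Q_fun r N \<mu> s = of_nat N * (\<Prod>j=1..r. (s + \<mu> j) / (2 * of_real pi))"

text \<open>
  \<open>L\<close> is the meromorphic continuation to the whole plane; being nicely meromorphic fixes its values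
  at removable singularities and at poles, so it is determined by the Euler product.
  The zeros of the polynomial \<open>P(s) = (s - lam 1) \<cdots> (s - lam m)\<close> are the \<open>lam k\<close>. With the bounds on
  the \<open>\<mu> j\<close>, the functional equation and \<open>L_poles\<close> imply that \<open>P(s) P(s - 1) \<Lambda>(s)\<close> is entire,
  so this is not listed as an assumption.
\<close>

locale L_function =
  fixes r :: nat
    and \<alpha> :: "nat \<Rightarrow> nat \<Rightarrow> complex"
    and \<epsilon> :: complex
    and N :: nat
    and \<mu> :: "nat \<Rightarrow> complex"
    and L :: "complex \<Rightarrow> complex"
    and m :: nat
    and lam :: "nat \<Rightarrow> complex"
    and \<theta> :: real
  assumes degree_pos: "r \<ge> 1"
    and euler_convergent: "\<And>s. Re s > 1 \<Longrightarrow> abs_convergent_prod (euler_factor r \<alpha> s)"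
    and euler_product: "\<And>s. Re s > 1 \<Longrightarrow> L s = (\<Prod>p. euler_factor r \<alpha> s p)"
    and alpha_bound_half: "\<And>p j. prime p \<Longrightarrow> j \<in> {1..r} \<Longrightarrow> norm (\<alpha> p j) \<le> real p powr (1/2)"
    and alpha_pairing: "finite {p. prime p \<and> \<not> unitary_pairing \<alpha> p {1..r}}"
    and alpha_pairing_exceptional:
      "\<And>p. prime p \<Longrightarrow> \<not> unitary_pairing \<alpha> p {1..r} \<Longrightarrow>
         \<exists>J\<subseteq>{1..r}. unitary_pairing \<alpha> p J \<and> (\<forall>j\<in>{1..r} - J. norm (\<alpha> p j) \<le> 1)"
    and epsilon_norm: "norm \<epsilon> = 1"
    and conductor_pos: "N > 0"
    and mu_bound_half: "\<And>j. j \<in> {1..r} \<Longrightarrow> Re (\<mu> j) \<ge> - 1/2"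
    and L_meromorphic: "L nicely_meromorphic_on UNIV"
    and Lambda_ratio: "ratio_of_entire_order_1 (completed_L r \<epsilon> N \<mu> L)"
    and functional_equation:
      "\<And>s. completed_L r \<epsilon> N \<mu> L s = conj_fun (completed_L r \<epsilon> N \<mu> L) (1 - s)"
    and lambda_imaginary: "\<And>k. k \<in> {1..m} \<Longrightarrow> Re (lam k) = 0"
    and L_poles:
      "\<And>z. int (card {k\<in>{1..m}. 1 + lam k = z}) = (if is_pole L z then - zorder L z else 0)"
    and theta_range: "0 \<le> \<theta>" "\<theta> < 1/2"
    and alpha_bound: "\<And>p j. prime p \<Longrightarrow> j \<in> {1..r} \<Longrightarrow> norm (\<alpha> p j) \<le> real p powr \<theta>"
    and mu_bound: "\<And>j. j \<in> {1..r} \<Longrightarrow> Re (\<mu> j) \<ge> - \<theta>"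

section \<open>The function $S(t)$\<close>

text \<open>
  The interval integral is oriented: it runs from \<open>\<infinity>\<close> down to \<open>1/2\<close>.
\<close>

definition S_regular :: "(complex \<Rightarrow> complex) \<Rightarrow> real \<Rightarrow> real" where
  "S_regular L t =
     1 / pi * Im (LBINT \<sigma>=\<infinity>..ereal (1/2). deriv L (Complex \<sigma> t) / L (Complex \<sigma> t))"

definition singular_ordinate :: "(complex \<Rightarrow> complex) \<Rightarrow> real \<Rightarrow> bool" where
  "singular_ordinate \<Lambda> t \<longleftrightarrow> (\<exists>z. Im z = t \<and> (\<Lambda> z = 0 \<or> is_pole \<Lambda> z))"

definition S_fun :: "(complex \<Rightarrow> complex) \<Rightarrow> (complex \<Rightarrow> complex) \<Rightarrow> real \<Rightarrow> real" where
  "S_fun \<Lambda> L t =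
     (if singular_ordinate \<Lambda> t then Lim (at_right t) (S_regular L) else S_regular L t)"

section \<open>The constant $c_\theta$\<close>

text \<open>The Riemann zeta function on the half-line \<open>x > 1\<close>, the only place where it is needed.\<close>

definition zeta_real :: "real \<Rightarrow> real" where
  "zeta_real x = (\<Sum>n. 1 / real (Suc n) powr x)"

definition z_theta :: "real \<Rightarrow> real \<Rightarrow> real" where
  "z_theta \<theta> \<sigma> =
     sqrt (zeta_real (2 * \<sigma> + 2 * \<theta>) * zeta_real (2 * \<sigma> - 2 * \<theta>)
           / (zeta_real (\<sigma> + \<theta>) * zeta_real (\<sigma> - \<theta>)))"

definition Z_theta :: "real \<Rightarrow> real \<Rightarrow> real" where
  "Z_theta \<theta> \<sigma> = sqrt (zeta_real (\<sigma> + \<theta>) * zeta_real (\<sigma> - \<theta>))"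

definition c_theta :: "real \<Rightarrow> real" where
  "c_theta \<theta> =
     ln (Z_theta \<theta> (3/2))
     + (LBINT \<sigma>=ereal (3/2)..\<infinity>. ln (Z_theta \<theta> \<sigma> / z_theta \<theta> \<sigma>))
     - (LBINT \<sigma>=ereal (3/2)..ereal (5/2). ln (z_theta \<theta> \<sigma>))
     + ln 4 * (deriv (z_theta \<theta>) (3/2) / z_theta \<theta> (3/2))"

end

theory Submission
  imports Defs
begin

text \<open>
  Moving the contour to the right (Littlewood) turns \<open>\<pi> \<integral> S\<close> into the difference of
  \<open>\<integral> ln \<bar>L(\<sigma> + it)\<bar> d\<sigma>\<close> over \<open>\<sigma> \<ge> 1/2\<close> at \<open>t\<^sub>2\<close> and at \<open>t\<^sub>1\<close>; for \<open>\<sigma> > 3/2\<close> the Euler product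
  and the pairing of the parameters bound both integrals by \<open>Z\<^sub>\<theta>\<close> and \<open>z\<^sub>\<theta>\<close>. At \<open>t\<^sub>2\<close> the remaining piece is
  bounded above by convexity between \<open>Re s = -1/2\<close>, where the functional equation produces \<open>Q\<close>, and
  \<open>Re s = 3/2\<close>. At \<open>t\<^sub>1\<close> it is bounded below by comparing \<open>\<sigma>\<close> with \<open>\<sigma> + 1\<close>: pairing every zero \<open>\<rho>\<close> of
  \<open>\<Lambda>\<close> with \<open>1 - cnj \<rho>\<close>, the increment of \<open>ln \<bar>\<Lambda>\<bar>\<close> integrates to at most \<open>ln 4\<close> times the real part
  of \<open>\<Lambda>'/\<Lambda>\<close> at \<open>3/2 + it\<close>, zero by zero, and Stirling's formula evaluates the gamma factors.
\<close>

section \<open>The primitive of the logarithm of a distance\<close>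

text \<open>Near zeros \<open>ln |L|\<close> has no pointwise lower bound, which makes
  \<open>t1\<close> the hard end. The shift to \<sigma> + 1 reaches the region of the Euler product,
  and its cost is an increment of \<open>ln |Xi|\<close>, \<open>Xi\<close> = P(s) P(s - 1)
  \<Lambda>(s), in which each zero contributes explicitly. The factor ln 4 is sharp: for a zero at
  1/2 + it both sides of the kernel inequality equal 2 ln 4. At 3/2 + it the log-derivative of a
  gamma factor is about half of ln (|3/2 + it + \<mu>| / (2 pi)), and so is its integrated
  increment; ln 4 times the former minus the latter leaves ln 2 - 1/2. The 1/4 at \<open>t2\<close>
  is the integral of the convexity weight (3/2 - \<sigma>) / 2. The factorization used on a disc has
  finitely many zeros, not closed under reflection. So it is applied at s and at 1 - cnj s and
  averaged; the error of the zero-free factor is made arbitrarily small by enlarging the disc. Poles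
  of L could spoil both ends. Every pole 1 + \<open>lam k\<close> is matched with some \<mu> j = -
  \<open>lam k\<close>, so it lies at least X away from both heights, and there are at most r poles;
  all corrections are thus of size r / X^2.\<close>

text \<open>
  At \<open>y = 0\<close> the last summand is \<open>0\<close> whatever the value of \<open>v / 0\<close>, which leaves a primitive of
  \<open>ln \<bar>v\<bar>\<close>.
\<close>

definition log_prim :: "real \<Rightarrow> real \<Rightarrow> real" where
  "log_prim y v = v / 2 * ln (v\<^sup>2 + y\<^sup>2) - v + y * arctan (v / y)"

lemma log_prim_minus: "log_prim y (- v) = - log_prim y v"
  by (simp add: log_prim_def arctan_minus)

lemma log_prim_0: "log_prim y 0 = 0"
  by (simp add: log_prim_def)

lemma ln_cmod_Complex: "ln (cmod (Complex v y)) = ln (v\<^sup>2 + y\<^sup>2) / 2"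
  by (simp add: cmod_def ln_sqrt)

lemma log_prim_deriv:
  assumes "v \<noteq> 0 \<or> y \<noteq> 0"
  shows "(log_prim y has_real_derivative ln (v\<^sup>2 + y\<^sup>2) / 2) (at v)"
proof -
  have pos: "v\<^sup>2 + y\<^sup>2 > 0"
    using assms by (metis sum_power2_gt_zero_iff)
  have q: "((\<lambda>v. v\<^sup>2 + y\<^sup>2) has_real_derivative 2 * v) (at v)"
    by (auto intro!: derivative_eq_intros)
  have l: "((\<lambda>v. ln (v\<^sup>2 + y\<^sup>2)) has_real_derivative (2 * v) / (v\<^sup>2 + y\<^sup>2)) (at v)"
    using DERIV_chain2[OF DERIV_ln_divide[OF pos] q] by simp
  have a: "((\<lambda>v. arctan (v / y)) has_real_derivative (1 / y) / (1 + (v / y)\<^sup>2)) (at v)"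
    using DERIV_chain2[OF DERIV_arctan DERIV_cdivide[OF DERIV_ident]] by (simp add: field_simps)
  have h: "((\<lambda>v::real. v / 2) has_real_derivative 1/2) (at v)"
    by (auto intro!: derivative_eq_intros)
  have *: "(log_prim y has_real_derivative
      (1/2 * ln (v\<^sup>2 + y\<^sup>2) + v / 2 * ((2 * v) / (v\<^sup>2 + y\<^sup>2)) - 1 + y * ((1 / y) / (1 + (v / y)\<^sup>2)))) (at v)"
  proof -
    note DERIV_mult[OF h l] DERIV_cmult[OF a, of y]
    from DERIV_add[OF DERIV_diff[OF this(1) DERIV_ident] this(2)]
    show ?thesis unfolding log_prim_def[abs_def] by (simp only: mult.commute)
  qed
  show ?thesis
  proof (cases "y = 0")
    case True
    then show ?thesis using * assms by (simp add: power2_eq_square)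
  next
    case False
    have "y * ((1 / y) / (1 + (v / y)\<^sup>2)) = y\<^sup>2 / (v\<^sup>2 + y\<^sup>2)"
      using False pos by (simp add: field_simps power2_eq_square)
    moreover have "v / 2 * ((2 * v) / (v\<^sup>2 + y\<^sup>2)) = v\<^sup>2 / (v\<^sup>2 + y\<^sup>2)"
      by (simp add: power2_eq_square)
    moreover have "v\<^sup>2 / (v\<^sup>2 + y\<^sup>2) + y\<^sup>2 / (v\<^sup>2 + y\<^sup>2) = 1"
      using pos by (metis add_divide_distrib divide_self less_irrefl)
    ultimately have "1/2 * ln (v\<^sup>2 + y\<^sup>2) + v / 2 * ((2 * v) / (v\<^sup>2 + y\<^sup>2)) - 1
        + y * ((1 / y) / (1 + (v / y)\<^sup>2)) = ln (v\<^sup>2 + y\<^sup>2) / 2"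
      by linarith
    then show ?thesis using * by (simp only:)
  qed
qed

lemma tendsto_x_ln_abs: "((\<lambda>x::real. x * ln (x\<^sup>2)) \<longlongrightarrow> 0) (at 0)"
proof -
  have "((\<lambda>x::real. x * ln (x\<^sup>2)) \<longlongrightarrow> 0) (at_right 0)"
    by real_asymp
  moreover have "((\<lambda>x::real. x * ln (x\<^sup>2)) \<longlongrightarrow> 0) (at_left 0)"
    by real_asymp
  ultimately show ?thesis by (simp add: filterlim_at_split)
qed

text \<open>The derivative is missing only at v = y = 0, where continuity follows from v ln (v^2)
  tending to 0. This lets the fundamental theorem run across a zero lying on the segment
  itself.\<close>

lemma continuous_log_prim: "continuous_on A (log_prim y)"
proof (rule continuous_on_subset[OF _ subset_UNIV], unfold continuous_on_eq_continuous_at[OF open_UNIV], rule ballI)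
  fix v :: real
  show "isCont (log_prim y) v"
  proof (cases "v \<noteq> 0 \<or> y \<noteq> 0")
    case True
    then show ?thesis using log_prim_deriv DERIV_isCont by blast
  next
    case False
    have "((\<lambda>x::real. x * ln (x\<^sup>2) / 2 - x) \<longlongrightarrow> 0 / 2 - 0) (at 0)"
      by (intro tendsto_intros tendsto_x_ln_abs) auto
    then show ?thesis using False by (simp add: isCont_def log_prim_def [abs_def])
  qed
qed

text \<open>The two rational terms v y / (v^2 + y^2) cancel and only the angle remains. With y = t -
  Im \<rho> this is the change of argument caused by \<rho> when the segment moves vertically, the
  local form of Littlewood's lemma.\<close>

lemma log_prim_deriv_y:
  assumes "y \<noteq> 0"
  shows "((\<lambda>y. log_prim y v) has_real_derivative arctan (v / y)) (at y)"
proof -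
  have pos: "v\<^sup>2 + y\<^sup>2 > 0"
    using assms by (metis sum_power2_gt_zero_iff)
  have d: "((\<lambda>y. v / y) has_real_derivative - v / y\<^sup>2) (at y)"
    using assms by (auto intro!: derivative_eq_intros simp: power2_eq_square)
  have a: "((\<lambda>y. arctan (v / y)) has_real_derivative (- v / y\<^sup>2) / (1 + (v / y)\<^sup>2)) (at y)"
    using DERIV_chain2[OF DERIV_arctan d] by (simp add: field_simps)
  have q: "((\<lambda>y. v\<^sup>2 + y\<^sup>2) has_real_derivative 2 * y) (at y)"
    by (auto intro!: derivative_eq_intros)
  have l: "((\<lambda>y. ln (v\<^sup>2 + y\<^sup>2)) has_real_derivative (2 * y) / (v\<^sup>2 + y\<^sup>2)) (at y)"
    using DERIV_chain2[OF DERIV_ln_divide[OF pos] q] by simp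
  have *: "((\<lambda>y. log_prim y v) has_real_derivative
      (v / 2 * ((2 * y) / (v\<^sup>2 + y\<^sup>2)) + (arctan (v / y) + y * ((- v / y\<^sup>2) / (1 + (v / y)\<^sup>2))))) (at y)"
  proof -
    have "((\<lambda>y. v / 2 * ln (v\<^sup>2 + y\<^sup>2)) has_real_derivative v / 2 * ((2 * y) / (v\<^sup>2 + y\<^sup>2))) (at y)"
      by (rule DERIV_cmult[OF l])
    moreover have "((\<lambda>y. y * arctan (v / y)) has_real_derivative
        1 * arctan (v / y) + ((- v / y\<^sup>2) / (1 + (v / y)\<^sup>2)) * y) (at y)"
      by (rule DERIV_mult[OF DERIV_ident a])
    ultimately have "((\<lambda>y. v / 2 * ln (v\<^sup>2 + y\<^sup>2) - v + y * arctan (v / y)) has_real_derivative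
        v / 2 * ((2 * y) / (v\<^sup>2 + y\<^sup>2)) - 0 + (1 * arctan (v / y) + ((- v / y\<^sup>2) / (1 + (v / y)\<^sup>2)) * y)) (at y)"
      by (intro DERIV_add DERIV_diff DERIV_const)
    then show ?thesis unfolding log_prim_def by (simp add: mult.commute)
  qed
  have "y * ((- v / y\<^sup>2) / (1 + (v / y)\<^sup>2)) = - (v * y / (v\<^sup>2 + y\<^sup>2))"
    using assms pos by (simp add: field_simps power2_eq_square)
  then show ?thesis using * by simp
qed

text \<open>The derivative in y jumps at y = 0, but the function does not: \<open>arctan\<close> is
  bounded and carries the factor y. Hence crossing the ordinate of a zero contributes no
  jump.\<close>

lemma continuous_log_prim_y: "continuous_on A (\<lambda>y. log_prim y v)"
proof (cases "v = 0")
  case True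
  then show ?thesis by (simp add: log_prim_0)
next
  case False
  have pos: "v\<^sup>2 + y\<^sup>2 > 0" for y
    using False by (metis sum_power2_gt_zero_iff)
  have "isCont (\<lambda>y. y * arctan (v / y)) y" for y
  proof (cases "y = 0")
    case True
    have "((\<lambda>y. y * arctan (v / y)) \<longlongrightarrow> 0) (at 0)"
    proof (rule Lim_null_comparison)
      show "\<forall>\<^sub>F x in at 0. norm (x * arctan (v / x)) \<le> \<bar>x\<bar> * (pi / 2)"
      proof (intro always_eventually allI)
        fix x :: real
        have "\<bar>arctan (v / x)\<bar> \<le> pi / 2" using arctan_bounded[of "v / x"] by linarith
        then show "norm (x * arctan (v / x)) \<le> \<bar>x\<bar> * (pi / 2)"
          unfolding real_norm_def abs_mult by (intro mult_left_mono) auto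
      qed
      show "((\<lambda>x::real. \<bar>x\<bar> * (pi / 2)) \<longlongrightarrow> 0) (at 0)"
        by (auto intro!: tendsto_eq_intros)
    qed
    then show ?thesis using True by (simp add: isCont_def)
  next
    case False
    then show ?thesis by (intro continuous_intros) auto
  qed
  then have "continuous_on A (\<lambda>y. y * arctan (v / y))"
    by (intro continuous_at_imp_continuous_on) auto
  moreover have "continuous_on A (\<lambda>y. v / 2 * ln (v\<^sup>2 + y\<^sup>2) - v)"
    using pos by (intro continuous_intros) (metis less_irrefl)+
  ultimately show ?thesis
    unfolding log_prim_def by (rule continuous_on_add[rotated])
qed

lemma ln_has_integral:
  assumes "a \<le> b"
  shows "((\<lambda>v. ln (cmod (Complex (v + d) y))) has_integral (log_prim y (b + d) - log_prim y (a + d))) {a..b}"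
\<comment> \<open>At v = -d the integrand is infinite in truth when y = 0; the point is excluded and
  continuity of the primitive suffices.\<close>
proof (rule fundamental_theorem_of_calculus_interior_strong[where S = "{-d}"])
  fix x assume "x \<in> {a<..<b} - {-d}"
  then have "x + d \<noteq> 0" by auto
  then have "((\<lambda>v. log_prim y (v + d)) has_real_derivative ln ((x + d)\<^sup>2 + y\<^sup>2) / 2) (at x)"
    using log_prim_deriv[of "x + d" y] by (simp add: DERIV_shift)
  then show "((\<lambda>v. log_prim y (v + d)) has_vector_derivative ln (cmod (Complex (x + d) y))) (at x)"
    by (simp add: ln_cmod_Complex has_real_derivative_iff_has_vector_derivative)
next
  show "continuous_on {a..b} (\<lambda>v. log_prim y (v + d))"
    by (intro continuous_on_compose2[OF continuous_log_prim[of UNIV]] continuous_intros) auto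
qed (use assms in auto)

lemma ln_cmod_deriv:
  assumes "f field_differentiable (at (Complex \<sigma> t))" "f (Complex \<sigma> t) \<noteq> 0"
  shows "((\<lambda>\<sigma>. ln (cmod (f (Complex \<sigma> t)))) has_real_derivative
           Re (deriv f (Complex \<sigma> t) / f (Complex \<sigma> t))) (at \<sigma>)"
proof -
  define s where "s = Complex \<sigma> t"
  have c: "((\<lambda>\<sigma>. Complex \<sigma> t) has_vector_derivative 1) (at \<sigma>)"
    unfolding has_vector_derivative_complex_iff by (auto intro!: derivative_eq_intros)
  have fd: "((\<lambda>\<sigma>. f (Complex \<sigma> t)) has_vector_derivative deriv f s) (at \<sigma>)"
    using field_vector_diff_chain_at[OF c, of f "deriv f s"] assms(1)
    by (simp add: o_def s_def field_differentiable_derivI)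
  then have d: "((\<lambda>\<sigma>. Re (f (Complex \<sigma> t))) has_real_derivative Re (deriv f s)) (at \<sigma>)"
      "((\<lambda>\<sigma>. Im (f (Complex \<sigma> t))) has_real_derivative Im (deriv f s)) (at \<sigma>)"
    unfolding has_vector_derivative_complex_iff by auto
  have pos: "(Re (f s))\<^sup>2 + (Im (f s))\<^sup>2 > 0"
    using assms(2) by (metis cmod_power2 s_def zero_less_norm_iff zero_less_power)
  have q: "((\<lambda>\<sigma>. (Re (f (Complex \<sigma> t)))\<^sup>2 + (Im (f (Complex \<sigma> t)))\<^sup>2) has_real_derivative
      2 * (Re (f s) * Re (deriv f s) + Im (f s) * Im (deriv f s))) (at \<sigma>)"
    using DERIV_add[OF DERIV_power[OF d(1), of 2] DERIV_power[OF d(2), of 2]]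
    by (simp add: s_def algebra_simps)
  have "((\<lambda>\<sigma>. ln ((Re (f (Complex \<sigma> t)))\<^sup>2 + (Im (f (Complex \<sigma> t)))\<^sup>2) / 2) has_real_derivative
      1 / ((Re (f s))\<^sup>2 + (Im (f s))\<^sup>2) * (2 * (Re (f s) * Re (deriv f s) + Im (f s) * Im (deriv f s))) / 2) (at \<sigma>)"
    by (rule DERIV_cdivide, rule DERIV_chain2[OF _ q], unfold s_def, rule DERIV_ln_divide)
       (use pos in \<open>simp add: s_def\<close>)
  moreover have "ln (cmod w) = ln ((Re w)\<^sup>2 + (Im w)\<^sup>2) / 2" for w
    using ln_cmod_Complex[of "Re w" "Im w"] by simp
  moreover have "1 / ((Re (f s))\<^sup>2 + (Im (f s))\<^sup>2) * (2 * (Re (f s) * Re (deriv f s) + Im (f s) * Im (deriv f s))) / 2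
      = Re (deriv f s / f s)"
  proof -
    have *: "1 / p * (2 * x) / 2 = x / p" for p x :: real by simp
    show ?thesis unfolding * by (simp add: Re_divide mult.commute)
  qed
  ultimately show ?thesis by (simp only: s_def)
qed

section \<open>The contribution of a pair of zeros\<close>

text \<open>Writing A = 1 - u^2, the product of the two denominators is A^2 + 2 Y (2 - A) + Y^2. The
  symmetric sum thus depends on u only through A, which turns the comparisons below into polynomial
  inequalities.\<close>

lemma kernel_pair:
  fixes Y :: real
  assumes "Y \<ge> 0" "\<bar>u\<bar> < 1"
  shows "(1+u)/((1+u)\<^sup>2+Y) + (1-u)/((1-u)\<^sup>2+Y)
     = 2*((1-u\<^sup>2)+Y)/((1-u\<^sup>2)\<^sup>2+2*Y*(2-(1-u\<^sup>2))+Y\<^sup>2)"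
    and "(1-u\<^sup>2)\<^sup>2+2*Y*(2-(1-u\<^sup>2))+Y\<^sup>2 > 0"
proof -
  have p: "(1+u)\<^sup>2+Y > 0" "(1-u)\<^sup>2+Y > 0"
    using assms by (auto intro!: add_pos_nonneg)
  have eq: "((1+u)\<^sup>2+Y) * ((1-u)\<^sup>2+Y) = (1-u\<^sup>2)\<^sup>2+2*Y*(2-(1-u\<^sup>2))+Y\<^sup>2"
    by (simp add: power2_eq_square algebra_simps)
  show "(1-u\<^sup>2)\<^sup>2+2*Y*(2-(1-u\<^sup>2))+Y\<^sup>2 > 0"
    using p eq by (metis mult_pos_pos)
  have "(1+u)/((1+u)\<^sup>2+Y) + (1-u)/((1-u)\<^sup>2+Y)
      = ((1+u) * ((1-u)\<^sup>2+Y) + (1-u) * ((1+u)\<^sup>2+Y)) / (((1+u)\<^sup>2+Y) * ((1-u)\<^sup>2+Y))"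
    using p by (subst add_frac_eq) (auto simp: mult_ac)
  also have "(1+u) * ((1-u)\<^sup>2+Y) + (1-u) * ((1+u)\<^sup>2+Y) = 2*((1-u\<^sup>2)+Y)"
    by (simp add: power2_eq_square algebra_simps)
  finally show "(1+u)/((1+u)\<^sup>2+Y) + (1-u)/((1-u)\<^sup>2+Y)
     = 2*((1-u\<^sup>2)+Y)/((1-u\<^sup>2)\<^sup>2+2*Y*(2-(1-u\<^sup>2))+Y\<^sup>2)"
    unfolding eq .
qed

text \<open>After cross-multiplication the difference is A - B times a polynomial in Y with
  nonnegative coefficients. For u between a and 1 it gives growth of the kernel sum by at most the
  factor (1 - a^2) / (1 - u^2).\<close>

lemma kernel_outer:
  fixes A B Y :: real
  assumes "0 < B" "B \<le> A" "A \<le> 1" "Y \<ge> 0"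
  shows "((B+Y)/(B\<^sup>2+2*Y*(2-B)+Y\<^sup>2)) * B \<le> ((A+Y)/(A\<^sup>2+2*Y*(2-A)+Y\<^sup>2)) * A"
proof -
  have pA: "A\<^sup>2+2*Y*(2-A)+Y\<^sup>2 > 0" and pB: "B\<^sup>2+2*Y*(2-B)+Y\<^sup>2 > 0"
    using assms by (auto intro!: add_pos_nonneg mult_nonneg_nonneg)
  have "(A+Y)*A*(B\<^sup>2+2*Y*(2-B)+Y\<^sup>2) - (B+Y)*B*(A\<^sup>2+2*Y*(2-A)+Y\<^sup>2)
     = Y*((A-B)*(4*(A+B)-3*(A*B))) + Y\<^sup>2*((A-B)*(A+B+4)) + Y^3*(A-B)"
    by (simp add: power2_eq_square power3_eq_cube algebra_simps)
  also have "\<dots> \<ge> 0"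
  proof -
    have "A * B \<le> B" using assms by (simp add: mult_left_le_one_le)
    then have "4*(A+B)-3*(A*B) \<ge> 0" using assms by argo
    then show ?thesis using assms by (intro add_nonneg_nonneg mult_nonneg_nonneg) auto
  qed
  finally show ?thesis using pA pB by (simp add: field_simps)
qed

text \<open>For u at most a the kernel sum can exceed its value at a, but only by a relative amount
  9/10 a^2. The constant is large enough for the polynomial inequality \<open>WZ\<close> and small
  enough to be absorbed in \<open>kernel_final\<close>.\<close>

lemma kernel_inner:
  fixes A B Y :: real
  assumes "3/4 \<le> A" "A \<le> B" "B \<le> 1" "Y \<ge> 0"
  shows "(B+Y)/(B\<^sup>2+2*Y*(2-B)+Y\<^sup>2) \<le> (1+9/10*(1-A)) * ((A+Y)/(A\<^sup>2+2*Y*(2-A)+Y\<^sup>2))"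
proof -
  have pA: "A\<^sup>2+2*Y*(2-A)+Y\<^sup>2 > 0" and pB: "B\<^sup>2+2*Y*(2-B)+Y\<^sup>2 > 0"
    using assms by (auto intro!: add_pos_nonneg mult_nonneg_nonneg)
  define Z where "Z = (A+Y)*(B\<^sup>2+2*Y*(2-B)+Y\<^sup>2)"
  define W where "W = (4-A-B)*Y+3*Y\<^sup>2-A*B"
  have Z0: "Z \<ge> 0" unfolding Z_def using assms pB by simp
  have id1: "(B+Y)*(A\<^sup>2+2*Y*(2-A)+Y\<^sup>2) - Z = (B-A)*W"
    unfolding W_def Z_def by (simp add: power2_eq_square algebra_simps)
  \<comment> \<open>As a cubic in Y, W - 9/10 Z has its lower coefficients controlled by
    \<open>c0\<close>, \<open>c1\<close>, \<open>c2\<close>. What remains is 1/3 Y + 525/1000 Y^2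
    \<le> 9/10 + 9/10 Y^3, settled separately for Y up to 1 and beyond.\<close>
  have WZ: "W \<le> 9/10*Z"
  proof -
    have c0: "A*B + 9/10*(A*B\<^sup>2) \<ge> 9/10"
    proof -
      have ab: "A*B \<ge> 3/4*(3/4)" using assms by (intro mult_mono) auto
      have "A*B\<^sup>2 = (A*B)*B" by (simp add: power2_eq_square)
      also have "\<dots> \<ge> (3/4*(3/4))*(3/4)" using ab assms by (intro mult_mono) auto
      finally show ?thesis using ab by simp
    qed
    have c1: "4-A-B - 9/10*B\<^sup>2 - 18/10*(A*(2-B)) \<le> 1/3"
    proof -
      have "3/4*(2-B) \<le> A*(2-B)" using assms by (intro mult_right_mono) auto
      moreover have "B\<^sup>2 \<ge> 2*(3/4)*B-(3/4)\<^sup>2"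
        using zero_le_power2[of "B-3/4"] by (simp add: power2_diff)
      ultimately show ?thesis using assms by (simp add: power2_eq_square)
    qed
    have c2: "3 - 9/10*(A+4-2*B) \<le> 525/1000" using assms by (simp add: algebra_simps)
    have id2: "W - 9/10*Z = - (A*B + 9/10*(A*B\<^sup>2)) + (4-A-B - 9/10*B\<^sup>2 - 18/10*(A*(2-B)))*Y
        + (3 - 9/10*(A+4-2*B))*Y\<^sup>2 - 9/10*Y^3"
      unfolding W_def Z_def by (simp add: power2_eq_square power3_eq_cube field_simps)
    have "(4-A-B - 9/10*B\<^sup>2 - 18/10*(A*(2-B)))*Y \<le> 1/3*Y"
      using c1 assms by (intro mult_right_mono) auto
    moreover have "(3 - 9/10*(A+4-2*B))*Y\<^sup>2 \<le> 525/1000*Y\<^sup>2"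
      using c2 by (intro mult_right_mono) auto
    moreover have "1/3*Y + 525/1000*Y\<^sup>2 \<le> 9/10 + 9/10*Y^3"
    proof (cases "Y \<le> 1")
      case True
      then have "Y\<^sup>2 \<le> 1" using assms by (simp add: power_le_one)
      moreover have "Y^3 \<ge> 0" using assms by simp
      ultimately show ?thesis using True by linarith
    next
      case False
      then have "Y\<^sup>2 \<le> Y^3" "Y \<le> Y^3" using power_increasing[of 2 3 Y] power_increasing[of 1 3 Y] by auto
      then show ?thesis using False by linarith
    qed
    ultimately show ?thesis using c0 id2 by linarith
  qed
  have "(B-A)*W \<le> 9/10*(1-A)*Z"
  proof (cases "W \<le> 0")
    case True
    then have "(B-A)*W \<le> 0" using assms by (simp add: mult_nonneg_nonpos)
    also have "0 \<le> 9/10*(1-A)*Z" using assms Z0 by simp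
    finally show ?thesis .
  next
    case False
    then have "(B-A)*W \<le> (1-A)*(9/10*Z)" using assms WZ by (intro mult_mono) auto
    then show ?thesis by (simp only: mult_ac)
  qed
  moreover have "(1+9/10*(1-A))*Z = Z + 9/10*(1-A)*Z" by (simp only: distrib_right mult_1)
  ultimately have "(B+Y)*(A\<^sup>2+2*Y*(2-A)+Y\<^sup>2) \<le> (1+9/10*(1-A))*Z"
    using id1 by linarith
  then show ?thesis using pA pB unfolding Z_def by (simp add: field_simps)
qed

text \<open>The factor multiplying v on the right is half of the kernel sum at distances 1 + a and 1
  - a. At distance 3/2 or more from the zero, 1 / (v^2 + Y) is no larger than that half sum.\<close>

lemma kernel_tail:
  fixes A Y v :: real
  assumes "3/4 \<le> A" "A \<le> 1" "Y \<ge> 0" "v \<ge> 3/2"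
  shows "v/(v\<^sup>2+Y) \<le> v * ((A+Y)/(A\<^sup>2+2*Y*(2-A)+Y\<^sup>2))"
proof -
  have pA: "A\<^sup>2+2*Y*(2-A)+Y\<^sup>2 > 0" and pv: "v\<^sup>2+Y > 0"
    using assms by (auto intro!: add_pos_nonneg mult_nonneg_nonneg)
  have v2: "v\<^sup>2 \<ge> 9/4" using power_mono[OF assms(4), of 2] by (simp add: power2_eq_square)
  have "(v\<^sup>2+Y)*(A+Y) - (A\<^sup>2+2*Y*(2-A)+Y\<^sup>2) = A*(v\<^sup>2-A) + Y*(v\<^sup>2+3*A-4)"
    by (simp add: power2_eq_square algebra_simps)
  also have "\<dots> \<ge> 0" using assms v2 by (intro add_nonneg_nonneg mult_nonneg_nonneg) auto
  finally have "1/(v\<^sup>2+Y) \<le> (A+Y)/(A\<^sup>2+2*Y*(2-A)+Y\<^sup>2)"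
    using pA pv by (simp add: field_simps)
  then have "v * (1/(v\<^sup>2+Y)) \<le> v * ((A+Y)/(A\<^sup>2+2*Y*(2-A)+Y\<^sup>2))"
    using assms by (intro mult_left_mono) auto
  then show ?thesis by simp
qed

lemma ln_one_plus_ge: 
  fixes a :: real assumes "a \<ge> 0" shows "a - a\<^sup>2/2 \<le> ln (1+a)"
proof -
  have "(\<lambda>x. ln (1+x) - (x - x\<^sup>2/2)) 0 \<le> (\<lambda>x. ln (1+x) - (x - x\<^sup>2/2)) a"
  proof (rule DERIV_nonneg_imp_nondecreasing[OF assms])
    fix x :: real assume "0 \<le> x" "x \<le> a"
    then show "\<exists>y. ((\<lambda>x. ln (1+x) - (x - x\<^sup>2/2)) has_real_derivative y) (at x) \<and> 0 \<le> y"
      by (intro exI[of _ "1/(1+x) - (1 - x)"])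
         (auto intro!: derivative_eq_intros simp: field_simps)
  qed
  then show ?thesis by simp
qed

text \<open>There is equality at a = 0, so low-order terms must cancel exactly. With ln (1 + a)
  replaced by a - a^2 / 2 the terms a and a^2 do cancel, leaving a^2 (38/10 a - 28/10 a^2) \<le> 2
  a^2 ln 2, for which ln 2 \<ge> 2/3 is enough.\<close>

lemma kernel_final:
  fixes a :: real assumes "0 \<le> a" "a \<le> 1/2"
  shows "a\<^sup>2 + 2*(1-a)*(a*(1+9/10*a\<^sup>2)) + 2*(1-a\<^sup>2)*(ln 2 - ln (1+a)) \<le> 2 * ln 2"
proof -
  have a2: "a\<^sup>2 \<le> 1/4" using power_mono[OF assms(2,1), of 2] by (simp add: power2_eq_square)
  have "(1-a\<^sup>2)*(a - a\<^sup>2/2) \<le> (1-a\<^sup>2)*ln(1+a)"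
    using ln_one_plus_ge[OF assms(1)] a2 by (intro mult_left_mono) auto
  moreover have "a\<^sup>2 * (2/3) \<le> a\<^sup>2 * ln 2" using ln2_ge_two_thirds by (intro mult_left_mono) auto
  moreover have "a\<^sup>2*(38/10*a - 28/10*a\<^sup>2) \<le> a\<^sup>2*(4/3)"
  proof (intro mult_left_mono)
    have "(1/2 - a) * (24/10 - 28/10*a) \<ge> 0" using assms by (intro mult_nonneg_nonneg) auto
    then show "38/10*a - 28/10*a\<^sup>2 \<le> 4/3" by (simp add: power2_eq_square field_simps)
  qed auto
  ultimately show ?thesis by (simp add: power2_eq_square field_simps)
qed

text \<open>With \<Phi> = \<open>log_prim y\<close> and \<Phi>'' = k, the left side is the second
  difference of \<Phi> about 2 plus twice the increment of M(u) = \<Phi>(1 + u) + \<Phi>(1 - u) from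
  a to 1. Each piece is a double integral of k. It is bounded by the kernel sum K at a times a
  function of a alone, and \<open>kernel_final\<close> adds these functions up.\<close>

lemma kernel_nonneg:
  fixes a y :: real
  assumes a: "0 \<le> a" "a \<le> 1/2"
  shows "log_prim y (2+a) + log_prim y (2-a) - 2 * log_prim y (1+a) - 2 * log_prim y (1-a)
    \<le> ln 4 * ((1+a)/((1+a)\<^sup>2+y\<^sup>2) + (1-a)/((1-a)\<^sup>2+y\<^sup>2))"
proof -
  define Y where "Y = y\<^sup>2"
  have Y: "Y \<ge> 0" by (simp add: Y_def)
  define k where "k = (\<lambda>v. v/(v\<^sup>2+Y))"
  define \<phi> where "\<phi> = (\<lambda>v. ln (v\<^sup>2+Y)/2)"
  define \<Phi> where "\<Phi> = log_prim y"
  define K where "K = k (1+a) + k (1-a)"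
  have Phi': "(\<Phi> has_real_derivative \<phi> v) (at v)" if "v > 0" for v
    using log_prim_deriv[of v y] that by (simp add: \<Phi>_def \<phi>_def Y_def)
  have phi': "(\<phi> has_real_derivative k v) (at v)" if "v > 0" for v
  proof -
    have "v\<^sup>2 + Y > 0" using that Y by (auto intro!: add_pos_nonneg)
    then show ?thesis unfolding \<phi>_def k_def
      by (auto intro!: derivative_eq_intros simp: field_simps)
  qed
  define A where "A = 1 - a\<^sup>2"
  have a2: "a\<^sup>2 \<le> 1/4" using power_mono[OF a(2,1), of 2] by (simp add: power2_eq_square)
  have A: "3/4 \<le> A" "A \<le> 1" using a2 by (auto simp: A_def)
  have Keq: "K = 2 * ((A+Y)/(A\<^sup>2+2*Y*(2-A)+Y\<^sup>2))"
    using kernel_pair(1)[OF Y, of a] a unfolding K_def k_def A_def by simp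
  have K0: "K > 0" unfolding Keq using A Y by (auto intro!: divide_pos_pos add_pos_nonneg mult_nonneg_nonneg)
  \<comment> \<open>Applied at 2 + u and 2 - u, whose sum is 4: the kernel there totals at most 2 K,
    and integrating twice gives K a^2.\<close>
  have F1: "k v \<le> v * (K/2)" if "v \<ge> 3/2" for v
  proof -
    have "K / 2 = (A+Y)/(A\<^sup>2+2*Y*(2-A)+Y\<^sup>2)"
      unfolding Keq by (rule nonzero_mult_div_cancel_left[OF zero_neq_numeral[symmetric]])
    then show ?thesis using kernel_tail[OF A Y that] by (metis k_def)
  qed
  have F2: "k (1+u) + k (1-u) \<le> K * (1+9/10*a\<^sup>2)" if "0 \<le> u" "u \<le> a" for u
  proof -
    have "u\<^sup>2 \<le> a\<^sup>2" using that by (intro power_mono) auto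
    then have "(1-u\<^sup>2+Y)/((1-u\<^sup>2)\<^sup>2+2*Y*(2-(1-u\<^sup>2))+Y\<^sup>2) \<le> (1+9/10*(1-A)) * ((A+Y)/(A\<^sup>2+2*Y*(2-A)+Y\<^sup>2))"
      using A Y by (intro kernel_inner) (auto simp: A_def)
    then have "2 * ((1-u\<^sup>2+Y)/((1-u\<^sup>2)\<^sup>2+2*Y*(2-(1-u\<^sup>2))+Y\<^sup>2)) \<le> 2 * ((A+Y)/(A\<^sup>2+2*Y*(2-A)+Y\<^sup>2)) * (1+9/10*(1-A))"
      by (simp only: mult_ac mult_left_mono zero_le_numeral)
    then show ?thesis
      using kernel_pair(1)[OF Y, of u] a that unfolding Keq k_def A_def by simp
  qed
  \<comment> \<open>For Y = 0 the kernel at 1 - u is unbounded as u tends to 1. The comparison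
    function 1 / (1 - u^2) has the same singularity but a finite double primitive.\<close>
  have F3: "k (1+u) + k (1-u) \<le> K * (1-a\<^sup>2) / (1-u\<^sup>2)" if "a \<le> u" "u < 1" for u
  proof -
    have "a\<^sup>2 \<le> u\<^sup>2" using that a by (intro power_mono) auto
    moreover have u1: "u\<^sup>2 < 1" using that a by (simp add: power_less_one_iff abs_square_less_1)
    ultimately have "(1-u\<^sup>2+Y)/((1-u\<^sup>2)\<^sup>2+2*Y*(2-(1-u\<^sup>2))+Y\<^sup>2) * (1-u\<^sup>2) \<le> ((A+Y)/(A\<^sup>2+2*Y*(2-A)+Y\<^sup>2)) * A"
      using A Y by (intro kernel_outer) (auto simp: A_def)
    then have "2 * ((1-u\<^sup>2+Y)/((1-u\<^sup>2)\<^sup>2+2*Y*(2-(1-u\<^sup>2))+Y\<^sup>2) * (1-u\<^sup>2))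
        \<le> 2 * (((A+Y)/(A\<^sup>2+2*Y*(2-A)+Y\<^sup>2)) * A)"
      by (rule mult_left_mono) simp
    moreover have "k (1+u) + k (1-u) = 2 * ((1-u\<^sup>2+Y)/((1-u\<^sup>2)\<^sup>2+2*Y*(2-(1-u\<^sup>2))+Y\<^sup>2))"
      using kernel_pair(1)[OF Y, of u] a that unfolding k_def by simp
    ultimately have "(k (1+u) + k (1-u)) * (1-u\<^sup>2) \<le> K * A"
      unfolding Keq by (simp only: mult.assoc)
    then show ?thesis using u1 by (simp add: A_def field_simps)
  qed
  have S1: "\<Phi> (2+a) + \<Phi> (2-a) - 2 * \<Phi> 2 \<le> K * a\<^sup>2"
  proof -
    define h1 where "h1 = (\<lambda>u. K*(2*u) - (\<phi> (2+u) - \<phi> (2-u)))"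
    define h where "h = (\<lambda>u. K*u\<^sup>2 - (\<Phi> (2+u) + \<Phi> (2-u)))"
    have h1: "h1 0 \<le> h1 u" if "0 \<le> u" "u \<le> a" for u
    proof (rule DERIV_nonneg_imp_nondecreasing[OF that(1)])
      fix x assume x: "0 \<le> x" "x \<le> u"
      have "(h1 has_real_derivative (2*K - (k (2+x) + k (2-x)))) (at x)"
        unfolding h1_def using x that a
        by (auto intro!: derivative_eq_intros DERIV_chain2[OF phi'])
      moreover have "2*K - (k (2+x) + k (2-x)) \<ge> 0"
        using F1[of "2+x"] F1[of "2-x"] x that a by (simp add: algebra_simps)
      ultimately show "\<exists>y. (h1 has_real_derivative y) (at x) \<and> 0 \<le> y" by blast
    qed
    have "h 0 \<le> h a"
    proof (rule DERIV_nonneg_imp_nondecreasing[OF a(1)])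
      fix x assume x: "0 \<le> x" "x \<le> a"
      have "(h has_real_derivative h1 x) (at x)"
        unfolding h_def h1_def using x a
        by (auto intro!: derivative_eq_intros DERIV_chain2[OF Phi'])
      moreover have "h1 x \<ge> 0" using h1[OF x] by (simp add: h1_def)
      ultimately show "\<exists>y. (h has_real_derivative y) (at x) \<and> 0 \<le> y" by blast
    qed
    then show ?thesis by (simp add: h_def)
  qed
  define N where "N = (\<lambda>u. \<phi> (1+u) - \<phi> (1-u))"
  have N': "(N has_real_derivative (k (1+u) + k (1-u))) (at u)" if "0 \<le> u" "u < 1" for u
    unfolding N_def using that by (auto intro!: derivative_eq_intros DERIV_chain2[OF phi'])
  have S2: "N a \<le> a * (K * (1+9/10*a\<^sup>2))"
  proof -
    have "(\<lambda>u. u * (K * (1+9/10*a\<^sup>2)) - N u) 0 \<le> (\<lambda>u. u * (K * (1+9/10*a\<^sup>2)) - N u) a"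
    proof (rule DERIV_nonneg_imp_nondecreasing[OF a(1)])
      fix x assume x: "0 \<le> x" "x \<le> a"
      then show "\<exists>y. ((\<lambda>u. u * (K * (1+9/10*a\<^sup>2)) - N u) has_real_derivative y) (at x) \<and> 0 \<le> y"
        using F2[OF x] a by (intro exI[of _ "K * (1+9/10*a\<^sup>2) - (k (1+x) + k (1-x))"])
           (auto intro!: derivative_eq_intros N')
    qed
    then show ?thesis by (simp add: N_def)
  qed
  \<comment> \<open>A primitive of 1 / (1 - u^2), the inverse hyperbolic tangent.\<close>
  define E1 where "E1 = (\<lambda>u::real. (ln (1+u) - ln (1-u)) / 2)"
  have S3: "N u \<le> N a + K*(1-a\<^sup>2) * (E1 u - E1 a)" if u: "a \<le> u" "u < 1" for u
  proof -
    have "(\<lambda>u. K*(1-a\<^sup>2) * E1 u - N u) a \<le> (\<lambda>u. K*(1-a\<^sup>2) * E1 u - N u) u"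
    proof (rule DERIV_nonneg_imp_nondecreasing[OF u(1)])
      fix x assume x: "a \<le> x" "x \<le> u"
      then have x1: "x < 1" "0 \<le> x" using u a by auto
      have "((\<lambda>u. K*(1-a\<^sup>2) * E1 u - N u) has_real_derivative
           (K*(1-a\<^sup>2) * ((1/(1+x) + 1/(1-x))/2) - (k (1+x) + k (1-x)))) (at x)"
        unfolding E1_def using x1 by (auto intro!: derivative_eq_intros N')
      moreover have "(1/(1+x) + 1/(1-x))/2 = 1/(1-x\<^sup>2)"
      proof -
        have nz: "1 + x \<noteq> 0" "1 - x \<noteq> 0" using x1 by auto
        then have "1/(1+x) + 1/(1-x) = 2/((1+x)*(1-x))" by (simp add: field_simps)
        moreover have "(1+x)*(1-x) = 1 - x\<^sup>2" by (simp add: power2_eq_square algebra_simps)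
        ultimately have e: "1/(1+x) + 1/(1-x) = 2/(1-x\<^sup>2)" by (simp only:)
        have "2 / w / 2 = 1 / w" for w :: real by simp
        then show ?thesis unfolding e .
      qed
      ultimately show "\<exists>y. ((\<lambda>u. K*(1-a\<^sup>2) * E1 u - N u) has_real_derivative y) (at x) \<and> 0 \<le> y"
        using F3[OF x(1) x1(1)] by (intro exI[of _ "K*(1-a\<^sup>2) / (1-x\<^sup>2) - (k (1+x) + k (1-x))"]) auto
    qed
    then show ?thesis by (simp add: algebra_simps)
  qed
  define M where "M = (\<lambda>u. \<Phi> (1+u) + \<Phi> (1-u))"
  \<comment> \<open>A primitive of \<open>E1\<close>; unlike \<open>E1\<close> it stays finite at u
    = 1.\<close>
  define E where "E = (\<lambda>u::real. ((1+u) * ln (1+u) + (1-u) * ln (1-u)) / 2)"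
  have S4: "M 1 - M a \<le> (1-a) * N a + K*(1-a\<^sup>2) * (ln 2 - ln (1+a))"
  proof -
    define h where "h = (\<lambda>u. u * N a + K*(1-a\<^sup>2) * (E u - u * E1 a) - M u)"
    \<comment> \<open>Needed at the endpoint u = 1, where 0 * ln 0 = 0 agrees with the
      limit.\<close>
    have contxln: "continuous_on {0..} (\<lambda>x::real. x * ln x)"
    proof (rule continuous_on_eq_continuous_within[THEN iffD2], rule ballI)
      fix x :: real assume "x \<in> {0..}"
      show "continuous (at x within {0..}) (\<lambda>x::real. x * ln x)"
      proof (cases "x = 0")
        case True
        have "((\<lambda>x::real. x * ln x) \<longlongrightarrow> 0) (at_right 0)" by real_asymp
        moreover have "at (0::real) within {0..} = at_right 0"
          by (metis at_within_Ici_at_right)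
        ultimately show ?thesis using True by (simp add: continuous_within)
      next
        case False
        then show ?thesis by (intro continuous_intros) auto
      qed
    qed
    have c1: "continuous_on {a..1} (\<lambda>u. (1-u) * ln (1-u))"
      by (rule continuous_on_compose2[OF contxln]) (auto intro!: continuous_intros)
    have c2: "continuous_on {a..1} (\<lambda>u. (1+u) * ln (1+u))"
      using a by (intro continuous_intros) auto
    have cM: "continuous_on {a..1} M"
      unfolding M_def \<Phi>_def
      by (intro continuous_intros continuous_on_compose2[OF continuous_log_prim[of UNIV]]) auto
    have cE: "continuous_on {a..1} E"
      unfolding E_def by (intro continuous_on_divide[OF continuous_on_add[OF c2 c1]]) auto
    have ch: "continuous_on {a..1} h"
      unfolding h_def by (intro continuous_on_diff continuous_on_add continuous_on_mult
          continuous_on_const continuous_on_id cE cM)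
    have "h a \<le> h 1"
    proof (rule DERIV_nonneg_imp_increasing_open[OF _ _ ch])
      show "a \<le> 1" using a by simp
      fix x assume x: "a < x" "x < 1"
      have xlnx: "((\<lambda>x. x * ln x) has_real_derivative (ln z + 1)) (at z)" if "z > 0" for z :: real
        using that by (auto intro!: derivative_eq_intros)
      have "((\<lambda>u. (1+u) * ln (1+u)) has_real_derivative (ln (1+x) + 1) * 1) (at x)"
        by (rule DERIV_chain2[OF xlnx]) (use x a in \<open>auto intro!: derivative_eq_intros\<close>)
      moreover have "((\<lambda>u. (1-u) * ln (1-u)) has_real_derivative (ln (1-x) + 1) * (-1)) (at x)"
        by (rule DERIV_chain2[OF xlnx]) (use x a in \<open>auto intro!: derivative_eq_intros\<close>)
      ultimately have "(E has_real_derivative ((ln (1+x) + 1) * 1 + (ln (1-x) + 1) * (-1)) / 2) (at x)"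
        unfolding E_def by (intro DERIV_cdivide DERIV_add)
      then have "(E has_real_derivative E1 x) (at x)"
        by (simp add: E1_def)
      moreover have "(M has_real_derivative N x) (at x)"
        unfolding M_def N_def using x a by (auto intro!: derivative_eq_intros DERIV_chain2[OF Phi'])
      ultimately have "(h has_real_derivative (N a + K*(1-a\<^sup>2) * (E1 x - E1 a) - N x)) (at x)"
        unfolding h_def by (auto intro!: derivative_eq_intros)
      then show "\<exists>y. (h has_real_derivative y) (at x) \<and> 0 \<le> y"
        using S3[of x] x by (intro exI[of _ "N a + K*(1-a\<^sup>2) * (E1 x - E1 a) - N x"]) auto
    qed
    moreover have "E 1 - E a - (1-a) * E1 a = ln 2 - ln (1+a)"
      by (simp add: E_def E1_def algebra_simps add_divide_distrib diff_divide_distrib)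
    then have "K*(1-a\<^sup>2) * (ln 2 - ln (1+a)) = K*(1-a\<^sup>2) * (E 1 - E1 a) - K*(1-a\<^sup>2) * (E a - a * E1 a)"
      by (simp add: algebra_simps flip: \<open>E 1 - E a - (1-a) * E1 a = ln 2 - ln (1+a)\<close>)
    ultimately show ?thesis by (simp add: h_def algebra_simps)
  qed
  \<comment> \<open>Because \<Phi> 0 = 0, the value of M at 1 supplies the -2 \<Phi>(2) of the
    second difference about 2.\<close>
  have M1: "M 1 = \<Phi> 2" by (simp add: M_def \<Phi>_def log_prim_0)
  have "\<Phi> (2+a) + \<Phi> (2-a) - 2 * \<Phi> (1+a) - 2 * \<Phi> (1-a)
      = (\<Phi> (2+a) + \<Phi> (2-a) - 2 * \<Phi> 2) + 2 * (M 1 - M a)"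
    using M1 by (simp add: M_def)
  also have "\<dots> \<le> K * a\<^sup>2 + 2 * ((1-a) * (a * (K * (1+9/10*a\<^sup>2))) + K*(1-a\<^sup>2) * (ln 2 - ln (1+a)))"
  proof -
    have "(1-a) * N a \<le> (1-a) * (a * (K * (1+9/10*a\<^sup>2)))"
      using S2 a by (intro mult_left_mono) auto
    moreover have "u + 2 * w \<le> v + 2 * (q + x)" if "p \<le> q" "u \<le> v" "w \<le> p + x" for p q u v w x :: real
      using that by argo
    ultimately show ?thesis using S1 S4 by blast
  qed
  also have "\<dots> = K * (a\<^sup>2 + 2*(1-a)*(a*(1+9/10*a\<^sup>2)) + 2*(1-a\<^sup>2)*(ln 2 - ln (1+a)))"
    by (simp add: algebra_simps)
  also have "\<dots> \<le> K * (2 * ln 2)"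
    using kernel_final[OF a] K0 by (intro mult_left_mono) auto
  also have "2 * ln 2 = ln (4::real)" using ln_realpow[of 2 2] by simp
  finally show ?thesis by (simp add: \<Phi>_def K_def k_def Y_def mult.commute)
qed

text \<open>The terms at b and -b cancel by oddness, and the rest is unchanged when b becomes -b, so
  b \<ge> 0 may be assumed.\<close>

lemma kernel_ineq:
  fixes b y :: real
  assumes "\<bar>b\<bar> \<le> 1/2"
  shows "(log_prim y (2-b) - 2 * log_prim y (1-b) + log_prim y (-b))
       + (log_prim y (2+b) - 2 * log_prim y (1+b) + log_prim y b)
    \<le> ln 4 * ((1-b)/((1-b)\<^sup>2+y\<^sup>2) + (1+b)/((1+b)\<^sup>2+y\<^sup>2))"
proof (cases "b \<ge> 0")
  case True
  then show ?thesis using kernel_nonneg[of b y] assms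
    by (simp add: log_prim_minus add.commute add.left_commute)
next
  case False
  then show ?thesis using kernel_nonneg[of "-b" y] assms
    by (simp add: log_prim_minus add.commute add.left_commute)
qed

section \<open>Entire functions of finite order\<close>

lemma entire_linear_factor:
  assumes "f holomorphic_on UNIV" "f a = 0"
  obtains g where "g holomorphic_on UNIV" "\<And>z. f z = (z - a) * g z"
proof
  let ?g = "\<lambda>z. if z = a then deriv f a else f z / (z - a)"
  show "?g holomorphic_on UNIV"
    by (rule pole_theorem_0[OF assms(1), of a]) (use assms in auto)
  show "f z = (z - a) * ?g z" for z using assms by auto
qed

text \<open>The points a i lie within R/3 of the centre, so on the circle of radius R every linear
  factor has modulus at least 2R/3. The maximum principle carries the resulting bound for the
  cofactor inside.\<close>

lemma cofactor_bound:
  assumes g: "g holomorphic_on UNIV" and f: "\<And>z. f z = g z * (\<Prod>i<n. z - a i)"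
    and a: "\<And>i. i < n \<Longrightarrow> cmod (a i - c) \<le> R/3" and R: "R > 0"
    and M: "\<And>z. cmod (z - c) = R \<Longrightarrow> cmod (f z) \<le> M" and z: "cmod (z - c) \<le> R"
  shows "cmod (g z) \<le> M / (2*R/3)^n"
proof -
  have "cmod (g w) \<le> M / (2*R/3)^n" if w: "cmod (w - c) = R" for w
  proof -
    have "cmod (w - a i) \<ge> 2*R/3" if "i < n" for i
      using a[OF that] w norm_triangle_ineq[of "w - a i" "a i - c"] by simp
    then have "(\<Prod>i<n. 2*R/3) \<le> (\<Prod>i<n. cmod (w - a i))"
      using R by (intro prod_mono) auto
    then have "(2*R/3)^n * cmod (g w) \<le> cmod (\<Prod>i<n. w - a i) * cmod (g w)"
      by (intro mult_right_mono) (auto simp: prod_norm)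
    also have "\<dots> = cmod (f w)" by (simp add: f norm_mult)
    also have "\<dots> \<le> M" by (rule M[OF w])
    finally show ?thesis using R by (simp add: field_simps)
  qed
  note b = this
  show ?thesis
  proof (rule maximum_modulus_frontier[of g "cball c R"])
    show "continuous_on (closure (cball c R)) g"
      using g holomorphic_on_imp_continuous_on continuous_on_subset by blast
    show "g holomorphic_on interior (cball c R)"
      using g holomorphic_on_subset by blast
    show "cmod (g w) \<le> M / (2*R/3)^n" if "w \<in> frontier (cball c R)" for w
      using that R by (intro b) (simp add: dist_norm norm_minus_commute)
    show "z \<in> cball c R" using z by (simp add: dist_norm norm_minus_commute)
  qed (rule bounded_cball)
qed

text \<open>A Jensen-type count: at the centre every linear factor is at most R/3, half of its lower
  bound on the circle, so each zero costs a factor 2.\<close>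

lemma zero_count_bound:
  assumes "g holomorphic_on UNIV" "\<And>z. f z = g z * (\<Prod>i<n. z - a i)"
    and a: "\<And>i. i < n \<Longrightarrow> cmod (a i - c) \<le> R/3" and R: "R > 0"
    and "\<And>z. cmod (z - c) = R \<Longrightarrow> cmod (f z) \<le> M"
  shows "2^n * cmod (f c) \<le> M"
proof -
  have gc: "cmod (g c) \<le> M / (2*R/3)^n"
    by (rule cofactor_bound[OF assms]) (use R in auto)
  have "(\<Prod>i<n. cmod (c - a i)) \<le> (\<Prod>i<n. R/3)"
    using a by (intro prod_mono) (auto simp: norm_minus_commute)
  then have "cmod (f c) \<le> cmod (g c) * (R/3)^n"
    by (simp add: assms(2) norm_mult mult_left_mono flip: prod_norm)
  also have "\<dots> \<le> M / (2*R/3)^n * (R/3)^n"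
    using gc R by (intro mult_right_mono) auto
  also have "\<dots> = M / 2^n"
    using R by (simp add: field_simps power_divide)
  finally show ?thesis by (simp add: field_simps)
qed

text \<open>Zeros are listed with repetition, so multiplicity needs no separate treatment.
  \<open>zero_count_bound\<close> limits the length of any such list; for a list of maximal length a
  further zero of the cofactor could be appended, which is absurd.\<close>

lemma entire_factor_zeros:
  assumes f: "f holomorphic_on UNIV" and fc: "f c \<noteq> 0" and R: "R > 0"
  obtains n :: nat and a g where "g holomorphic_on UNIV" "\<And>z. f z = g z * (\<Prod>i<n. z - a i)"
    "\<And>i. i < n \<Longrightarrow> cmod (a i - c) \<le> R/3" "\<And>z. cmod (z - c) \<le> R/3 \<Longrightarrow> g z \<noteq> 0"
proof -
  define P where "P = (\<lambda>n (a::nat \<Rightarrow> complex) g. g holomorphic_on UNIV \<and> (\<forall>z. f z = g z * (\<Prod>i<n. z - a i))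
     \<and> (\<forall>i<n. cmod (a i - c) \<le> R/3))"
  have "compact (f ` sphere c R)"
    using f by (intro compact_continuous_image) (auto intro: holomorphic_on_imp_continuous_on holomorphic_on_subset)
  then obtain M where "\<And>w. w \<in> f ` sphere c R \<Longrightarrow> cmod w \<le> M"
    using compact_imp_bounded bounded_iff by metis
  then have M: "cmod (f z) \<le> M" if "cmod (z - c) = R" for z
    using that by (auto simp: dist_norm norm_minus_commute)
  obtain b :: nat where b: "M / cmod (f c) < 2^b"
    using real_arch_pow[of 2] by auto
  have bnd: "n \<le> b" if ex: "\<exists>a g. P n a g" for n
  proof -
    obtain a g where "P n a g" using ex by blast
    then have "2^n * cmod (f c) \<le> M"
      unfolding P_def by (intro zero_count_bound[of g f a n c R M] M) (use R in auto)
    then have "2^n \<le> M / cmod (f c)" using fc by (simp add: field_simps)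
    then have "(2::real)^n < 2^b" using b by linarith
    then show ?thesis by simp
  qed
  have "P 0 (\<lambda>_. 0) f" by (simp add: P_def f)
  then have ex: "\<exists>a g. P 0 a g" by blast
  define n where "n = (GREATEST n. \<exists>a g. P n a g)"
  have "\<exists>a g. P n a g" unfolding n_def
    using GreatestI_nat[of "\<lambda>n. \<exists>a g. P n a g", OF ex bnd] by blast
  then obtain a g where P: "P n a g" by blast
  have "g z \<noteq> 0" if z: "cmod (z - c) \<le> R/3" for z
  proof
    assume "g z = 0"
    moreover have "g holomorphic_on UNIV" using P by (simp add: P_def)
    ultimately obtain g' where g': "g' holomorphic_on UNIV" "\<And>w. g w = (w - z) * g' w"
      using entire_linear_factor by metis
    have "f w = g' w * (\<Prod>i<Suc n. w - (a(n := z)) i)" for w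
    proof -
      have "(\<Prod>i<n. w - (a(n := z)) i) = (\<Prod>i<n. w - a i)" by (intro prod.cong) auto
      then show ?thesis using P g'(2)[of w] by (simp add: P_def mult_ac)
    qed
    then have "P (Suc n) (a(n := z)) g'" using P z g'(1) by (auto simp: P_def less_Suc_eq)
    then have "\<exists>a g. P (Suc n) a g" by blast
    then have "Suc n \<le> n"
      using Greatest_le_nat[of "\<lambda>n. \<exists>a g. P n a g" "Suc n" b] bnd unfolding n_def by blast
    then show False by simp
  qed
  moreover have "g holomorphic_on UNIV" "\<And>z. f z = g z * (\<Prod>i<n. z - a i)"
    "\<And>i. i < n \<Longrightarrow> cmod (a i - c) \<le> R/3"
    using P by (auto simp: P_def)
  ultimately show ?thesis by (intro that)
qed

text \<open>The Moebius map k / (2B - k) sends the half-plane Re k < B into the unit disc and 0 to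
  0. Schwarz's lemma gives modulus at most 1/2 at half the radius, and solving |k| \<le> (2B + |k|)
  / 2 yields 2B.\<close>

lemma Borel_Caratheodory:
  assumes h: "h holomorphic_on ball c r" and r: "r > 0"
    and B: "\<And>z. z \<in> ball c r \<Longrightarrow> Re (h z) < Re (h c) + B"
    and z: "cmod (z - c) \<le> r/2"
  shows "cmod (h z - h c) \<le> 2 * B"
proof -
  have B0: "B > 0" using B[of c] r by simp
  define k where "k = (\<lambda>\<zeta>. h (c + of_real r * \<zeta>) - h c)"
  have inb: "c + of_real r * \<zeta> \<in> ball c r" if "cmod \<zeta> < 1" for \<zeta>
    using that r by (simp add: dist_norm norm_mult)
  have k: "k holomorphic_on ball 0 1"
    unfolding k_def using inb
    by (intro holomorphic_intros holomorphic_on_compose_gen[OF _ h, unfolded o_def]) auto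
  have Rek: "Re (k \<zeta>) < B" if "cmod \<zeta> < 1" for \<zeta>
    using B[OF inb[OF that]] by (simp add: k_def)
  have ne: "2 * of_real B - k \<zeta> \<noteq> 0" if "cmod \<zeta> < 1" for \<zeta>
  proof
    assume "2 * of_real B - k \<zeta> = 0"
    then have "k \<zeta> = of_real (2 * B)" by simp
    then show False using Rek[OF that] B0 by simp
  qed
  define w where "w = (\<lambda>\<zeta>. k \<zeta> / (2 * of_real B - k \<zeta>))"
  have hw: "w holomorphic_on ball 0 1"
    unfolding w_def using ne k by (intro holomorphic_intros) auto
  have w1: "cmod (w \<zeta>) < 1" if "cmod \<zeta> < 1" for \<zeta>
  proof -
    have "(cmod (k \<zeta>))\<^sup>2 < (cmod (2 * of_real B - k \<zeta>))\<^sup>2"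
      using Rek[OF that] B0 unfolding cmod_power2 by (simp add: power2_eq_square algebra_simps)
    then have "cmod (k \<zeta>) < cmod (2 * of_real B - k \<zeta>)"
      using power2_less_imp_less norm_ge_zero by blast
    then show ?thesis using ne[OF that] by (simp add: w_def norm_divide)
  qed
  have w0: "w 0 = 0" by (simp add: w_def k_def)
  define \<zeta> where "\<zeta> = (z - c) / of_real r"
  have \<zeta>: "cmod \<zeta> \<le> 1/2" using z r by (simp add: \<zeta>_def norm_divide field_simps)
  have zz: "cmod (w \<zeta>) \<le> 1/2"
    using Schwarz_Lemma(1)[OF hw w0 w1, of \<zeta>] \<zeta> by simp
  have kz: "k \<zeta> = h z - h c" using r by (simp add: k_def \<zeta>_def)
  have "k \<zeta> = w \<zeta> * (2 * of_real B - k \<zeta>)" using ne[of \<zeta>] \<zeta> by (simp add: w_def)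
  then have "cmod (k \<zeta>) \<le> 1/2 * (2 * B + cmod (k \<zeta>))"
  proof -
    assume *: "k \<zeta> = w \<zeta> * (2 * of_real B - k \<zeta>)"
    have "cmod (2 * of_real B - k \<zeta>) \<le> 2 * B + cmod (k \<zeta>)"
      using norm_triangle_ineq4[of "2 * of_real B" "k \<zeta>"] B0 by simp
    then have "cmod (w \<zeta>) * cmod (2 * of_real B - k \<zeta>) \<le> 1/2 * (2 * B + cmod (k \<zeta>))"
      using zz by (intro mult_mono) auto
    then show ?thesis using * by (metis norm_mult)
  qed
  then show ?thesis by (simp add: kz)
qed

text \<open>Discs of radius r/4 about points of the small ball stay in the ball of radius r/2, where
  the previous bound holds. Cauchy's inequality for the second derivative gives 2 * 2B / (r/4)^2 =
  64 B / r^2.\<close>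

lemma deriv_lipschitz_of_Re_bound:
  assumes h: "h holomorphic_on ball c r" and r: "r > 0"
    and B: "\<And>z. z \<in> ball c r \<Longrightarrow> Re (h z) < Re (h c) + B"
    and z: "z \<in> ball c (r/4)" "w \<in> ball c (r/4)"
  shows "cmod (deriv h z - deriv h w) \<le> 64 * B / r\<^sup>2 * cmod (z - w)"
proof -
  have hd: "deriv h holomorphic_on ball c r" using h by (intro holomorphic_deriv) auto
  have 2: "cmod (deriv (deriv h) x) \<le> 64 * B / r\<^sup>2" if x: "x \<in> ball c (r/4)" for x
  proof -
    have sub: "cball x (r/4) \<subseteq> cball c (r/2)"
    proof
      fix y assume "y \<in> cball x (r/4)"
      then show "y \<in> cball c (r/2)" using x dist_triangle[of c y x] by simp
    qed
    have sub': "cball c (r/2) \<subseteq> ball c r" using r by auto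
    define g where "g = (\<lambda>z. h z - h c)"
    have hg: "g holomorphic_on ball c r" unfolding g_def by (intro holomorphic_intros h)
    have "cmod ((deriv ^^ 2) g x) \<le> fact 2 * (2 * B) / (r/4)^2"
    proof (rule Cauchy_inequality)
      show "g holomorphic_on ball x (r/4)"
        using hg sub sub' by (meson ball_subset_cball holomorphic_on_subset order_trans)
      show "continuous_on (cball x (r/4)) g"
        using hg sub sub' by (meson holomorphic_on_imp_continuous_on holomorphic_on_subset order_trans)
      show "0 < r/4" using r by simp
      fix y assume "cmod (x - y) = r/4"
      then have "y \<in> cball c (r/2)" using sub by (auto simp: dist_norm subset_iff)
      then show "cmod (g y) \<le> 2 * B"
        unfolding g_def by (intro Borel_Caratheodory[OF h r B]) (auto simp: dist_norm norm_minus_commute)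
    qed
    moreover have "(deriv ^^ 2) g x = deriv (deriv h) x"
    proof -
      have xin: "x \<in> ball c r" using x r by auto
      have eq: "deriv g y = deriv h y" if "y \<in> ball c r" for y
        unfolding g_def using that h holomorphic_on_imp_differentiable_at[OF h open_ball that]
        by simp
      have "deriv (deriv g) x = deriv (deriv h) x"
        by (rule deriv_cong_ev) (use eq xin in \<open>auto simp: eventually_nhds intro!: exI[of _ "ball c r"]\<close>)
      then show ?thesis by (simp add: numeral_2_eq_2)
    qed
    ultimately show ?thesis by (simp add: power2_eq_square field_simps)
  qed
  show ?thesis
  proof (rule field_differentiable_bound[OF convex_ball _ _ z])
    fix x assume x: "x \<in> ball c (r/4)"
    then have "x \<in> ball c r" using r by auto
    then show "(deriv h has_field_derivative deriv (deriv h) x) (at x within ball c (r/4))"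
      using hd holomorphic_derivI[OF hd open_ball] by (meson has_field_derivative_at_within)
    show "cmod (deriv (deriv h) x) \<le> 64 * B / r\<^sup>2" by (rule 2[OF x])
  qed
qed

text \<open>The cofactor has no zero in the disc of radius R/3, hence a logarithm k there. Only
  values of f at the centre and on the outer circle enter the bound on Re k; the added 1 makes it
  strict.\<close>

lemma entire_factor_core:
  assumes f: "f holomorphic_on UNIV" and fc: "f c \<noteq> 0" and R: "R > 0"
    and M: "\<And>z. cmod (z - c) = R \<Longrightarrow> cmod (f z) \<le> M"
  shows "\<exists>(n::nat) a g k. g holomorphic_on UNIV \<and> (\<forall>z. f z = g z * (\<Prod>i<n. z - a i))
    \<and> (\<forall>i<n. cmod (a i - c) \<le> R/3) \<and> cmod (f c) / (R/3)^n \<le> cmod (g c)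
    \<and> k holomorphic_on ball c (R/3) \<and> (\<forall>z\<in>ball c (R/3). g z = exp (k z))
    \<and> (\<forall>z\<in>ball c (R/3). Re (k z) < Re (k c) + (ln M - ln (cmod (f c)) + 1))"
proof -
  obtain n :: nat and a g where g: "g holomorphic_on UNIV" and fg: "\<And>z. f z = g z * (\<Prod>i<n. z - a i)"
    and a: "\<And>i. i < n \<Longrightarrow> cmod (a i - c) \<le> R/3" and nz: "\<And>z. cmod (z - c) \<le> R/3 \<Longrightarrow> g z \<noteq> 0"
    using entire_factor_zeros[OF f fc R] by metis
  have "g holomorphic_on ball c (R/3)" using g holomorphic_on_subset by blast
  then obtain k where k: "k holomorphic_on ball c (R/3)" "\<And>x. x \<in> ball c (R/3) \<Longrightarrow> exp (k x) = g x"
    using holomorphic_logarithm_exists[of "ball c (R/3)" g c] nz R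
    by (auto simp: dist_norm norm_minus_commute)
  have "(\<Prod>i<n. cmod (c - a i)) \<le> (\<Prod>i<n. R/3)"
    using a by (intro prod_mono) (auto simp: norm_minus_commute)
  then have "cmod (f c) \<le> cmod (g c) * (R/3)^n"
    by (simp add: fg norm_mult mult_left_mono flip: prod_norm)
  then have gc: "cmod (f c) / (R/3)^n \<le> cmod (g c)" using R by (simp add: field_simps)
  have M0: "M > 0" using zero_count_bound[OF g fg a R M] fc
    by (metis less_le_trans mult_pos_pos zero_less_norm_iff zero_less_numeral zero_less_power)
  have "Re (k z) < Re (k c) + (ln M - ln (cmod (f c)) + 1)" if z: "z \<in> ball c (R/3)" for z
  proof -
    have R2: "2 * R / 3 > 0" "R / 3 > 0" using R by auto
    have "cmod (g z) \<le> M / (2*R/3)^n"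
      by (rule cofactor_bound[OF g fg a R M]) (use z R in \<open>auto simp: dist_norm norm_minus_commute\<close>)
    then have "exp (Re (k z)) \<le> M / (2*R/3)^n" by (metis k(2) z norm_exp_eq_Re)
    then have "Re (k z) \<le> ln (M / (2*R/3)^n)"
      using ln_mono[of "exp (Re (k z))" "M / (2*R/3)^n"] by simp
    also have "\<dots> = ln M - n * ln (2*R/3)" using M0 R2 by (simp add: ln_div ln_realpow)
    finally have 1: "Re (k z) \<le> ln M - n * ln (2*R/3)" .
    have "cmod (f c) / (R/3)^n \<le> exp (Re (k c))"
      using gc R by (simp flip: k(2)[of c])
    then have "ln (cmod (f c) / (R/3)^n) \<le> Re (k c)"
      using fc R2 ln_mono[of "cmod (f c) / (R/3)^n" "exp (Re (k c))"] by simp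
    moreover have "ln (cmod (f c) / (R/3)^n) = ln (cmod (f c)) - n * ln (R/3)"
      using fc R2 by (simp add: ln_div ln_realpow)
    ultimately have 2: "ln (cmod (f c)) - n * ln (R/3) \<le> Re (k c)" by simp
    \<comment> \<open>The unknown number of zeros enters both bounds, with R/3 at the centre and
      2R/3 above, so its net effect has the favourable sign.\<close>
    have "ln (R/3) \<le> ln (2*R/3)" using R2 by simp
    then have "n * ln (R/3) \<le> n * ln (2*R/3)" by (intro mult_left_mono) auto
    then show ?thesis using 1 2 by linarith
  qed
  then show ?thesis using g fg a gc k
    by (intro exI[of _ n] exI[of _ a] exI[of _ g] exI[of _ k]) auto
qed

section \<open>Growth bounds, quotients and local factorizations\<close>

definition exp_growth :: "(complex \<Rightarrow> complex) \<Rightarrow> real \<Rightarrow> bool" where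
  "exp_growth f a \<longleftrightarrow> (\<exists>C\<ge>0. \<forall>z. cmod (f z) \<le> exp (C * (1 + cmod z) powr a))"

text \<open>A quotient needs a lower bound on g, impossible near its zeros. These are taken out: the
  zero-free cofactor h of g is bounded below by Borel-Caratheodory, while X h is f divided by the
  same linear factors and so bounded above.\<close>

lemma exp_growth_quotient:
  assumes X: "X holomorphic_on UNIV" and f: "f holomorphic_on UNIV" and g: "g holomorphic_on UNIV"
    and gc: "g c \<noteq> 0" and eq: "\<And>z. X z * g z = f z"
    and gf: "exp_growth f a" and gg: "exp_growth g a" and a: "a \<ge> 0"
  shows "exp_growth X a"
proof -
  obtain Cf where Cf: "Cf \<ge> 0" "\<And>z. cmod (f z) \<le> exp (Cf * (1 + cmod z) powr a)"
    using gf by (auto simp: exp_growth_def)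
  obtain Cg where Cg: "Cg \<ge> 0" "\<And>z. cmod (g z) \<le> exp (Cg * (1 + cmod z) powr a)"
    using gg by (auto simp: exp_growth_def)
  define K where "K = 7 * (1 + cmod c)"
  define l where "l = \<bar>ln (cmod (g c))\<bar>"
  define C where "C = (Cf + 2 * Cg) * K powr a + 3 * l + 2"
  have C0: "C \<ge> 0" unfolding C_def l_def using Cf Cg by simp
  have "cmod (X z) \<le> exp (C * (1 + cmod z) powr a)" for z
  proof -
    \<comment> \<open>Chosen so that z lies within half of the radius R/3 of the zero-free
      disc.\<close>
    define R where "R = 6 * cmod (z - c) + 1"
    have R: "R > 0" unfolding R_def by (metis add_nonneg_pos mult_nonneg_nonneg norm_ge_zero zero_le_numeral zero_less_one)
    define T where "T = (K * (1 + cmod z)) powr a"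
    have bound: "1 + cmod w \<le> K * (1 + cmod z)" if "cmod (w - c) = R" for w
    proof -
      have "cmod w \<le> R + cmod c" using that norm_triangle_ineq[of "w - c" c] by simp
      moreover have "cmod (z - c) \<le> cmod z + cmod c" by (rule norm_triangle_ineq4)
      ultimately have "1 + cmod w \<le> 2 + 6 * cmod z + 7 * cmod c" unfolding R_def by linarith
      also have "\<dots> \<le> K * (1 + cmod z)" unfolding K_def by (simp add: algebra_simps)
      finally show ?thesis .
    qed
    have Mf: "cmod (f w) \<le> exp (Cf * T)" if "cmod (w - c) = R" for w
    proof -
      have "(1 + cmod w) powr a \<le> T"
        unfolding T_def using bound[OF that] a by (intro powr_mono2) auto
      then show ?thesis using Cf(2)[of w] Cf(1) by (meson exp_le_cancel_iff mult_left_mono order_trans)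
    qed
    have Mg: "cmod (g w) \<le> exp (Cg * T)" if "cmod (w - c) = R" for w
    proof -
      have "(1 + cmod w) powr a \<le> T"
        unfolding T_def using bound[OF that] a by (intro powr_mono2) auto
      then show ?thesis using Cg(2)[of w] Cg(1) by (meson exp_le_cancel_iff mult_left_mono order_trans)
    qed
    obtain n :: nat and b h k where *: "h holomorphic_on UNIV \<and> (\<forall>z. g z = h z * (\<Prod>i<n. z - b i))
      \<and> (\<forall>i<n. cmod (b i - c) \<le> R/3) \<and> cmod (g c) / (R/3)^n \<le> cmod (h c)
      \<and> k holomorphic_on ball c (R/3) \<and> (\<forall>z\<in>ball c (R/3). h z = exp (k z))
      \<and> (\<forall>z\<in>ball c (R/3). Re (k z) < Re (k c) + (ln (exp (Cg * T)) - ln (cmod (g c)) + 1))"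
      using entire_factor_core[OF g gc R Mg] by blast
    then have h: "h holomorphic_on UNIV" and gh: "\<And>z. g z = h z * (\<Prod>i<n. z - b i)"
      and b: "\<And>i. i < n \<Longrightarrow> cmod (b i - c) \<le> R/3"
      and hc: "cmod (g c) / (R/3)^n \<le> cmod (h c)"
      and k: "k holomorphic_on ball c (R/3)" "\<And>z. z \<in> ball c (R/3) \<Longrightarrow> h z = exp (k z)"
      and kB: "\<And>z. z \<in> ball c (R/3) \<Longrightarrow> Re (k z) < Re (k c) + (ln (exp (Cg * T)) - ln (cmod (g c)) + 1)"
      by blast+
    define B where "B = Cg * T - ln (cmod (g c)) + 1"
    have zb: "cmod (z - c) \<le> (R/3)/2" unfolding R_def by simp
    then have zb': "z \<in> ball c (R/3)" using R by (simp add: dist_norm norm_minus_commute)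
    have "cmod (k z - k c) \<le> 2 * B"
      by (rule Borel_Caratheodory[OF k(1) _ _ zb]) (use R kB in \<open>auto simp: B_def\<close>)
    then have "Re (k c) - Re (k z) \<le> 2 * B"
      using abs_Re_le_cmod[of "k z - k c"] by simp
    then have hz: "cmod (h c) * exp (- 2 * B) \<le> cmod (h z)"
      using k(2)[OF zb'] k(2)[of c] R by (simp flip: exp_add)
    \<comment> \<open>The points b i are zeros of g and hence of f, with X h as the cofactor in
      f.\<close>
    have X1: "cmod (X z * h z) \<le> exp (Cf * T) / (2*R/3)^n"
    proof (rule cofactor_bound[where g = "\<lambda>z. X z * h z" and f = f and a = b and c = c])
      show "(\<lambda>z. X z * h z) holomorphic_on UNIV" by (intro holomorphic_intros X h)
      show "f z = X z * h z * (\<Prod>i<n. z - b i)" for z using eq[of z] gh[of z] by (simp add: mult.assoc)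
      show "cmod (z - c) \<le> R" using zb R by simp
    qed (use b R Mf in auto)
    define G where "G = cmod (g c)"
    have G0: "G > 0" using gc by (simp add: G_def)
    have "G / (R/3)^n * exp (- 2 * B) \<le> cmod (h c) * exp (- 2 * B)"
      using hc by (intro mult_right_mono) (auto simp: G_def)
    then have hz': "G / (R/3)^n * exp (- 2 * B) \<le> cmod (h z)" using hz by linarith
    have "cmod (X z) * (G / (R/3)^n * exp (- 2 * B)) \<le> cmod (X z) * cmod (h z)"
      using hz' by (intro mult_left_mono) auto
    also have "\<dots> \<le> exp (Cf * T) / (2*R/3)^n" using X1 by (simp add: norm_mult)
    \<comment> \<open>Weakening 2R/3 to R/3 makes the powers cancel, so n disappears from the
      estimate.\<close>
    also have "\<dots> \<le> exp (Cf * T) / (R/3)^n"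
      using R by (intro divide_left_mono power_mono) auto
    finally have "cmod (X z) * (G * exp (- 2 * B)) \<le> exp (Cf * T)"
      using R by (simp add: divide_simps)
    then have "cmod (X z) \<le> exp (Cf * T) * exp (2 * B) / G"
      using G0 by (simp add: field_simps exp_minus)
    also have "\<dots> = exp (Cf * T + 2 * B - ln G)"
      using G0 by (simp add: exp_add exp_diff)
    also have "Cf * T + 2 * B - ln G \<le> C * (1 + cmod z) powr a"
    proof -
      have T: "T = K powr a * (1 + cmod z) powr a"
        unfolding T_def K_def by (simp add: powr_mult)
      have p1: "(1 + cmod z) powr a \<ge> 1" using a by (simp add: ge_one_powr_ge_zero)
      have "Cf * T + 2 * B - ln G \<le> (Cf + 2 * Cg) * T + (3 * l + 2)"
        unfolding B_def l_def G_def by (simp add: algebra_simps)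
      also have "\<dots> \<le> (Cf + 2 * Cg) * T + (3 * l + 2) * (1 + cmod z) powr a"
      proof -
        have "3 * l + 2 \<ge> 0" by (simp add: l_def)
        then have "(3 * l + 2) * 1 \<le> (3 * l + 2) * (1 + cmod z) powr a"
          using p1 by (intro mult_left_mono)
        then show ?thesis by simp
      qed
      also have "\<dots> = C * (1 + cmod z) powr a" unfolding T C_def by (simp add: algebra_simps)
      finally show ?thesis .
    qed
    finally show ?thesis by simp
  qed
  then show ?thesis using C0 unfolding exp_growth_def by blast
qed

text \<open>
  A substitute for the Hadamard product: taking out the zeros in a much larger disc leaves a factor
  whose logarithmic derivative is almost constant on the disc of interest, because the order is
  less than 2.
\<close>
lemma entire_local_factorization:
  assumes f: "f holomorphic_on UNIV" and fc: "f c \<noteq> 0" and gr: "exp_growth f a"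
    and a: "0 \<le> a" "a < 2" and \<rho>: "\<rho> > 0" and \<delta>: "\<delta> > 0"
  obtains n :: nat and A k where "\<And>i. i < n \<Longrightarrow> f (A i) = 0" "k holomorphic_on ball c \<rho>"
    "\<And>z. z \<in> ball c \<rho> \<Longrightarrow> f z = exp (k z) * (\<Prod>i<n. z - A i)"
    "\<And>z w. z \<in> ball c \<rho> \<Longrightarrow> w \<in> ball c \<rho> \<Longrightarrow> cmod (deriv k z - deriv k w) \<le> \<delta> * cmod (z - w)"
proof -
  obtain C where C: "C \<ge> 0" "\<And>z. cmod (f z) \<le> exp (C * (1 + cmod z) powr a)"
    using gr by (auto simp: exp_growth_def)
  \<comment> \<open>The bound on the variation of Re k supplied by \<open>entire_factor_core\<close>
    for radius R.\<close>
  define Bf where "Bf = (\<lambda>R. C * (1 + cmod c + R) powr a - ln (cmod (f c)) + 1)"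
  have "((\<lambda>R. 64 * Bf R / (R/3)\<^sup>2) \<longlongrightarrow> 0) at_top"
  proof -
    define u where "u = 1 + cmod c"
    define v where "v = - ln (cmod (f c)) + 1"
    have u: "u > 0" unfolding u_def by (simp add: add_pos_nonneg)
    have "((\<lambda>R. (u + R) powr a / R\<^sup>2) \<longlongrightarrow> 0) at_top" using a u by real_asymp
    moreover have "((\<lambda>R. v / R\<^sup>2) \<longlongrightarrow> 0) at_top" by real_asymp
    ultimately have "((\<lambda>R. 576 * C * ((u + R) powr a / R\<^sup>2) + 576 * (v / R\<^sup>2)) \<longlongrightarrow> 576 * C * 0 + 576 * 0) at_top"
      by (intro tendsto_intros)
    moreover have "64 * Bf R / (R/3)\<^sup>2 = 576 * C * ((u + R) powr a / R\<^sup>2) + 576 * (v / R\<^sup>2)" for R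
    proof -
      have "Bf R = C * (u + R) powr a + v" by (simp add: Bf_def u_def v_def)
      then show ?thesis by (simp add: power_divide add_divide_distrib ring_distribs)
    qed
    ultimately show ?thesis by simp
  qed
  \<comment> \<open>Here a < 2 is decisive: Bf grows like R^a and is divided by R^2.\<close>
  then have "\<forall>\<^sub>F R in at_top. 64 * Bf R / (R/3)\<^sup>2 < \<delta>"
    using \<delta> order_tendstoD(2) by blast
  then obtain R0 where R0: "\<And>R. R \<ge> R0 \<Longrightarrow> 64 * Bf R / (R/3)\<^sup>2 < \<delta>"
    by (auto simp: eventually_at_top_linorder)
  \<comment> \<open>The factor 12 puts the ball of radius \<rho> inside the quarter of the disc of
    radius R/3 on which the Lipschitz bound holds.\<close>
  define R where "R = max R0 (12 * \<rho>)"
  have R: "R > 0" "R/3 > 0" "\<rho> \<le> R/3/4" using \<rho> by (auto simp: R_def)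
  have M: "cmod (f z) \<le> exp (C * (1 + cmod c + R) powr a)" if "cmod (z - c) = R" for z
  proof -
    have "cmod z \<le> R + cmod c" using that norm_triangle_ineq[of "z - c" c] by simp
    then have "(1 + cmod z) powr a \<le> (1 + cmod c + R) powr a" using a by (intro powr_mono2) auto
    then show ?thesis using C by (meson exp_le_cancel_iff mult_left_mono order_trans)
  qed
  obtain n :: nat and b h k where "h holomorphic_on UNIV \<and> (\<forall>z. f z = h z * (\<Prod>i<n. z - b i))
      \<and> (\<forall>i<n. cmod (b i - c) \<le> R/3) \<and> cmod (f c) / (R/3)^n \<le> cmod (h c)
      \<and> k holomorphic_on ball c (R/3) \<and> (\<forall>z\<in>ball c (R/3). h z = exp (k z))
      \<and> (\<forall>z\<in>ball c (R/3). Re (k z) < Re (k c) + (ln (exp (C * (1 + cmod c + R) powr a)) - ln (cmod (f c)) + 1))"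
    using entire_factor_core[OF f fc R(1) M] by blast
  then have fh: "\<And>z. f z = h z * (\<Prod>i<n. z - b i)"
      and k: "k holomorphic_on ball c (R/3)" "\<And>z. z \<in> ball c (R/3) \<Longrightarrow> h z = exp (k z)"
      and kB: "\<And>z. z \<in> ball c (R/3) \<Longrightarrow> Re (k z) < Re (k c) + (ln (exp (C * (1 + cmod c + R) powr a)) - ln (cmod (f c)) + 1)"
    by blast+
  have kB': "Re (k z) < Re (k c) + Bf R" if "z \<in> ball c (R/3)" for z
    using kB[OF that] by (simp add: Bf_def)
  have sub: "ball c \<rho> \<subseteq> ball c (R/3/4)" "ball c \<rho> \<subseteq> ball c (R/3)" using R by auto
  show ?thesis
  proof (rule that)
    show "f (b i) = 0" if "i < n" for i
      using that by (auto simp: fh[of "b i"])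
    show "k holomorphic_on ball c \<rho>" using k(1) sub holomorphic_on_subset by blast
    show "f z = exp (k z) * (\<Prod>i<n. z - b i)" if "z \<in> ball c \<rho>" for z
      using fh k(2) that sub by auto
    fix z w assume zw: "z \<in> ball c \<rho>" "w \<in> ball c \<rho>"
    have "cmod (deriv k z - deriv k w) \<le> 64 * Bf R / (R/3)\<^sup>2 * cmod (z - w)"
      by (rule deriv_lipschitz_of_Re_bound[OF k(1) R(2) kB']) (use zw sub in auto)
    also have "\<dots> \<le> \<delta> * cmod (z - w)"
      using R0[of R] by (intro mult_right_mono) (auto simp: R_def)
    finally show "cmod (deriv k z - deriv k w) \<le> \<delta> * cmod (z - w)" .
  qed
qed

text \<open>Centring at the critical line, b = Re \<rho> - 1/2, makes the four logarithms primitives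
  at 2 - b, 1 - b, -b and their mirror images. The integral is then literally the left side of
  \<open>kernel_ineq\<close>, and \<open>Kt\<close> its right side.\<close>

lemma reflect_log_integral:
  fixes \<rho> :: complex and t :: real
  assumes "0 \<le> Re \<rho>" "Re \<rho> \<le> 1"
  defines "Kt \<equiv> (3/2 - Re \<rho>) / ((3/2 - Re \<rho>)\<^sup>2 + (t - Im \<rho>)\<^sup>2)
                + (1/2 + Re \<rho>) / ((1/2 + Re \<rho>)\<^sup>2 + (t - Im \<rho>)\<^sup>2)"
  shows "\<exists>I. ((\<lambda>\<sigma>. ln (cmod (Complex (\<sigma>+1) t - \<rho>)) + ln (cmod (Complex (\<sigma>+1) t - (1 - cnj \<rho>)))
            - ln (cmod (Complex \<sigma> t - \<rho>)) - ln (cmod (Complex \<sigma> t - (1 - cnj \<rho>)))) has_integral I) {1/2..3/2}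
         \<and> I \<le> ln 4 * Kt"
proof -
  define b where "b = Re \<rho> - 1/2"
  define y where "y = t - Im \<rho>"
  have e: "Complex (\<sigma>+1) t - \<rho> = Complex (\<sigma> + (1/2 - b)) y"
       "Complex (\<sigma>+1) t - (1 - cnj \<rho>) = Complex (\<sigma> + (1/2 + b)) y"
       "Complex \<sigma> t - \<rho> = Complex (\<sigma> + (-1/2 - b)) y"
       "Complex \<sigma> t - (1 - cnj \<rho>) = Complex (\<sigma> + (-1/2 + b)) y" for \<sigma>
    by (auto simp: complex_eq_iff b_def y_def)
  note I = ln_has_integral[of "1/2" "3/2" _ y, OF order.strict_implies_order, simplified]
  have *: "((\<lambda>\<sigma>. ln (cmod (Complex (\<sigma> + (1/2 - b)) y)) + ln (cmod (Complex (\<sigma> + (1/2 + b)) y))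
            - ln (cmod (Complex (\<sigma> + (-1/2 - b)) y)) - ln (cmod (Complex (\<sigma> + (-1/2 + b)) y))) has_integral
        ((log_prim y (3/2 + (1/2 - b)) - log_prim y (1/2 + (1/2 - b)))
         + (log_prim y (3/2 + (1/2 + b)) - log_prim y (1/2 + (1/2 + b)))
         - (log_prim y (3/2 + (-1/2 - b)) - log_prim y (1/2 + (-1/2 - b)))
         - (log_prim y (3/2 + (-1/2 + b)) - log_prim y (1/2 + (-1/2 + b))))) {1/2..3/2}"
    by (intro has_integral_add has_integral_diff ln_has_integral) auto
  have "\<bar>b\<bar> \<le> 1/2" unfolding b_def abs_le_iff using assms(1,2) by auto
  from kernel_ineq[OF this, of y] have "
        ((log_prim y (3/2 + (1/2 - b)) - log_prim y (1/2 + (1/2 - b)))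
         + (log_prim y (3/2 + (1/2 + b)) - log_prim y (1/2 + (1/2 + b)))
         - (log_prim y (3/2 + (-1/2 - b)) - log_prim y (1/2 + (-1/2 - b)))
         - (log_prim y (3/2 + (-1/2 + b)) - log_prim y (1/2 + (-1/2 + b))))
      \<le> ln 4 * ((1-b)/((1-b)\<^sup>2+y\<^sup>2) + (1+b)/((1+b)\<^sup>2+y\<^sup>2))" by simp
  also have "(1-b)/((1-b)\<^sup>2+y\<^sup>2) + (1+b)/((1+b)\<^sup>2+y\<^sup>2) = Kt"
    by (simp add: b_def y_def Kt_def)
  finally show ?thesis using * unfolding e(1,2) unfolding e(3,4) by blast
qed

text \<open>Averaging the factorization at s with that at 1 - cnj s pairs every listed zero with its
  mirror image, even if the finite list is not symmetric. Each pair is handled by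
  \<open>reflect_log_integral\<close>; the exponential factor contributes a multiple of \<delta>,
  and \<delta> tends to 0.\<close>

lemma xi_log_integral:
  fixes X :: "complex \<Rightarrow> complex" and t :: real
  assumes X: "X holomorphic_on UNIV" and gr: "exp_growth X a" "0 \<le> a" "a < 2"
    and sym: "\<And>s. cmod (X (1 - cnj s)) = cmod (X s)"
    and zeros: "\<And>s. X s = 0 \<Longrightarrow> 0 \<le> Re s \<and> Re s \<le> 1"
  shows "\<exists>I. ((\<lambda>\<sigma>. ln (cmod (X (Complex (\<sigma>+1) t))) - ln (cmod (X (Complex \<sigma> t)))) has_integral I) {1/2..3/2}
     \<and> I \<le> ln 4 * Re (deriv X (Complex (3/2) t) / X (Complex (3/2) t))"
proof -
  define f where "f = (\<lambda>\<sigma>. ln (cmod (X (Complex (\<sigma>+1) t))) - ln (cmod (X (Complex \<sigma> t))))"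
  define D where "D = Re (deriv X (Complex (3/2) t) / X (Complex (3/2) t))"
  have X2: "X 2 \<noteq> 0" using zeros[of 2] by auto
  define R where "R = \<bar>t\<bar> + 10"
  \<comment> \<open>The factor 2 on I and D comes from using X both at s and at its
    reflection.\<close>
  have "\<exists>I. (f has_integral I) {1/2..3/2} \<and> 2 * I \<le> 3 * \<delta> + ln 4 * (2 * D + 2 * \<delta>)" if \<delta>: "\<delta> > 0" for \<delta>
  proof -
    have R0: "R > 0" by (simp add: R_def)
    obtain n :: nat and A k where A: "\<And>i. i < n \<Longrightarrow> X (A i) = 0" and k: "k holomorphic_on ball 2 R"
      and fac: "\<And>z. z \<in> ball 2 R \<Longrightarrow> X z = exp (k z) * (\<Prod>i<n. z - A i)"
      and lip: "\<And>z w. z \<in> ball 2 R \<Longrightarrow> w \<in> ball 2 R \<Longrightarrow> cmod (deriv k z - deriv k w) \<le> \<delta> * cmod (z - w)"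
      using entire_local_factorization[OF X X2 gr R0 \<delta>] by blast
    have inb: "Complex \<sigma> t \<in> ball 2 (R - 1)" if "-5 \<le> \<sigma>" "\<sigma> \<le> 5" for \<sigma>
    proof -
      have "cmod (Complex \<sigma> t - 2) \<le> \<bar>\<sigma> - 2\<bar> + \<bar>t\<bar>"
        using cmod_le[of "Complex \<sigma> t - 2"] by simp
      then show ?thesis using that by (simp add: dist_norm norm_minus_commute R_def abs_le_iff)
    qed
    have sub: "ball 2 (R - 1) \<subseteq> ball (2::complex) R" by auto
    have inb': "Complex \<sigma> t \<in> ball 2 R" if "-5 \<le> \<sigma>" "\<sigma> \<le> 5" for \<sigma>
      using inb[OF that] sub by blast
    have lnfac: "ln (cmod (X z)) = Re (k z) + (\<Sum>i<n. ln (cmod (z - A i)))" if "z \<in> ball 2 R" "X z \<noteq> 0" for z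
    proof -
      have nz: "z \<noteq> A i" if "i < n" for i using A[OF that] \<open>X z \<noteq> 0\<close> by auto
      have "cmod (X z) = exp (Re (k z)) * (\<Prod>i<n. cmod (z - A i))"
        by (simp add: fac[OF that(1)] norm_mult prod_norm)
      also have "ln \<dots> = Re (k z) + ln (\<Prod>i<n. cmod (z - A i))"
        using nz by (subst ln_mult) (auto intro!: prod_pos)
      also have "ln (\<Prod>i<n. cmod (z - A i)) = (\<Sum>i<n. ln (cmod (z - A i)))"
        using nz by (intro ln_prod) auto
      finally show ?thesis .
    qed
    have refl: "1 - cnj (Complex \<sigma> t) = Complex (1 - \<sigma>) t" for \<sigma> by (simp add: complex_eq_iff)
    have two: "2 * ln (cmod (X (Complex \<sigma> t))) = Re (k (Complex \<sigma> t)) + Re (k (Complex (1-\<sigma>) t))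
        + (\<Sum>i<n. ln (cmod (Complex \<sigma> t - A i)) + ln (cmod (Complex \<sigma> t - (1 - cnj (A i)))))"
      if "-4 \<le> \<sigma>" "\<sigma> \<le> 5" "X (Complex \<sigma> t) \<noteq> 0" for \<sigma>
    proof -
      have eq: "cmod (X (Complex (1 - \<sigma>) t)) = cmod (X (Complex \<sigma> t))"
        using sym[of "Complex \<sigma> t"] by (simp add: refl)
      then have "X (Complex (1 - \<sigma>) t) \<noteq> 0" using that(3) by auto
      moreover have "cmod (Complex (1-\<sigma>) t - A i) = cmod (Complex \<sigma> t - (1 - cnj (A i)))" for i
        by (simp add: cmod_def power2_commute) (simp add: power2_eq_square algebra_simps)
      ultimately show ?thesis
        using lnfac[of "Complex \<sigma> t"] lnfac[of "Complex (1-\<sigma>) t"] inb'[of \<sigma>] inb'[of "1-\<sigma>"] that eq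
        by (simp add: sum.distrib)
    qed
    define Kt where "Kt = (\<lambda>i. (3/2 - Re (A i)) / ((3/2 - Re (A i))\<^sup>2 + (t - Im (A i))\<^sup>2)
                + (1/2 + Re (A i)) / ((1/2 + Re (A i))\<^sup>2 + (t - Im (A i))\<^sup>2))"
    define F where "F = (\<lambda>i \<sigma>. ln (cmod (Complex (\<sigma>+1) t - A i)) + ln (cmod (Complex (\<sigma>+1) t - (1 - cnj (A i))))
            - ln (cmod (Complex \<sigma> t - A i)) - ln (cmod (Complex \<sigma> t - (1 - cnj (A i)))))"
    have "\<forall>i. \<exists>I. i < n \<longrightarrow> (F i has_integral I) {1/2..3/2} \<and> I \<le> ln 4 * Kt i"
      using reflect_log_integral[of "A _" t] zeros A unfolding F_def Kt_def by blast
    then obtain J where J: "\<And>i. i < n \<Longrightarrow> (F i has_integral J i) {1/2..3/2}" "\<And>i. i < n \<Longrightarrow> J i \<le> ln 4 * Kt i"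
      by metis
    \<comment> \<open>The part of 2 f due to the exponential factors. It is a second-order
      difference of Re k, so an almost constant derivative of k makes it small.\<close>
    define g where "g = (\<lambda>\<sigma>. Re (k (Complex (\<sigma>+1) t)) + Re (k (Complex (-\<sigma>) t))
        - Re (k (Complex \<sigma> t)) - Re (k (Complex (1-\<sigma>) t)))"
    have hc: "continuous_on A (\<lambda>\<sigma>. Complex (h \<sigma>) t)" if "continuous_on A h" for h A
      using that by (auto simp: Complex_eq intro!: continuous_intros)
    have gc: "continuous_on {1/2..3/2} g"
      unfolding g_def
      by (intro continuous_intros continuous_on_compose2[OF holomorphic_on_imp_continuous_on[OF k]] hc)
         (auto intro!: inb')
    have gb: "g \<sigma> \<le> 3 * \<delta>" if \<sigma>: "\<sigma> \<in> {1/2..3/2}" for \<sigma>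
    proof -
      \<comment> \<open>The derivative of q is a difference of k' at points one apart, hence at most
        \<delta>; g compares q at \<sigma> and -\<sigma>, which are at most 3 apart.\<close>
      define q where "q = (\<lambda>z. k (z + 1) - k z)"
      have "cmod (q (Complex \<sigma> t) - q (Complex (-\<sigma>) t)) \<le> \<delta> * cmod (Complex \<sigma> t - Complex (-\<sigma>) t)"
      proof (rule field_differentiable_bound[of "ball 2 (R - 1)" q "\<lambda>z. deriv k (z + 1) - deriv k z"])
        fix z assume z: "z \<in> ball (2::complex) (R - 1)"
        have "dist 2 (z + 1) \<le> dist 2 z + dist z (z + 1)" by (rule dist_triangle)
        then have z1: "z + 1 \<in> ball 2 R" using z by (simp add: dist_norm)
        have z2: "z \<in> ball 2 R" using z by auto
        have "(k has_field_derivative deriv k (z + 1)) (at (z + 1))" "(k has_field_derivative deriv k z) (at z)"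
          using holomorphic_derivI[OF k open_ball] z1 z2 by auto
        then have "(q has_field_derivative deriv k (z + 1) - deriv k z) (at z)"
          unfolding q_def by (intro DERIV_diff) (simp_all add: DERIV_shift)
        then show "(q has_field_derivative deriv k (z + 1) - deriv k z) (at z within ball 2 (R - 1))"
          by (rule has_field_derivative_at_within)
        show "cmod (deriv k (z + 1) - deriv k z) \<le> \<delta>"
          using lip[OF z1 z2] by simp
      qed (use \<sigma> inb in auto)
      also have "Complex \<sigma> t - Complex (-\<sigma>) t = of_real (2 * \<sigma>)" by (simp add: complex_eq_iff)
      also have "\<delta> * cmod (of_real (2 * \<sigma>)) \<le> \<delta> * 3"
        using \<sigma> \<delta> by (intro mult_left_mono) (simp_all add: norm_mult)
      finally have "Re (q (Complex \<sigma> t) - q (Complex (-\<sigma>) t)) \<le> 3 * \<delta>"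
        using complex_Re_le_cmod[of "q (Complex \<sigma> t) - q (Complex (-\<sigma>) t)"] by linarith
      moreover have "Complex \<sigma> t + 1 = Complex (\<sigma>+1) t" "Complex (-\<sigma>) t + 1 = Complex (1-\<sigma>) t"
        by (auto simp: complex_eq_iff)
      ultimately show ?thesis by (simp add: g_def q_def)
    qed
    have gi: "(g has_integral integral {1/2..3/2} g) {1/2..3/2}"
      using integrable_integral[OF integrable_continuous_interval[OF gc]] .
    have gi_le: "integral {1/2..3/2} g \<le> 3 * \<delta>"
      using has_integral_le[OF gi has_integral_const_real[of "3 * \<delta>"] gb] by simp
    have tot: "((\<lambda>\<sigma>. (g \<sigma> + (\<Sum>i<n. F i \<sigma>)) / 2) has_integral ((integral {1/2..3/2} g + (\<Sum>i<n. J i)) / 2)) {1/2..3/2}"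
      using J by (intro has_integral_divide has_integral_add gi has_integral_sum) auto
    have fin: "finite {\<sigma>\<in>{1/2..3/2}. X (Complex \<sigma> t) = 0}"
    proof -
      have "finite (A ` {..<n})" by simp
      moreover have "{\<sigma>\<in>{1/2..3/2}. X (Complex \<sigma> t) = 0} \<subseteq> Re ` (A ` {..<n})"
      proof
        fix \<sigma> assume "\<sigma> \<in> {\<sigma>\<in>{1/2..3/2}. X (Complex \<sigma> t) = 0}"
        then have "(\<Prod>i<n. Complex \<sigma> t - A i) = 0" using fac[OF inb'[of \<sigma>]] by auto
        then obtain i where "i < n" "Complex \<sigma> t = A i" by auto
        then show "\<sigma> \<in> Re ` (A ` {..<n})" by (metis complex.sel(1) imageI lessThan_iff)
      qed
      ultimately show ?thesis using finite_subset by blast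
    qed
    \<comment> \<open>At the finitely many zeros on the segment ln 0 has a default value and the
      identity fails; the integral does not see them.\<close>
    have fI: "(f has_integral ((integral {1/2..3/2} g + (\<Sum>i<n. J i)) / 2)) {1/2..3/2}"
    proof (rule has_integral_spike_finite[OF fin _ tot])
      fix \<sigma> assume \<sigma>: "\<sigma> \<in> {1/2..3/2} - {\<sigma>\<in>{1/2..3/2}. X (Complex \<sigma> t) = 0}"
      then have "X (Complex (\<sigma>+1) t) \<noteq> 0" using zeros[of "Complex (\<sigma>+1) t"] by auto
      then have "2 * f \<sigma> = g \<sigma> + (\<Sum>i<n. F i \<sigma>)"
        using two[of "\<sigma>+1"] two[of \<sigma>] \<sigma>
        by (simp add: f_def g_def F_def sum.distrib sum_subtractf algebra_simps)
      then show "f \<sigma> = (g \<sigma> + (\<Sum>i<n. F i \<sigma>)) / 2" by simp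
    qed
    \<comment> \<open>Differentiating \<open>two\<close> at 3/2. Reflection reverses the direction
      of \<sigma>, hence the minus sign on the second derivative of k.\<close>
    have D2: "2 * D = Re (deriv k (Complex (3/2) t)) - Re (deriv k (Complex (-1/2) t)) + (\<Sum>i<n. Kt i)"
    proof -
      have nz: "X (Complex (3/2) t) \<noteq> 0" using zeros[of "Complex (3/2) t"] by auto
      have "X field_differentiable at (Complex (3/2) t)"
        using X holomorphic_on_imp_differentiable_at by blast
      then have d1: "((\<lambda>\<sigma>. 2 * ln (cmod (X (Complex \<sigma> t)))) has_real_derivative 2 * D) (at (3/2))"
        unfolding D_def by (intro DERIV_cmult ln_cmod_deriv nz)
      have cR: "((\<lambda>\<sigma>. Complex \<sigma> t) has_vector_derivative 1) (at \<sigma>)" for \<sigma>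
        unfolding has_vector_derivative_complex_iff by (auto intro!: derivative_eq_intros)
      have cR2: "((\<lambda>\<sigma>. Complex (1-\<sigma>) t) has_vector_derivative -1) (at \<sigma>)" for \<sigma>
        unfolding has_vector_derivative_complex_iff by (auto intro!: derivative_eq_intros)
      have kd: "(k has_field_derivative deriv k (Complex \<sigma> t)) (at (Complex \<sigma> t))" if "-5 \<le> \<sigma>" "\<sigma> \<le> 5" for \<sigma>
        using holomorphic_derivI[OF k open_ball] inb'[OF that] by blast
      have "((\<lambda>\<sigma>. k (Complex \<sigma> t)) has_vector_derivative 1 * deriv k (Complex (3/2) t)) (at (3/2))"
        using field_vector_diff_chain_at[OF cR kd] by (simp add: o_def)
      then have k1: "((\<lambda>\<sigma>. Re (k (Complex \<sigma> t))) has_real_derivative Re (deriv k (Complex (3/2) t))) (at (3/2))"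
        unfolding has_vector_derivative_complex_iff by simp
      have "((\<lambda>\<sigma>. k (Complex (1-\<sigma>) t)) has_vector_derivative -1 * deriv k (Complex (1-3/2) t)) (at (3/2))"
      proof -
        have "(k has_field_derivative deriv k (Complex (1-3/2) t)) (at (Complex (1 - 3/2) t))"
          by (rule kd) auto
        from field_vector_diff_chain_at[OF cR2 this] show ?thesis by (simp only: o_def)
      qed
      then have k2: "((\<lambda>\<sigma>. Re (k (Complex (1-\<sigma>) t))) has_real_derivative - Re (deriv k (Complex (-1/2) t))) (at (3/2))"
        unfolding has_vector_derivative_complex_iff by simp
      have l: "((\<lambda>\<sigma>. ln (cmod (Complex \<sigma> t - \<rho>))) has_real_derivative (3/2 - Re \<rho>) / ((3/2 - Re \<rho>)\<^sup>2 + (t - Im \<rho>)\<^sup>2)) (at (3/2))"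
        if "Re \<rho> \<le> 1" for \<rho>
      proof -
        have "((\<lambda>z. z - \<rho>) has_field_derivative 1) (at z)" for z
          by (auto intro!: derivative_eq_intros)
        then have "deriv (\<lambda>z. z - \<rho>) z = 1" "(\<lambda>z. z - \<rho>) field_differentiable at z" for z
          by (auto intro: DERIV_imp_deriv simp: field_differentiable_def)
        then have "((\<lambda>\<sigma>. ln (cmod (Complex \<sigma> t - \<rho>))) has_real_derivative Re (1 / (Complex (3/2) t - \<rho>))) (at (3/2))"
          using ln_cmod_deriv[of "\<lambda>z. z - \<rho>" "3/2" t] that by (auto simp: complex_eq_iff)
        then show ?thesis by (simp add: Re_divide)
      qed
      have Ai: "Re (A i) \<le> 1" "Re (1 - cnj (A i)) \<le> 1" if "i < n" for i
        using zeros[OF A[OF that]] by auto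
      have "((\<lambda>\<sigma>. Re (k (Complex \<sigma> t)) + Re (k (Complex (1-\<sigma>) t))
        + (\<Sum>i<n. ln (cmod (Complex \<sigma> t - A i)) + ln (cmod (Complex \<sigma> t - (1 - cnj (A i))))))
         has_real_derivative (Re (deriv k (Complex (3/2) t)) + (- Re (deriv k (Complex (-1/2) t))) + 
         (\<Sum>i<n. (3/2 - Re (A i)) / ((3/2 - Re (A i))\<^sup>2 + (t - Im (A i))\<^sup>2)
            + (3/2 - Re (1 - cnj (A i))) / ((3/2 - Re (1 - cnj (A i)))\<^sup>2 + (t - Im (1 - cnj (A i)))\<^sup>2)))) (at (3/2))"
        using Ai by (intro DERIV_add DERIV_sum k1 k2 l) auto
      then have d2: "((\<lambda>\<sigma>. Re (k (Complex \<sigma> t)) + Re (k (Complex (1-\<sigma>) t))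
        + (\<Sum>i<n. ln (cmod (Complex \<sigma> t - A i)) + ln (cmod (Complex \<sigma> t - (1 - cnj (A i))))))
         has_real_derivative (Re (deriv k (Complex (3/2) t)) - Re (deriv k (Complex (-1/2) t)) + (\<Sum>i<n. Kt i))) (at (3/2))"
        by (simp add: Kt_def)
      have "((\<lambda>\<sigma>. 2 * ln (cmod (X (Complex \<sigma> t)))) has_real_derivative
          (Re (deriv k (Complex (3/2) t)) - Re (deriv k (Complex (-1/2) t)) + (\<Sum>i<n. Kt i))) (at (3/2))"
      proof (rule has_field_derivative_transform_within_open[OF d2, of "{1<..<2}"])
        fix \<sigma> :: real assume "\<sigma> \<in> {1<..<2}"
        then show "Re (k (Complex \<sigma> t)) + Re (k (Complex (1-\<sigma>) t))
        + (\<Sum>i<n. ln (cmod (Complex \<sigma> t - A i)) + ln (cmod (Complex \<sigma> t - (1 - cnj (A i))))) = 2 * ln (cmod (X (Complex \<sigma> t)))"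
          using two[of \<sigma>] zeros[of "Complex \<sigma> t"] by force
      qed auto
      then show ?thesis using d1 DERIV_unique by blast
    qed
    have "cmod (deriv k (Complex (3/2) t) - deriv k (Complex (-1/2) t)) \<le> \<delta> * cmod (Complex (3/2) t - Complex (-1/2) t)"
      by (intro lip inb') auto
    also have "Complex (3/2) t - Complex (-1/2) t = 2" by (simp add: complex_eq_iff)
    finally have "\<bar>Re (deriv k (Complex (3/2) t) - deriv k (Complex (-1/2) t))\<bar> \<le> 2 * \<delta>"
      using abs_Re_le_cmod[of "deriv k (Complex (3/2) t) - deriv k (Complex (-1/2) t)"] by simp
    then have "(\<Sum>i<n. Kt i) \<le> 2 * D + 2 * \<delta>" using D2 by (simp add: abs_le_iff)
    then have "ln 4 * (\<Sum>i<n. Kt i) \<le> ln 4 * (2 * D + 2 * \<delta>)" by (intro mult_left_mono) auto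
    moreover have "(\<Sum>i<n. J i) \<le> ln 4 * (\<Sum>i<n. Kt i)"
      unfolding sum_distrib_left using J(2) by (intro sum_mono) auto
    ultimately have "integral {1/2..3/2} g + (\<Sum>i<n. J i) \<le> 3 * \<delta> + ln 4 * (2 * D + 2 * \<delta>)"
      using gi_le by linarith
    then show ?thesis using fI by (intro exI[of _ "(integral {1/2..3/2} g + (\<Sum>i<n. J i)) / 2"]) auto
  qed
  note main = this
  obtain I where I: "(f has_integral I) {1/2..3/2}" using main[of 1] by auto
  have le: "2 * I \<le> 3 * \<delta> + ln 4 * (2 * D + 2 * \<delta>)" if "\<delta> > 0" for \<delta>
    using main[OF that] I has_integral_unique by blast
  \<comment> \<open>I does not depend on \<delta>, by uniqueness of the integral, so the limit may
    be taken in the inequality.\<close>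
  have "((\<lambda>\<delta>. 3 * \<delta> + ln 4 * (2 * D + 2 * \<delta>)) \<longlongrightarrow> 3 * 0 + ln 4 * (2 * D + 2 * 0)) (at_right 0)"
    by (intro tendsto_intros)
  then have "2 * I \<le> 3 * 0 + ln 4 * (2 * D + 2 * 0)"
    by (rule tendsto_lowerbound) (auto simp: eventually_at_right_less intro!: eventually_at_rightI[of 0 1] le)
  then have "I \<le> ln 4 * D" by simp
  then show ?thesis using I unfolding f_def D_def by blast
qed

section \<open>Stirling estimates for the gamma factors\<close>

text \<open>The left side is the error of the trapezoidal rule for the integral of 1/z from w to w +
  1. With the endpoint w + u in place of w + 1, its derivative in u has modulus at most u^2 / (2
  |w|^3).\<close>

lemma trapezoid_error:
  fixes w :: complex
  assumes w: "Re w \<ge> 0" "w \<noteq> 0"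
  shows "cmod (Ln (w + 1) - Ln w - (1 / w + 1 / (w + 1)) / 2) \<le> 1 / (6 * cmod w ^ 3)"
proof -
  have nz: "w + of_real u \<noteq> 0" "cmod (w + of_real u) \<ge> cmod w" "w + of_real u \<notin> \<real>\<^sub>\<le>\<^sub>0" if "u \<ge> 0" for u
  proof -
    have "(Re w)\<^sup>2 \<le> (Re w + u)\<^sup>2" using w that by (intro power_mono) auto
    then show g: "cmod (w + of_real u) \<ge> cmod w" by (simp add: cmod_def)
    then show z: "w + of_real u \<noteq> 0" using w by auto
    show "w + of_real u \<notin> \<real>\<^sub>\<le>\<^sub>0"
    proof
      assume "w + of_real u \<in> \<real>\<^sub>\<le>\<^sub>0"
      then have "Re (w + of_real u) \<le> 0" "Im (w + of_real u) = 0" by (auto simp: complex_nonpos_Reals_iff)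
      then have "w + of_real u = 0" using w that by (auto simp: complex_eq_iff)
      then show False using z by simp
    qed
  qed
  define e where "e = (\<lambda>u::real. Ln (w + of_real u) - Ln w - of_real u / 2 * (1 / w + 1 / (w + of_real u)))"
  have der: "(e has_vector_derivative - (of_real u)\<^sup>2 / (2 * w * (w + of_real u)\<^sup>2)) (at u)" if "u \<ge> 0" for u
  proof -
    have "((\<lambda>z. Ln (w + z) - Ln w - z / 2 * (1 / w + 1 / (w + z))) has_field_derivative
        (1 / (w + of_real u) - (1 / 2 * (1 / w + 1 / (w + of_real u)) + of_real u / 2 * (- 1 / (w + of_real u)\<^sup>2)))) (at (of_real u))"
    proof -
      have 1: "((\<lambda>z. Ln (w + z)) has_field_derivative 1 / (w + of_real u)) (at (of_real u))"
        using nz[OF that] by (auto intro!: derivative_eq_intros simp: field_simps)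
      have 2: "((\<lambda>z. 1 / w + 1 / (w + z)) has_field_derivative - 1 / (w + of_real u)\<^sup>2) (at (of_real u))"
      proof -
        have "((\<lambda>z. w + z) has_field_derivative 1) (at (of_real u))"
          by (auto intro!: derivative_eq_intros)
        from DERIV_add[OF DERIV_const[of "1 / w"] DERIV_inverse'[OF this nz(1)[OF that]]]
        show ?thesis by (simp add: inverse_eq_divide power2_eq_square)
      qed
      have 3: "((\<lambda>z::complex. z / 2) has_field_derivative 1 / 2) (at (of_real u))"
        by (auto intro!: derivative_eq_intros)
      show ?thesis
        using DERIV_diff[OF DERIV_diff[OF 1 DERIV_const[of "Ln w"]] DERIV_mult[OF 3 2]]
        by (simp add: mult.commute)
    qed
    moreover have "1 / (w + of_real u) - (1 / 2 * (1 / w + 1 / (w + of_real u)) + of_real u / 2 * (- 1 / (w + of_real u)\<^sup>2))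
       = - (of_real u)\<^sup>2 / (2 * w * (w + of_real u)\<^sup>2)"
    proof -
      have "1 / a - (1 / 2 * (1 / w + 1 / a) + b / 2 * (- 1 / a\<^sup>2)) = - b\<^sup>2 / (2 * w * a\<^sup>2)"
        if "a \<noteq> 0" "a = w + b" for a b
        using that(1) w(2) by (simp add: divide_simps) (simp add: that(2) power2_eq_square algebra_simps)
      then show ?thesis using nz(1)[OF that] by blast
    qed
    ultimately have X: "((\<lambda>z. Ln (w + z) - Ln w - z / 2 * (1 / w + 1 / (w + z))) has_field_derivative
        - (of_real u)\<^sup>2 / (2 * w * (w + of_real u)\<^sup>2)) (at (of_real u))"
      by (simp only:)
    show ?thesis
      unfolding e_def by (rule has_vector_derivative_real_field[OF X])
  qed
  have "cmod (e 1 - e 0) \<le> 1 ^ 3 / (6 * cmod w ^ 3) - 0 ^ 3 / (6 * cmod w ^ 3)"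
  proof (rule differentiable_bound_general[where f = e and \<phi> = "\<lambda>u. u ^ 3 / (6 * cmod w ^ 3)" and a = 0 and b = 1])
    show "continuous_on {0..1} e"
      using der by (meson atLeastAtMost_iff continuous_at_imp_continuous_on has_vector_derivative_continuous)
    show "continuous_on {0..1} (\<lambda>u. u ^ 3 / (6 * cmod w ^ 3))"
      using w by (intro continuous_intros) auto
    fix u :: real assume u: "0 < u" "u < 1"
    show "(e has_vector_derivative - (of_real u)\<^sup>2 / (2 * w * (w + of_real u)\<^sup>2)) (at u)"
      using der u by simp
    show "((\<lambda>u. u ^ 3 / (6 * cmod w ^ 3)) has_vector_derivative u\<^sup>2 / (2 * cmod w ^ 3)) (at u)"
      unfolding has_real_derivative_iff_has_vector_derivative[symmetric]
      using w by (auto intro!: derivative_eq_intros simp: field_simps)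
    have "cmod (- (of_real u)\<^sup>2 / (2 * w * (w + of_real u)\<^sup>2)) = u\<^sup>2 / (2 * (cmod w * cmod (w + of_real u) ^ 2))"
      by (simp add: norm_divide norm_mult norm_power)
    also have "\<dots> \<le> u\<^sup>2 / (2 * (cmod w * cmod w ^ 2))"
      using nz(2)[of u] u w by (intro divide_left_mono mult_left_mono power_mono mult_pos_pos) auto
    finally show "cmod (- (of_real u)\<^sup>2 / (2 * w * (w + of_real u)\<^sup>2)) \<le> u\<^sup>2 / (2 * cmod w ^ 3)"
      by (simp add: power3_eq_cube power2_eq_square)
  qed auto
  then show ?thesis by (simp add: e_def)
qed

text \<open>Integral comparison: G is the primitive of (c^2 + x^2)^(-3/2) that vanishes at 0 and is
  bounded by 1 / c^2.\<close>

lemma sum_inverse_cube: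
  fixes c :: real assumes c: "c > 0"
  shows "(\<Sum>n<m. 1 / sqrt (c\<^sup>2 + (real (Suc n))\<^sup>2) ^ 3) \<le> 1 / c\<^sup>2"
proof -
  define G where "G = (\<lambda>x. x / (c\<^sup>2 * sqrt (c\<^sup>2 + x\<^sup>2)))"
  have pos: "c\<^sup>2 + x\<^sup>2 > 0" for x using c by (simp add: add_pos_nonneg)
  have G': "(G has_real_derivative 1 / sqrt (c\<^sup>2 + x\<^sup>2) ^ 3) (at x)" for x
  proof -
    define q where "q = sqrt (c\<^sup>2 + x\<^sup>2)"
    have q: "q > 0" "q\<^sup>2 = c\<^sup>2 + x\<^sup>2" using pos[of x] by (auto simp: q_def)
    have r: "((\<lambda>x. c\<^sup>2 + x\<^sup>2) has_real_derivative 2 * x) (at x)" by (auto intro!: derivative_eq_intros)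
    have s: "((\<lambda>x. sqrt (c\<^sup>2 + x\<^sup>2)) has_real_derivative inverse q / 2 * (2 * x)) (at x)"
      unfolding q_def by (rule DERIV_chain2[OF DERIV_real_sqrt[OF pos] r])
    have "(G has_real_derivative (1 * (c\<^sup>2 * q) - x * (c\<^sup>2 * (inverse q / 2 * (2 * x)))) / ((c\<^sup>2 * q) * (c\<^sup>2 * q))) (at x)"
      unfolding G_def q_def
      by (rule DERIV_divide[OF DERIV_ident DERIV_cmult[OF s[unfolded q_def]]]) (use c pos[of x] in auto)
    moreover have "(1 * (c\<^sup>2 * q) - x * (c\<^sup>2 * (inverse q / 2 * (2 * x)))) / ((c\<^sup>2 * q) * (c\<^sup>2 * q)) = 1 / q ^ 3"
    proof -
      have "1 * (c\<^sup>2 * q) - x * (c\<^sup>2 * (inverse q / 2 * (2 * x))) = c\<^sup>2 * (q\<^sup>2 - x\<^sup>2) / q"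
        using q(1) by (simp add: field_simps power2_eq_square)
      then show ?thesis using q c by (simp add: power2_eq_square power3_eq_cube)
    qed
    ultimately show ?thesis by (simp add: q_def)
  qed
  have step: "1 / sqrt (c\<^sup>2 + (real (Suc n))\<^sup>2) ^ 3 \<le> G (real (Suc n)) - G (real n)" for n
  proof -
    have "\<exists>z>real n. z < real (Suc n) \<and> G (real (Suc n)) - G (real n) = (real (Suc n) - real n) * (1 / sqrt (c\<^sup>2 + z\<^sup>2) ^ 3)"
      by (rule MVT2) (auto intro: G')
    then obtain z where z: "z > real n" "z < real (Suc n)"
        "G (real (Suc n)) - G (real n) = (real (Suc n) - real n) * (1 / sqrt (c\<^sup>2 + z\<^sup>2) ^ 3)" by blast
    have "z\<^sup>2 \<le> (real (Suc n))\<^sup>2" using z by (intro power_mono) auto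
    then have "sqrt (c\<^sup>2 + z\<^sup>2) ^ 3 \<le> sqrt (c\<^sup>2 + (real (Suc n))\<^sup>2) ^ 3" by (intro power_mono) auto
    moreover have "sqrt (c\<^sup>2 + z\<^sup>2) ^ 3 > 0" using pos[of z] by simp
    ultimately show ?thesis using z(3) by (simp add: frac_le)
  qed
  have "(\<Sum>n<m. 1 / sqrt (c\<^sup>2 + (real (Suc n))\<^sup>2) ^ 3) \<le> (\<Sum>n<m. G (real (Suc n)) - G (real n))"
    by (intro sum_mono step)
  also have "\<dots> = G (real m) - G 0"
    using sum_lessThan_telescope[of "\<lambda>n. G (real n)" m] by simp
  also have "\<dots> \<le> 1 / c\<^sup>2"
  proof -
    have "real m \<le> sqrt (c\<^sup>2 + (real m)\<^sup>2)" by (rule real_le_rsqrt) simp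
    then show ?thesis using pos[of "real m"] c by (simp add: G_def field_simps)
  qed
  finally show ?thesis .
qed

text \<open>Summing trapezoidal errors along z, z + 1, ... telescopes to the limit formula for
  \<open>Digamma\<close>. Re z \<ge> 0 gives |z + n|^2 \<ge> |z|^2 + n^2, and |z| \<ge> 2 turns the
  first term 1 / c^3 into 1 / (2 c^2); then (1/6)(1/2 + 1) = 1/4.\<close>

lemma Digamma_bound:
  fixes z :: complex
  assumes z: "Re z \<ge> 0" "cmod z \<ge> 2"
  shows "cmod (Digamma z - Ln z + 1 / (2 * z)) \<le> 1 / (4 * (cmod z)\<^sup>2)"
proof -
  define c where "c = cmod z"
  have c: "c \<ge> 2" "c > 0" using z by (auto simp: c_def)
  have z0: "z \<noteq> 0" using z by auto
  define E where "E = (\<lambda>w::complex. Ln (w + 1) - Ln w - (1 / w + 1 / (w + 1)) / 2)"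
  have nz: "z + of_nat n \<noteq> 0" for n
  proof
    assume "z + of_nat n = 0"
    then have "Re z + real n = 0" "Im z = 0" by (auto simp: complex_eq_iff)
    then show False using z by (auto simp: cmod_def)
  qed
  have lower: "cmod (z + of_nat n) \<ge> sqrt (c\<^sup>2 + (real n)\<^sup>2)" for n
  proof -
    have "c\<^sup>2 + (real n)\<^sup>2 \<le> (Re z + real n)\<^sup>2 + (Im z)\<^sup>2"
      using z(1) by (simp add: c_def cmod_power2 power2_sum)
    then show ?thesis by (simp add: cmod_def)
  qed
  have cpos: "c\<^sup>2 + (real n)\<^sup>2 > 0" for n using c by (simp add: add_pos_nonneg)
  have En: "cmod (E (z + of_nat n)) \<le> 1 / 6 * (1 / sqrt (c\<^sup>2 + (real n)\<^sup>2) ^ 3)" for n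
  proof -
    have "cmod (E (z + of_nat n)) \<le> 1 / (6 * cmod (z + of_nat n) ^ 3)"
      unfolding E_def by (rule trapezoid_error) (use z nz in auto)
    also have "\<dots> \<le> 1 / (6 * sqrt (c\<^sup>2 + (real n)\<^sup>2) ^ 3)"
      using lower[of n] cpos[of n] nz[of n] by (intro divide_left_mono mult_left_mono power_mono mult_pos_pos) auto
    finally show ?thesis by simp
  qed
  have sumE: "cmod (\<Sum>n<m. E (z + of_nat n)) \<le> 1 / (4 * c\<^sup>2)" for m
  proof (cases m)
    case 0
    then show ?thesis by simp
  next
    case (Suc k)
    have "cmod (\<Sum>n<m. E (z + of_nat n)) \<le> (\<Sum>n<m. 1 / 6 * (1 / sqrt (c\<^sup>2 + (real n)\<^sup>2) ^ 3))"
      by (rule sum_norm_le) (rule En)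
    also have "\<dots> = 1 / 6 * (1 / c ^ 3 + (\<Sum>n<k. 1 / sqrt (c\<^sup>2 + (real (Suc n))\<^sup>2) ^ 3))"
      using c unfolding Suc sum.lessThan_Suc_shift by (simp add: sum_distrib_left algebra_simps)
    also have "\<dots> \<le> 1 / 6 * (1 / (2 * c\<^sup>2) + 1 / c\<^sup>2)"
    proof (intro mult_left_mono add_mono sum_inverse_cube c(2))
      have "c\<^sup>2 * 2 \<le> c\<^sup>2 * c" using c by (intro mult_left_mono) auto
      then show "1 / c ^ 3 \<le> 1 / (2 * c\<^sup>2)"
        using c by (intro divide_left_mono) (auto simp: power3_eq_cube power2_eq_square)
    qed auto
    also have "\<dots> = 1 / (4 * c\<^sup>2)" by (simp add: field_simps)
    finally show ?thesis .
  qed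
  have tele: "(\<Sum>n<m. E (z + of_nat n)) = Ln (z + of_nat m) - Ln z - (\<Sum>n<m. inverse (z + of_nat n))
      + (1 / z - 1 / (z + of_nat m)) / 2" for m
  proof (induction m)
    case (Suc m)
    define b where "b = z + of_nat m"
    have gen: "L1 - L0 - S + (p0 - p) / 2 + (L2 - L1 - (p + p1) / 2) = L2 - L0 - (S + p) + (p0 - p1) / 2"
      for L1 L0 L2 S p0 p p1 :: complex
      by (simp add: field_simps)
    have "z + of_nat (Suc m) = b + 1" by (simp add: b_def)
    then show ?case
      unfolding sum.lessThan_Suc Suc.IH unfolding E_def b_def[symmetric] inverse_eq_divide
      by (simp only: gen)
  qed simp
  have lim: "(\<lambda>m. of_real (ln (real m)) - (\<Sum>n<m. inverse (z + of_nat n)) - Ln z + 1 / (2 * z)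
      + ((Ln (z + of_nat m) - of_real (ln (real m))) - 1 / (z + of_nat m) / 2))
      \<longlonglongrightarrow> Digamma z - Ln z + 1 / (2 * z) + (0 - 0 / 2)"
  proof (intro tendsto_intros Digamma_LIMSEQ[OF z0])
    have i: "(\<lambda>m. z / of_nat m) \<longlonglongrightarrow> 0" by (rule lim_const_over_n)
    have "(\<lambda>m. Ln (1 + z / of_nat m)) \<longlonglongrightarrow> Ln (1 + 0)"
      by (intro tendsto_intros i) auto
    then have "(\<lambda>m. Ln (1 + z / of_nat m)) \<longlonglongrightarrow> 0" by simp
    moreover have "\<forall>\<^sub>F m in sequentially. Ln (1 + z / of_nat m) = Ln (z + of_nat m) - of_real (ln (real m))"
      using eventually_gt_at_top[of 0]
    proof eventually_elim
      case (elim m)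
      have "1 + z / of_nat m = (z + of_nat m) / of_nat m" using elim by (simp add: field_simps)
      then have "1 + z / of_nat m \<noteq> 0" using nz elim by simp
      then have "Ln (of_real (real m) * (1 + z / of_nat m)) = ln (real m) + Ln (1 + z / of_nat m)"
        using elim by (subst Ln_times_of_real) auto
      moreover have "of_real (real m) * (1 + z / of_nat m) = z + of_nat m" using elim by (simp add: field_simps)
      ultimately show ?case by simp
    qed
    ultimately show "(\<lambda>m. Ln (z + of_nat m) - of_real (ln (real m))) \<longlonglongrightarrow> 0"
      by (rule Lim_transform_eventually)
    have "filterlim (\<lambda>m. z + of_nat m) at_infinity sequentially"
      by (intro tendsto_add_filterlim_at_infinity[OF tendsto_const tendsto_of_nat])
    then show "(\<lambda>m. 1 / (z + of_nat m)) \<longlonglongrightarrow> 0"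
      by (intro tendsto_divide_0[OF tendsto_const])
  qed auto
  have "(\<lambda>m. \<Sum>n<m. E (z + of_nat n)) \<longlonglongrightarrow> Digamma z - Ln z + 1 / (2 * z)"
    using lim unfolding tele by (simp add: algebra_simps diff_divide_distrib)
  then show ?thesis
    using sumE by (intro Lim_norm_ubound[OF trivial_limit_sequentially]) (auto simp: c_def)
qed

text \<open>Each factor (1 + w) exp (-w) of the Weierstrass product has modulus at most exp (|w|^2 /
  2), and the sum of 1 / k^2 is at most 2. Exponent 2 suffices, since the convexity argument
  tolerates such growth.\<close>

lemma rGamma_bound: "cmod (rGamma z) \<le> exp (2 * cmod z + (cmod z)\<^sup>2)" for z :: complex
proof (rule Lim_norm_ubound[OF trivial_limit_sequentially rGamma_Weierstrass_complex], rule always_eventually, rule allI)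
  fix n
  have fac: "cmod ((1 + w) * exp (- w)) \<le> exp ((cmod w)\<^sup>2 / 2)" for w
  proof -
    have "(cmod (1 + w))\<^sup>2 = 1 + (2 * Re w + (cmod w)\<^sup>2)"
      by (simp add: cmod_power2 power2_sum)
    also have "\<dots> \<le> exp (2 * Re w + (cmod w)\<^sup>2)" by (rule exp_ge_add_one_self)
    also have "\<dots> = (exp (Re w + (cmod w)\<^sup>2 / 2))\<^sup>2" by (simp flip: exp_of_nat_mult)
    finally have "cmod (1 + w) \<le> exp (Re w + (cmod w)\<^sup>2 / 2)"
      by (rule power2_le_imp_le) simp
    then have "cmod (1 + w) * exp (- Re w) \<le> exp (Re w + (cmod w)\<^sup>2 / 2) * exp (- Re w)"
      by (intro mult_right_mono) auto
    then show ?thesis by (simp add: norm_mult flip: exp_add)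
  qed
  have s2': "(\<Sum>k=1..Suc l. 1 / (real k)\<^sup>2) \<le> 2 - 1 / (real l + 1)" for l
  proof (induction l)
    case (Suc l)
    have "1 / (real l + 2)\<^sup>2 \<le> 1 / ((real l + 1) * (real l + 2))"
      unfolding power2_eq_square by (intro divide_left_mono mult_right_mono) auto
    also have "\<dots> = 1 / (real l + 1) - 1 / (real l + 2)" by (simp add: divide_simps)
    finally show ?case using Suc by (simp add: add_ac)
  qed simp
  have s2: "(\<Sum>k=1..n. 1 / (real k)\<^sup>2) \<le> 2"
  proof (cases n)
    case (Suc l)
    have "1 / (real l + 1) \<ge> 0" by simp
    then show ?thesis using s2'[of l] unfolding Suc by linarith
  qed simp
  have "cmod (rGamma_series_Weierstrass z n)
      = exp (euler_mascheroni * Re z) * cmod z * (\<Prod>k=1..n. cmod ((1 + z / of_nat k) * exp (- (z / of_nat k))))"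
  proof -
    have "Re (euler_mascheroni * z) = euler_mascheroni * Re z"
      by (metis Re_complex_of_real Im_complex_of_real of_real_euler_mascheroni times_complex.sel(1)
          diff_zero mult_zero_left)
    then show ?thesis
      by (simp add: rGamma_series_Weierstrass_def norm_mult flip: prod_norm)
  qed
  also have "\<dots> \<le> exp (cmod z) * exp (cmod z) * (\<Prod>k=1..n. exp ((cmod z)\<^sup>2 / 2 * (1 / (real k)\<^sup>2)))"
  proof (intro mult_mono prod_mono conjI)
    have "euler_mascheroni * Re z \<le> 1 * cmod z"
    proof (cases "Re z \<ge> 0")
      case True
      then show ?thesis using euler_mascheroni_less_13_over_22 complex_Re_le_cmod[of z]
        by (intro mult_mono) auto
    next
      case False
      then have "euler_mascheroni * Re z \<le> 0"
        using euler_mascheroni_gt_19_over_33 by (intro mult_nonneg_nonpos) auto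
      then show ?thesis by (smt (verit) norm_ge_zero)
    qed
    then show "exp (euler_mascheroni * Re z) \<le> exp (cmod z)" by simp
    show "cmod z \<le> exp (cmod z)" using exp_ge_add_one_self[of "cmod z"] by linarith
    show "cmod ((1 + z / of_nat k) * exp (- (z / of_nat k))) \<le> exp ((cmod z)\<^sup>2 / 2 * (1 / (real k)\<^sup>2))" for k
      using fac[of "z / of_nat k"] by (simp add: norm_divide power_divide mult.commute)
  qed (auto intro!: prod_nonneg)
  also have "\<dots> = exp (2 * cmod z + (cmod z)\<^sup>2 / 2 * (\<Sum>k=1..n. 1 / (real k)\<^sup>2))"
    by (simp add: exp_sum sum_distrib_left exp_add exp_double flip: power2_eq_square)
  also have "\<dots> \<le> exp (2 * cmod z + (cmod z)\<^sup>2)"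
  proof -
    have "(cmod z)\<^sup>2 / 2 * (\<Sum>k=1..n. 1 / (real k)\<^sup>2) \<le> (cmod z)\<^sup>2 / 2 * 2" using s2 by (intro mult_left_mono) auto
    then show ?thesis by simp
  qed
  finally show "cmod (rGamma_series_Weierstrass z n) \<le> exp (2 * cmod z + (cmod z)\<^sup>2)" .
qed

section \<open>Logarithmic derivatives and increments of the gamma factors\<close>

lemma Gamma_R_deriv:
  assumes "Re s > 0"
  shows "Gamma_R s \<noteq> 0"
    "(Gamma_R has_field_derivative Gamma_R s * (Digamma (s / 2) / 2 - of_real (ln pi) / 2)) (at s)"
proof -
  have np: "s / 2 \<notin> \<int>\<^sub>\<le>\<^sub>0"
    using assms by (auto elim!: nonpos_Ints_cases simp: complex_eq_iff)
  then show "Gamma_R s \<noteq> 0" by (simp add: Gamma_R_def Gamma_eq_zero_iff)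
  have h: "((\<lambda>s. s / 2) has_field_derivative 1 / 2) (at s)"
    by (auto intro!: derivative_eq_intros)
  have 1: "((\<lambda>s. Gamma (s / 2)) has_field_derivative Gamma (s / 2) * Digamma (s / 2) * (1 / 2)) (at s)"
    by (rule DERIV_chain2[OF has_field_derivative_Gamma[OF np] h])
  have "((\<lambda>s. exp (- s / 2 * of_real (ln pi))) has_field_derivative
      exp (- s / 2 * of_real (ln pi)) * (- of_real (ln pi) / 2)) (at s)"
    by (auto intro!: derivative_eq_intros)
  then have 2: "((\<lambda>s. of_real pi powr (- s / 2)) has_field_derivative of_real pi powr (- s / 2) * (- of_real (ln pi) / 2)) (at s)"
    by (simp add: powr_def Ln_of_real)
  show "(Gamma_R has_field_derivative Gamma_R s * (Digamma (s / 2) / 2 - of_real (ln pi) / 2)) (at s)"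
    unfolding Gamma_R_def[abs_def] using DERIV_mult[OF 2 1] by (simp add: algebra_simps)
qed

lemma ln_Gamma_R_deriv:
  assumes "\<sigma> + Re \<mu> > 0"
  shows "((\<lambda>\<sigma>. ln (cmod (Gamma_R (Complex \<sigma> t + \<mu>)))) has_real_derivative
     (Re (Digamma ((Complex \<sigma> t + \<mu>) / 2)) - ln pi) / 2) (at \<sigma>)"
proof -
  define s where "s = Complex \<sigma> t + \<mu>"
  have s: "Re s > 0" using assms by (simp add: s_def)
  have d: "((\<lambda>z. Gamma_R (z + \<mu>)) has_field_derivative Gamma_R s * (Digamma (s / 2) / 2 - of_real (ln pi) / 2)) (at (Complex \<sigma> t))"
    using Gamma_R_deriv(2)[OF s] by (simp add: DERIV_shift s_def)
  then have fd: "(\<lambda>z. Gamma_R (z + \<mu>)) field_differentiable (at (Complex \<sigma> t))"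
    by (auto simp: field_differentiable_def)
  have "deriv (\<lambda>z. Gamma_R (z + \<mu>)) (Complex \<sigma> t) / Gamma_R s = Digamma (s / 2) / 2 - of_real (ln pi) / 2"
    using DERIV_imp_deriv[OF d] Gamma_R_deriv(1)[OF s] by simp
  then show ?thesis
    using ln_cmod_deriv[OF fd] Gamma_R_deriv(1)[OF s]
    by (simp add: s_def[symmetric] diff_divide_distrib)
qed

lemma Gamma_R_log_deriv_bound:
  assumes "Re v \<ge> 0" "cmod v \<ge> 4"
  shows "\<bar>(Re (Digamma (v / 2)) - ln pi) / 2 - (ln (cmod v / (2 * pi)) - Re v / (cmod v)\<^sup>2) / 2\<bar> \<le> 1 / (2 * (cmod v)\<^sup>2)"
proof -
  have v0: "v \<noteq> 0" using assms by auto
  have "cmod (Digamma (v/2) - Ln (v/2) + 1 / (2 * (v/2))) \<le> 1 / (4 * (cmod (v/2))\<^sup>2)"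
    using assms by (intro Digamma_bound) (auto simp: norm_divide)
  also have "\<dots> = 1 / (cmod v)\<^sup>2" by (simp add: norm_divide power_divide)
  finally have "\<bar>Re (Digamma (v/2) - Ln (v/2) + 1 / (2 * (v/2)))\<bar> \<le> 1 / (cmod v)\<^sup>2"
    using abs_Re_le_cmod order_trans by blast
  moreover have "Re (Ln (v/2)) = ln (cmod v) - ln 2"
    using v0 by (simp add: norm_divide ln_div)
  moreover have "Re (1 / (2 * (v/2))) = Re v / (cmod v)\<^sup>2"
    by (simp add: Re_divide cmod_power2)
  moreover have "ln (cmod v / (2 * pi)) = ln (cmod v) - ln 2 - ln pi"
    using v0 by (simp add: ln_div ln_mult)
  moreover have "\<bar>(a - lp) / 2 - (b - l2 - lp - q) / 2\<bar> \<le> n / 2"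
    if "\<bar>a - (b - l2) + q\<bar> \<le> n" for a b lp l2 q n :: real
    using that by (auto simp: abs_le_iff field_simps)
  moreover have "1 / (2 * (cmod v)\<^sup>2) = (1 / (cmod v)\<^sup>2) / 2" by simp
  ultimately show ?thesis by (simp only: minus_complex.sel plus_complex.sel)
qed

text \<open>The maximum of c / (2 c^2 + X^2) over c is attained at c = X / sqrt 2. This is the
  source of the sqrt 2 in the final error term.\<close>

lemma quadratic_bound:
  fixes c X T :: real
  assumes "0 \<le> c" "X > 0" "c\<^sup>2 + X\<^sup>2 \<le> T"
  shows "c / (c\<^sup>2 + T) \<le> 1 / (2 * sqrt 2 * X)"
proof -
  have "0 \<le> (sqrt 2 * c - X)\<^sup>2" by simp
  then have "2 * sqrt 2 * X * c \<le> 2 * c\<^sup>2 + X\<^sup>2"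
    by (simp add: power2_diff power_mult_distrib algebra_simps)
  also have "\<dots> \<le> c\<^sup>2 + T" using assms by simp
  finally have *: "2 * sqrt 2 * X * c \<le> c\<^sup>2 + T" .
  have "c\<^sup>2 + T > 0" using assms by (smt (verit) zero_le_power2 zero_less_power)
  then have "c / (c\<^sup>2 + T) \<le> ((c\<^sup>2 + T) / (2 * sqrt 2 * X)) / (c\<^sup>2 + T)"
    using * assms by (intro divide_right_mono) (simp_all add: pos_le_divide_eq mult.commute)
  then show ?thesis using \<open>c\<^sup>2 + T > 0\<close> by simp
qed

lemma Re_over_norm_bound:
  assumes "0 \<le> Re v" "Re v \<le> c" "X > 0" "(Im v)\<^sup>2 \<ge> c\<^sup>2 + X\<^sup>2"
  shows "Re v / (cmod v)\<^sup>2 \<le> 1 / (2 * sqrt 2 * X)"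
proof -
  have "(Re v)\<^sup>2 \<le> c\<^sup>2" using assms by (intro power_mono) auto
  then have "(Re v)\<^sup>2 + X\<^sup>2 \<le> (Im v)\<^sup>2" using assms(4) by linarith
  then show ?thesis using quadratic_bound[of "Re v" X "(Im v)\<^sup>2"] assms
    by (simp add: cmod_power2)
qed

text \<open>Here |w + \<eta>|^2 = |w|^2 (1 + y) with y^2 at most 2 / X^2, and ln (1 + y) \<ge> y - 2
  y^2 for |y| \<le> 1/2. Halving gives the error 2 / X^2; the \<eta>^2 in y has the good sign and is
  dropped.\<close>

lemma ln_shift_bounds:
  fixes w :: complex and \<eta> X :: real
  assumes x: "1 \<le> Re w" and X: "X > 5" and im: "(Im w)\<^sup>2 \<ge> (Re w + 1)\<^sup>2 + X\<^sup>2" and \<eta>: "\<bar>\<eta>\<bar> \<le> 1"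
  shows "ln (cmod (w + of_real \<eta>)) \<ge> ln (cmod w) + \<eta> * Re w / (cmod w)\<^sup>2 - 2 / X\<^sup>2"
proof -
  define x where "x = Re w"
  define W where "W = (cmod w)\<^sup>2"
  define y where "y = (2 * x * \<eta> + \<eta>\<^sup>2) / W"
  have X2: "X\<^sup>2 > 25" using X power_strict_mono[of 5 X 2] by simp
  have W: "W \<ge> 2 * x\<^sup>2 + 2 * x + 1 + X\<^sup>2"
    using im unfolding W_def cmod_power2 x_def by (simp add: power2_eq_square algebra_simps)
  have x1: "x \<ge> 1" using x by (simp add: x_def)
  have "W \<ge> X\<^sup>2" using W x1 zero_le_power2[of x] by linarith
  then have W0: "W > 0" "W \<ge> X\<^sup>2" using X2 by auto
  have \<eta>2: "\<eta>\<^sup>2 \<le> 1" using \<eta> by (simp add: abs_square_le_1)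
  have num: "\<bar>2 * x * \<eta> + \<eta>\<^sup>2\<bar> \<le> 2 * x + 1"
  proof -
    have "\<bar>2 * x * \<eta> + \<eta>\<^sup>2\<bar> \<le> 2 * x * \<bar>\<eta>\<bar> + \<eta>\<^sup>2" using x1 abs_triangle_ineq[of "2*x*\<eta>" "\<eta>\<^sup>2"] by (simp add: abs_mult)
    also have "\<dots> \<le> 2 * x * 1 + 1" using x1 \<eta> \<eta>2 by (intro add_mono mult_left_mono) auto
    finally show ?thesis by simp
  qed
  have xx: "x * x \<ge> x * 1" using x1 by (intro mult_left_mono) auto
  have yb: "\<bar>y\<bar> \<le> 1/2"
  proof -
    have "x\<^sup>2 \<ge> x" using xx by (simp add: power2_eq_square)
    moreover have "2 * (2 * x + 1) = 4 * x + 2" by simp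
    ultimately have "2 * (2 * x + 1) \<le> W" using W X2 x1 by linarith
    then have "(2 * x + 1) / W \<le> 1 / 2" using W0 by (simp add: field_simps)
    moreover have "\<bar>y\<bar> \<le> (2 * x + 1) / W" using num W0 by (simp add: y_def divide_right_mono)
    ultimately show ?thesis by linarith
  qed
  have y2: "y\<^sup>2 \<le> 2 / X\<^sup>2"
  proof -
    have "(2 * x * \<eta> + \<eta>\<^sup>2)\<^sup>2 \<le> (2 * x + 1)\<^sup>2" using num by (simp add: abs_le_square_iff[symmetric])
    also have "\<dots> \<le> 2 * W" using W X2 by (simp add: power2_eq_square algebra_simps)
    finally have "y\<^sup>2 \<le> 2 * W / W\<^sup>2" using W0 by (simp add: y_def power_divide divide_right_mono)
    also have "\<dots> = 2 / W" using W0 by (simp add: power2_eq_square)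
    also have "\<dots> \<le> 2 / X\<^sup>2" using W0 X by (intro divide_left_mono mult_pos_pos) auto
    finally show ?thesis .
  qed
  have sq: "(cmod (w + of_real \<eta>))\<^sup>2 = W * (1 + y)"
  proof -
    have "(cmod (w + of_real \<eta>))\<^sup>2 = W + (2 * x * \<eta> + \<eta>\<^sup>2)"
      unfolding W_def cmod_power2 x_def by (simp add: power2_eq_square algebra_simps)
    then show ?thesis using W0 by (simp add: y_def field_simps)
  qed
  have p1: "1 + y > 0" using yb by (simp add: abs_le_iff)
  have w0: "cmod w > 0" using W0 by (simp add: W_def)
  have "cmod (w + of_real \<eta>) \<noteq> 0"
    using sq p1 W0 by (metis mult_pos_pos less_irrefl zero_power2)
  then have ln2: "2 * ln (cmod (w + of_real \<eta>)) = ln W + ln (1 + y)"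
    using sq W0 p1 by (metis ln_mult_pos ln_realpow norm_ge_zero of_nat_numeral order_le_imp_less_or_eq)
  have lnW: "ln W = 2 * ln (cmod w)" using w0 by (simp add: W_def ln_realpow)
  have "\<bar>ln (1 + y) - y\<bar> \<le> 2 * y\<^sup>2" using yb by (rule abs_ln_one_plus_x_minus_x_bound)
  then have "ln (1 + y) \<ge> y - 2 * (2 / X\<^sup>2)" using y2 by (simp add: abs_le_iff)
  moreover have "y \<ge> 2 * (\<eta> * x / W)"
    using W0 by (simp add: y_def add_divide_distrib mult_ac)
  ultimately show ?thesis using ln2 lnW by (simp add: W_def x_def)
qed

text \<open>Let a be half of ln (|w| / (2 pi)). The log-derivative at 3/2 is at most about a, while
  the integrated increment I is at least about a, so the combination is (ln 4 - 1) a = (ln 2 - 1/2)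
  2a up to errors.\<close>

lemma Gamma_R_estimate:
  fixes t X :: real and \<mu> :: complex
  assumes \<mu>: "Re \<mu> > -1/2" and X: "X > 5" and t: "(t + Im \<mu>)\<^sup>2 \<ge> (5/2 + Re \<mu>)\<^sup>2 + X\<^sup>2"
  shows "\<exists>I. ((\<lambda>\<sigma>. ln (cmod (Gamma_R (Complex (\<sigma>+1) t + \<mu>))) - ln (cmod (Gamma_R (Complex \<sigma> t + \<mu>)))) has_integral I) {1/2..3/2}
    \<and> ln 4 * ((Re (Digamma ((Complex (3/2) t + \<mu>) / 2)) - ln pi) / 2) - I
       \<le> (ln 2 - 1/2) * ln (cmod (Complex (3/2) t + \<mu>) / (2 * pi)) + 1 / (4 * sqrt 2 * X) + 11/5 / X\<^sup>2"
proof -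
  define g where "g = (\<lambda>\<sigma>. ln (cmod (Gamma_R (Complex \<sigma> t + \<mu>))))"
  define g' where "g' = (\<lambda>\<sigma>. (Re (Digamma ((Complex \<sigma> t + \<mu>) / 2)) - ln pi) / 2)"
  define w where "w = Complex (3/2) t + \<mu>"
  define x where "x = Re w"
  have x: "x = 3/2 + Re \<mu>" "x > 1" using \<mu> by (auto simp: x_def w_def)
  have imw: "(Im w)\<^sup>2 \<ge> (x + 1)\<^sup>2 + X\<^sup>2" using t by (simp add: w_def x_def add_ac)
  have X2: "X\<^sup>2 > 25" using X power_strict_mono[of 5 X 2] by simp
  have der: "(g has_real_derivative g' \<sigma>) (at \<sigma>)" if "\<sigma> \<ge> 1/2" for \<sigma>
    unfolding g_def g'_def using that \<mu> by (intro ln_Gamma_R_deriv) auto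
  have veq: "Complex \<sigma> t + \<mu> = w + of_real (\<sigma> - 3/2)" for \<sigma>
    by (simp add: w_def complex_eq_iff)
  have nv: "(cmod (w + of_real \<eta>))\<^sup>2 \<ge> X\<^sup>2" for \<eta>
  proof -
    have "X\<^sup>2 \<le> (Im w)\<^sup>2" using imw by (smt (verit) zero_le_power2)
    then show ?thesis by (simp add: cmod_power2 add_increasing)
  qed
  have nv4: "cmod (w + of_real \<eta>) \<ge> 4" for \<eta>
  proof -
    have "(4::real)\<^sup>2 \<le> (cmod (w + of_real \<eta>))\<^sup>2" using nv[of \<eta>] X2 by simp
    then show ?thesis by (rule power2_le_imp_le) simp
  qed
  have inv: "1 / (2 * (cmod (w + of_real \<eta>))\<^sup>2) \<le> 1 / (2 * X\<^sup>2)" for \<eta>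
    using nv[of \<eta>] X2 by (intro divide_left_mono mult_left_mono mult_pos_pos) auto
  define a where "a = ln (cmod w / (2 * pi)) / 2"
  define b where "b = x / (cmod w)\<^sup>2 / 2"
  define e where "e = 1 / (4 * sqrt 2 * X) + 3 / (2 * X\<^sup>2)"
  have lower: "g' \<sigma> \<ge> a + b * (\<sigma> - 3/2) - e" if \<sigma>: "\<sigma> \<in> {1/2..5/2}" for \<sigma>
  proof -
    define \<eta> where "\<eta> = \<sigma> - 3/2"
    have \<eta>: "\<bar>\<eta>\<bar> \<le> 1" using \<sigma> by (auto simp: \<eta>_def abs_le_iff)
    define v where "v = w + of_real \<eta>"
    have Rev: "Re v = x + \<eta>" "Re v \<ge> 0" using \<eta> x by (auto simp: v_def x_def abs_le_iff)
    have v4: "cmod v \<ge> 4" using nv4 by (simp add: v_def)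
    have 1: "\<bar>g' \<sigma> - (ln (cmod v / (2 * pi)) - Re v / (cmod v)\<^sup>2) / 2\<bar> \<le> 1 / (2 * X\<^sup>2)"
      using Gamma_R_log_deriv_bound[of v] Rev v4 inv[of \<eta>]
      unfolding g'_def veq \<eta>_def[symmetric] v_def[symmetric] by linarith
    have 2: "Re v / (cmod v)\<^sup>2 \<le> 1 / (2 * sqrt 2 * X)"
      using Rev \<eta> X imw by (intro Re_over_norm_bound[of v "x + 1"]) (auto simp: v_def x_def abs_le_iff)
    have 3: "ln (cmod v) \<ge> ln (cmod w) + \<eta> * x / (cmod w)\<^sup>2 - 2 / X\<^sup>2"
      unfolding v_def x_def using x X imw \<eta> by (intro ln_shift_bounds) (auto simp: x_def)
    have "cmod w \<ge> 4" using nv4[of 0] by simp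
    then have w0: "cmod w > 0" by linarith
    have l1: "ln (cmod v / (2 * pi)) = ln (cmod v) - ln (2 * pi)" using v4 by (subst ln_div) auto
    have l2: "ln (cmod w / (2 * pi)) = ln (cmod w) - ln (2 * pi)" using w0 by (subst ln_div) auto
    have b2: "b * \<eta> = \<eta> * x / (cmod w)\<^sup>2 / 2" by (simp add: b_def)
    have e2: "e = (1 / (2 * sqrt 2 * X)) / 2 + 1 / (2 * X\<^sup>2) + (2 / X\<^sup>2) / 2"
      by (simp add: e_def field_simps)
    have "g' \<sigma> \<ge> (ln (cmod v / (2 * pi)) - Re v / (cmod v)\<^sup>2) / 2 - 1 / (2 * X\<^sup>2)"
      using 1 by (simp add: abs_le_iff)
    also have "(ln (cmod v / (2 * pi)) - Re v / (cmod v)\<^sup>2) / 2 - 1 / (2 * X\<^sup>2) \<ge> a + b * \<eta> - e"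
    proof -
      have "(p' - c - u) / 2 - e1 \<ge> (p - c) / 2 + q / 2 - (r / 2 + e1 + s / 2)"
        if "u \<le> r" "p' \<ge> p + q - s" for p p' c u e1 q r s :: real
        using that by (auto simp: field_simps)
      then show ?thesis unfolding a_def b2 e2 l1 l2 using 2 3 by blast
    qed
    finally show ?thesis by (simp add: \<eta>_def)
  qed
  have upper: "g' (3/2) \<le> a + 1 / (2 * X\<^sup>2)"
  proof -
    have "\<bar>g' (3/2) - (ln (cmod w / (2 * pi)) - x / (cmod w)\<^sup>2) / 2\<bar> \<le> 1 / (2 * X\<^sup>2)"
      using Gamma_R_log_deriv_bound[of w] x nv4[of 0] inv[of 0]
      unfolding g'_def w_def[symmetric] x_def by simp
    moreover have "(ln (cmod w / (2 * pi)) - x / (cmod w)\<^sup>2) / 2 \<le> a"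
      unfolding a_def using x by (intro divide_right_mono) auto
    moreover have "g \<le> p + q" if "\<bar>g - v\<bar> \<le> q" "v \<le> p" for g p q v :: real
      using that by linarith
    ultimately show ?thesis by blast
  qed
  \<comment> \<open>The linear part b (s - 3/2), averaged over s from \<sigma> to \<sigma> + 1, is b
    (\<sigma> - 1). It is odd about the midpoint of the range of \<sigma>, so it integrates to 0 and
    the size of b is irrelevant.\<close>
  have diff: "g (\<sigma> + 1) - g \<sigma> \<ge> (a - e) + b * (\<sigma> - 1)" if \<sigma>: "\<sigma> \<in> {1/2..3/2}" for \<sigma>
  proof -
    define h where "h = (\<lambda>s. g s - (a - e) * s - b * ((s - 3/2)\<^sup>2 / 2))"
    have "h \<sigma> \<le> h (\<sigma> + 1)"
    proof (rule DERIV_nonneg_imp_nondecreasing[of \<sigma> "\<sigma> + 1" h])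
      fix s assume s: "\<sigma> \<le> s" "s \<le> \<sigma> + 1"
      have "(h has_real_derivative g' s - (a - e) - b * (s - 3/2)) (at s)"
        unfolding h_def using der[of s] s \<sigma> by (auto intro!: derivative_eq_intros)
      then show "\<exists>y. (h has_real_derivative y) (at s) \<and> 0 \<le> y"
        using lower[of s] s \<sigma> by (intro exI[of _ "g' s - (a - e) - b * (s - 3/2)"]) auto
    qed simp
    then show ?thesis by (simp add: h_def power2_eq_square field_simps)
  qed
  have cg: "continuous_on {1/2..} g"
    by (intro continuous_at_imp_continuous_on ballI) (meson DERIV_isCont der atLeast_iff)
  have "continuous_on {1/2..3/2} (\<lambda>\<sigma>. g (\<sigma> + 1))"
    by (rule continuous_on_compose2[OF cg]) (auto intro!: continuous_intros)
  moreover have "continuous_on {1/2..3/2} g"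
    by (rule continuous_on_subset[OF cg]) auto
  ultimately have "continuous_on {1/2..3/2} (\<lambda>\<sigma>. g (\<sigma> + 1) - g \<sigma>)"
    by (rule continuous_on_diff)
  then obtain I where I: "((\<lambda>\<sigma>. g (\<sigma> + 1) - g \<sigma>) has_integral I) {1/2..3/2}"
    using integrable_continuous_interval by blast
  have "((\<lambda>\<sigma>. (a - e) + b * (\<sigma> - 1)) has_integral
      (((a - e) * (3/2) + b * ((3/2 - 1)\<^sup>2 / 2)) - ((a - e) * (1/2) + b * ((1/2 - 1)\<^sup>2 / 2)))) {1/2..3/2}"
    by (rule fundamental_theorem_of_calculus)
       (auto intro!: derivative_eq_intros simp: has_real_derivative_iff_has_vector_derivative[symmetric])
  moreover have "((a - e) * (3/2) + b * ((3/2 - 1)\<^sup>2 / 2)) - ((a - e) * (1/2) + b * ((1/2 - 1)\<^sup>2 / 2)) = a - e"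
    by (simp add: power2_eq_square field_simps)
  ultimately have "((\<lambda>\<sigma>. (a - e) + b * (\<sigma> - 1)) has_integral (a - e)) {1/2..3/2}"
    by (simp only:)
  then have Ige: "I \<ge> a - e" using has_integral_le[OF _ I] diff by blast
  have l4: "ln 4 = 2 * ln (2::real)" using ln_realpow[of 2 2] by simp
  have l4b: "0 \<le> ln (4::real)" "ln (4::real) \<le> 7/5" using ln2_le_25_over_36 by (auto simp: l4)
  have "ln 4 * g' (3/2) \<le> ln 4 * (a + 1 / (2 * X\<^sup>2))" using upper l4b by (intro mult_left_mono) auto
  moreover have "ln 4 * (1 / (2 * X\<^sup>2)) \<le> 7/5 * (1 / (2 * X\<^sup>2))" using l4b by (intro mult_right_mono) auto
  moreover have "ln 4 * (a + 1 / (2 * X\<^sup>2)) = ln 4 * a + ln 4 * (1 / (2 * X\<^sup>2))" by (simp add: distrib_left)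
  moreover have "(ln 2 - 1/2) * (2 * a) = ln 4 * a - a" by (simp add: l4 algebra_simps)
  \<comment> \<open>Origin of 11/5: 3/2 from e and (7/5) / 2 from ln 4 \<le> 7/5 in the bound at
    3/2.\<close>
  moreover have "(3 / (2 * X\<^sup>2)) + 7/5 * (1 / (2 * X\<^sup>2)) = 11/5 / X\<^sup>2" by simp
  ultimately have "ln 4 * g' (3/2) - I \<le> (ln 2 - 1/2) * (2 * a) + 1 / (4 * sqrt 2 * X) + 11/5 / X\<^sup>2"
    using Ige unfolding e_def by linarith
  moreover have "2 * a = ln (cmod w / (2 * pi))" by (simp add: a_def)
  ultimately show ?thesis using I unfolding g_def g'_def w_def by auto
qed

section \<open>The zeta function on the half-line\<close>

lemma zeta_term: "1 / real (Suc n) powr x = real (Suc n) powr (-x)"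
  by (simp add: powr_minus_divide)

lemma zeta_summable:
  assumes "x > 1"
  shows "summable (\<lambda>n. 1 / real (Suc n) powr x)"
proof -
  have "summable (\<lambda>n. real n powr (-x))" using assms by (simp add: summable_real_powr_iff)
  then show ?thesis unfolding zeta_term by (rule summable_ignore_initial_segment[where k = 1, simplified])
qed

lemma zeta_has_sum:
  assumes "x > 1"
  shows "((\<lambda>k. real k powr (-x)) has_sum zeta_real x) {1..}"
proof -
  have "((\<lambda>n. real (Suc n) powr (-x)) has_sum zeta_real x) UNIV"
    using zeta_summable[OF assms] unfolding zeta_real_def zeta_term
    by (intro sums_nonneg_imp_has_sum summable_sums) auto
  moreover have "bij_betw Suc UNIV {1..}"
    by (rule bij_betwI[where g = "\<lambda>k. k - 1"]) auto
  ultimately show ?thesis using has_sum_reindex_bij_betw[of Suc UNIV "{1..}"] by fastforce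
qed

lemma zeta_ge_1: assumes "x > 1" shows "zeta_real x \<ge> 1"
proof -
  have "(\<Sum>n<1. 1 / real (Suc n) powr x) \<le> (\<Sum>n. 1 / real (Suc n) powr x)"
    by (rule sum_le_suminf[OF zeta_summable[OF assms]]) auto
  then show ?thesis by (simp add: zeta_real_def)
qed

text \<open>Every term with n \<ge> 2 loses a factor n^(x0 - x) \<le> 2^(x0 - x). This is the decay
  that makes the integrals over the far half-line converge.\<close>

lemma zeta_minus_1_bound:
  assumes "1 < x0" "x0 \<le> x"
  shows "zeta_real x - 1 \<le> 2 powr (x0 - x) * zeta_real x0"
proof -
  have s: "summable (\<lambda>n. 1 / real (Suc n) powr x)" "summable (\<lambda>n. 1 / real (Suc n) powr x0)"
    using assms zeta_summable by auto
  have "zeta_real x - 1 = (\<Sum>n. 1 / real (Suc (Suc n)) powr x)"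
    unfolding zeta_real_def using suminf_split_head[OF s(1)] by simp
  also have "\<dots> \<le> (\<Sum>n. 2 powr (x0 - x) * (1 / real (Suc (Suc n)) powr x0))"
  proof (rule suminf_le)
    fix n
    have "real (Suc (Suc n)) powr (x0 - x) \<le> 2 powr (x0 - x)"
      using assms by (intro powr_mono2') auto
    then have "real (Suc (Suc n)) powr (x0 - x) * real (Suc (Suc n)) powr (-x0) \<le> 2 powr (x0 - x) * real (Suc (Suc n)) powr (-x0)"
      by (intro mult_right_mono) auto
    moreover have "real (Suc (Suc n)) powr (x0 - x) * real (Suc (Suc n)) powr (-x0) = real (Suc (Suc n)) powr (-x)"
      by (simp flip: powr_add)
    ultimately show "1 / real (Suc (Suc n)) powr x \<le> 2 powr (x0 - x) * (1 / real (Suc (Suc n)) powr x0)"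
      unfolding zeta_term by (simp only:)
  next
    show "summable (\<lambda>n. 1 / real (Suc (Suc n)) powr x)" using s(1) by (subst summable_Suc_iff)
    show "summable (\<lambda>n. 2 powr (x0 - x) * (1 / real (Suc (Suc n)) powr x0))"
      using s(2) by (intro summable_mult) (subst summable_Suc_iff)
  qed
  also have "\<dots> = 2 powr (x0 - x) * (\<Sum>n. 1 / real (Suc (Suc n)) powr x0)"
    using s(2) by (intro suminf_mult) (subst summable_Suc_iff)
  also have "(\<Sum>n. 1 / real (Suc (Suc n)) powr x0) = zeta_real x0 - 1"
    unfolding zeta_real_def using suminf_split_head[OF s(2)] by simp
  also have "2 powr (x0 - x) * (zeta_real x0 - 1) \<le> 2 powr (x0 - x) * zeta_real x0"
    by (intro mult_left_mono) auto
  finally show ?thesis .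
qed

text \<open>The sieve of Eratosthenes: A n holds the positive integers without prime factor up to n.
  Passing a prime p splits A into its sieved part and p times itself, so the sum of h over A is
  multiplied by 1 - p^(-x).\<close>

lemma zeta_euler_product:
  assumes x: "x > 1"
  shows "(\<lambda>n. \<Prod>p\<le>n. if prime p then inverse (1 - real p powr (-x)) else 1) \<longlonglongrightarrow> zeta_real x"
proof -
  define h where "h = (\<lambda>k. real k powr (-x))"
  have hs: "h summable_on {1..}" using zeta_has_sum[OF x] unfolding h_def by (auto simp: summable_on_def)
  have hsub: "h summable_on B" if "B \<subseteq> {1..}" for B
    using summable_on_subset_banach[OF hs that] .
  have zs: "infsum h {1..} = zeta_real x" using zeta_has_sum[OF x] unfolding h_def by (rule infsumI)
  define A where "A = (\<lambda>n. {k::nat. k \<ge> 1 \<and> (\<forall>p\<le>n. prime p \<longrightarrow> \<not> p dvd k)})"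
  have A1: "A n \<subseteq> {1..}" for n by (auto simp: A_def)
  define E where "E = (\<lambda>p. if prime p then 1 - real p powr (-x) else 1)"
  have E0: "E p > 0" for p
  proof (cases "prime p")
    case True
    then have "real p > 1" using prime_gt_1_nat[OF True] by simp
    then have "real p powr (-x) < real p powr 0" using x by (intro powr_less_mono) auto
    then show ?thesis using True prime_gt_0_nat[OF True] by (simp add: E_def)
  qed (simp add: E_def)
  have step: "infsum h (A (Suc n)) = E (Suc n) * infsum h (A n)" for n
  proof (cases "prime (Suc n)")
    case False
    then have "A (Suc n) = A n" unfolding A_def by (auto simp: le_Suc_eq)
    then show ?thesis using False by (simp add: E_def)
  next
    case True
    define p where "p = Suc n"
    have p: "prime p" using True by (simp add: p_def)
    have split: "A n = A (Suc n) \<union> (\<lambda>k. p * k) ` A n"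
    proof (intro equalityI subsetI)
      fix k assume k: "k \<in> A n"
      show "k \<in> A (Suc n) \<union> (\<lambda>k. p * k) ` A n"
      proof (cases "p dvd k")
        case True
        then obtain l where l: "k = p * l" by (rule dvdE)
        have "l \<in> A n" using k unfolding A_def l by auto
        then show ?thesis using l by blast
      next
        case False
        then show ?thesis using k unfolding A_def p_def by (auto simp: le_Suc_eq)
      qed
    next
      fix k assume "k \<in> A (Suc n) \<union> (\<lambda>k. p * k) ` A n"
      then show "k \<in> A n"
      proof
        assume "k \<in> (\<lambda>k. p * k) ` A n"
        then obtain l where l: "k = p * l" "l \<in> A n" by blast
        have "\<not> q dvd k" if q: "q \<le> n" "prime q" for q
        proof
          assume "q dvd k"
          then have "q dvd p \<or> q dvd l" using q(2) l(1) prime_dvd_mult_iff by blast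
          then show False
          proof
            assume "q dvd p"
            then have "q = p" using p q(2) primes_dvd_imp_eq by blast
            then show False using q(1) p_def by simp
          next
            assume "q dvd l"
            then show False using l(2) q by (auto simp: A_def)
          qed
        qed
        then show ?thesis using l prime_gt_0_nat[OF p] by (auto simp: A_def)
      qed (auto simp: A_def)
    qed
    have disj: "A (Suc n) \<inter> (\<lambda>k. p * k) ` A n = {}"
    proof -
      have "\<not> p dvd k" if "k \<in> A (Suc n)" for k
        using that p by (auto simp: A_def p_def)
      then have "p * k \<notin> A (Suc n)" for k using dvd_triv_left by blast
      then show ?thesis by blast
    qed
    have inj: "inj_on (\<lambda>k. p * k) (A n)" using prime_gt_0_nat[OF p] by (auto simp: inj_on_def)
    have sub: "(\<lambda>k. p * k) ` A n \<subseteq> {1..}" using split A1 by blast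
    have "infsum h (A n) = infsum h (A (Suc n)) + infsum h ((\<lambda>k. p * k) ` A n)"
      using infsum_Un_disjoint[OF hsub[OF A1] hsub[OF sub] disj] split by simp
    also have "infsum h ((\<lambda>k. p * k) ` A n) = infsum (\<lambda>k. real p powr (-x) * h k) (A n)"
      by (subst infsum_reindex[OF inj]) (auto simp: o_def h_def powr_mult)
    also have "\<dots> = real p powr (-x) * infsum h (A n)"
      by (rule infsum_cmult_right) (rule hsub[OF A1])
    finally have "infsum h (A n) = infsum h (A (Suc n)) + real p powr (-x) * infsum h (A n)" .
    moreover have "E (Suc n) = 1 - real p powr (-x)" using p by (simp add: E_def p_def)
    ultimately show ?thesis by (simp add: left_diff_distrib)
  qed
  have A0: "infsum h (A 0) = zeta_real x"
  proof -
    have "A 0 = {1..}" by (auto simp: A_def)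
    then show ?thesis using zs by simp
  qed
  have prodE: "infsum h (A n) = zeta_real x * (\<Prod>p\<le>n. E p)" for n
  proof (induction n)
    case 0
    then show ?case using A0 by (simp add: E_def)
  next
    case (Suc n)
    then show ?case using step[of n] by (simp add: mult_ac)
  qed
  \<comment> \<open>Apart from 1, every member of A n exceeds n, so the sum lies between 1 and 1
    plus the tail of the zeta series.\<close>
  have lim1: "(\<lambda>n. infsum h (A n)) \<longlonglongrightarrow> 1"
  proof (rule tendsto_sandwich[of "\<lambda>_. 1" _ _ "\<lambda>n. 1 + (zeta_real x - (\<Sum>k=1..n. h k))"])
    have fin: "infsum h {1..n} = (\<Sum>k=1..n. h k)" for n by simp
    have "(\<lambda>n. \<Sum>k<n. 1 / real (Suc k) powr x) \<longlonglongrightarrow> zeta_real x"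
      using summable_LIMSEQ[OF zeta_summable[OF x]] unfolding zeta_real_def .
    moreover have "(\<Sum>k<n. 1 / real (Suc k) powr x) = (\<Sum>k=1..n. h k)" for n
      unfolding h_def zeta_term by (induction n) auto
    ultimately have "(\<lambda>n. 1 + (zeta_real x - (\<Sum>k=1..n. h k))) \<longlonglongrightarrow> 1 + (zeta_real x - zeta_real x)"
      by (intro tendsto_intros) simp
    then show "(\<lambda>n. 1 + (zeta_real x - (\<Sum>k=1..n. h k))) \<longlonglongrightarrow> 1" by simp
    have in1: "1 \<in> A n" for n by (auto simp: A_def)
    have eq: "infsum h (A n) = 1 + infsum h (A n - {1})" for n
    proof -
      have "A n = {1} \<union> (A n - {1})" using in1 by auto
      then have "infsum h (A n) = infsum h ({1} \<union> (A n - {1}))" by simp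
      also have "\<dots> = infsum h {1} + infsum h (A n - {1})"
        using A1 by (intro infsum_Un_disjoint hsub) auto
      finally show ?thesis by (simp add: h_def)
    qed
    show "\<forall>\<^sub>F n in sequentially. 1 \<le> infsum h (A n)"
      unfolding eq by (intro always_eventually allI) (simp add: infsum_nonneg h_def)
    have le: "infsum h (A n - {1}) \<le> infsum h {Suc n..}" for n
    proof (rule infsum_mono2)
      show "A n - {1} \<subseteq> {Suc n..}"
      proof
        fix k assume k: "k \<in> A n - {1}"
        then have "k \<noteq> 1" by auto
        then obtain p where p: "prime p" "p dvd k" using prime_factor_nat by blast
        have "k > 0" using k by (auto simp: A_def)
        then have "p \<le> k" using p(2) dvd_imp_le by blast
        moreover have "\<not> p \<le> n" using k p by (auto simp: A_def)
        ultimately show "k \<in> {Suc n..}" by auto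
      qed
      show "h summable_on A n - {1}" using A1 by (intro hsub) blast
      show "h summable_on {Suc n..}" by (intro hsub) auto
    qed (simp add: h_def)
    have spl: "infsum h {1..} = (\<Sum>k=1..n. h k) + infsum h {Suc n..}" for n
    proof -
      have "{1..} = {1..n} \<union> {Suc n..}" by auto
      then have "infsum h {1..} = infsum h ({1..n} \<union> {Suc n..})" by simp
      also have "\<dots> = infsum h {1..n} + infsum h {Suc n..}"
        by (intro infsum_Un_disjoint hsub) auto
      finally show ?thesis by simp
    qed
    show "\<forall>\<^sub>F n in sequentially. infsum h (A n) \<le> 1 + (zeta_real x - (\<Sum>k=1..n. h k))"
    proof (intro always_eventually allI)
      fix n
      show "infsum h (A n) \<le> 1 + (zeta_real x - (\<Sum>k=1..n. h k))"
        using le[of n] spl[of n] eq[of n] zs by linarith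
    qed
  qed simp
  have "(\<lambda>n. zeta_real x / infsum h (A n)) \<longlonglongrightarrow> zeta_real x / 1"
    by (intro tendsto_intros lim1) simp
  moreover have "zeta_real x / infsum h (A n) = (\<Prod>p\<le>n. if prime p then inverse (1 - real p powr (-x)) else 1)" for n
  proof -
    have "(\<Prod>p\<le>n. if prime p then inverse (1 - real p powr (-x)) else 1) = (\<Prod>p\<le>n. inverse (E p))"
      by (intro prod.cong) (auto simp: E_def)
    also have "\<dots> = inverse (\<Prod>p\<le>n. E p)" by (induction n) auto
    finally show ?thesis using zeta_ge_1[OF x] by (simp add: prodE field_simps)
  qed
  ultimately show ?thesis by simp
qed

text \<open>For holomorphic terms a locally uniform summable majorant of the terms themselves
  permits termwise differentiation, so the series is extended to complex argument and its real part
  restricted.\<close>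

lemma zeta_differentiable:
  assumes "x > 1"
  shows "\<exists>D. (zeta_real has_real_derivative D) (at x)"
proof -
  define S where "S = {z::complex. Re z > 1}"
  have S: "open S" unfolding S_def by (rule open_halfspace_Re_gt)
  define f where "f = (\<lambda>n (z::complex). exp (- z * of_real (ln (real (Suc n)))))"
  have "\<exists>g g'. \<forall>x \<in> S. ((\<lambda>n. f n x) sums g x) \<and> ((\<lambda>n. (\<lambda>n z. f n z * - of_real (ln (real (Suc n)))) n x) sums g' x)
      \<and> (g has_field_derivative g' x) (at x)"
  proof (rule series_and_derivative_comparison_local[OF S])
    fix n z assume "z \<in> S"
    show "(f n has_field_derivative f n z * - of_real (ln (real (Suc n)))) (at z)"
      unfolding f_def by (auto intro!: derivative_eq_intros)
  next
    fix z assume z: "z \<in> S"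
    define d where "d = (Re z - 1) / 2"
    have d: "d > 0" using z by (simp add: d_def S_def)
    have "cmod (f n y) \<le> 1 / real (Suc n) powr (1 + d)" if "y \<in> ball z d \<inter> S" for n y
    proof -
      have "\<bar>Re (y - z)\<bar> < d" using that abs_Re_le_cmod[of "y - z"] by (simp add: dist_norm norm_minus_commute)
      then have y: "Re y \<ge> 1 + d" unfolding d_def minus_complex.sel by argo
      have "cmod (f n y) = real (Suc n) powr (- Re y)" by (simp add: f_def powr_def)
      also have "\<dots> \<le> real (Suc n) powr (- (1 + d))" using y by (intro powr_mono) auto
      also have "\<dots> = 1 / real (Suc n) powr (1 + d)" by (rule powr_minus_divide)
      finally show ?thesis .
    qed
    then show "\<exists>d h. 0 < d \<and> summable h \<and> (\<forall>\<^sub>F n in sequentially. \<forall>y\<in>ball z d \<inter> S. cmod (f n y) \<le> h n)"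
      using d zeta_summable[of "1 + d"]
      by (intro exI[of _ d] exI[of _ "\<lambda>n. 1 / real (Suc n) powr (1 + d)"]) (auto intro!: always_eventually)
  qed
  then obtain g g' where g: "\<And>z. z \<in> S \<Longrightarrow> (\<lambda>n. f n z) sums g z" "\<And>z. z \<in> S \<Longrightarrow> (g has_field_derivative g' z) (at z)"
    by blast
  have eq: "Re (g (of_real y)) = zeta_real y" if "y > 1" for y
  proof -
    have "(\<lambda>n. f n (of_real y)) sums g (of_real y)" using g(1) that by (simp add: S_def)
    then have "(\<lambda>n. Re (f n (of_real y))) sums Re (g (of_real y))" by (rule sums_Re)
    moreover have "Re (f n (of_real y)) = 1 / real (Suc n) powr y" for n
    proof -
      have "f n (of_real y) = of_real (exp (- (y * ln (real (Suc n)))))"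
        unfolding f_def by (simp del: of_nat_Suc flip: exp_of_real)
      then show ?thesis by (simp add: powr_def exp_minus inverse_eq_divide del: of_nat_Suc)
    qed
    ultimately show ?thesis by (simp add: zeta_real_def sums_iff)
  qed
  have "of_real x \<in> S" using assms by (simp add: S_def)
  from has_vector_derivative_real_field[OF g(2)[OF this]]
  have "((\<lambda>x. g (of_real x)) has_vector_derivative g' (of_real x)) (at x)" by simp
  then have "((\<lambda>x. Re (g (of_real x))) has_real_derivative Re (g' (of_real x))) (at x)"
    unfolding has_vector_derivative_complex_iff by simp
  then have "(zeta_real has_real_derivative Re (g' (of_real x))) (at x)"
    by (rule has_field_derivative_transform_within_open[of _ _ _ "{1<..}"]) (use assms eq in auto)
  then show ?thesis by blast
qed

section \<open>Convexity in a strip\<close>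

lemma second_derivative_local_max:
  fixes f f' :: "real \<Rightarrow> real"
  assumes d: "\<delta> > 0" and f: "\<And>x. \<bar>x\<bar> < \<delta> \<Longrightarrow> (f has_real_derivative f' x) (at x)"
    and f': "(f' has_real_derivative D) (at 0)" and mx: "\<And>x. \<bar>x\<bar> < \<delta> \<Longrightarrow> f x \<le> f 0"
  shows "D \<le> 0"
proof (rule ccontr)
  assume "\<not> D \<le> 0"
  then have D: "D > 0" by simp
  have "f' 0 = 0"
    by (rule DERIV_local_max[OF f[of 0] d]) (use d mx in auto)
  obtain e where e: "e > 0" "\<And>h. h > 0 \<Longrightarrow> h < e \<Longrightarrow> f' 0 < f' (0 + h)"
    using DERIV_pos_inc_right[OF f' D] by blast
  define b where "b = min e \<delta> / 2"
  have b: "b > 0" "b < e" "b < \<delta>" using e d by (auto simp: b_def)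
  have "f 0 < f b"
  proof (rule DERIV_pos_imp_increasing_open[OF b(1)])
    fix x assume "0 < x" "x < b"
    then show "\<exists>y. (f has_real_derivative y) (at x) \<and> 0 < y"
      using f[of x] e(2)[of x] b \<open>f' 0 = 0\<close> by (intro exI[of _ "f' x"]) auto
  next
    show "continuous_on {0..b} f"
      using f b by (intro continuous_at_imp_continuous_on ballI DERIV_isCont[OF f]) auto
  qed
  then show False using mx[of b] b by simp
qed

text \<open>
  The exponent is not harmonic: its Laplacian is \<open>Re (deriv H)\<close>, and it is the positivity of this
  quantity that makes the weighted modulus satisfy the maximum principle.
\<close>
lemma weighted_modulus_no_local_max:
  fixes J G H :: "complex \<Rightarrow> complex" and s :: complex and B :: real
  assumes d: "\<delta> > 0" and J: "J holomorphic_on ball s \<delta>" and G: "G holomorphic_on ball s \<delta>"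
    and H: "H holomorphic_on ball s \<delta>" and pos: "Re (deriv H s) > 0" and nz: "J s \<noteq> 0"
  defines "U \<equiv> \<lambda>z. cmod (J z) * exp (Re (G z) - (B - Re z) / 2 * Re (H z))"
  shows "\<exists>z\<in>ball s \<delta>. U z > U s"
proof (rule ccontr)
  assume "\<not> ?thesis"
  then have mx: "U z \<le> U s" if "z \<in> ball s \<delta>" for z using that by force
  have "continuous_on (ball s \<delta>) J" using J holomorphic_on_imp_continuous_on by blast
  then have "\<exists>e>0. ball s e \<subseteq> ball s \<delta> \<and> (\<forall>z\<in>ball s e. J z \<noteq> 0)"
  proof -
    have "isCont J s" using \<open>continuous_on (ball s \<delta>) J\<close> d by (simp add: continuous_on_eq_continuous_at)
    then obtain e where e: "e > 0" "\<forall>z. dist s z < e \<longrightarrow> J z \<noteq> 0"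
      using continuous_at_avoid nz by blast
    then show ?thesis by (intro exI[of _ "min e \<delta>"]) (use d in auto)
  qed
  then obtain e where e: "e > 0" "ball s e \<subseteq> ball s \<delta>" "\<And>z. z \<in> ball s e \<Longrightarrow> J z \<noteq> 0" by blast
  have "J holomorphic_on ball s e" using J e(2) holomorphic_on_subset by blast
  \<comment> \<open>With a local logarithm of J, ln U becomes the real part of a holomorphic
    function minus the product of an affine function of Re z with the harmonic function Re
    H.\<close>
  then obtain j where j: "j holomorphic_on ball s e" "\<And>z. z \<in> ball s e \<Longrightarrow> exp (j z) = J z"
    using holomorphic_logarithm_exists[of "ball s e" J s] e by auto
  define K where "K = (\<lambda>z. j z + G z)"
  have K: "K holomorphic_on ball s e"
    unfolding K_def using j(1) G e(2) holomorphic_on_subset by (intro holomorphic_intros) blast+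
  have H': "H holomorphic_on ball s e" using H e(2) holomorphic_on_subset by blast
  define u where "u = (\<lambda>z. Re (K z) - (B - Re z) / 2 * Re (H z))"
  have Uu: "U z = exp (u z)" if "z \<in> ball s e" for z
    by (simp add: U_def u_def K_def flip: j(2)[OF that] exp_add)
  have umax: "u z \<le> u s" if "z \<in> ball s e" for z
    using mx[of z] Uu[OF that] Uu[of s] e that by auto
  have K1: "(K has_field_derivative deriv K z) (at z)" "(H has_field_derivative deriv H z) (at z)" 
    "(deriv K has_field_derivative deriv (deriv K) z) (at z)" "(deriv H has_field_derivative deriv (deriv H) z) (at z)"
    if "z \<in> ball s e" for z
    using holomorphic_derivI[OF _ open_ball that] K H' holomorphic_deriv[OF _ open_ball] by blast+
  have chain: "((\<lambda>x. Re (f (s + of_real x * v))) has_real_derivative Re (v * f' )) (at x)"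
    if "(f has_field_derivative f') (at (s + of_real x * v))" for f f' x v
  proof -
    have "((\<lambda>x. s + of_real x * v) has_vector_derivative v) (at x)"
      by (auto intro!: derivative_eq_intros)
    from field_vector_diff_chain_at[OF this that]
    have "((\<lambda>x. f (s + of_real x * v)) has_vector_derivative v * f') (at x)" by (simp add: o_def)
    then show ?thesis unfolding has_vector_derivative_complex_iff by simp
  qed
  define c where "c = (B - Re s) / 2"
  have in1: "s + of_real x * 1 \<in> ball s e" "s + of_real x * \<i> \<in> ball s e" if "\<bar>x\<bar> < e" for x
    using that by (auto simp: dist_norm norm_mult)
  \<comment> \<open>Second derivative along the real axis. Only this direction differentiates the
    affine weight, which produces the extra Re (deriv H s).\<close>
  have "Re (deriv (deriv K) s) - (c * Re (deriv (deriv H) s) - Re (deriv H s)) \<le> 0"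
  proof (rule second_derivative_local_max[OF e(1)])
    fix x :: real assume x: "\<bar>x\<bar> < e"
    show "((\<lambda>x. u (s + of_real x * 1)) has_real_derivative
       (Re (1 * deriv K (s + of_real x * 1)) - ((- 1 / 2) * Re (H (s + of_real x * 1)) + Re (1 * deriv H (s + of_real x * 1)) * (c - x / 2)))) (at x)"
    proof -
      have "((\<lambda>x. c - x / 2) has_real_derivative (- 1 / 2)) (at x)"
        by (auto intro!: derivative_eq_intros)
      from DERIV_diff[OF chain[OF K1(1)[OF in1(1)[OF x]]] DERIV_mult[OF this chain[OF K1(2)[OF in1(1)[OF x]]]]]
      moreover have "(B - Re (s + of_real x * 1)) / 2 = c - x / 2" for x
        by (simp add: c_def field_simps)
      ultimately show ?thesis by (simp only: u_def)
    qed
    show "u (s + of_real x * 1) \<le> u (s + of_real 0 * 1)" using umax[OF in1(1)[OF x]] by simp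
  next
    have s0: "s + of_real 0 * 1 \<in> ball s e" using e by simp
    have "((\<lambda>x. c - x / 2) has_real_derivative (- 1 / 2)) (at 0)"
      by (auto intro!: derivative_eq_intros)
    from DERIV_diff[OF chain[OF K1(3)[OF s0]] DERIV_add[OF DERIV_cmult[OF chain[OF K1(2)[OF s0]], of "-1/2"] DERIV_mult[OF chain[OF K1(4)[OF s0]] this]]]
    show "((\<lambda>x. Re (1 * deriv K (s + of_real x * 1)) - ((- 1 / 2) * Re (H (s + of_real x * 1)) + Re (1 * deriv H (s + of_real x * 1)) * (c - x / 2)))
       has_real_derivative Re (deriv (deriv K) s) - (c * Re (deriv (deriv H) s) - Re (deriv H s))) (at 0)"
      by (simp add: algebra_simps)
  qed
  \<comment> \<open>Second derivative along the imaginary axis. Added to the previous one, the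
    harmonic parts cancel and Re (deriv H s) \<le> 0 remains, contradicting
    \<open>pos\<close>.\<close>
  moreover have "- Re (deriv (deriv K) s) + c * Re (deriv (deriv H) s) \<le> 0"
  proof (rule second_derivative_local_max[OF e(1)])
    fix x :: real assume x: "\<bar>x\<bar> < e"
    show "((\<lambda>x. u (s + of_real x * \<i>)) has_real_derivative
       (Re (\<i> * deriv K (s + of_real x * \<i>)) - c * Re (\<i> * deriv H (s + of_real x * \<i>)))) (at x)"
      using DERIV_diff[OF chain[OF K1(1)[OF in1(2)[OF x]]] DERIV_cmult[OF chain[OF K1(2)[OF in1(2)[OF x]]], of c]]
      by (simp add: u_def c_def)
    show "u (s + of_real x * \<i>) \<le> u (s + of_real 0 * \<i>)" using umax[OF in1(2)[OF x]] by simp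
  next
    have s0: "s + of_real 0 * \<i> \<in> ball s e" using e by simp
    have K2: "((\<lambda>z. \<i> * deriv K z) has_field_derivative \<i> * deriv (deriv K) z) (at z)"
       "((\<lambda>z. \<i> * deriv H z) has_field_derivative \<i> * deriv (deriv H) z) (at z)" if "z \<in> ball s e" for z
      using K1[OF that] by (auto intro!: DERIV_cmult)
    from DERIV_diff[OF chain[OF K2(1)[OF s0]] DERIV_cmult[OF chain[OF K2(2)[OF s0]], of c]]
    show "((\<lambda>x. Re (\<i> * deriv K (s + of_real x * \<i>)) - c * Re (\<i> * deriv H (s + of_real x * \<i>)))
       has_real_derivative - Re (deriv (deriv K) s) + c * Re (deriv (deriv H) s)) (at 0)"
      by simp
  qed
  ultimately show False using pos by simp
qed

text \<open>In a vertical strip the completed square shows Re (s^4) to be bounded below and of size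
  (Im s)^4. So exp (-\<epsilon> s^4) is a convergence factor in both directions that beats exp (C
  |s|^2), which a quadratic exponent with small \<epsilon> would not.\<close>

lemma Re_power4: "Re (s ^ 4) = ((Im s)\<^sup>2 - 3 * (Re s)\<^sup>2)\<^sup>2 - 8 * (Re s) ^ 4"
proof -
  have "s ^ 4 = (s\<^sup>2)\<^sup>2" by simp
  also have "Re \<dots> = (Re (s\<^sup>2))\<^sup>2 - (Im (s\<^sup>2))\<^sup>2" by (simp add: power2_eq_square)
  also have "Re (s\<^sup>2) = (Re s)\<^sup>2 - (Im s)\<^sup>2" by (simp add: power2_eq_square)
  also have "Im (s\<^sup>2) = 2 * Re s * Im s" by (simp add: power2_eq_square)
  finally show ?thesis by (simp add: power2_eq_square power4_eq_xxxx algebra_simps)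
qed

lemma strip_growth_limit:
  fixes C K \<epsilon> :: real
  assumes "\<epsilon> > 0"
  shows "\<exists>T0. \<forall>T\<ge>T0. C * (4 + T)\<^sup>2 + K - \<epsilon> * (T\<^sup>2 - 27/4)\<^sup>2 \<le> 0"
proof -
  have "filterlim (\<lambda>T. C * (4 + T)\<^sup>2 + K - \<epsilon> * (T\<^sup>2 - 27/4)\<^sup>2) at_bot at_top"
    using assms by real_asymp
  then have "\<forall>\<^sub>F T in at_top. C * (4 + T)\<^sup>2 + K - \<epsilon> * (T\<^sup>2 - 27/4)\<^sup>2 \<le> 0"
    unfolding filterlim_at_bot by blast
  then show ?thesis by (simp add: eventually_at_top_linorder)
qed

text \<open>Phragmen-Lindeloef with a bound on the left edge that varies with s. The interpolating
  weight is 0 on Re s = 3/2 and 1 on Re s = -1/2. It is not the modulus of a holomorphic function,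
  so the maximum principle comes from \<open>weighted_modulus_no_local_max\<close>.\<close>

lemma strip_convexity_bound:
  fixes J H :: "complex \<Rightarrow> complex" and A K C T1 :: real
  assumes J: "J holomorphic_on {s. Re s > -1}" and H: "H holomorphic_on {s. Re s > -1}"
    and H': "\<And>s. Re s > -1 \<Longrightarrow> Re (deriv H s) > 0" and HK: "\<And>s. Re s > -1 \<Longrightarrow> Re (H s) \<ge> - K"
    and A: "A > 0" and C: "C \<ge> 0"
    and right: "\<And>s. Re s = 3/2 \<Longrightarrow> cmod (J s) \<le> A"
    and left: "\<And>s. Re s = -1/2 \<Longrightarrow> cmod (J s) \<le> A * exp (Re (H s))"
    and gr: "\<And>s. -1/2 \<le> Re s \<Longrightarrow> Re s \<le> 3/2 \<Longrightarrow> \<bar>Im s\<bar> \<ge> T1 \<Longrightarrow> cmod (J s) \<le> exp (C * (1 + cmod s)\<^sup>2)"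
    and s: "-1/2 \<le> Re s" "Re s \<le> 3/2"
  shows "cmod (J s) \<le> A * exp ((3/2 - Re s) / 2 * Re (H s))"
proof -
  have main: "cmod (J s) * exp (Re (- of_real \<epsilon> * s ^ 4) - (3/2 - Re s) / 2 * Re (H s)) \<le> A * exp (41 * \<epsilon>)"
    if \<epsilon>: "\<epsilon> > 0" for \<epsilon>
  proof -
    define G where "G = (\<lambda>s::complex. - of_real \<epsilon> * s ^ 4)"
    define U where "U = (\<lambda>z. cmod (J z) * exp (Re (G z) - (3/2 - Re z) / 2 * Re (H z)))"
    define B where "B = A * exp (41 * \<epsilon>)"
    obtain T0 where T0: "\<And>T. T \<ge> T0 \<Longrightarrow> C * (4 + T)\<^sup>2 + (\<bar>K\<bar> - ln A) - \<epsilon> * (T\<^sup>2 - 27/4)\<^sup>2 \<le> 0"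
      using strip_growth_limit[OF \<epsilon>, of C "\<bar>K\<bar> - ln A"] by blast
    \<comment> \<open>T \<ge> 3 keeps T^2 - 27/4 positive, so that squaring preserves the order;
      27/4 = 3 (3/2)^2 is the largest 3 (Re z)^2 in the strip.\<close>
    define T where "T = max (max T0 T1) (\<bar>Im s\<bar> + 3)"
    have T: "T \<ge> T0" "T \<ge> T1" "T > \<bar>Im s\<bar>" "T \<ge> 3" by (auto simp: T_def)
    define R where "R = cbox (Complex (-1/2) (-T)) (Complex (3/2) T)"
    have R: "z \<in> R \<longleftrightarrow> -1/2 \<le> Re z \<and> Re z \<le> 3/2 \<and> \<bar>Im z\<bar> \<le> T" for z
      by (auto simp: R_def in_cbox_complex_iff abs_le_iff)
    have G4: "Re (G z) = - \<epsilon> * ((Im z)\<^sup>2 - 3 * (Re z)\<^sup>2)\<^sup>2 + 8 * \<epsilon> * (Re z) ^ 4" for z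
    proof -
      have "Re (G z) = - \<epsilon> * Re (z ^ 4)" by (simp add: G_def)
      then show ?thesis unfolding Re_power4 by (simp add: right_diff_distrib)
    qed
    \<comment> \<open>41 is the integer above 8 (3/2)^4 = 81/2.\<close>
    have G41: "Re (G z) \<le> - \<epsilon> * ((Im z)\<^sup>2 - 3 * (Re z)\<^sup>2)\<^sup>2 + 41 * \<epsilon>" if "-1/2 \<le> Re z" "Re z \<le> 3/2" for z
    proof -
      have "\<bar>Re z\<bar> \<le> 3/2" using that by (auto simp: abs_le_iff)
      then have "\<bar>Re z\<bar> ^ 4 \<le> (3/2) ^ 4" by (intro power_mono) auto
      then have "(Re z) ^ 4 \<le> 41/8" by (simp add: power4_eq_xxxx)
      then have "8 * \<epsilon> * (Re z) ^ 4 \<le> 8 * \<epsilon> * (41/8)" using \<epsilon> by (intro mult_left_mono) auto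
      then show ?thesis using G4[of z] by simp
    qed
    have G41': "Re (G z) \<le> 41 * \<epsilon>" if "-1/2 \<le> Re z" "Re z \<le> 3/2" for z
    proof -
      have "\<epsilon> * ((Im z)\<^sup>2 - 3 * (Re z)\<^sup>2)\<^sup>2 \<ge> 0" using \<epsilon> by simp
      then show ?thesis using G41[OF that] by linarith
    qed
    have bound: "U z \<le> B" if z: "z \<in> R" "Re z = -1/2 \<or> Re z = 3/2 \<or> \<bar>Im z\<bar> = T" for z
    proof -
      have zr: "-1/2 \<le> Re z" "Re z \<le> 3/2" using z R by auto
      consider "Re z = 3/2" | "Re z = -1/2" | "\<bar>Im z\<bar> = T" using z(2) by blast
      then show ?thesis
      proof cases
        case 1
        have "U z = cmod (J z) * exp (Re (G z))" by (simp add: U_def 1)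
        also have "\<dots> \<le> A * exp (41 * \<epsilon>)"
          using right[OF 1] G41'[OF zr] A by (intro mult_mono) auto
        finally show ?thesis by (simp add: B_def)
      next
        case 2
        have "U z = cmod (J z) * exp (Re (G z) - Re (H z))" by (simp add: U_def 2)
        also have "\<dots> \<le> (A * exp (Re (H z))) * exp (41 * \<epsilon> - Re (H z))"
          using left[OF 2] G41'[OF zr] A by (intro mult_mono) auto
        also have "\<dots> = A * exp (41 * \<epsilon>)" by (simp add: exp_diff)
        finally show ?thesis by (simp add: B_def)
      next
        case 3
        have "cmod z \<le> \<bar>Re z\<bar> + \<bar>Im z\<bar>" by (rule cmod_le)
        then have cz: "1 + cmod z \<le> 4 + T" using zr 3 by (auto simp: abs_le_iff)
        have "(1 + cmod z)\<^sup>2 \<le> (4 + T)\<^sup>2" using cz by (intro power_mono) auto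
        then have "C * (1 + cmod z)\<^sup>2 \<le> C * (4 + T)\<^sup>2" using C by (intro mult_left_mono)
        then have J1: "cmod (J z) \<le> exp (C * (4 + T)\<^sup>2)"
          using gr[OF zr] 3 T by (smt (verit) exp_le_cancel_iff)
        have "(Re z)\<^sup>2 \<le> (3/2)\<^sup>2" using zr by (auto simp: abs_le_square_iff[symmetric] abs_le_iff)
        moreover have "(3::real)\<^sup>2 \<le> T\<^sup>2" using T by (intro power_mono) auto
        moreover have "(Im z)\<^sup>2 = T\<^sup>2" using 3 by (metis power2_abs)
        ultimately have "T\<^sup>2 - 27/4 \<le> (Im z)\<^sup>2 - 3 * (Re z)\<^sup>2" "0 \<le> T\<^sup>2 - 27/4" by (auto simp: power2_eq_square)
        then have "\<epsilon> * (T\<^sup>2 - 27/4)\<^sup>2 \<le> \<epsilon> * ((Im z)\<^sup>2 - 3 * (Re z)\<^sup>2)\<^sup>2"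
          using \<epsilon> by (intro mult_left_mono power_mono) auto
        then have G1: "Re (G z) \<le> - \<epsilon> * (T\<^sup>2 - 27/4)\<^sup>2 + 41 * \<epsilon>" using G41[OF zr] by simp
        have c01: "0 \<le> (3/2 - Re z) / 2" "(3/2 - Re z) / 2 \<le> 1" using zr by auto
        have "(3/2 - Re z) / 2 * (- Re (H z)) \<le> \<bar>K\<bar>"
        proof (cases "Re (H z) \<ge> 0")
          case True
          then have "(3/2 - Re z) / 2 * (- Re (H z)) \<le> 0" using c01 by (intro mult_nonneg_nonpos) auto
          then show ?thesis by linarith
        next
          case False
          then have "(3/2 - Re z) / 2 * (- Re (H z)) \<le> 1 * (- Re (H z))" using c01 by (intro mult_right_mono) auto
          then show ?thesis using HK[of z] zr by simp
        qed
        then have e1: "Re (G z) - (3/2 - Re z) / 2 * Re (H z) \<le> - \<epsilon> * (T\<^sup>2 - 27/4)\<^sup>2 + 41 * \<epsilon> + \<bar>K\<bar>"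
          using G1 by simp
        have "U z \<le> exp (C * (4 + T)\<^sup>2) * exp (- \<epsilon> * (T\<^sup>2 - 27/4)\<^sup>2 + 41 * \<epsilon> + \<bar>K\<bar>)"
          unfolding U_def using J1 e1 by (intro mult_mono) auto
        also have "\<dots> = exp (C * (4 + T)\<^sup>2 + (- \<epsilon> * (T\<^sup>2 - 27/4)\<^sup>2 + 41 * \<epsilon> + \<bar>K\<bar>))"
          by (simp only: exp_add)
        also have "C * (4 + T)\<^sup>2 + (- \<epsilon> * (T\<^sup>2 - 27/4)\<^sup>2 + 41 * \<epsilon> + \<bar>K\<bar>)
            = (C * (4 + T)\<^sup>2 + (\<bar>K\<bar> - ln A) - \<epsilon> * (T\<^sup>2 - 27/4)\<^sup>2) + (ln A + 41 * \<epsilon>)" by simp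
        also have "exp \<dots> = exp (C * (4 + T)\<^sup>2 + (\<bar>K\<bar> - ln A) - \<epsilon> * (T\<^sup>2 - 27/4)\<^sup>2) * (A * exp (41 * \<epsilon>))"
          using A by (simp only: exp_add exp_ln)
        also have "\<dots> \<le> 1 * (A * exp (41 * \<epsilon>))"
          using T0[OF T(1)] A by (intro mult_right_mono) auto
        finally show ?thesis by (simp add: B_def)
      qed
    qed
    have sub: "R \<subseteq> {s. Re s > -1}" using R by auto
    have cU: "continuous_on R U"
      unfolding U_def G_def
      using holomorphic_on_imp_continuous_on[OF J] holomorphic_on_imp_continuous_on[OF H] sub
      by (intro continuous_intros) (auto intro: continuous_on_subset)
    have "compact R" "R \<noteq> {}" using R[of 0] T by (auto simp: R_def)
    then obtain z where z: "z \<in> R" "\<And>w. w \<in> R \<Longrightarrow> U w \<le> U z"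
      using continuous_attains_sup[OF _ _ cU] by blast
    have "U z \<le> B"
    proof (rule ccontr)
      assume nB: "\<not> U z \<le> B"
      \<comment> \<open>A maximum above B cannot lie on the boundary of the rectangle, so it is
        interior, where no local maximum can occur.\<close>
      then have inner: "-1/2 < Re z" "Re z < 3/2" "\<bar>Im z\<bar> < T"
        using bound[OF z(1)] z(1) R[of z] by (auto simp: less_le)
      have B0: "B > 0" using A by (simp add: B_def)
      then have nz: "J z \<noteq> 0" using nB by (auto simp: U_def)
      have "z \<in> box (Complex (-1/2) (-T)) (Complex (3/2) T)" using inner by (auto simp: in_box_complex_iff)
      then obtain \<delta> where d: "\<delta> > 0" "ball z \<delta> \<subseteq> box (Complex (-1/2) (-T)) (Complex (3/2) T)"
        using open_box open_contains_ball by blast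
      then have dR: "ball z \<delta> \<subseteq> R" unfolding R_def using box_subset_cbox by blast
      have hol: "J holomorphic_on ball z \<delta>" "H holomorphic_on ball z \<delta>"
        using J H dR sub holomorphic_on_subset by (meson order_trans)+
      have "G holomorphic_on ball z \<delta>" unfolding G_def by (intro holomorphic_intros)
      then obtain w where "w \<in> ball z \<delta>" "U w > U z"
        using weighted_modulus_no_local_max[OF d(1) hol(1) _ hol(2) H'[of z] nz, of G "3/2"] inner
        unfolding U_def by auto
      then show False using z(2)[of w] dR by auto
    qed
    moreover have "s \<in> R" using s T R by auto
    ultimately show ?thesis using z(2)[of s] unfolding U_def G_def B_def by linarith
  qed
  \<comment> \<open>V is free of \<epsilon>, so the convergence factor can be removed by letting
    \<epsilon> tend to 0 at the fixed point s.\<close>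
  define V where "V = cmod (J s) * exp (- ((3/2 - Re s) / 2 * Re (H s)))"
  have "V \<le> A * exp (\<epsilon> * (41 + Re (s ^ 4)))" if "\<epsilon> > 0" for \<epsilon>
  proof -
    define c where "c = (3/2 - Re s) / 2 * Re (H s)"
    have "Re (- of_real \<epsilon> * s ^ 4) - c = - c + - \<epsilon> * Re (s ^ 4)" by simp
    then have "V * exp (- \<epsilon> * Re (s ^ 4)) \<le> A * exp (41 * \<epsilon>)"
      using main[OF that] unfolding V_def c_def[symmetric] by (simp only: exp_add mult.assoc)
    then have "V * exp (- \<epsilon> * Re (s ^ 4)) * exp (\<epsilon> * Re (s ^ 4)) \<le> A * exp (41 * \<epsilon>) * exp (\<epsilon> * Re (s ^ 4))"
      by (rule mult_right_mono) simp
    moreover have "V * exp (- \<epsilon> * Re (s ^ 4)) * exp (\<epsilon> * Re (s ^ 4)) = V"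
      by (simp add: exp_minus)
    moreover have "A * exp (41 * \<epsilon>) * exp (\<epsilon> * Re (s ^ 4)) = A * exp (\<epsilon> * (41 + Re (s ^ 4)))"
      by (simp add: distrib_left exp_add mult.commute mult.left_commute)
    ultimately show ?thesis by (simp only:)
  qed
  moreover have "((\<lambda>\<epsilon>. A * exp (\<epsilon> * (41 + Re (s ^ 4)))) \<longlongrightarrow> A * exp (0 * (41 + Re (s ^ 4)))) (at_right 0)"
    by (intro tendsto_intros)
  ultimately have "V \<le> A * exp (0 * (41 + Re (s ^ 4)))"
    by (intro tendsto_lowerbound[where F = "at_right 0"]) (auto intro!: eventually_at_rightI[of 0 1])
  then show ?thesis by (simp add: V_def exp_minus field_simps)
qed

section \<open>The Euler product\<close>

text \<open>Counting the indices of J twice, once reindexed by the involution, groups the moduli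
  into pairs q and 1/q; this explains the factor 2. Indices outside J have modulus at most 1 and are
  treated singly through \<open>f2\<close>.\<close>

lemma unitary_pairing_sum:
  fixes f :: "real \<Rightarrow> real" and C b :: real
  assumes J: "J \<subseteq> {1..r}" "unitary_pairing \<alpha> p J" "\<And>j. j \<in> {1..r} - J \<Longrightarrow> cmod (\<alpha> p j) \<le> 1"
    and b: "b > 0" "\<And>j. j \<in> {1..r} \<Longrightarrow> cmod (\<alpha> p j) \<le> b"
    and f1: "\<And>q. 1 / b \<le> q \<Longrightarrow> q \<le> b \<Longrightarrow> f q + f (1 / q) \<le> C"
    and f2: "\<And>q. 0 \<le> q \<Longrightarrow> q \<le> 1 \<Longrightarrow> 2 * f q \<le> C"
  shows "2 * (\<Sum>j=1..r. f (cmod (\<alpha> p j))) \<le> real r * C"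
proof -
  obtain \<pi> where \<pi>: "\<And>j. j \<in> J \<Longrightarrow> \<pi> j \<in> J" "\<And>j. j \<in> J \<Longrightarrow> \<pi> (\<pi> j) = j"
      "\<And>j. j \<in> J \<Longrightarrow> cmod (\<alpha> p j * \<alpha> p (\<pi> j)) = 1"
    using J(2) unfolding unitary_pairing_def by blast
  have fin: "finite J" using J(1) finite_subset by blast
  have inv: "(\<Sum>j\<in>J. f (cmod (\<alpha> p (\<pi> j)))) = (\<Sum>j\<in>J. f (cmod (\<alpha> p j)))"
    by (rule sum.reindex_bij_witness[of J \<pi> \<pi>]) (use \<pi> in auto)
  have "2 * (\<Sum>j\<in>J. f (cmod (\<alpha> p j))) = (\<Sum>j\<in>J. f (cmod (\<alpha> p j)) + f (cmod (\<alpha> p (\<pi> j))))"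
    by (simp add: sum.distrib inv)
  also have "\<dots> \<le> (\<Sum>j\<in>J. C)"
  proof (rule sum_mono)
    fix j assume j: "j \<in> J"
    have m: "cmod (\<alpha> p j) * cmod (\<alpha> p (\<pi> j)) = 1" using \<pi>(3)[OF j] by (simp add: norm_mult)
    then have nz: "cmod (\<alpha> p j) > 0" by (metis mult_zero_left norm_ge_zero order_le_less zero_neq_one)
    have eq: "cmod (\<alpha> p (\<pi> j)) = 1 / cmod (\<alpha> p j)" using m nz by (simp add: field_simps)
    have "1 / cmod (\<alpha> p j) \<le> b" using b(2)[of "\<pi> j"] \<pi>(1)[OF j] J(1) eq by auto
    then have "1 / b \<le> cmod (\<alpha> p j)" using nz b(1) by (simp add: field_simps)
    then show "f (cmod (\<alpha> p j)) + f (cmod (\<alpha> p (\<pi> j))) \<le> C"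
      unfolding eq using b(2)[of j] j J(1) by (intro f1) auto
  qed
  finally have 1: "2 * (\<Sum>j\<in>J. f (cmod (\<alpha> p j))) \<le> (\<Sum>j\<in>J. C)" .
  have 2: "2 * (\<Sum>j\<in>{1..r} - J. f (cmod (\<alpha> p j))) \<le> (\<Sum>j\<in>{1..r} - J. C)"
    unfolding sum_distrib_left by (intro sum_mono f2 J(3)) auto
  have "(\<Sum>j=1..r. f (cmod (\<alpha> p j))) = (\<Sum>j\<in>{1..r} - J. f (cmod (\<alpha> p j))) + (\<Sum>j\<in>J. f (cmod (\<alpha> p j)))"
    by (rule sum.subset_diff[OF J(1)]) simp
  moreover have "(\<Sum>j=1..r. C) = (\<Sum>j\<in>{1..r} - J. C) + (\<Sum>j\<in>J. C)"
    by (rule sum.subset_diff[OF J(1)]) simp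
  ultimately show ?thesis using 1 2 by simp
qed

text \<open>On the range from 1/b to b the sum q + 1/q is largest at the ends: the difference is (b
  - q)(q b - 1) / (q b).\<close>

lemma pair_sum_le:
  fixes q b :: real
  assumes b: "b \<ge> 1" and q: "1 / b \<le> q" "q \<le> b"
  shows "q + 1 / q \<le> b + 1 / b"
proof -
  have "0 < 1 / b" using b by simp
  then have q0: "q > 0" using q(1) by linarith
  have "q * b - 1 \<ge> 0" using q(1) b by (simp add: field_simps)
  then have "(b - q) * (q * b - 1) / (q * b) \<ge> 0" using q q0 b by (intro divide_nonneg_nonneg mult_nonneg_nonneg) auto
  moreover have "(b - q) * (q * b - 1) / (q * b) = (b + 1 / b) - (q + 1 / q)"
    using q0 b by (simp add: field_simps)
  ultimately show ?thesis by simp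
qed

lemma two_le_pair: "b > 0 \<Longrightarrow> 2 \<le> b + 1 / (b::real)"
proof -
  assume b: "b > 0"
  have "b + 1 / b - 2 = (b - 1)\<^sup>2 / b" using b by (simp add: field_simps power2_eq_square)
  also have "\<dots> \<ge> 0" using b by simp
  finally show ?thesis by simp
qed

context
  fixes y b :: real
  assumes y: "0 < y" "y * b < 1" and b: "b \<ge> 1"
begin

private lemma y1: "y < 1"
  using y b by (metis less_le_trans less_eq_real_def linorder_not_less mult_le_cancel_left1 mult.commute order_le_less_trans)

private lemma yq: "0 \<le> q \<Longrightarrow> q \<le> b \<Longrightarrow> y * q < 1"
  using y by (meson less_eq_real_def mult_left_mono order_le_less_trans)

private lemma inv_range: "1 / b \<le> q \<Longrightarrow> q \<le> b \<Longrightarrow> 0 < q \<and> 0 \<le> 1/q \<and> 1/q \<le> b"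
proof -
  assume q: "1 / b \<le> q" "q \<le> b"
  have "0 < 1 / b" using b by simp
  then have q0: "q > 0" using q(1) by linarith
  then show ?thesis using q b by (simp add: field_simps)
qed

text \<open>Since (1 - y q)(1 - y/q) = 1 + y^2 - y (q + 1/q), only q + 1/q matters, and the worst
  case is q = b. A single modulus q \<le> 1 is no worse than q = 1, the pair with q + 1/q = 2. In
  the application y = p^(-\<sigma>) and b = p^\<theta>.\<close>

lemma pair_upper:
  shows "1 / b \<le> q \<Longrightarrow> q \<le> b \<Longrightarrow> - ln (1 - y * q) + - ln (1 - y * (1 / q)) \<le> - ln (1 - y * b) + - ln (1 - y * (1 / b))"
    and "0 \<le> q \<Longrightarrow> q \<le> 1 \<Longrightarrow> 2 * (- ln (1 - y * q)) \<le> - ln (1 - y * b) + - ln (1 - y * (1 / b))"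
proof -
  have b1: "0 \<le> 1 / b" "1 / b \<le> b" using b by (auto simp: field_simps intro: order_trans[OF _ mult_mono[of 1 b 1 b]])
  have B: "1 - y * b > 0" "1 - y * (1/b) > 0" using yq[of b] yq[OF b1] b by auto
  have prod: "(1 - y * q) * (1 - y * (1/q)) = 1 + y\<^sup>2 - y * (q + 1/q)" if "q \<noteq> 0" for q :: real
    using that by (simp add: field_simps power2_eq_square)
  have lnb: "ln (1 - y * b) + ln (1 - y * (1 / b)) = ln (1 + y\<^sup>2 - y * (b + 1/b))"
    using B b prod[of b] by (subst ln_mult_pos[symmetric]) auto
  have Bp: "1 + y\<^sup>2 - y * (b + 1/b) > 0" using B b prod[of b] by (metis mult_pos_pos not_one_le_zero)
  {
    assume q: "1 / b \<le> q" "q \<le> b"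
    have q0: "q > 0" "0 \<le> 1/q" "1/q \<le> b" using inv_range[OF q] by auto
    have Q: "1 - y * q > 0" "1 - y * (1/q) > 0" using yq[of q] yq[of "1/q"] q q0 by auto
    have "y * (q + 1/q) \<le> y * (b + 1/b)" using pair_sum_le[OF b q] y by (intro mult_left_mono) auto
    then have "ln (1 + y\<^sup>2 - y * (b + 1/b)) \<le> ln (1 + y\<^sup>2 - y * (q + 1/q))"
      using Bp by (intro ln_mono) auto
    moreover have "ln (1 - y * q) + ln (1 - y * (1 / q)) = ln (1 + y\<^sup>2 - y * (q + 1/q))"
      using Q q0 prod[of q] by (subst ln_mult_pos[symmetric]) auto
    ultimately show "- ln (1 - y * q) + - ln (1 - y * (1 / q)) \<le> - ln (1 - y * b) + - ln (1 - y * (1 / b))"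
      using lnb by linarith
  }
  {
    assume q: "0 \<le> q" "q \<le> 1"
    have "y * 2 \<le> y * (b + 1/b)" using two_le_pair[of b] b y by (intro mult_left_mono) auto
    then have "1 + y\<^sup>2 - y * (b + 1/b) \<le> (1 - y)\<^sup>2" by (simp add: power2_diff)
    also have "(1 - y)\<^sup>2 \<le> (1 - y * q)\<^sup>2" using q y y1 by (intro power_mono) (auto simp: mult_left_le)
    finally have "ln (1 + y\<^sup>2 - y * (b + 1/b)) \<le> ln ((1 - y * q)\<^sup>2)" using Bp by (intro ln_mono) auto
    also have "\<dots> = 2 * ln (1 - y * q)" using yq[of q] q b by (simp add: ln_realpow)
    finally show "2 * (- ln (1 - y * q)) \<le> - ln (1 - y * b) + - ln (1 - y * (1 / b))"
      using lnb by linarith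
  }
qed

lemma pair_lower:
  shows "1 / b \<le> q \<Longrightarrow> q \<le> b \<Longrightarrow> ln (1 + y * q) + ln (1 + y * (1 / q)) \<le> ln (1 + y * b) + ln (1 + y * (1 / b))"
    and "0 \<le> q \<Longrightarrow> q \<le> 1 \<Longrightarrow> 2 * ln (1 + y * q) \<le> ln (1 + y * b) + ln (1 + y * (1 / b))"
proof -
  have pos: "1 + y * q > 0" if "q \<ge> 0" for q using that y by (simp add: add_pos_nonneg)
  have prod: "(1 + y * q) * (1 + y * (1/q)) = 1 + y\<^sup>2 + y * (q + 1/q)" if "q \<noteq> 0" for q :: real
    using that by (simp add: field_simps power2_eq_square)
  have lnb: "ln (1 + y * q) + ln (1 + y * (1 / q)) = ln (1 + y\<^sup>2 + y * (q + 1/q))" if "q > 0" for q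
    using pos[of q] pos[of "1/q"] that prod[of q] by (subst ln_mult_pos[symmetric]) auto
  have pos2: "1 + y\<^sup>2 + y * (q + 1/q) > 0" if "q > 0" for q
    using that y by (intro add_pos_nonneg) auto
  {
    assume q: "1 / b \<le> q" "q \<le> b"
    have q0: "q > 0" using inv_range[OF q] by auto
    have "y * (q + 1/q) \<le> y * (b + 1/b)" using pair_sum_le[OF b q] y by (intro mult_left_mono) auto
    then have "ln (1 + y\<^sup>2 + y * (q + 1/q)) \<le> ln (1 + y\<^sup>2 + y * (b + 1/b))"
      using pos2[OF q0] by (intro ln_mono) auto
    then show "ln (1 + y * q) + ln (1 + y * (1 / q)) \<le> ln (1 + y * b) + ln (1 + y * (1 / b))"
      using lnb[OF q0] lnb[of b] b by simp
  }
  {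
    assume q: "0 \<le> q" "q \<le> 1"
    have "y * 2 \<le> y * (b + 1/b)" using two_le_pair[of b] b y by (intro mult_left_mono) auto
    then have *: "(1 + y)\<^sup>2 \<le> 1 + y\<^sup>2 + y * (b + 1/b)" by (simp add: power2_sum)
    have "(1 + y * q)\<^sup>2 \<le> (1 + y)\<^sup>2" using q y by (intro power_mono) (auto simp: mult_left_le)
    then have "ln ((1 + y * q)\<^sup>2) \<le> ln (1 + y\<^sup>2 + y * (b + 1/b))"
      using * pos[of q] q by (intro ln_mono) auto
    moreover have "ln ((1 + y * q)\<^sup>2) = 2 * ln (1 + y * q)" using pos[of q] q by (simp add: ln_realpow)
    ultimately show "2 * ln (1 + y * q) \<le> ln (1 + y * b) + ln (1 + y * (1 / b))"
      using lnb[of b] b by simp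
  }
qed

text \<open>The differentiated counterpart of \<open>pair_lower\<close>: the sum is again a function
  F of q + 1/q alone, and F increases because y < 1.\<close>

lemma pair_logistic:
  shows "1 / b \<le> q \<Longrightarrow> q \<le> b \<Longrightarrow> y * q / (1 + y * q) + y * (1 / q) / (1 + y * (1 / q))
            \<le> y * b / (1 + y * b) + y * (1 / b) / (1 + y * (1 / b))"
    and "0 \<le> q \<Longrightarrow> q \<le> 1 \<Longrightarrow> 2 * (y * q / (1 + y * q)) \<le> y * b / (1 + y * b) + y * (1 / b) / (1 + y * (1 / b))"
proof -
  define F where "F = (\<lambda>T. 1 - (1 - y\<^sup>2) / (1 + y\<^sup>2 + y * T))"
  have y2: "1 - y\<^sup>2 \<ge> 0" using y y1 by (simp add: power_le_one)
  have eq: "y * q / (1 + y * q) + y * (1 / q) / (1 + y * (1 / q)) = F (q + 1/q)" if "q > 0" for q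
  proof -
    have p: "1 + y * q > 0" "1 + y * (1/q) > 0" using that y by (auto intro!: add_pos_nonneg)
    have prod: "(1 + y * q) * (1 + y * (1/q)) = 1 + y\<^sup>2 + y * (q + 1/q)"
      using that by (simp add: field_simps power2_eq_square)
    have "u / (1 + u) + v / (1 + v) = 1 - (1 - u * v) / ((1 + u) * (1 + v))" if "1 + u > 0" "1 + v > 0" for u v :: real
      using that by (simp add: divide_simps) (simp add: algebra_simps)
    from this[OF p] show ?thesis unfolding F_def prod using that by (simp add: power2_eq_square)
  qed
  have mono: "F T \<le> F T'" if "0 \<le> T" "T \<le> T'" for T T'
  proof -
    have "1 + y\<^sup>2 + y * T > 0" using that y by (intro add_pos_nonneg) auto
    moreover have "1 + y\<^sup>2 + y * T \<le> 1 + y\<^sup>2 + y * T'" using that y by simp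
    ultimately have "(1 - y\<^sup>2) / (1 + y\<^sup>2 + y * T') \<le> (1 - y\<^sup>2) / (1 + y\<^sup>2 + y * T)"
      using y2 by (intro divide_left_mono mult_pos_pos) auto
    then show ?thesis by (simp add: F_def)
  qed
  {
    assume q: "1 / b \<le> q" "q \<le> b"
    have q0: "q > 0" "0 \<le> 1/q" using inv_range[OF q] by auto
    show "y * q / (1 + y * q) + y * (1 / q) / (1 + y * (1 / q)) \<le> y * b / (1 + y * b) + y * (1 / b) / (1 + y * (1 / b))"
      using eq[OF q0(1)] eq[of b] b mono[OF _ pair_sum_le[OF b q]] q0 by simp
  }
  {
    assume q: "0 \<le> q" "q \<le> 1"
    have frac: "u / (1 + u) = 1 - 1 / (1 + u)" if "1 + u > 0" for u :: real
      using that by (simp add: divide_simps)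
    have "1 + y * q > 0" "1 + y > 0" using q y by (auto intro!: add_pos_nonneg)
    then have "y * q / (1 + y * q) = 1 - 1 / (1 + y * q)" "y / (1 + y) = 1 - 1 / (1 + y)"
      using frac by blast+
    moreover have "1 / (1 + y) \<le> 1 / (1 + y * q)"
      using q y by (intro divide_left_mono mult_pos_pos) (auto simp: mult_left_le intro!: add_pos_nonneg)
    ultimately have "2 * (y * q / (1 + y * q)) \<le> y * 1 / (1 + y * 1) + y * (1 / 1) / (1 + y * (1 / 1))" by simp
    also have "\<dots> = F (1 + 1/1)" by (rule eq) simp
    also have "\<dots> \<le> F (b + 1/b)" using two_le_pair[of b] b by (intro mono) auto
    also have "\<dots> = y * b / (1 + y * b) + y * (1 / b) / (1 + y * (1 / b))" using eq[of b] b by simp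
    finally show "2 * (y * q / (1 + y * q)) \<le> y * b / (1 + y * b) + y * (1 / b) / (1 + y * (1 / b))" .
  }
qed

end

text \<open>On a circle |u| = \<rho> < 1 the minimum of Re (u / (1 - u)) is attained at u =
  -\<rho>.\<close>

lemma Re_logistic_lower:
  fixes u :: complex assumes "cmod u < 1"
  shows "Re (u / (1 - u)) \<ge> - (cmod u / (1 + cmod u))"
proof -
  define \<rho> where "\<rho> = cmod u"
  have r: "0 \<le> \<rho>" "\<rho> < 1" using assms by (auto simp: \<rho>_def)
  have nz: "1 - u \<noteq> 0" using assms by auto
  have "\<bar>Re u\<bar> \<le> \<rho>" using abs_Re_le_cmod by (simp add: \<rho>_def)
  then have "(Re u + \<rho>) * (1 - \<rho>) \<ge> 0" using r by (intro mult_nonneg_nonneg) (auto simp: abs_le_iff)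
  moreover have n2: "(cmod (1 - u))\<^sup>2 = 1 - 2 * Re u + \<rho>\<^sup>2"
    unfolding \<rho>_def cmod_power2 by (simp add: power2_eq_square algebra_simps)
  ultimately have "(cmod (1 - u))\<^sup>2 \<le> (1 - Re u) * (1 + \<rho>)"
    by (simp add: power2_eq_square algebra_simps)
  moreover have "(cmod (1 - u))\<^sup>2 > 0" using nz by simp
  ultimately have "1 / (1 + \<rho>) \<le> (1 - Re u) / (cmod (1 - u))\<^sup>2" using r by (simp add: field_simps)
  also have "\<dots> = Re (1 / (1 - u))" by (simp add: Re_divide cmod_power2)
  also have "1 / (1 - u) = 1 + u / (1 - u)" using nz by (simp add: field_simps)
  finally have "1 / (1 + \<rho>) - 1 \<le> Re (u / (1 - u))" by simp
  moreover have "1 / (1 + \<rho>) - 1 = - (\<rho> / (1 + \<rho>))" using r by (simp add: field_simps)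
  ultimately show ?thesis by (simp add: \<rho>_def)
qed

section \<open>Euler factors of L compared with those of zeta quotients\<close>

context L_function
begin

lemma prime_powr_facts:
  assumes p: "prime p" and \<sigma>: "\<sigma> > \<theta>"
  defines "y \<equiv> real p powr (-\<sigma>)" and "b \<equiv> real p powr \<theta>"
  shows "0 < y" "y * b < 1" "b \<ge> 1" "y * b = real p powr (-(\<sigma> - \<theta>))" "y * (1 / b) = real p powr (-(\<sigma> + \<theta>))"
proof -
  have p1: "real p > 1" using prime_gt_1_nat[OF p] by simp
  show "0 < y" using p1 by (simp add: y_def)
  show "b \<ge> 1" using p1 theta_range by (simp add: b_def ge_one_powr_ge_zero)
  show yb: "y * b = real p powr (-(\<sigma> - \<theta>))" by (simp add: y_def b_def flip: powr_add)
  have "real p powr (-(\<sigma> - \<theta>)) < real p powr 0" using p1 \<sigma> by (intro powr_less_mono) auto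
  then show "y * b < 1" using yb p1 by simp
  show "y * (1 / b) = real p powr (-(\<sigma> + \<theta>))"
    by (simp add: y_def b_def flip: powr_add powr_minus_divide)
qed

lemma pairing_exists:
  assumes "prime p"
  shows "\<exists>J\<subseteq>{1..r}. unitary_pairing \<alpha> p J \<and> (\<forall>j\<in>{1..r} - J. norm (\<alpha> p j) \<le> 1)"
proof (cases "unitary_pairing \<alpha> p {1..r}")
  case True
  then show ?thesis by (intro exI[of _ "{1..r}"]) auto
qed (use alpha_pairing_exceptional[OF assms] in blast)

lemma prime_pair_sum:
  fixes f :: "real \<Rightarrow> real"
  assumes p: "prime p"
    and f1: "\<And>q. 1 / (real p powr \<theta>) \<le> q \<Longrightarrow> q \<le> real p powr \<theta> \<Longrightarrow> f q + f (1 / q) \<le> C"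
    and f2: "\<And>q. 0 \<le> q \<Longrightarrow> q \<le> 1 \<Longrightarrow> 2 * f q \<le> C"
  shows "2 * (\<Sum>j=1..r. f (cmod (\<alpha> p j))) \<le> real r * C"
proof -
  obtain J where "J \<subseteq> {1..r}" "unitary_pairing \<alpha> p J" "\<And>j. j \<in> {1..r} - J \<Longrightarrow> norm (\<alpha> p j) \<le> 1"
    using pairing_exists[OF p] by blast
  then show ?thesis
    using prime_gt_0_nat[OF p] alpha_bound[OF p] f1 f2
    by (intro unitary_pairing_sum[where b = "real p powr \<theta>"]) auto
qed

text \<open>The Euler factor at p of the square of \<open>Z_theta\<close>; squares avoid the square
  roots and match the doubled sums over pairs.\<close>

definition zeta_pair_upper :: "real \<Rightarrow> nat \<Rightarrow> real" where
  "zeta_pair_upper \<sigma> p = (if prime p then inverse (1 - real p powr (-(\<sigma> - \<theta>))) * inverse (1 - real p powr (-(\<sigma> + \<theta>))) else 1)"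

text \<open>The Euler factor at p of the square of \<open>z_theta\<close>, since 1 / (1 + u) = (1 -
  u) / (1 - u^2) is the local factor of zeta(2x) / zeta(x) for u = p^(-x).\<close>

definition zeta_pair_lower :: "real \<Rightarrow> nat \<Rightarrow> real" where
  "zeta_pair_lower \<sigma> p = (if prime p then inverse (1 + real p powr (-(\<sigma> - \<theta>))) * inverse (1 + real p powr (-(\<sigma> + \<theta>))) else 1)"

lemma cmod_nat_powr: "p > 0 \<Longrightarrow> cmod (of_nat p powr (- s)) = real p powr (- Re s)"
  using norm_powr_real_powr[of "of_nat p" "-s"] by simp

lemma alpha_term_lt_1:
  assumes p: "prime p" and s: "Re s > \<theta>" and j: "j \<in> {1..r}"
  shows "cmod (\<alpha> p j * of_nat p powr (- s)) = real p powr (- Re s) * cmod (\<alpha> p j)"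
    "cmod (\<alpha> p j * of_nat p powr (- s)) < 1"
proof -
  show eq: "cmod (\<alpha> p j * of_nat p powr (- s)) = real p powr (- Re s) * cmod (\<alpha> p j)"
    using prime_gt_0_nat[OF p] by (simp add: norm_mult cmod_nat_powr)
  note F = prime_powr_facts[OF p s]
  have "real p powr (- Re s) * cmod (\<alpha> p j) \<le> real p powr (- Re s) * real p powr \<theta>"
    using alpha_bound[OF p j] by (intro mult_left_mono) auto
  then show "cmod (\<alpha> p j * of_nat p powr (- s)) < 1" using F(2) eq by simp
qed

lemma ln_euler_factor:
  assumes p: "prime p" and s: "Re s > \<theta>"
  shows "cmod (euler_factor r \<alpha> s p) > 0"
    "ln (cmod (euler_factor r \<alpha> s p)) = - (\<Sum>j=1..r. ln (cmod (1 - \<alpha> p j * of_nat p powr (- s))))"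
proof -
  have nz: "1 - \<alpha> p j * of_nat p powr (- s) \<noteq> 0" if "j \<in> {1..r}" for j
    using alpha_term_lt_1(2)[OF p s that] by auto
  have eq: "cmod (euler_factor r \<alpha> s p) = (\<Prod>j=1..r. inverse (cmod (1 - \<alpha> p j * of_nat p powr (- s))))"
    using p by (simp add: euler_factor_def norm_inverse flip: prod_norm)
  show "cmod (euler_factor r \<alpha> s p) > 0" unfolding eq using nz by (intro prod_pos) auto
  show "ln (cmod (euler_factor r \<alpha> s p)) = - (\<Sum>j=1..r. ln (cmod (1 - \<alpha> p j * of_nat p powr (- s))))"
    unfolding eq using nz by (subst ln_prod) (auto simp: ln_inverse sum_negf)
qed

text \<open>The triangle inequality replaces each 1 - \<alpha> p^(-s) by 1 - y |\<alpha>| or 1 + y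
  |\<alpha>|. The pairing then bounds twice the sum over the moduli by r times its value on the
  extreme pair p^\<theta>, p^(-\<theta>).\<close>

lemma euler_factor_bounds:
  assumes s: "Re s > \<theta>"
  shows "(cmod (euler_factor r \<alpha> s p))\<^sup>2 \<le> zeta_pair_upper (Re s) p ^ r"
    "(cmod (euler_factor r \<alpha> s p))\<^sup>2 \<ge> zeta_pair_lower (Re s) p ^ r"
proof -
  consider "prime p" | "\<not> prime p" by blast
  then have "(cmod (euler_factor r \<alpha> s p))\<^sup>2 \<le> zeta_pair_upper (Re s) p ^ r \<and>
    (cmod (euler_factor r \<alpha> s p))\<^sup>2 \<ge> zeta_pair_lower (Re s) p ^ r"
  proof cases
    case 1
    note p = 1
    define y where "y = real p powr (- Re s)"
    define b where "b = real p powr \<theta>"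
    note F = prime_powr_facts[OF p s, folded y_def b_def]
    define E where "E = cmod (euler_factor r \<alpha> s p)"
    have E0: "E > 0" using ln_euler_factor(1)[OF p s] by (simp add: E_def)
    have bb: "1 / b \<le> b" using F(3) by (simp add: field_simps) (metis mult_le_one mult_mono order_trans le_numeral_extra(4) linear mult_1 zero_le_one)
    have y1b: "y * (1 / b) \<le> y * b" using bb F(1) by (intro mult_left_mono) auto
    have pos: "1 - y * b > 0" "1 - y * (1/b) > 0" "1 + y * b > 0" "1 + y * (1/b) > 0"
    proof -
      have "y * b > 0" "y * (1/b) > 0" using F(1,3) by auto
      then show "1 - y * b > 0" "1 - y * (1/b) > 0" "1 + y * b > 0" "1 + y * (1/b) > 0"
        using F(2) y1b by linarith+
    qed
    have u: "y * cmod (\<alpha> p j) < 1" "cmod (\<alpha> p j * of_nat p powr (- s)) = y * cmod (\<alpha> p j)" if "j \<in> {1..r}" for j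
      using alpha_term_lt_1[OF p s that] by (auto simp: y_def)
    have tri: "1 - y * cmod (\<alpha> p j) \<le> cmod (1 - \<alpha> p j * of_nat p powr (- s))"
        "cmod (1 - \<alpha> p j * of_nat p powr (- s)) \<le> 1 + y * cmod (\<alpha> p j)" if "j \<in> {1..r}" for j
      using norm_triangle_ineq2[of 1 "\<alpha> p j * of_nat p powr (- s)"] norm_triangle_ineq4[of 1 "\<alpha> p j * of_nat p powr (- s)"]
        u(2)[OF that] by auto
    have "2 * ln E = 2 * (\<Sum>j=1..r. - ln (cmod (1 - \<alpha> p j * of_nat p powr (- s))))"
      by (simp add: E_def ln_euler_factor(2)[OF p s] sum_negf)
    also have "\<dots> \<le> 2 * (\<Sum>j=1..r. - ln (1 - y * cmod (\<alpha> p j)))"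
    proof (intro mult_left_mono sum_mono)
      fix j assume j: "j \<in> {1..r}"
      have "ln (1 - y * cmod (\<alpha> p j)) \<le> ln (cmod (1 - \<alpha> p j * of_nat p powr (- s)))"
        using tri(1)[OF j] u(1)[OF j] by (intro ln_mono) auto
      then show "- ln (cmod (1 - \<alpha> p j * of_nat p powr (- s))) \<le> - ln (1 - y * cmod (\<alpha> p j))" by simp
    qed simp
    also have "\<dots> \<le> real r * (- ln (1 - y * b) + - ln (1 - y * (1 / b)))"
      by (rule prime_pair_sum[OF p, where f = "\<lambda>q. - ln (1 - y * q)"])
         (use pair_upper[OF F(1-3)] in \<open>simp_all add: b_def\<close>)
    also have "\<dots> = ln ((inverse (1 - y * b) * inverse (1 - y * (1 / b))) ^ r)"
      using pos by (simp add: ln_realpow ln_mult_pos ln_inverse)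
    finally have "ln (E\<^sup>2) \<le> ln ((inverse (1 - y * b) * inverse (1 - y * (1 / b))) ^ r)"
      using E0 by (simp add: ln_realpow)
    then have 1: "E\<^sup>2 \<le> (inverse (1 - y * b) * inverse (1 - y * (1 / b))) ^ r"
      using E0 pos by (subst (asm) ln_le_cancel_iff) auto
    have "2 * ln E = - (2 * (\<Sum>j=1..r. ln (cmod (1 - \<alpha> p j * of_nat p powr (- s)))))"
      by (simp add: E_def ln_euler_factor(2)[OF p s])
    also have "\<dots> \<ge> - (2 * (\<Sum>j=1..r. ln (1 + y * cmod (\<alpha> p j))))"
    proof (intro le_imp_neg_le mult_left_mono sum_mono)
      fix j assume j: "j \<in> {1..r}"
      show "ln (cmod (1 - \<alpha> p j * of_nat p powr (- s))) \<le> ln (1 + y * cmod (\<alpha> p j))"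
        using tri[OF j] u(1)[OF j] by (intro ln_mono) auto
    qed simp
    moreover have "2 * (\<Sum>j=1..r. ln (1 + y * cmod (\<alpha> p j))) \<le> real r * (ln (1 + y * b) + ln (1 + y * (1 / b)))"
      by (rule prime_pair_sum[OF p, where f = "\<lambda>q. ln (1 + y * q)"])
         (use pair_lower[OF F(1-3)] in \<open>simp_all add: b_def\<close>)
    moreover have "- (real r * (ln (1 + y * b) + ln (1 + y * (1 / b)))) = ln ((inverse (1 + y * b) * inverse (1 + y * (1 / b))) ^ r)"
      using pos by (simp add: ln_realpow ln_mult_pos ln_inverse algebra_simps)
    ultimately have "ln ((inverse (1 + y * b) * inverse (1 + y * (1 / b))) ^ r) \<le> 2 * ln E" by linarith
    also have "2 * ln E = ln (E\<^sup>2)" using E0 by (simp add: ln_realpow)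
    finally have 2: "(inverse (1 + y * b) * inverse (1 + y * (1 / b))) ^ r \<le> E\<^sup>2"
      using E0 pos by (subst (asm) ln_le_cancel_iff) auto
    show ?thesis using 1 2 p unfolding F(4,5) by (simp add: zeta_pair_upper_def zeta_pair_lower_def E_def)
  next
    case 2
    then show ?thesis by (simp add: euler_factor_def zeta_pair_upper_def zeta_pair_lower_def)
  qed
  then show "(cmod (euler_factor r \<alpha> s p))\<^sup>2 \<le> zeta_pair_upper (Re s) p ^ r"
    "(cmod (euler_factor r \<alpha> s p))\<^sup>2 \<ge> zeta_pair_lower (Re s) p ^ r" by auto
qed

lemma zeta_pair_pos:
  assumes "\<sigma> > \<theta>" shows "zeta_pair_lower \<sigma> p > 0" "zeta_pair_upper \<sigma> p > 0"
proof -
  show "zeta_pair_lower \<sigma> p > 0"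
    using prime_gt_0_nat[of p] by (auto simp: zeta_pair_lower_def intro!: mult_pos_pos add_pos_pos)
  show "zeta_pair_upper \<sigma> p > 0"
  proof (cases "prime p")
    case True
    note F = prime_powr_facts[OF True assms]
    have "real p > 1" using prime_gt_1_nat[OF True] by simp
    then have "real p powr (-(\<sigma> + \<theta>)) < real p powr 0" using assms theta_range by (intro powr_less_mono) auto
    then have "real p powr (-(\<sigma> + \<theta>)) < 1" using \<open>real p > 1\<close> by simp
    then show ?thesis using F(2) F(4) True by (simp add: zeta_pair_upper_def)
  qed (simp add: zeta_pair_upper_def)
qed

lemma zeta_pair_upper_lim:
  assumes "\<sigma> > 1 + \<theta>"
  shows "(\<lambda>n. \<Prod>p\<le>n. zeta_pair_upper \<sigma> p) \<longlonglongrightarrow> (Z_theta \<theta> \<sigma>)\<^sup>2"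
proof -
  have "(\<lambda>n. (\<Prod>p\<le>n. if prime p then inverse (1 - real p powr (-(\<sigma> - \<theta>))) else 1)
      * (\<Prod>p\<le>n. if prime p then inverse (1 - real p powr (-(\<sigma> + \<theta>))) else 1)) \<longlonglongrightarrow> zeta_real (\<sigma> - \<theta>) * zeta_real (\<sigma> + \<theta>)"
    using assms theta_range by (intro tendsto_mult zeta_euler_product) auto
  moreover have "(\<Prod>p\<le>n. if prime p then inverse (1 - real p powr (-(\<sigma> - \<theta>))) else 1)
      * (\<Prod>p\<le>n. if prime p then inverse (1 - real p powr (-(\<sigma> + \<theta>))) else 1) = (\<Prod>p\<le>n. zeta_pair_upper \<sigma> p)" for n
    unfolding prod.distrib[symmetric] zeta_pair_upper_def by (intro prod.cong) auto
  moreover have "(Z_theta \<theta> \<sigma>)\<^sup>2 = zeta_real (\<sigma> - \<theta>) * zeta_real (\<sigma> + \<theta>)"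
    using zeta_ge_1[of "\<sigma> - \<theta>"] zeta_ge_1[of "\<sigma> + \<theta>"] assms theta_range by (simp add: Z_theta_def mult.commute)
  ultimately show ?thesis by simp
qed

lemma zeta_pair_lower_lim:
  assumes "\<sigma> > 1 + \<theta>"
  shows "(\<lambda>n. \<Prod>p\<le>n. zeta_pair_lower \<sigma> p) \<longlonglongrightarrow> (z_theta \<theta> \<sigma>)\<^sup>2"
proof -
  define e where "e = (\<lambda>x n. \<Prod>p\<le>n. if prime p then inverse (1 - real p powr (-x)) else 1)"
  have e: "(\<lambda>n. e x n) \<longlonglongrightarrow> zeta_real x" if "x > 1" for x
    unfolding e_def by (rule zeta_euler_product[OF that])
  have z1: "zeta_real x \<ge> 1" if "x > 1" for x by (rule zeta_ge_1[OF that])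
  have x: "\<sigma> - \<theta> > 1" "\<sigma> + \<theta> > 1" "2 * \<sigma> - 2 * \<theta> > 1" "2 * \<sigma> + 2 * \<theta> > 1" using assms theta_range by auto
  have "(\<lambda>n. e (2 * \<sigma> + 2 * \<theta>) n * e (2 * \<sigma> - 2 * \<theta>) n / (e (\<sigma> + \<theta>) n * e (\<sigma> - \<theta>) n)) \<longlonglongrightarrow>
      zeta_real (2 * \<sigma> + 2 * \<theta>) * zeta_real (2 * \<sigma> - 2 * \<theta>) / (zeta_real (\<sigma> + \<theta>) * zeta_real (\<sigma> - \<theta>))"
    using z1[OF x(1)] z1[OF x(2)] by (intro tendsto_intros e x) auto
  moreover have "e (2 * x) n / e x n = (\<Prod>p\<le>n. if prime p then inverse (1 + real p powr (-x)) else 1)" if "x > 1" for x n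
  proof -
    have "e (2 * x) n / e x n = (\<Prod>p\<le>n. (if prime p then inverse (1 - real p powr (-(2*x))) else 1) / (if prime p then inverse (1 - real p powr (-x)) else 1))"
      by (simp add: e_def prod_dividef)
    also have "\<dots> = (\<Prod>p\<le>n. if prime p then inverse (1 + real p powr (-x)) else 1)"
    proof (intro prod.cong refl)
      fix p
      show "(if prime p then inverse (1 - real p powr (-(2*x))) else 1) / (if prime p then inverse (1 - real p powr (-x)) else 1)
          = (if prime p then inverse (1 + real p powr (-x)) else 1)"
      proof (cases "prime p")
        case True
        define u where "u = real p powr (-x)"
        have "real p > 1" using prime_gt_1_nat[OF True] by simp
        then have u: "u < 1" "u > 0"
          using powr_less_mono[of "-x" 0 "real p"] that by (simp_all add: u_def)
        have "real p powr (-(2*x)) = u\<^sup>2" using \<open>real p > 1\<close>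
          by (simp add: u_def power2_eq_square flip: powr_add)
        moreover have "1 - u\<^sup>2 = (1 - u) * (1 + u)" by (simp add: power2_eq_square algebra_simps)
        ultimately have e: "1 - real p powr (-(2*x)) = (1 - u) * (1 + u)" by simp
        have "inverse (a * b) / inverse a = inverse b" if "a \<noteq> 0" for a b :: real
          using that by (simp add: divide_inverse)
        from this[of "1 - u" "1 + u"] have "inverse ((1 - u) * (1 + u)) / inverse (1 - u) = inverse (1 + u)"
          using u(1) by linarith
        then show ?thesis using True unfolding e u_def[symmetric] by simp
      qed simp
    qed
    finally show ?thesis .
  qed
  note half = this
  have "e (2 * \<sigma> + 2 * \<theta>) n * e (2 * \<sigma> - 2 * \<theta>) n / (e (\<sigma> + \<theta>) n * e (\<sigma> - \<theta>) n) = (\<Prod>p\<le>n. zeta_pair_lower \<sigma> p)" for n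
  proof -
    have "e (2 * \<sigma> + 2 * \<theta>) n * e (2 * \<sigma> - 2 * \<theta>) n / (e (\<sigma> + \<theta>) n * e (\<sigma> - \<theta>) n)
       = (e (2 * (\<sigma> - \<theta>)) n / e (\<sigma> - \<theta>) n) * (e (2 * (\<sigma> + \<theta>)) n / e (\<sigma> + \<theta>) n)"
    proof -
      have "2 * \<sigma> + 2 * \<theta> = 2 * (\<sigma> + \<theta>)" "2 * \<sigma> - 2 * \<theta> = 2 * (\<sigma> - \<theta>)" by simp_all
      then show ?thesis by (simp only: times_divide_times_eq mult.commute)
    qed
    also have "\<dots> = (\<Prod>p\<le>n. zeta_pair_lower \<sigma> p)"
      unfolding half[OF x(1)] half[OF x(2)] prod.distrib[symmetric] zeta_pair_lower_def by (intro prod.cong) auto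
    finally show ?thesis .
  qed
  ultimately have "(\<lambda>n. \<Prod>p\<le>n. zeta_pair_lower \<sigma> p) \<longlonglongrightarrow>
      zeta_real (2 * \<sigma> + 2 * \<theta>) * zeta_real (2 * \<sigma> - 2 * \<theta>) / (zeta_real (\<sigma> + \<theta>) * zeta_real (\<sigma> - \<theta>))" by simp
  moreover have "(z_theta \<theta> \<sigma>)\<^sup>2 = zeta_real (2 * \<sigma> + 2 * \<theta>) * zeta_real (2 * \<sigma> - 2 * \<theta>) / (zeta_real (\<sigma> + \<theta>) * zeta_real (\<sigma> - \<theta>))"
    unfolding z_theta_def using z1[OF x(1)] z1[OF x(2)] z1[OF x(3)] z1[OF x(4)]
    by (intro real_sqrt_pow2 divide_nonneg_nonneg mult_nonneg_nonneg) auto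
  ultimately show ?thesis by simp
qed

lemma L_euler_lim:
  assumes "Re s > 1"
  shows "(\<lambda>n. \<Prod>p\<le>n. euler_factor r \<alpha> s p) \<longlonglongrightarrow> L s" "L s \<noteq> 0"
proof -
  have c: "convergent_prod (euler_factor r \<alpha> s)"
    using euler_convergent[OF assms] by (rule abs_convergent_prod_imp_convergent_prod)
  show "(\<lambda>n. \<Prod>p\<le>n. euler_factor r \<alpha> s p) \<longlonglongrightarrow> L s"
    using convergent_prod_LIMSEQ[OF c] euler_product[OF assms] by simp
  have "euler_factor r \<alpha> s p \<noteq> 0" for p
  proof (cases "prime p")
    case True
    have "Re s > \<theta>" using assms theta_range by simp
    then show ?thesis using ln_euler_factor(1)[OF True] by auto
  qed (simp add: euler_factor_def)
  then show "L s \<noteq> 0" using prodinf_nonzero[OF c] euler_product[OF assms] by simp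
qed

lemma z_theta_pos:
  assumes "\<sigma> > 1 + \<theta>"
  shows "z_theta \<theta> \<sigma> > 0" "Z_theta \<theta> \<sigma> \<ge> 1"
proof -
  have x: "\<sigma> - \<theta> > 1" "\<sigma> + \<theta> > 1" "2 * \<sigma> - 2 * \<theta> > 1" "2 * \<sigma> + 2 * \<theta> > 1" using assms theta_range by auto
  note z = x[THEN zeta_ge_1]
  have z0: "zeta_real (\<sigma> - \<theta>) > 0" "zeta_real (\<sigma> + \<theta>) > 0" "zeta_real (2 * \<sigma> - 2 * \<theta>) > 0" "zeta_real (2 * \<sigma> + 2 * \<theta>) > 0"
    using z by linarith+
  show "z_theta \<theta> \<sigma> > 0" using z0 by (simp add: z_theta_def)
  have "1 * 1 \<le> zeta_real (\<sigma> + \<theta>) * zeta_real (\<sigma> - \<theta>)" using z by (intro mult_mono) auto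
  then show "Z_theta \<theta> \<sigma> \<ge> 1" by (simp add: Z_theta_def)
qed

lemma ln_L_bounds:
  assumes \<sigma>: "Re s > 1 + \<theta>"
  shows "ln (cmod (L s)) \<le> real r * ln (Z_theta \<theta> (Re s))"
    "real r * ln (z_theta \<theta> (Re s)) \<le> ln (cmod (L s))"
proof -
  have s1: "Re s > 1" "Re s > \<theta>" using \<sigma> theta_range by auto
  have L0: "cmod (L s) > 0" using L_euler_lim(2)[OF s1(1)] by simp
  have limL: "(\<lambda>n. \<Prod>p\<le>n. (cmod (euler_factor r \<alpha> s p))\<^sup>2) \<longlonglongrightarrow> (cmod (L s))\<^sup>2"
    using tendsto_power[OF tendsto_norm[OF L_euler_lim(1)[OF s1(1)]], of 2] by (simp add: prod_power_distrib flip: prod_norm)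
  have U: "(cmod (L s))\<^sup>2 \<le> ((Z_theta \<theta> (Re s))\<^sup>2) ^ r"
  proof (rule LIMSEQ_le[OF limL tendsto_power[OF zeta_pair_upper_lim[OF \<sigma>]]])
    show "\<exists>N. \<forall>n\<ge>N. (\<Prod>p\<le>n. (cmod (euler_factor r \<alpha> s p))\<^sup>2) \<le> (\<Prod>p\<le>n. zeta_pair_upper (Re s) p) ^ r"
      unfolding prod_power_distrib by (intro exI allI impI prod_mono) (auto simp: euler_factor_bounds[OF s1(2)])
  qed
  have Lo: "((z_theta \<theta> (Re s))\<^sup>2) ^ r \<le> (cmod (L s))\<^sup>2"
  proof (rule LIMSEQ_le[OF tendsto_power[OF zeta_pair_lower_lim[OF \<sigma>]] limL])
    show "\<exists>N. \<forall>n\<ge>N. (\<Prod>p\<le>n. zeta_pair_lower (Re s) p) ^ r \<le> (\<Prod>p\<le>n. (cmod (euler_factor r \<alpha> s p))\<^sup>2)"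
      unfolding prod_power_distrib using zeta_pair_pos(1)[OF s1(2)]
      by (intro exI allI impI prod_mono) (auto simp: euler_factor_bounds[OF s1(2)] less_imp_le)
  qed
  have Zp: "Z_theta \<theta> (Re s) > 0" "z_theta \<theta> (Re s) > 0" using z_theta_pos[OF \<sigma>] by auto
  have "ln ((cmod (L s))\<^sup>2) \<le> ln (((Z_theta \<theta> (Re s))\<^sup>2) ^ r)" using U L0 by (intro ln_mono) auto
  then show "ln (cmod (L s)) \<le> real r * ln (Z_theta \<theta> (Re s))" using L0 Zp by (simp add: ln_realpow)
  have "ln (((z_theta \<theta> (Re s))\<^sup>2) ^ r) \<le> ln ((cmod (L s))\<^sup>2)" using Lo L0 Zp by (intro ln_mono) auto
  then show "real r * ln (z_theta \<theta> (Re s)) \<le> ln (cmod (L s))" using L0 Zp by (simp add: ln_realpow)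
qed

text \<open>Monotonicity in \<sigma> survives the passage to the infinite product, so the later
  bound on L'/L needs no termwise differentiation of that product. For one prime it is a sign of a
  derivative, settled by \<open>Re_logistic_lower\<close> and \<open>pair_logistic\<close>.\<close>

lemma euler_factor_ratio_mono:
  assumes "\<theta> < \<sigma>1" "\<sigma>1 \<le> \<sigma>2"
  shows "zeta_pair_lower \<sigma>1 p ^ r / (cmod (euler_factor r \<alpha> (Complex \<sigma>1 t) p))\<^sup>2
     \<le> zeta_pair_lower \<sigma>2 p ^ r / (cmod (euler_factor r \<alpha> (Complex \<sigma>2 t) p))\<^sup>2"
proof (cases "prime p")
  case False
  then show ?thesis by (simp add: zeta_pair_lower_def euler_factor_def)
next
  case True
  note p = True
  have p1: "real p > 1" using prime_gt_1_nat[OF p] by simp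
  \<comment> \<open>The logarithm of the ratio, extended as an explicit function of
    \<sigma>.\<close>
  define D where "D = (\<lambda>\<sigma>. real r * (- ln (1 + real p powr (-(\<sigma> - \<theta>))) - ln (1 + real p powr (-(\<sigma> + \<theta>))))
      + 2 * (\<Sum>j=1..r. ln (cmod (1 - \<alpha> p j * of_nat p powr (- Complex \<sigma> t)))))"
  have Deq: "zeta_pair_lower \<sigma> p ^ r / (cmod (euler_factor r \<alpha> (Complex \<sigma> t) p))\<^sup>2 = exp (D \<sigma>)" if "\<sigma> > \<theta>" for \<sigma>
  proof -
    have E: "cmod (euler_factor r \<alpha> (Complex \<sigma> t) p) > 0"
        "ln (cmod (euler_factor r \<alpha> (Complex \<sigma> t) p)) = - (\<Sum>j=1..r. ln (cmod (1 - \<alpha> p j * of_nat p powr (- Complex \<sigma> t))))"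
      using ln_euler_factor[OF p, of "Complex \<sigma> t"] that by auto
    have pos: "1 + real p powr (-(\<sigma> - \<theta>)) > 0" "1 + real p powr (-(\<sigma> + \<theta>)) > 0" by (auto intro!: add_pos_nonneg)
    have "D \<sigma> = real r * ln (zeta_pair_lower \<sigma> p) - 2 * ln (cmod (euler_factor r \<alpha> (Complex \<sigma> t) p))"
      using pos p unfolding D_def E(2) zeta_pair_lower_def by (simp add: ln_mult_pos ln_inverse)
    then show ?thesis using E(1) zeta_pair_pos(1)[OF that, of p]
      by (simp add: exp_diff exp_of_nat_mult exp_double flip: exp_of_nat_mult[of 2, simplified])
  qed
  have "D \<sigma>1 \<le> D \<sigma>2"
  proof (rule DERIV_nonneg_imp_nondecreasing[of \<sigma>1 \<sigma>2 D])
    fix \<sigma> assume "\<sigma>1 \<le> \<sigma>" "\<sigma> \<le> \<sigma>2"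
    then have \<sigma>: "\<sigma> > \<theta>" using assms by simp
    define y where "y = real p powr (-\<sigma>)"
    define b where "b = real p powr \<theta>"
    note F = prime_powr_facts[OF p \<sigma>, folded y_def b_def]
    define u where "u = (\<lambda>j. \<alpha> p j * of_nat p powr (- Complex \<sigma> t))"
    have d1: "((\<lambda>\<sigma>. ln (1 + real p powr (-(\<sigma> + c)))) has_real_derivative
        - ln (real p) * (real p powr (-(\<sigma> + c)) / (1 + real p powr (-(\<sigma> + c))))) (at \<sigma>)" for c
    proof -
      have "((\<lambda>\<sigma>. 1 + real p powr (-(\<sigma> + c))) has_real_derivative real p powr (-(\<sigma> + c)) * (- ln (real p))) (at \<sigma>)"
        using p1 by (auto intro!: derivative_eq_intros)
      moreover have "1 + real p powr (-(\<sigma> + c)) > 0" by (auto intro!: add_pos_nonneg)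
      ultimately show ?thesis using DERIV_chain2[OF DERIV_ln_divide] by (force simp: mult_ac)
    qed
    have d2: "((\<lambda>\<sigma>. ln (cmod (1 - \<alpha> p j * of_nat p powr (- Complex \<sigma> t)))) has_real_derivative
        ln (real p) * Re (u j / (1 - u j))) (at \<sigma>)" if j: "j \<in> {1..r}" for j
    proof -
      define c :: complex where "c = of_real (ln (real p))"
      define f where "f = (\<lambda>s. 1 - \<alpha> p j * exp (- s * c))"
      have lnp: "Ln (of_nat p) = c" using Ln_of_real[of "real p"] p1 by (simp add: c_def)
      have pw: "of_nat p powr (- s) = exp (- s * c)" for s using p1 by (simp add: powr_def lnp)
      have fp: "f s = 1 - \<alpha> p j * of_nat p powr (- s)" for s by (simp add: f_def pw)
      have "(f has_field_derivative c * (\<alpha> p j * exp (- Complex \<sigma> t * c))) (at (Complex \<sigma> t))"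
        unfolding f_def by (auto intro!: derivative_eq_intros)
      then have fd: "(f has_field_derivative of_real (ln (real p)) * u j) (at (Complex \<sigma> t))"
        by (simp only: u_def pw c_def)
      have nz: "f (Complex \<sigma> t) \<noteq> 0"
        using alpha_term_lt_1(2)[OF p _ j, of "Complex \<sigma> t"] \<sigma> by (auto simp: fp)
      have "((\<lambda>\<sigma>. ln (cmod (f (Complex \<sigma> t)))) has_real_derivative Re (deriv f (Complex \<sigma> t) / f (Complex \<sigma> t))) (at \<sigma>)"
        using fd nz by (intro ln_cmod_deriv) (auto simp: field_differentiable_def)
      moreover have "deriv f (Complex \<sigma> t) / f (Complex \<sigma> t) = of_real (ln (real p)) * (u j / (1 - u j))"
        using DERIV_imp_deriv[OF fd] by (simp add: fp u_def)
      moreover have "Re (of_real a * z) = a * Re z" for a z by simp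
      ultimately show ?thesis by (simp only: fp)
    qed
    define D' where "D' = real r * (- (- ln (real p) * (y * b / (1 + y * b))) - (- ln (real p) * (y * (1/b) / (1 + y * (1/b)))))
       + 2 * (\<Sum>j=1..r. ln (real p) * Re (u j / (1 - u j)))"
    have "(D has_real_derivative D') (at \<sigma>)"
    proof -
      have d1a: "((\<lambda>\<sigma>. ln (1 + real p powr (-(\<sigma> - \<theta>)))) has_real_derivative
          - ln (real p) * (real p powr (-(\<sigma> - \<theta>)) / (1 + real p powr (-(\<sigma> - \<theta>))))) (at \<sigma>)"
        using d1[of "-\<theta>"] by (simp only: diff_conv_add_uminus)
      have "((\<lambda>\<sigma>. \<Sum>j=1..r. ln (cmod (1 - \<alpha> p j * of_nat p powr (- Complex \<sigma> t)))) has_real_derivative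
          (\<Sum>j=1..r. ln (real p) * Re (u j / (1 - u j)))) (at \<sigma>)"
        by (intro DERIV_sum d2) simp
      from DERIV_add[OF DERIV_cmult[OF DERIV_diff[OF DERIV_minus[OF d1a] d1[of \<theta>]], of "real r"] DERIV_cmult[OF this, of 2]]
      show ?thesis unfolding D_def D'_def F(4,5) .
    qed
    moreover have "D' \<ge> 0"
    proof -
      have "Re (u j / (1 - u j)) \<ge> - (y * cmod (\<alpha> p j) / (1 + y * cmod (\<alpha> p j)))" if j: "j \<in> {1..r}" for j
        using Re_logistic_lower[of "u j"] alpha_term_lt_1[OF p _ j, of "Complex \<sigma> t"] \<sigma>
        by (simp add: u_def y_def)
      then have "(\<Sum>j=1..r. Re (u j / (1 - u j))) \<ge> (\<Sum>j=1..r. - (y * cmod (\<alpha> p j) / (1 + y * cmod (\<alpha> p j))))"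
        by (intro sum_mono) auto
      moreover have "2 * (\<Sum>j=1..r. y * cmod (\<alpha> p j) / (1 + y * cmod (\<alpha> p j)))
          \<le> real r * (y * b / (1 + y * b) + y * (1/b) / (1 + y * (1/b)))"
        by (rule prime_pair_sum[OF p, where f = "\<lambda>q. y * q / (1 + y * q)"])
           (use pair_logistic[OF F(1-3)] in \<open>simp_all only: b_def\<close>)
      ultimately have "0 \<le> real r * (y * b / (1 + y * b) + y * (1/b) / (1 + y * (1/b))) + 2 * (\<Sum>j=1..r. Re (u j / (1 - u j)))"
        by (simp add: sum_negf)
      then have "0 \<le> ln (real p) * (real r * (y * b / (1 + y * b) + y * (1/b) / (1 + y * (1/b))) + 2 * (\<Sum>j=1..r. Re (u j / (1 - u j))))"
        using p1 by (intro mult_nonneg_nonneg) auto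
      also have "\<dots> = D'"
        unfolding D'_def sum_distrib_left[symmetric] by (simp only: distrib_left mult_ac minus_mult_left[symmetric] minus_minus diff_minus_eq_add)
      finally show ?thesis .
    qed
    ultimately show "\<exists>y. (D has_real_derivative y) (at \<sigma>) \<and> 0 \<le> y" by blast
  qed (use assms in auto)
  then show ?thesis using Deq[of \<sigma>1] Deq[of \<sigma>2] assms by simp
qed

lemma ln_ratio_mono:
  assumes "1 + \<theta> < \<sigma>1" "\<sigma>1 \<le> \<sigma>2"
  shows "real r * ln (z_theta \<theta> \<sigma>1) - ln (cmod (L (Complex \<sigma>1 t))) \<le> real r * ln (z_theta \<theta> \<sigma>2) - ln (cmod (L (Complex \<sigma>2 t)))"
proof -
  have lim: "(\<lambda>n. \<Prod>p\<le>n. zeta_pair_lower \<sigma> p ^ r / (cmod (euler_factor r \<alpha> (Complex \<sigma> t) p))\<^sup>2) \<longlonglongrightarrow>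
      ((z_theta \<theta> \<sigma>)\<^sup>2) ^ r / (cmod (L (Complex \<sigma> t)))\<^sup>2" if "\<sigma> > 1 + \<theta>" for \<sigma>
  proof -
    have s1: "Re (Complex \<sigma> t) > 1" using that theta_range by simp
    have "(\<lambda>n. (\<Prod>p\<le>n. zeta_pair_lower \<sigma> p) ^ r / (cmod (\<Prod>p\<le>n. euler_factor r \<alpha> (Complex \<sigma> t) p))\<^sup>2) \<longlonglongrightarrow>
      ((z_theta \<theta> \<sigma>)\<^sup>2) ^ r / (cmod (L (Complex \<sigma> t)))\<^sup>2"
      using L_euler_lim[OF s1] by (intro tendsto_intros zeta_pair_lower_lim that) auto
    then show ?thesis by (simp add: prod_power_distrib prod_dividef flip: prod_norm)
  qed
  have g: "\<sigma>1 > \<theta>" "\<sigma>2 > 1 + \<theta>" using assms by auto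
  have le: "((z_theta \<theta> \<sigma>1)\<^sup>2) ^ r / (cmod (L (Complex \<sigma>1 t)))\<^sup>2 \<le> ((z_theta \<theta> \<sigma>2)\<^sup>2) ^ r / (cmod (L (Complex \<sigma>2 t)))\<^sup>2"
  proof (rule LIMSEQ_le[OF lim[OF assms(1)] lim[OF g(2)]])
    show "\<exists>N. \<forall>n\<ge>N. (\<Prod>p\<le>n. zeta_pair_lower \<sigma>1 p ^ r / (cmod (euler_factor r \<alpha> (Complex \<sigma>1 t) p))\<^sup>2)
       \<le> (\<Prod>p\<le>n. zeta_pair_lower \<sigma>2 p ^ r / (cmod (euler_factor r \<alpha> (Complex \<sigma>2 t) p))\<^sup>2)"
      using zeta_pair_pos(1)[OF g(1)] euler_factor_ratio_mono[OF g(1) assms(2)]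
      by (intro exI allI impI prod_mono conjI) (auto intro!: divide_nonneg_nonneg simp: less_imp_le)
  qed
  have pos: "z_theta \<theta> \<sigma> > 0" "cmod (L (Complex \<sigma> t)) > 0" if "\<sigma> > 1 + \<theta>" for \<sigma>
    using z_theta_pos(1)[OF that] L_euler_lim(2)[of "Complex \<sigma> t"] that theta_range by auto
  have eq: "ln (((z_theta \<theta> \<sigma>)\<^sup>2) ^ r / (cmod (L (Complex \<sigma> t)))\<^sup>2) = 2 * (real r * ln (z_theta \<theta> \<sigma>) - ln (cmod (L (Complex \<sigma> t))))"
    if "\<sigma> > 1 + \<theta>" for \<sigma>
    using pos[OF that] by (simp add: ln_div ln_realpow right_diff_distrib)
  have "ln (((z_theta \<theta> \<sigma>1)\<^sup>2) ^ r / (cmod (L (Complex \<sigma>1 t)))\<^sup>2) \<le> ln (((z_theta \<theta> \<sigma>2)\<^sup>2) ^ r / (cmod (L (Complex \<sigma>2 t)))\<^sup>2)"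
    using le pos[OF assms(1)] by (intro ln_mono) auto
  then show ?thesis using eq[OF assms(1)] eq[OF g(2)] by simp
qed

end

section \<open>The completed function\<close>

lemma exp_growth_mono:
  assumes "exp_growth f a" "a \<le> a'"
  shows "exp_growth f a'"
proof -
  obtain C where C: "C \<ge> 0" "\<And>z. cmod (f z) \<le> exp (C * (1 + cmod z) powr a)"
    using assms(1) by (auto simp: exp_growth_def)
  have "cmod (f z) \<le> exp (C * (1 + cmod z) powr a')" for z
  proof -
    have "(1 + cmod z) powr a \<le> (1 + cmod z) powr a'" using assms(2) by (intro powr_mono) auto
    then show ?thesis using C(2)[of z] C(1) by (meson exp_le_cancel_iff mult_left_mono order_trans)
  qed
  then show ?thesis using C(1) unfolding exp_growth_def by blast
qed

lemma exp_growth_mult: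
  assumes "exp_growth f a" "exp_growth g a"
  shows "exp_growth (\<lambda>z. f z * g z) a"
proof -
  obtain C where C: "C \<ge> 0" "\<And>z. cmod (f z) \<le> exp (C * (1 + cmod z) powr a)"
    using assms(1) by (auto simp: exp_growth_def)
  obtain D where D: "D \<ge> 0" "\<And>z. cmod (g z) \<le> exp (D * (1 + cmod z) powr a)"
    using assms(2) by (auto simp: exp_growth_def)
  have "cmod (f z * g z) \<le> exp ((C + D) * (1 + cmod z) powr a)" for z
    using mult_mono[OF C(2)[of z] D(2)[of z]] by (simp add: norm_mult distrib_right exp_add)
  then show ?thesis using C(1) D(1) unfolding exp_growth_def by (intro exI[of _ "C + D"]) auto
qed

lemma exp_growth_linear: "a \<ge> 1 \<Longrightarrow> exp_growth (\<lambda>z. z - c) a"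
proof -
  assume a: "a \<ge> 1"
  have "cmod (z - c) \<le> exp ((1 + cmod c) * (1 + cmod z) powr a)" for z
  proof -
    have "(1 + cmod z) powr 1 \<le> (1 + cmod z) powr a" using a by (intro powr_mono) auto
    then have p: "1 + cmod z \<le> (1 + cmod z) powr a" by (simp add: powr_one)
    have "cmod (z - c) \<le> cmod z + cmod c" by (rule norm_triangle_ineq4)
    also have "\<dots> \<le> (1 + cmod c) * (1 + cmod z)" by (simp add: algebra_simps)
    also have "\<dots> \<le> (1 + cmod c) * (1 + cmod z) powr a" using p by (intro mult_left_mono) auto
    also have "\<dots> \<le> exp ((1 + cmod c) * (1 + cmod z) powr a)"
      using exp_ge_add_one_self[of "(1 + cmod c) * (1 + cmod z) powr a"] by linarith
    finally show ?thesis .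
  qed
  then show ?thesis unfolding exp_growth_def by (intro exI[of _ "1 + cmod c"]) auto
qed

lemma exp_growth_1: "exp_growth (\<lambda>_. 1) a"
  unfolding exp_growth_def by (intro exI[of _ 0]) auto

lemma exp_growth_prod:
  assumes "\<And>k. k \<in> A \<Longrightarrow> exp_growth (f k) a"
  shows "exp_growth (\<lambda>z. \<Prod>k\<in>A. f k z) a"
  using assms
proof (induction A rule: infinite_finite_induct)
  case (insert k A)
  then show ?case using exp_growth_mult[of "f k" a "\<lambda>z. \<Prod>k\<in>A. f k z"] by simp
qed (auto simp: exp_growth_1)

text \<open>The order is an infimum, which need not be attained; 3/2 serves as an exponent strictly
  between 1 and the limit 2 of the local factorization.\<close>

lemma exp_growth_of_order:
  assumes f: "f holomorphic_on UNIV" and ord: "entire_order f = 1"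
  shows "exp_growth f (3/2)"
proof -
  have "entire_order f < ereal (3/2)" by (simp add: ord)
  then obtain a where a: "0 < a" "a < 3/2" "(\<lambda>z. norm (f z)) \<in> O[at_infinity](\<lambda>z. exp (norm z powr a))"
    unfolding entire_order_def INF_less_iff by auto
  obtain K where K: "K > 0" "\<forall>\<^sub>F z in at_infinity. norm (norm (f z)) \<le> K * norm (exp (norm z powr a))"
    using landau_o.bigE[OF a(3)] by blast
  then obtain B where B: "\<And>z. B \<le> norm z \<Longrightarrow> cmod (f z) \<le> K * exp (norm z powr a)"
    by (auto simp: eventually_at_infinity)
  have "compact (f ` cball 0 \<bar>B\<bar>)"
    using f by (intro compact_continuous_image) (auto intro: holomorphic_on_imp_continuous_on holomorphic_on_subset)
  then obtain M where M: "\<And>w. w \<in> f ` cball 0 \<bar>B\<bar> \<Longrightarrow> cmod w \<le> M"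
    using compact_imp_bounded bounded_iff by metis
  define C where "C = 1 + \<bar>K\<bar> + \<bar>M\<bar>"
  have "cmod (f z) \<le> exp (C * (1 + cmod z) powr (3/2))" for z
  proof -
    have p1: "1 \<le> (1 + cmod z) powr (3/2)" by (simp add: ge_one_powr_ge_zero)
    have exp_le: "x \<le> exp x" for x :: real using exp_ge_add_one_self[of x] by linarith
    have mul: "c \<le> c * (1 + cmod z) powr (3/2)" if "c \<ge> 0" for c
      using mult_left_mono[OF p1 that] by simp
    show ?thesis
    proof (cases "B \<le> cmod z")
      case True
      have "cmod z powr a \<le> (1 + cmod z) powr a" using a by (intro powr_mono2) auto
      also have "\<dots> \<le> (1 + cmod z) powr (3/2)" using a by (intro powr_mono) auto
      finally have 1: "cmod z powr a \<le> (1 + cmod z) powr (3/2)" .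
      have "cmod (f z) \<le> exp K * exp (cmod z powr a)"
        using B[OF True] exp_le[of K] by (meson exp_ge_zero mult_right_mono order_trans)
      also have "\<dots> = exp (K + cmod z powr a)" by (simp add: exp_add)
      also have "K + cmod z powr a \<le> \<bar>K\<bar> * (1 + cmod z) powr (3/2) + 1 * (1 + cmod z) powr (3/2) + \<bar>M\<bar> * (1 + cmod z) powr (3/2)"
        using mul[of "\<bar>K\<bar>"] mul[of "\<bar>M\<bar>"] 1 by linarith
      also have "\<dots> = C * (1 + cmod z) powr (3/2)" by (simp add: C_def algebra_simps)
      finally show ?thesis by simp
    next
      case False
      then have "cmod (f z) \<le> \<bar>M\<bar>" using M[of "f z"] by fastforce
      also have "\<dots> \<le> exp (\<bar>M\<bar>)" by (rule exp_le)
      also have "\<bar>M\<bar> \<le> C * (1 + cmod z) powr (3/2)"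
        using mul[of C] by (simp add: C_def)
      finally show ?thesis by simp
    qed
  qed
  moreover have "C \<ge> 0" by (simp add: C_def)
  ultimately show ?thesis unfolding exp_growth_def by blast
qed

lemma exp_growth_rGamma: "exp_growth rGamma 2"
proof -
  have "cmod (rGamma z) \<le> exp (1 * (1 + cmod z) powr 2)" for z
  proof -
    have "(1 + cmod z) powr 2 = (1 + cmod z)\<^sup>2" by (subst powr_numeral) auto
    then have "2 * cmod z + (cmod z)\<^sup>2 \<le> 1 * (1 + cmod z) powr 2" by (simp add: power2_sum)
    then show ?thesis using rGamma_bound[of z] by (meson exp_le_cancel_iff order_trans)
  qed
  then show ?thesis unfolding exp_growth_def by (intro exI[of _ 1]) auto
qed

lemma exp_growth_affine:
  assumes "exp_growth f a" "a \<ge> 0"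
  shows "exp_growth (\<lambda>z. f ((z + c) / 2)) a"
proof -
  obtain C where C: "C \<ge> 0" "\<And>z. cmod (f z) \<le> exp (C * (1 + cmod z) powr a)"
    using assms(1) by (auto simp: exp_growth_def)
  have "cmod (f ((z + c) / 2)) \<le> exp (C * (1 + cmod c) powr a * (1 + cmod z) powr a)" for z
  proof -
    have "cmod ((z + c) / 2) \<le> cmod z + cmod c"
    proof -
      have "cmod ((z + c) / 2) = cmod (z + c) / 2" by (simp add: norm_divide)
      then show ?thesis using norm_triangle_ineq[of z c] norm_ge_zero[of "z + c"] by linarith
    qed
    then have "1 + cmod ((z + c) / 2) \<le> 1 + cmod z + cmod c" by simp
    also have "\<dots> \<le> (1 + cmod c) * (1 + cmod z)" by (simp add: algebra_simps)
    finally have "1 + cmod ((z + c) / 2) \<le> (1 + cmod c) * (1 + cmod z)" .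
    then have "(1 + cmod ((z + c) / 2)) powr a \<le> ((1 + cmod c) * (1 + cmod z)) powr a"
      using assms(2) by (intro powr_mono2) auto
    also have "\<dots> = (1 + cmod c) powr a * (1 + cmod z) powr a" by (simp add: powr_mult)
    finally have "C * (1 + cmod ((z + c) / 2)) powr a \<le> C * ((1 + cmod c) powr a * (1 + cmod z) powr a)"
      using C(1) by (rule mult_left_mono)
    then show ?thesis using C(2)[of "(z + c) / 2"] by (smt (verit) exp_le_cancel_iff mult.assoc)
  qed
  then show ?thesis using C(1) unfolding exp_growth_def by (intro exI[of _ "C * (1 + cmod c) powr a"]) auto
qed

lemma exp_growth_exp_linear:
  assumes "a \<ge> 1"
  shows "exp_growth (\<lambda>z. exp (b * z + d)) a"
proof -
  have "cmod (exp (b * z + d)) \<le> exp ((cmod b + cmod d) * (1 + cmod z) powr a)" for z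
  proof -
    have "(1 + cmod z) powr 1 \<le> (1 + cmod z) powr a" using assms by (intro powr_mono) auto
    then have p: "1 + cmod z \<le> (1 + cmod z) powr a" by (simp add: powr_one)
    have "Re (b * z + d) \<le> cmod (b * z + d)" by (rule complex_Re_le_cmod)
    also have "\<dots> \<le> cmod b * cmod z + cmod d" using norm_triangle_ineq[of "b * z" d] by (simp add: norm_mult)
    also have "\<dots> \<le> (cmod b + cmod d) * (1 + cmod z)" by (simp add: algebra_simps)
    also have "\<dots> \<le> (cmod b + cmod d) * (1 + cmod z) powr a" using p by (intro mult_left_mono) auto
    finally show ?thesis by simp
  qed
  then show ?thesis unfolding exp_growth_def by (intro exI[of _ "cmod b + cmod d"]) auto
qed

section \<open>Removal of the poles, the entire function \<open>Xi\<close> and its growth\<close>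

context L_function
begin

lemma pole_L:
  assumes "is_pole L z"
  shows "zorder L z < 0" "card {k\<in>{1..m}. 1 + lam k = z} > 0" "Re z = 1"
proof -
  have "isolated_singularity_at L z"
    using L_meromorphic unfolding nicely_meromorphic_on_def
    by (meson UNIV_I meromorphic_on_isolated_singularity meromorphic_on_subset subset_UNIV meromorphic_at_iff)
  then show z: "zorder L z < 0" using assms isolated_pole_imp_neg_zorder by blast
  then show c: "card {k\<in>{1..m}. 1 + lam k = z} > 0" using L_poles[of z] assms by simp
  then have "{k\<in>{1..m}. 1 + lam k = z} \<noteq> {}" by (metis card.empty less_irrefl)
  then obtain k where "k \<in> {1..m}" "1 + lam k = z" by blast
  then show "Re z = 1" using lambda_imaginary[of k] by auto
qed

lemma pole_L_iff: "is_pole L z \<longleftrightarrow> (\<exists>k\<in>{1..m}. z = 1 + lam k)"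
proof
  assume "is_pole L z"
  from pole_L(2)[OF this] have "{k\<in>{1..m}. 1 + lam k = z} \<noteq> {}" by (metis card.empty less_irrefl)
  then show "\<exists>k\<in>{1..m}. z = 1 + lam k" by blast
next
  assume "\<exists>k\<in>{1..m}. z = 1 + lam k"
  then have "{k\<in>{1..m}. 1 + lam k = z} \<noteq> {}" by blast
  then have "card {k\<in>{1..m}. 1 + lam k = z} > 0" by (simp add: card_gt_0_iff)
  then show "is_pole L z" using L_poles[of z] by (metis gr_implies_not0 of_nat_eq_0_iff)
qed

lemma L_analytic: "\<not> is_pole L z \<Longrightarrow> L analytic_on {z}"
  using nicely_meromorphic_on_imp_analytic_at[OF L_meromorphic] by blast

definition Ppoly :: "complex \<Rightarrow> complex" where
  "Ppoly s = (\<Prod>k=1..m. s - lam k)"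

lemma Ppoly_holo [holomorphic_intros]: "f holomorphic_on A \<Longrightarrow> (\<lambda>s. Ppoly (f s)) holomorphic_on A"
  unfolding Ppoly_def by (intro holomorphic_intros)

lemma Ppoly_nz: "Re s \<noteq> 0 \<Longrightarrow> Ppoly s \<noteq> 0"
  using lambda_imaginary by (auto simp: Ppoly_def)

lemma Ppoly_factor: "Ppoly s = (s - z) ^ card {k\<in>{1..m}. lam k = z} * (\<Prod>k\<in>{k\<in>{1..m}. lam k \<noteq> z}. s - lam k)"
proof -
  have "Ppoly s = (\<Prod>k\<in>{k\<in>{1..m}. lam k = z}. s - lam k) * (\<Prod>k\<in>{k\<in>{1..m}. lam k \<noteq> z}. s - lam k)"
    unfolding Ppoly_def by (subst prod.union_disjoint[symmetric]) (auto intro!: prod.cong)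
  also have "(\<Prod>k\<in>{k\<in>{1..m}. lam k = z}. s - lam k) = (s - z) ^ card {k\<in>{1..m}. lam k = z}"
    by (subst prod_constant[symmetric]) (auto intro!: prod.cong)
  finally show ?thesis .
qed

text \<open>L with its poles cancelled. A nicely meromorphic function is 0 at its poles, so the
  pointwise product would be 0 there instead of the limit; \<open>remove_sings\<close> repairs
  this.\<close>

definition Lhat :: "complex \<Rightarrow> complex" where
  "Lhat = remove_sings (\<lambda>s. Ppoly (s - 1) * L s)"

text \<open>By \<open>L_poles\<close> the order of the pole is exactly the multiplicity of the zero
  of P(s - 1), so the product is regular and does not vanish. The nonvanishing is what later locates
  the poles of the gamma factor.\<close>

lemma Lhat_pole:
  assumes p: "is_pole L z"
  shows "Lhat analytic_on {z}" "Lhat z \<noteq> 0"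
proof -
  have iso: "isolated_singularity_at L z"
    using L_meromorphic unfolding nicely_meromorphic_on_def
    by (meson UNIV_I meromorphic_on_isolated_singularity meromorphic_on_subset subset_UNIV meromorphic_at_iff)
  then obtain \<rho> where \<rho>: "\<rho> > 0" "L analytic_on ball z \<rho> - {z}"
    unfolding isolated_singularity_at_def by blast
  then have "L holomorphic_on ball z \<rho> - {z}" using analytic_imp_holomorphic by blast
  from zorder_exist_pole[OF this open_ball _ p] \<rho>(1)
  obtain g \<rho>' where g: "g = zor_poly L z" "g z \<noteq> 0" "\<rho>' > 0" "g holomorphic_on cball z \<rho>'" "cball z \<rho>' \<subseteq> ball z \<rho>"
    "\<And>w. w \<in> cball z \<rho>' - {z} \<Longrightarrow> L w = g w / (w - z) ^ nat (- zorder L z)"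
    by auto
  define e where "e = card {k\<in>{1..m}. lam k = z - 1}"
  have ek: "{k\<in>{1..m}. 1 + lam k = z} = {k\<in>{1..m}. lam k = z - 1}" by (auto simp: algebra_simps)
  have e: "nat (- zorder L z) = e" using L_poles[of z] p unfolding ek e_def by simp
  define h where "h = (\<lambda>w. \<Prod>k\<in>{k\<in>{1..m}. lam k \<noteq> z - 1}. w - 1 - lam k)"
  have hz: "h z \<noteq> 0" by (auto simp: h_def algebra_simps)
  have Pf: "Ppoly (w - 1) = (w - z) ^ e * h w" for w
    using Ppoly_factor[of "w - 1" "z - 1"] by (simp add: e_def h_def)
  have eq: "Ppoly (w - 1) * L w = h w * g w" if "w \<in> cball z \<rho>' - {z}" for w
    using g(6)[OF that] that by (simp add: Pf e)
  have "continuous_on (cball z \<rho>') (\<lambda>w. h w * g w)"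
    unfolding h_def using g(4) by (intro continuous_intros holomorphic_on_imp_continuous_on)
  then have "isCont (\<lambda>w. h w * g w) z"
    using g(3) by (intro continuous_on_interior) auto
  then have "((\<lambda>w. h w * g w) \<longlongrightarrow> h z * g z) (at z)" by (simp add: isCont_def)
  then have lim: "((\<lambda>w. Ppoly (w - 1) * L w) \<longlongrightarrow> h z * g z) (at z)"
    by (rule Lim_transform_within[OF _ g(3)]) (auto simp: eq dist_commute)
  have "isolated_singularity_at (\<lambda>w. Ppoly (w - 1) * L w) z"
    unfolding isolated_singularity_at_def
  proof (intro exI conjI)
    show "(\<lambda>w. Ppoly (w - 1) * L w) analytic_on ball z \<rho> - {z}"
      unfolding Ppoly_def by (intro analytic_intros \<rho>(2))
  qed (rule \<rho>(1))
  then show "Lhat analytic_on {z}" unfolding Lhat_def using lim by (rule remove_sings_analytic_at)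
  have "Lhat z = h z * g z" unfolding Lhat_def using lim by (rule remove_sings_eqI)
  then show "Lhat z \<noteq> 0" using hz g(2) by simp
qed

lemma Lhat_eq:
  assumes "\<not> is_pole L z"
  shows "Lhat analytic_on {z}" "Lhat z = Ppoly (z - 1) * L z"
proof -
  have a: "(\<lambda>s. Ppoly (s - 1) * L s) analytic_on {z}"
    unfolding Ppoly_def by (intro analytic_intros L_analytic assms)
  then show "Lhat z = Ppoly (z - 1) * L z" unfolding Lhat_def by simp
  show "Lhat analytic_on {z}"
    unfolding Lhat_def using a analytic_at_cong[OF eventually_remove_sings_eq_nhds[OF a] refl] by blast
qed

lemma Lhat_holo: "Lhat holomorphic_on A"
proof -
  have "Lhat analytic_on UNIV"
    using Lhat_pole(1) Lhat_eq(1) analytic_on_analytic_at by blast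
  then show ?thesis using analytic_imp_holomorphic holomorphic_on_subset by blast
qed

abbreviation "gam \<equiv> gamma_factor r \<epsilon> N \<mu>"
abbreviation "Lam \<equiv> completed_L r \<epsilon> N \<mu> L"

lemma mu_pos: "j \<in> {1..r} \<Longrightarrow> Re s > \<theta> \<Longrightarrow> Re (s + \<mu> j) > 0"
  using mu_bound[of j] by simp

lemma gam_nz: "Re s > \<theta> \<Longrightarrow> gam s \<noteq> 0"
  unfolding gamma_factor_def using Gamma_R_deriv(1)[OF mu_pos] epsilon_norm conductor_pos
  by (auto simp: )

lemma gam_holo: "gam holomorphic_on {s. Re s > \<theta>}"
proof -
  have "(\<lambda>s. Gamma_R (s + \<mu> j)) holomorphic_on {s. Re s > \<theta>}" if j: "j \<in> {1..r}" for j
  proof (rule holomorphic_on_compose_gen[of "\<lambda>s. s + \<mu> j" _ Gamma_R "{s. Re s > 0}", unfolded o_def])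
    show "Gamma_R holomorphic_on {s. Re s > 0}"
      unfolding holomorphic_on_def field_differentiable_def
      using Gamma_R_deriv(2) has_field_derivative_at_within by blast
  qed (use mu_pos[OF j] in \<open>auto intro!: holomorphic_intros\<close>)
  then show ?thesis
    unfolding gamma_factor_def using conductor_pos by (intro holomorphic_intros) auto
qed

text \<open>The reciprocal of the gamma factor, built from \<open>rGamma\<close> so as to be entire.
  Inverting \<open>gam\<close> pointwise would give wrong values where \<open>Gamma\<close> has
  poles.\<close>

definition rgam :: "complex \<Rightarrow> complex" where
  "rgam s = inverse \<epsilon> * of_nat N powr (- (s - 1/2) / 2)
     * (\<Prod>j=1..r. of_real pi powr ((s + \<mu> j) / 2) * rGamma ((s + \<mu> j) / 2))"

lemma rgam_holo: "rgam holomorphic_on A"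
  unfolding rgam_def using conductor_pos by (intro holomorphic_intros) auto

lemma gam_rgam: assumes "Re s > \<theta>" shows "gam s * rgam s = 1"
proof -
  have "Gamma_R (s + \<mu> j) * (of_real pi powr ((s + \<mu> j) / 2) * rGamma ((s + \<mu> j) / 2)) = 1" if "j \<in> {1..r}" for j
  proof -
    define z where "z = (s + \<mu> j) / 2"
    have "Re z > 0" using mu_pos[OF that assms] by (simp add: z_def)
    then have "z \<notin> \<int>\<^sub>\<le>\<^sub>0" by (auto elim!: nonpos_Ints_cases simp: complex_eq_iff)
    then have "Gamma z * rGamma z = 1" by (simp add: rGamma_inverse_Gamma Gamma_eq_zero_iff)
    moreover have "of_real pi powr (- z) * of_real pi powr z = 1" by (simp flip: powr_add)
    moreover have "Gamma_R (s + \<mu> j) = of_real pi powr (- z) * Gamma z"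
      by (simp only: Gamma_R_def z_def minus_divide_left)
    ultimately show ?thesis unfolding z_def[symmetric]
      by (simp only: mult_ac) (metis mult.assoc mult.commute mult_1)
  qed
  then have "(\<Prod>j=1..r. Gamma_R (s + \<mu> j)) * (\<Prod>j=1..r. of_real pi powr ((s + \<mu> j) / 2) * rGamma ((s + \<mu> j) / 2)) = 1"
    by (simp flip: prod.distrib)
  moreover have "of_nat N powr ((s - 1/2) / 2) * of_nat N powr (- (s - 1/2) / 2) = (1::complex)"
  proof -
    have "(s - 1/2) / 2 + - (s - 1/2) / 2 = 0" by (simp add: field_simps)
    then show ?thesis using conductor_pos by (simp only: powr_add[symmetric]) simp
  qed
  moreover have "\<epsilon> * inverse \<epsilon> = 1" using epsilon_norm by (metis norm_zero right_inverse zero_neq_one)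
  moreover have "e * n * p * (e' * n' * p') = 1" if "p * p' = 1" "n * n' = 1" "e * e' = 1"
    for e e' n n' p p' :: complex
  proof -
    have "e * n * p * (e' * n' * p') = (e * e') * (n * n') * (p * p')" by (simp only: mult_ac)
    then show ?thesis by (simp only: that mult_1_right)
  qed
  ultimately show ?thesis unfolding gamma_factor_def rgam_def by blast
qed

lemma gam_shift:
  assumes "Re s = -1/2"
  shows "cmod (gam (s + 2)) * cmod (rgam s) = cmod (Q_fun r N \<mu> s)"
proof -
  have j: "Gamma_R (s + 2 + \<mu> j) * (of_real pi powr ((s + \<mu> j) / 2) * rGamma ((s + \<mu> j) / 2)) = (s + \<mu> j) / (2 * of_real pi)"
    if j: "j \<in> {1..r}" for j
  proof -
    define z where "z = (s + \<mu> j) / 2"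
    have "Re (\<mu> j) > -1/2" using mu_bound[OF j] theta_range by linarith
    then have "Re (z + 1) > 0" using assms by (simp add: z_def field_simps)
    then have "z + 1 \<notin> \<int>\<^sub>\<le>\<^sub>0" by (auto elim!: nonpos_Ints_cases simp: complex_eq_iff)
    then have g: "Gamma (z + 1) * rGamma (z + 1) = 1" by (simp add: rGamma_inverse_Gamma Gamma_eq_zero_iff)
    have eq: "(s + 2 + \<mu> j) / 2 = z + 1" by (simp add: z_def field_simps)
    have G: "Gamma_R (s + 2 + \<mu> j) = of_real pi powr (- (z + 1)) * Gamma (z + 1)"
      by (simp only: Gamma_R_def minus_divide_left[symmetric] eq)
    have p: "of_real pi powr (- (z + 1)) * of_real pi powr z = inverse (of_real pi :: complex)"
      by (simp add: powr_minus flip: powr_add)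
    have "Gamma_R (s + 2 + \<mu> j) * (of_real pi powr z * rGamma z)
       = (of_real pi powr (- (z + 1)) * of_real pi powr z) * (Gamma (z + 1) * rGamma (z + 1)) * z"
      unfolding G by (subst rGamma_plus1[symmetric]) (simp add: mult_ac)
    also have "\<dots> = inverse (of_real pi) * z" by (simp only: p g mult_1_right)
    finally show ?thesis unfolding z_def[symmetric] by (simp add: z_def field_simps)
  qed
  have "(\<Prod>j=1..r. Gamma_R (s + 2 + \<mu> j)) * (\<Prod>j=1..r. of_real pi powr ((s + \<mu> j) / 2) * rGamma ((s + \<mu> j) / 2))
      = (\<Prod>j=1..r. (s + \<mu> j) / (2 * of_real pi))"
    unfolding prod.distrib[symmetric] by (intro prod.cong refl) (use j in \<open>simp add: mult.assoc\<close>)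
  then have P: "cmod (\<Prod>j=1..r. Gamma_R (s + 2 + \<mu> j)) * cmod (\<Prod>j=1..r. of_real pi powr ((s + \<mu> j) / 2) * rGamma ((s + \<mu> j) / 2))
      = cmod (\<Prod>j=1..r. (s + \<mu> j) / (2 * of_real pi))" by (simp only: norm_mult[symmetric])
  have Np: "cmod (of_nat N powr ((s + 2 - 1/2) / 2)) * cmod (of_nat N powr (- (s - 1/2) / 2)) = real N"
  proof -
    have "of_nat N powr ((s + 2 - 1/2) / 2) * of_nat N powr (- (s - 1/2) / 2) = (of_nat N :: complex) powr ((s + 2 - 1/2) / 2 + - (s - 1/2) / 2)"
      by (simp add: powr_add)
    also have "(s + 2 - 1/2) / 2 + - (s - 1/2) / 2 = 1" by (simp add: field_simps)
    finally have "of_nat N powr ((s + 2 - 1/2) / 2) * of_nat N powr (- (s - 1/2) / 2) = (of_nat N :: complex)"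
      using conductor_pos by simp
    then show ?thesis by (metis norm_mult norm_of_nat)
  qed
  have "cmod (gam (s + 2)) * cmod (rgam s) = (cmod (of_nat N powr ((s + 2 - 1/2) / 2)) * cmod (of_nat N powr (- (s - 1/2) / 2)))
    * (cmod (\<Prod>j=1..r. Gamma_R (s + 2 + \<mu> j)) * cmod (\<Prod>j=1..r. of_real pi powr ((s + \<mu> j) / 2) * rGamma ((s + \<mu> j) / 2)))"
    unfolding gamma_factor_def rgam_def by (simp add: norm_mult epsilon_norm norm_inverse mult_ac)
  then show ?thesis unfolding P Np Q_fun_def by (simp add: norm_mult)
qed

lemma exp_growth_rgam: "exp_growth rgam 2"
proof -
  have pw: "exp_growth (\<lambda>s. of_real c powr ((s + d) / 2)) 2" if "c > 0" for c :: real and d :: complex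
  proof -
    have "of_real c powr ((s + d) / 2) = exp (of_real (ln c) / 2 * s + of_real (ln c) / 2 * d)" for s
      using that by (simp add: powr_def Ln_of_real field_simps)
    then show ?thesis using exp_growth_exp_linear[of 2 "of_real (ln c) / 2" "of_real (ln c) / 2 * d"] by simp
  qed
  have c: "exp_growth (\<lambda>s. inverse \<epsilon> * of_nat N powr (- (s - 1/2) / 2)) 2"
  proof -
    define l :: complex where "l = of_real (ln (real N))"
    have e1: "inverse \<epsilon> = exp (Ln (inverse \<epsilon>))" using epsilon_norm by (subst exp_Ln) auto
    have "Ln (of_nat N) = l" using Ln_of_real[of "real N"] conductor_pos by (simp add: l_def)
    then have "of_nat N powr (- (s - 1/2) / 2) = exp (- (s - 1/2) / 2 * l)" for s
      using conductor_pos by (simp add: powr_def)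
    moreover have "- (s - 1/2) / 2 * l = - l / 2 * s + l / 4" for s
      by (simp add: field_simps)
    ultimately have "of_nat N powr (- (s - 1/2) / 2) = exp (- l / 2 * s + l / 4)" for s
      by (simp only:)
    then have "inverse \<epsilon> * of_nat N powr (- (s - 1/2) / 2) = exp (- l / 2 * s + (l / 4 + Ln (inverse \<epsilon>)))" for s
    proof -
      have "exp (- l / 2 * s + (l / 4 + Ln (inverse \<epsilon>))) = exp (- l / 2 * s + l / 4) * exp (Ln (inverse \<epsilon>))"
        by (simp only: add.assoc[symmetric] exp_add[of "- l / 2 * s + l / 4"])
      then show ?thesis using \<open>\<And>s. of_nat N powr (- (s - 1/2) / 2) = exp (- l / 2 * s + l / 4)\<close> e1
        by (simp only: mult.commute)
    qed
    then show ?thesis using exp_growth_exp_linear[of 2 "- l / 2" "l / 4 + Ln (inverse \<epsilon>)"] by simp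
  qed
  show ?thesis unfolding rgam_def
    by (intro exp_growth_mult[OF c] exp_growth_prod exp_growth_mult pw exp_growth_affine exp_growth_rGamma) auto
qed

lemma Lam_right:
  assumes "Re s > \<theta>" "\<not> is_pole L s"
  shows "Lam s = gam s * L s"
proof -
  have "gam analytic_on {s}"
    using gam_holo assms(1) open_halfspace_Re_gt[of \<theta>] analytic_at by blast
  then have "(\<lambda>s. gam s * L s) analytic_on {s}" by (intro analytic_intros L_analytic assms(2))
  then show ?thesis unfolding completed_L_def by (rule remove_sings_at_analytic)
qed

lemma Lam_FE: "Lam s = cnj (Lam (1 - cnj s))"
  using functional_equation[of s] by (simp add: conj_fun_def)

definition Xi0 :: "complex \<Rightarrow> complex" where
  "Xi0 s = Ppoly s * gam s * Lhat s"

text \<open>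
  The entire function \<open>P(s) P(s - 1) \<Lambda>(s)\<close>, glued from its expressions on the two sides of the critical
  line so that its values at the poles of \<open>\<Lambda>\<close> are the correct ones.
\<close>
definition Xi :: "complex \<Rightarrow> complex" where
  "Xi s = (if Re s \<ge> 1/2 then Xi0 s else cnj (Xi0 (1 - cnj s)))"

lemma Ppoly_cnj: "cnj (Ppoly (1 - cnj s)) * cnj (Ppoly (- cnj s)) = Ppoly s * Ppoly (s - 1)"
proof -
  have c: "cnj (lam k) = - lam k" if "k \<in> {1..m}" for k
    using lambda_imaginary[OF that] by (simp add: complex_eq_iff)
  have "cnj (Ppoly (1 - cnj s)) * cnj (Ppoly (- cnj s)) = (\<Prod>k=1..m. (1 - s + lam k) * (- s + lam k))"
    unfolding Ppoly_def cnj_prod prod.distrib[symmetric] by (intro prod.cong) (auto simp: c)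
  also have "\<dots> = (\<Prod>k=1..m. (s - lam k) * (s - 1 - lam k))"
    by (intro prod.cong) (auto simp: algebra_simps)
  finally show ?thesis by (simp add: Ppoly_def prod.distrib)
qed

lemma Xi0_Lam: "Re s > \<theta> \<Longrightarrow> \<not> is_pole L s \<Longrightarrow> Xi0 s = Ppoly s * Ppoly (s - 1) * Lam s"
  by (simp add: Xi0_def Lam_right Lhat_eq(2) mult_ac)

text \<open>On the overlap neither s nor its reflection is a pole, so the functional equation
  applies pointwise. The strip is nonempty since \<theta> < 1/2, which makes the two halves of
  \<open>Xi\<close> one holomorphic function.\<close>

lemma Xi0_reflect:
  assumes "\<theta> < Re s" "Re s < 1 - \<theta>"
  shows "Xi0 s = cnj (Xi0 (1 - cnj s))"
proof -
  have np: "\<not> is_pole L s" "\<not> is_pole L (1 - cnj s)" using pole_L(3) assms theta_range by fastforce+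
  have "cnj (Xi0 (1 - cnj s)) = cnj (Ppoly (1 - cnj s)) * cnj (Ppoly (- cnj s)) * cnj (Lam (1 - cnj s))"
    using assms np by (subst Xi0_Lam) auto
  also have "\<dots> = Xi0 s" unfolding Ppoly_cnj Lam_FE[symmetric] using assms np by (simp add: Xi0_Lam)
  finally show ?thesis by simp
qed

lemma Xi_right: "Re s > \<theta> \<Longrightarrow> Xi s = Xi0 s"
  using Xi0_reflect[of s] theta_range by (auto simp: Xi_def)

lemma Xi_left: "Re s < 1 - \<theta> \<Longrightarrow> Xi s = cnj (Xi0 (1 - cnj s))"
  using Xi0_reflect[of s] theta_range by (auto simp: Xi_def)

lemma Xi_holo: "Xi holomorphic_on UNIV"
proof -
  have 1: "Xi0 holomorphic_on {s. Re s > \<theta>}"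
    unfolding Xi0_def by (intro holomorphic_intros gam_holo Lhat_holo)
  then have A: "Xi holomorphic_on {s. Re s > \<theta>}"
    by (rule holomorphic_transform) (simp add: Xi_right)
  have "(\<lambda>s. Xi0 (1 - s)) holomorphic_on {s. Re s < 1 - \<theta>}"
    by (rule holomorphic_on_compose_gen[OF _ 1, unfolded o_def]) (auto intro!: holomorphic_intros)
  moreover have "cnj ` {s. Re s < 1 - \<theta>} = {s. Re s < 1 - \<theta>}"
    by (auto simp: image_iff intro!: exI[of _ "cnj _"])
  ultimately have "cnj \<circ> (\<lambda>s. Xi0 (1 - s)) \<circ> cnj holomorphic_on {s. Re s < 1 - \<theta>}"
    by (intro holomorphic_on_compose_cnj_cnj open_halfspace_Re_lt) simp
  then have B: "Xi holomorphic_on {s. Re s < 1 - \<theta>}"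
    by (rule holomorphic_transform) (simp add: Xi_left)
  have "{s. Re s > \<theta>} \<union> {s. Re s < 1 - \<theta>} = UNIV" using theta_range by auto
  then show ?thesis
    using holomorphic_on_Un[OF A B open_halfspace_Re_gt open_halfspace_Re_lt] by simp
qed

lemma Xi_sym: "cmod (Xi (1 - cnj s)) = cmod (Xi s)"
proof (cases "Re s \<ge> 1/2")
  case True
  then have "Xi (1 - cnj s) = cnj (Xi0 s)" "Xi s = Xi0 s"
    using Xi_left[of "1 - cnj s"] Xi_right[of s] theta_range by auto
  then show ?thesis by simp
next
  case False
  then have "Xi (1 - cnj s) = Xi0 (1 - cnj s)" "Xi s = cnj (Xi0 (1 - cnj s))"
    using Xi_right[of "1 - cnj s"] Xi_left[of s] theta_range by auto
  then show ?thesis by simp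
qed

lemma Xi_right_nz: assumes "Re s > 1" shows "Xi s \<noteq> 0"
proof -
  have "\<not> is_pole L s" using pole_L(3) assms by fastforce
  then show ?thesis
    using assms theta_range gam_nz[of s] L_euler_lim(2)[OF assms] Ppoly_nz[of s] Ppoly_nz[of "s - 1"]
    by (simp add: Xi_right Xi0_def Lhat_eq(2))
qed

lemma Xi_zeros: assumes "Xi s = 0" shows "0 \<le> Re s \<and> Re s \<le> 1"
proof -
  have "Xi (1 - cnj s) = 0" using Xi_sym[of s] assms by simp
  then show ?thesis using Xi_right_nz[of s] Xi_right_nz[of "1 - cnj s"] assms by fastforce
qed

lemma Xi_Lam:
  assumes "s \<notin> lam ` {1..m}" "s \<notin> (\<lambda>k. 1 + lam k) ` {1..m}"
  shows "Xi s = Ppoly s * Ppoly (s - 1) * Lam s"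
proof (cases "Re s > \<theta>")
  case True
  moreover have "\<not> is_pole L s" using assms(2) pole_L_iff[of s] by blast
  ultimately show ?thesis by (simp add: Xi_right Xi0_Lam)
next
  case False
  have "\<not> is_pole L (1 - cnj s)"
  proof
    assume "is_pole L (1 - cnj s)"
    then obtain k where k: "k \<in> {1..m}" "1 - cnj s = 1 + lam k" using pole_L_iff by blast
    then have "s = lam k" using lambda_imaginary[of k] by (auto simp: complex_eq_iff)
    then show False using assms k by blast
  qed
  then have "cnj (Xi0 (1 - cnj s)) = cnj (Ppoly (1 - cnj s)) * cnj (Ppoly (- cnj s)) * cnj (Lam (1 - cnj s))"
    using False theta_range by (subst Xi0_Lam) auto
  also have "\<dots> = Ppoly s * Ppoly (s - 1) * Lam s" unfolding Ppoly_cnj Lam_FE[symmetric] ..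
  finally show ?thesis using False theta_range by (simp add: Xi_left)
qed

text \<open>With \<Lambda> = f / g, \<open>Xi\<close> is an entire quotient of P(s) P(s - 1) f by g.
  The identity \<open>Xi\<close> g = F holds off a countable set by \<open>Xi_Lam\<close>, hence
  everywhere, and \<open>exp_growth_quotient\<close> applies.\<close>

lemma exp_growth_Xi: "exp_growth Xi (3/2)"
proof -
  obtain f g where f: "f holomorphic_on UNIV" "entire_order f = 1" and g: "g holomorphic_on UNIV" "entire_order g = 1"
    and fg: "\<And>s. g s \<noteq> 0 \<Longrightarrow> Lam s = f s / g s"
    using Lambda_ratio unfolding ratio_of_entire_order_1_def by blast
  have gr: "exp_growth f (3/2)" "exp_growth g (3/2)" using exp_growth_of_order f g by auto
  \<comment> \<open>For g = 0 the relation with f would say nothing; order exactly 1 excludes it, as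
    the zero function has order below 1.\<close>
  have "\<exists>c. g c \<noteq> 0"
  proof (rule ccontr)
    assume "\<not> ?thesis"
    then have g0: "g = (\<lambda>_. 0)" by auto
    have "entire_order g \<le> ereal (1/2)"
      unfolding entire_order_def by (rule INF_lower) (simp add: g0)
    then show False using g(2) by simp
  qed
  then obtain c where c: "g c \<noteq> 0" by blast
  define F where "F = (\<lambda>s. Ppoly s * Ppoly (s - 1) * f s)"
  have Fh: "F holomorphic_on UNIV" unfolding F_def by (intro holomorphic_intros f)
  have Pg: "exp_growth Ppoly (3/2)" "exp_growth (\<lambda>s. Ppoly (s - 1)) (3/2)"
  proof -
    show "exp_growth Ppoly (3/2)" unfolding Ppoly_def[abs_def]
      by (intro exp_growth_prod exp_growth_linear) auto
    have "exp_growth (\<lambda>s. \<Prod>k=1..m. s - (1 + lam k)) (3/2)"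
      by (intro exp_growth_prod exp_growth_linear) auto
    then show "exp_growth (\<lambda>s. Ppoly (s - 1)) (3/2)" unfolding Ppoly_def by (simp add: algebra_simps)
  qed
  have Fg: "exp_growth F (3/2)" unfolding F_def by (intro exp_growth_mult Pg gr)
  have "(\<lambda>s. Xi s * g s) = F"
  proof (rule holomorphic_countable_equal_UNIV)
    show "(\<lambda>s. Xi s * g s) holomorphic_on UNIV" by (intro holomorphic_intros Xi_holo g)
    define S where "S = {s. g s = 0} \<union> lam ` {1..m} \<union> (\<lambda>k. 1 + lam k) ` {1..m}"
    have "countable {s\<in>UNIV. g s = 0}"
    proof (rule holomorphic_countable_zeros[OF g(1)])
      \<comment> \<open>A constant is O(exp (|z|^(1/2))) and so has order at most 1/2.\<close>
      show "\<not> g constant_on UNIV"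
      proof
        assume "g constant_on UNIV"
        then obtain d where d: "\<And>s. g s = d" by (auto simp: constant_on_def)
        have "(\<lambda>z::complex. norm (g z)) \<in> O[at_infinity](\<lambda>z. exp (norm z powr (1/2)))"
        proof (rule bigoI[of _ "cmod d"])
          show "\<forall>\<^sub>F x in at_infinity. norm (norm (g x)) \<le> cmod d * norm (exp (norm (x::complex) powr (1/2)))"
            by (intro always_eventually allI) (simp add: d mult_le_cancel_left1)
        qed
        then have "entire_order g \<le> ereal (1/2)"
          unfolding entire_order_def by (intro INF_lower) simp
        then show False using g(2) by simp
      qed
    qed auto
    then have S: "countable S" by (simp add: S_def)
    have "- S \<subseteq> {s. Xi s * g s = F s}"
    proof
      fix s assume "s \<in> - S"
      then have "g s \<noteq> 0" "s \<notin> lam ` {1..m}" "s \<notin> (\<lambda>k. 1 + lam k) ` {1..m}" by (auto simp: S_def)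
      then show "s \<in> {s. Xi s * g s = F s}" using Xi_Lam[of s] fg[of s] by (simp add: F_def)
    qed
    moreover have "uncountable (- S)" using S uncountable_UNIV_complex uncountable_minus_countable
      by (metis Compl_eq_Diff_UNIV)
    ultimately show "uncountable {s. Xi s * g s = F s}" using countable_subset by blast
  qed (rule Fh)
  then have "Xi s * g s = F s" for s by meson
  then show ?thesis by (intro exp_growth_quotient[OF Xi_holo Fh g(1) c _ Fg gr(2)]) auto
qed

text \<open>Both sides are entire and agree near 2, where \<open>gam\<close> and \<open>rgam\<close>
  are inverse. On the left of the critical line this expresses \<open>Lhat\<close> through functions
  whose growth and symmetry are known.\<close>

lemma Lhat_Ppoly: "Lhat s * Ppoly s = Xi s * rgam s"
proof -
  have "(\<lambda>s. Lhat s * Ppoly s) = (\<lambda>s. Xi s * rgam s)"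
  proof (rule holomorphic_countable_equal_UNIV)
    show "(\<lambda>s. Lhat s * Ppoly s) holomorphic_on UNIV" by (intro holomorphic_intros Lhat_holo)
    show "(\<lambda>s. Xi s * rgam s) holomorphic_on UNIV" by (intro holomorphic_intros Xi_holo rgam_holo)
    have "ball 2 1 \<subseteq> {s. Lhat s * Ppoly s = Xi s * rgam s}"
    proof
      fix s :: complex assume "s \<in> ball 2 1"
      then have "\<bar>Re (2 - s)\<bar> < 1" using abs_Re_le_cmod[of "2 - s"] by (simp add: dist_norm)
      then have "Re s > \<theta>" using theta_range by (simp add: abs_less_iff)
      then show "s \<in> {s. Lhat s * Ppoly s = Xi s * rgam s}"
        using gam_rgam[of s] by (simp add: Xi_right Xi0_def)
    qed
    moreover have "uncountable (ball (2::complex) 1)" by (rule uncountable_ball) simp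
    ultimately show "uncountable {s. Lhat s * Ppoly s = Xi s * rgam s}" using countable_subset by blast
  qed
  then show ?thesis by meson
qed

text \<open>
  By the functional equation \<open>\<Lambda>\<close> has a pole at every \<open>lam k\<close>, where \<open>L\<close> is finite, so it comes from the
  gamma factor. Hence the poles of \<open>L\<close> are as far from the line of integration as the \<open>\<mu> j\<close> are.
\<close>
lemma lam_multiplicity: "card {k\<in>{1..m}. lam k = z} \<le> card {j\<in>{1..r}. \<mu> j = - z}"
proof (cases "{k\<in>{1..m}. lam k = z} = {}")
  case True
  then show ?thesis by (simp only: card.empty)
next
  case False
  then obtain k where k: "k \<in> {1..m}" "lam k = z" by blast
  have z0: "Re z = 0" using lambda_imaginary k by blast
  define e where "e = card {k\<in>{1..m}. lam k = z}"
  define d where "d = card {j\<in>{1..r}. \<mu> j = - z}"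
  have pole: "is_pole L (1 + z)" using k pole_L_iff by blast
  have "Xi (1 + z) \<noteq> 0"
    using Lhat_pole(2)[OF pole] gam_nz[of "1 + z"] Ppoly_nz[of "1 + z"] z0 theta_range
    by (simp add: Xi_right Xi0_def)
  moreover have "1 - cnj (1 + z) = z" using z0 by (simp add: complex_eq_iff)
  \<comment> \<open>\<open>Xi\<close> does not vanish at the pole 1 + z of L, as the pole is
    cancelled exactly; reflection carries this to z.\<close>
  ultimately have Xz: "Xi z \<noteq> 0" using Xi_sym[of "1 + z"] by auto
  define A where "A = (\<lambda>s. Lhat s * (\<Prod>k\<in>{k\<in>{1..m}. lam k \<noteq> z}. s - lam k))"
  define B where "B = (\<lambda>s. Xi s * (inverse \<epsilon> * of_nat N powr (- (s - 1/2) / 2) * (\<Prod>j=1..r. of_real pi powr ((s + \<mu> j) / 2))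
     * ((\<Prod>j\<in>{j\<in>{1..r}. \<mu> j = - z}. rGamma ((s - z) / 2 + 1) / 2) * (\<Prod>j\<in>{j\<in>{1..r}. \<mu> j \<noteq> - z}. rGamma ((s + \<mu> j) / 2)))))"
  \<comment> \<open>Each j with \<mu> j = -z gives a simple zero of
    \<open>rGamma ((s + \<mu> j) / 2)\<close> at z; these d zeros are made explicit.\<close>
  have rsplit: "rgam s = (s - z) ^ d * (inverse \<epsilon> * of_nat N powr (- (s - 1/2) / 2) * (\<Prod>j=1..r. of_real pi powr ((s + \<mu> j) / 2))
     * ((\<Prod>j\<in>{j\<in>{1..r}. \<mu> j = - z}. rGamma ((s - z) / 2 + 1) / 2) * (\<Prod>j\<in>{j\<in>{1..r}. \<mu> j \<noteq> - z}. rGamma ((s + \<mu> j) / 2))))" for s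
  proof -
    have "(\<Prod>j=1..r. rGamma ((s + \<mu> j) / 2)) = (\<Prod>j\<in>{j\<in>{1..r}. \<mu> j = - z}. rGamma ((s + \<mu> j) / 2)) * (\<Prod>j\<in>{j\<in>{1..r}. \<mu> j \<noteq> - z}. rGamma ((s + \<mu> j) / 2))"
      by (subst prod.union_disjoint[symmetric]) (auto intro!: prod.cong)
    also have "(\<Prod>j\<in>{j\<in>{1..r}. \<mu> j = - z}. rGamma ((s + \<mu> j) / 2)) = (\<Prod>j\<in>{j\<in>{1..r}. \<mu> j = - z}. (s - z) * (rGamma ((s - z) / 2 + 1) / 2))"
    proof (intro prod.cong refl)
      fix j assume "j \<in> {j\<in>{1..r}. \<mu> j = - z}"
      then show "rGamma ((s + \<mu> j) / 2) = (s - z) * (rGamma ((s - z) / 2 + 1) / 2)"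
        using rGamma_plus1[of "(s - z) / 2"] by simp
    qed
    also have "\<dots> = (s - z) ^ d * (\<Prod>j\<in>{j\<in>{1..r}. \<mu> j = - z}. rGamma ((s - z) / 2 + 1) / 2)"
      by (simp only: prod.distrib prod_constant d_def)
    finally have "(\<Prod>j=1..r. rGamma ((s + \<mu> j) / 2)) = (s - z) ^ d * (\<Prod>j\<in>{j\<in>{1..r}. \<mu> j = - z}. rGamma ((s - z) / 2 + 1) / 2)
        * (\<Prod>j\<in>{j\<in>{1..r}. \<mu> j \<noteq> - z}. rGamma ((s + \<mu> j) / 2))" .
    then show ?thesis unfolding rgam_def prod.distrib by (simp only: mult_ac)
  qed
  have id: "(s - z) ^ e * A s = (s - z) ^ d * B s" for s
    using Lhat_Ppoly[of s] Ppoly_factor[of s z] unfolding rsplit[of s] A_def B_def e_def by (simp only: mult_ac)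
  have Bz: "B z \<noteq> 0"
  proof -
    \<comment> \<open>A zero would mean \<mu> j = -z - 2n with Re \<mu> j > -1/2, forcing n = 0 and
      \<mu> j = -z.\<close>
    have "rGamma ((z + \<mu> j) / 2) \<noteq> 0" if "j \<in> {1..r}" "\<mu> j \<noteq> - z" for j
    proof
      assume "rGamma ((z + \<mu> j) / 2) = 0"
      then obtain n where n: "(z + \<mu> j) / 2 = - of_nat n"
        by (auto simp: rGamma_eq_zero_iff elim!: nonpos_Ints_cases')
      then have "z + \<mu> j = - of_nat (2 * n)" by (simp add: field_simps)
      then have 1: "Re (\<mu> j) = - real (2 * n)" "z + \<mu> j = - of_nat (2 * n)" using z0 by (auto simp: complex_eq_iff)
      then have "real (2 * n) < 1" using mu_bound[OF that(1)] theta_range by simp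
      then have "n = 0" by simp
      then show False using 1(2) that(2) by (simp add: eq_neg_iff_add_eq_0 add.commute)
    qed
    then show ?thesis unfolding B_def using Xz epsilon_norm conductor_pos by (auto simp: rGamma_eq_zero_iff)
  qed
  have cont: "isCont A z" "isCont B z"
  proof -
    have "A holomorphic_on UNIV" unfolding A_def by (intro holomorphic_intros Lhat_holo)
    then show "isCont A z"
      using holomorphic_on_imp_continuous_on continuous_on_eq_continuous_at open_UNIV by blast
    have "B holomorphic_on UNIV" unfolding B_def using conductor_pos by (intro holomorphic_intros Xi_holo) auto
    then show "isCont B z"
      using holomorphic_on_imp_continuous_on continuous_on_eq_continuous_at open_UNIV by blast
  qed
  have "e \<le> d"
  proof (rule ccontr)
    assume "\<not> e \<le> d"
    then have ed: "e > d" by simp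
    \<comment> \<open>If e > d, cancelling (s - z)^d leaves a zero at z on the left but none on the
      right.\<close>
    have "(s - z) ^ (e - d) * A s = B s" if "s \<noteq> z" for s
    proof -
      have "(s - z) ^ e = (s - z) ^ d * (s - z) ^ (e - d)" using ed by (simp flip: power_add)
      then show ?thesis using id[of s] that by simp
    qed
    then have "((\<lambda>s. (s - z) ^ (e - d) * A s) \<longlongrightarrow> B z) (at z)"
      using cont(2) unfolding isCont_def
      by (subst tendsto_cong[of _ B]) (auto simp: eventually_at_filter)
    moreover have "((\<lambda>s. (s - z) ^ (e - d) * A s) \<longlongrightarrow> (z - z) ^ (e - d) * A z) (at z)"
      using cont(1) unfolding isCont_def by (intro tendsto_intros)
    ultimately have "B z = (z - z) ^ (e - d) * A z" using tendsto_unique[OF at_neq_bot] by blast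
    then show False using Bz ed by simp
  qed
  then show ?thesis by (simp add: e_def d_def)
qed

lemma lam_matches_mu:
  assumes "k \<in> {1..m}"
  shows "\<exists>j\<in>{1..r}. \<mu> j = - lam k"
proof -
  have "{k'\<in>{1..m}. lam k' = lam k} \<noteq> {}" using assms by blast
  then have "card {k'\<in>{1..m}. lam k' = lam k} > 0" by (simp add: card_gt_0_iff)
  then have "card {j\<in>{1..r}. \<mu> j = - lam k} > 0" using lam_multiplicity[of "lam k"] by linarith
  then show ?thesis by (metis (mono_tags, lifting) card.empty empty_iff ex_in_conv less_irrefl mem_Collect_eq)
qed

text \<open>The sets of indices j attached to different values of \<open>lam\<close> are disjoint.
  The pole corrections can therefore be charged to the terms with factor r.\<close>

lemma m_le_r: "m \<le> r"
proof -
  have "m = (\<Sum>k\<in>{1..m}. 1)" by simp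
  also have "\<dots> = (\<Sum>z\<in>lam ` {1..m}. \<Sum>k\<in>{k\<in>{1..m}. lam k = z}. 1)"
    by (rule sum.image_gen) simp
  also have "\<dots> = (\<Sum>z\<in>lam ` {1..m}. card {k\<in>{1..m}. lam k = z})" by simp
  also have "\<dots> \<le> (\<Sum>z\<in>lam ` {1..m}. card {j\<in>{1..r}. \<mu> j = - z})"
    by (intro sum_mono lam_multiplicity)
  also have "\<dots> = card (\<Union>z\<in>lam ` {1..m}. {j\<in>{1..r}. \<mu> j = - z})"
    by (subst card_UN_disjoint) auto
  also have "\<dots> \<le> card {1..r}" by (intro card_mono) auto
  finally show ?thesis by simp
qed

end

section \<open>Littlewood's lemma\<close>

text \<open>Along s, s + 1, s + 2, ... the increments of h are dominated by a geometric series with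
  ratio 1/2, whose sum gives the factor 2.\<close>

lemma half_plane_limit:
  fixes h :: "complex \<Rightarrow> complex"
  assumes h: "h holomorphic_on {s. Re s > 1}" and C: "C \<ge> 0"
    and b: "\<And>s. Re s \<ge> 2 \<Longrightarrow> cmod (deriv h s) \<le> C * 2 powr (- Re s)"
  shows "\<exists>c. \<forall>s. Re s \<ge> 2 \<longrightarrow> cmod (h s - c) \<le> 2 * C * 2 powr (- Re s)"
proof -
  have diff: "cmod (h z - h w) \<le> C * 2 powr (- a) * cmod (z - w)" if "a \<ge> 2" "Re z \<ge> a" "Re w \<ge> a" for z w a
  proof (rule field_differentiable_bound[of "{s. Re s \<ge> a}"])
    show "convex {s. Re s \<ge> a}" by (rule convex_halfspace_Re_ge)
    fix s assume s: "s \<in> {s. Re s \<ge> a}"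
    show "(h has_field_derivative deriv h s) (at s within {s. Re s \<ge> a})"
      using holomorphic_derivI[OF h open_halfspace_Re_gt, of s] s that by (auto intro: has_field_derivative_at_within)
    have "2 powr (- Re s) \<le> 2 powr (- a)" using s by (intro powr_mono) auto
    then have "C * 2 powr (- Re s) \<le> C * 2 powr (- a)" using C by (rule mult_left_mono)
    then show "cmod (deriv h s) \<le> C * 2 powr (- a)" using b[of s] s that by auto
  qed (use that in auto)
  have pt: "\<exists>c. (\<lambda>n. h (s + of_nat n)) \<longlonglongrightarrow> c \<and> cmod (h s - c) \<le> 2 * C * 2 powr (- Re s)" if s: "Re s \<ge> 2" for s
  proof -
    define x where "x = (\<lambda>n. h (s + of_nat n))"
    define g where "g = (\<lambda>n. C * 2 powr (- Re s) * (1/2) ^ n)"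
    have le: "cmod (x (Suc n) - x n) \<le> g n" for n
    proof -
      have "cmod (x (Suc n) - x n) \<le> C * 2 powr (- (Re s + real n)) * cmod ((s + of_nat (Suc n)) - (s + of_nat n))"
        unfolding x_def using s by (intro diff) auto
      also have "(s + of_nat (Suc n)) - (s + of_nat n) = 1" by simp
      also have "2 powr (- (Re s + real n)) = 2 powr (- Re s) * (1/2) ^ n"
        by (simp add: powr_diff powr_realpow power_one_over field_simps powr_minus)
      finally show ?thesis by (simp add: g_def mult.assoc)
    qed
    have gs: "g sums (C * 2 powr (- Re s) * 2)"
      unfolding g_def using geometric_sums[of "1/2::real"] by (intro sums_mult) simp
    have sm: "summable (\<lambda>n. x (Suc n) - x n)"
      by (rule summable_comparison_test'[OF sums_summable[OF gs], of 0]) (rule le)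
    have "(\<lambda>N. \<Sum>n<N. x (Suc n) - x n) \<longlonglongrightarrow> (\<Sum>n. x (Suc n) - x n)" by (rule summable_LIMSEQ[OF sm])
    then have "(\<lambda>N. x N - x 0) \<longlonglongrightarrow> (\<Sum>n. x (Suc n) - x n)" by (simp add: sum_lessThan_telescope)
    then have "(\<lambda>N. (x N - x 0) + x 0) \<longlonglongrightarrow> (\<Sum>n. x (Suc n) - x n) + x 0" by (intro tendsto_intros)
    then have 1: "x \<longlonglongrightarrow> (\<Sum>n. x (Suc n) - x n) + x 0" by simp
    have "cmod (\<Sum>n. x (Suc n) - x n) \<le> suminf g" by (rule norm_suminf_le[OF le sums_summable[OF gs]])
    also have "suminf g = 2 * C * 2 powr (- Re s)" using sums_unique[OF gs] by simp
    finally show ?thesis using 1 unfolding x_def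
      by (intro exI[of _ "(\<Sum>n. x (Suc n) - x n) + x 0"]) (simp add: x_def norm_minus_commute)
  qed
  obtain c where c: "(\<lambda>n. h (2 + of_nat n)) \<longlonglongrightarrow> c" using pt[of 2] by auto
  have "cmod (h s - c) \<le> 2 * C * 2 powr (- Re s)" if s: "Re s \<ge> 2" for s
  proof -
    obtain c' where c': "(\<lambda>n. h (s + of_nat n)) \<longlonglongrightarrow> c'" "cmod (h s - c') \<le> 2 * C * 2 powr (- Re s)"
      using pt[OF s] by blast
    \<comment> \<open>The limit along s + n does not depend on s: the distance from s + n to 2 + n
      is fixed while the derivative between them tends to 0.\<close>
    have "(\<lambda>n. h (s + of_nat n) - h (2 + of_nat n)) \<longlonglongrightarrow> 0"
    proof (rule Lim_null_comparison)
      show "\<forall>\<^sub>F n in sequentially. cmod (h (s + of_nat n) - h (2 + of_nat n)) \<le> C * cmod (s - 2) * 2 powr (- (2 + real n))"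
      proof (intro always_eventually allI)
        fix n
        have "cmod (h (s + of_nat n) - h (2 + of_nat n)) \<le> C * 2 powr (- (2 + real n)) * cmod ((s + of_nat n) - (2 + of_nat n))"
          using s by (intro diff) auto
        then show "cmod (h (s + of_nat n) - h (2 + of_nat n)) \<le> C * cmod (s - 2) * 2 powr (- (2 + real n))"
          by (simp add: mult_ac)
      qed
      have "(\<lambda>n. 2 powr (- (2 + real n))) \<longlonglongrightarrow> 0" by real_asymp
      then show "(\<lambda>n. C * cmod (s - 2) * 2 powr (- (2 + real n))) \<longlonglongrightarrow> 0" by (rule tendsto_mult_right_zero)
    qed
    moreover have "(\<lambda>n. h (s + of_nat n) - h (2 + of_nat n)) \<longlonglongrightarrow> c' - c" by (intro tendsto_diff c c'(1))
    ultimately have "c' - c = 0" using LIMSEQ_unique by blast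
    then show ?thesis using c'(2) by simp
  qed
  then show ?thesis by blast
qed

lemma deriv_horizontal:
  assumes "(F has_field_derivative f) (at (Complex \<sigma> t))"
  shows "((\<lambda>\<sigma>. F (Complex \<sigma> t)) has_vector_derivative f) (at \<sigma>)"
proof -
  have "((\<lambda>\<sigma>. Complex \<sigma> t) has_vector_derivative 1) (at \<sigma>)"
    unfolding has_vector_derivative_complex_iff by (auto intro!: derivative_eq_intros)
  from field_vector_diff_chain_at[OF this assms] show ?thesis by (simp add: o_def)
qed

lemma deriv_vertical:
  assumes "(F has_field_derivative f) (at (Complex \<sigma> t))"
  shows "((\<lambda>t. F (Complex \<sigma> t)) has_vector_derivative \<i> * f) (at t)"
proof -
  have "((\<lambda>t. Complex \<sigma> t) has_vector_derivative \<i>) (at t)"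
    unfolding has_vector_derivative_complex_iff by (auto intro!: derivative_eq_intros)
  from field_vector_diff_chain_at[OF this assms] show ?thesis by (simp add: o_def)
qed

section \<open>Integrals along segments from an explicit factorization\<close>

lemma logderiv_prod:
  fixes a :: "'a \<Rightarrow> complex"
  assumes "finite A" "\<And>i. i \<in> A \<Longrightarrow> s \<noteq> a i"
  shows "((\<lambda>s. \<Prod>i\<in>A. s - a i) has_field_derivative (\<Prod>i\<in>A. s - a i) * (\<Sum>i\<in>A. 1 / (s - a i))) (at s)"
  using assms
proof (induction A rule: finite_induct)
  case (insert i A)
  have "((\<lambda>s. s - a i) has_field_derivative 1) (at s)" by (auto intro!: derivative_eq_intros)
  from DERIV_mult[OF this insert.IH] insert
  have "((\<lambda>s. (s - a i) * (\<Prod>i\<in>A. s - a i)) has_field_derivative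
     1 * (\<Prod>i\<in>A. s - a i) + (\<Prod>i\<in>A. s - a i) * (\<Sum>i\<in>A. 1 / (s - a i)) * (s - a i)) (at s)" by simp
  moreover have "1 * (\<Prod>i\<in>A. s - a i) + (\<Prod>i\<in>A. s - a i) * (\<Sum>i\<in>A. 1 / (s - a i)) * (s - a i)
     = ((s - a i) * (\<Prod>i\<in>A. s - a i)) * (1 / (s - a i) + (\<Sum>i\<in>A. 1 / (s - a i)))"
    using insert.prems[of i] by (simp add: distrib_left mult_ac)
  ultimately show ?case using insert by simp
qed simp

text \<open>A function with logarithmic exponential factor q, zeros a and poles b on U. The relation
  is multiplied out and required only off the points b, where the value of f is a
  convention.\<close>

locale log_factor =
  fixes f q :: "complex \<Rightarrow> complex" and U :: "complex set"
    and A :: "'a set" and a :: "'a \<Rightarrow> complex" and B :: "'b set" and b :: "'b \<Rightarrow> complex"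
  assumes U: "open U" and q: "q holomorphic_on U" and fin: "finite A" "finite B"
    and eq: "\<And>s. s \<in> U \<Longrightarrow> s \<notin> b ` B \<Longrightarrow> f s * (\<Prod>j\<in>B. s - b j) = exp (q s) * (\<Prod>i\<in>A. s - a i)"
begin

lemma prod_nz: "s \<notin> a ` A \<Longrightarrow> (\<Prod>i\<in>A. s - a i) \<noteq> 0" "s \<notin> b ` B \<Longrightarrow> (\<Prod>j\<in>B. s - b j) \<noteq> 0"
  using fin by auto

lemma nonzero: "s \<in> U \<Longrightarrow> s \<notin> a ` A \<Longrightarrow> s \<notin> b ` B \<Longrightarrow> f s \<noteq> 0"
  using eq[of s] prod_nz(1)[of s] by (metis exp_not_eq_zero mult_eq_0_iff)

lemma ln_f:
  assumes "s \<in> U" "s \<notin> a ` A" "s \<notin> b ` B"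
  shows "ln (cmod (f s)) = Re (q s) + (\<Sum>i\<in>A. ln (cmod (s - a i))) - (\<Sum>j\<in>B. ln (cmod (s - b j)))"
proof -
  have "cmod (f s) * (\<Prod>j\<in>B. cmod (s - b j)) = exp (Re (q s)) * (\<Prod>i\<in>A. cmod (s - a i))"
    using arg_cong[OF eq[OF assms(1,3)], of cmod] by (simp add: norm_mult prod_norm)
  moreover have pos: "cmod (f s) > 0" "(\<Prod>j\<in>B. cmod (s - b j)) > 0" "(\<Prod>i\<in>A. cmod (s - a i)) > 0"
    using nonzero[OF assms] assms fin by (auto intro!: prod_pos)
  ultimately have "ln (cmod (f s)) + ln (\<Prod>j\<in>B. cmod (s - b j)) = Re (q s) + ln (\<Prod>i\<in>A. cmod (s - a i))"
    using ln_mult_pos[of "cmod (f s)" "\<Prod>j\<in>B. cmod (s - b j)"] ln_mult_pos[of "exp (Re (q s))" "\<Prod>i\<in>A. cmod (s - a i)"]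
    by simp
  moreover have "ln (\<Prod>j\<in>B. cmod (s - b j)) = (\<Sum>j\<in>B. ln (cmod (s - b j)))"
    using assms fin by (intro ln_prod) auto
  moreover have "ln (\<Prod>i\<in>A. cmod (s - a i)) = (\<Sum>i\<in>A. ln (cmod (s - a i)))"
    using assms fin by (intro ln_prod) auto
  ultimately show ?thesis by simp
qed

lemma deriv_f:
  assumes "s \<in> U" "s \<notin> a ` A" "s \<notin> b ` B"
  shows "(f has_field_derivative f s * (deriv q s + (\<Sum>i\<in>A. 1 / (s - a i)) - (\<Sum>j\<in>B. 1 / (s - b j)))) (at s)"
proof -
  define E where "E = exp (q s)"
  define P where "P = (\<Prod>i\<in>A. s - a i)"
  define D where "D = (\<Prod>j\<in>B. s - b j)"
  have D: "D \<noteq> 0" using prod_nz(2)[OF assms(3)] by (simp add: D_def)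
  have fs: "f s = E * P / D" using eq[OF assms(1,3)] D by (simp add: E_def P_def D_def field_simps)
  have dq: "(q has_field_derivative deriv q s) (at s)" using holomorphic_derivI[OF q U assms(1)] .
  have 1: "((\<lambda>s. exp (q s)) has_field_derivative E * deriv q s) (at s)"
    unfolding E_def by (rule DERIV_chain2[OF DERIV_exp dq])
  have 2: "((\<lambda>s. \<Prod>i\<in>A. s - a i) has_field_derivative P * (\<Sum>i\<in>A. 1 / (s - a i))) (at s)"
    unfolding P_def using assms fin by (intro logderiv_prod) auto
  have 3: "((\<lambda>s. \<Prod>j\<in>B. s - b j) has_field_derivative D * (\<Sum>j\<in>B. 1 / (s - b j))) (at s)"
    unfolding D_def using assms fin by (intro logderiv_prod) auto
  have g: "((\<lambda>s. exp (q s) * (\<Prod>i\<in>A. s - a i) / (\<Prod>j\<in>B. s - b j)) has_field_derivative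
     f s * (deriv q s + (\<Sum>i\<in>A. 1 / (s - a i)) - (\<Sum>j\<in>B. 1 / (s - b j)))) (at s)"
  proof -
    define S1 where "S1 = (\<Sum>i\<in>A. 1 / (s - a i))"
    define S2 where "S2 = (\<Sum>j\<in>B. 1 / (s - b j))"
    have "((E * deriv q s * P + P * S1 * E) * D - E * P * (D * S2)) / (D * D) = E * P / D * (deriv q s + S1 - S2)"
      using D by (simp add: divide_simps) (simp add: algebra_simps)
    then show ?thesis
      using DERIV_divide[OF DERIV_mult[OF 1 2] 3] prod_nz(2)[OF assms(3)]
      by (simp add: E_def[symmetric] P_def[symmetric] D_def[symmetric] S1_def[symmetric] S2_def[symmetric] fs)
  qed
  have "open (U - b ` B)" using U fin by (intro open_Diff finite_imp_closed) auto
  then show ?thesis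
  proof (rule has_field_derivative_transform_within_open[OF g])
    fix w assume "w \<in> U - b ` B"
    then show "exp (q w) * (\<Prod>i\<in>A. w - a i) / (\<Prod>j\<in>B. w - b j) = f w"
      using eq[of w] prod_nz(2)[of w] by (auto simp: field_simps)
  qed (use assms in auto)
qed

text \<open>This holds at every height, including those of zeros and poles, because
  \<open>log_prim\<close> integrates the logarithmic singularities.\<close>

lemma ln_f_integral:
  assumes Q: "\<And>s. s \<in> U \<Longrightarrow> (Q has_field_derivative q s) (at s)" and x: "x0 \<le> x1"
    and seg: "\<And>\<sigma>. \<sigma> \<in> {x0..x1} \<Longrightarrow> Complex \<sigma> t \<in> U"
  shows "((\<lambda>\<sigma>. ln (cmod (f (Complex \<sigma> t)))) has_integral (Re (Q (Complex x1 t)) - Re (Q (Complex x0 t))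
     + (\<Sum>i\<in>A. log_prim (t - Im (a i)) (x1 - Re (a i)) - log_prim (t - Im (a i)) (x0 - Re (a i)))
     - (\<Sum>j\<in>B. log_prim (t - Im (b j)) (x1 - Re (b j)) - log_prim (t - Im (b j)) (x0 - Re (b j))))) {x0..x1}"
proof (rule has_integral_spike_finite[where S = "Re ` (a ` A \<union> b ` B)"])
  show "finite (Re ` (a ` A \<union> b ` B))" using fin by simp
  have ln1: "((\<lambda>\<sigma>. ln (cmod (Complex \<sigma> t - z))) has_integral (log_prim (t - Im z) (x1 - Re z) - log_prim (t - Im z) (x0 - Re z))) {x0..x1}" for z
  proof -
    have "Complex \<sigma> t - z = Complex (\<sigma> + - Re z) (t - Im z)" for \<sigma> by (simp add: complex_eq_iff)
    then show ?thesis using ln_has_integral[OF x, of "- Re z" "t - Im z"] by simp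
  qed
  have "((\<lambda>\<sigma>. Re (q (Complex \<sigma> t))) has_integral (Re (Q (Complex x1 t)) - Re (Q (Complex x0 t)))) {x0..x1}"
  proof (rule fundamental_theorem_of_calculus[OF x])
    fix \<sigma> assume "\<sigma> \<in> {x0..x1}"
    then have "((\<lambda>\<sigma>. Q (Complex \<sigma> t)) has_vector_derivative q (Complex \<sigma> t)) (at \<sigma>)"
      by (intro deriv_horizontal Q seg)
    then show "((\<lambda>\<sigma>. Re (Q (Complex \<sigma> t))) has_vector_derivative Re (q (Complex \<sigma> t))) (at \<sigma> within {x0..x1})"
      unfolding has_vector_derivative_complex_iff has_real_derivative_iff_has_vector_derivative[symmetric]
      by (auto intro: has_field_derivative_at_within)
  qed
  then show "((\<lambda>\<sigma>. Re (q (Complex \<sigma> t)) + (\<Sum>i\<in>A. ln (cmod (Complex \<sigma> t - a i))) - (\<Sum>j\<in>B. ln (cmod (Complex \<sigma> t - b j))))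
     has_integral (Re (Q (Complex x1 t)) - Re (Q (Complex x0 t))
     + (\<Sum>i\<in>A. log_prim (t - Im (a i)) (x1 - Re (a i)) - log_prim (t - Im (a i)) (x0 - Re (a i)))
     - (\<Sum>j\<in>B. log_prim (t - Im (b j)) (x1 - Re (b j)) - log_prim (t - Im (b j)) (x0 - Re (b j))))) {x0..x1}"
    by (intro has_integral_add has_integral_diff has_integral_sum fin ln1)
  fix \<sigma> assume \<sigma>: "\<sigma> \<in> {x0..x1} - Re ` (a ` A \<union> b ` B)"
  then have "Complex \<sigma> t \<notin> a ` A" "Complex \<sigma> t \<notin> b ` B"
    by (metis (no_types, lifting) DiffD2 UnI1 UnI2 complex.sel(1) imageI)+
  then show "ln (cmod (f (Complex \<sigma> t))) = Re (q (Complex \<sigma> t)) + (\<Sum>i\<in>A. ln (cmod (Complex \<sigma> t - a i))) - (\<Sum>j\<in>B. ln (cmod (Complex \<sigma> t - b j)))"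
    using \<sigma> seg by (intro ln_f) auto
qed

lemma logderiv_integral:
  assumes x: "x0 \<le> x1" and seg: "\<And>\<sigma>. \<sigma> \<in> {x0..x1} \<Longrightarrow> Complex \<sigma> t \<in> U"
    and t: "t \<notin> Im ` (a ` A \<union> b ` B)"
  shows "continuous_on {x0..x1} (\<lambda>\<sigma>. deriv f (Complex \<sigma> t) / f (Complex \<sigma> t))"
    "((\<lambda>\<sigma>. Im (deriv f (Complex \<sigma> t) / f (Complex \<sigma> t))) has_integral
      (Im (q (Complex x1 t)) - Im (q (Complex x0 t))
     - (\<Sum>i\<in>A. arctan ((x1 - Re (a i)) / (t - Im (a i))) - arctan ((x0 - Re (a i)) / (t - Im (a i))))
     + (\<Sum>j\<in>B. arctan ((x1 - Re (b j)) / (t - Im (b j))) - arctan ((x0 - Re (b j)) / (t - Im (b j)))))) {x0..x1}"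
proof -
  have nin: "Complex \<sigma> t \<notin> a ` A" "Complex \<sigma> t \<notin> b ` B" for \<sigma>
    using t by (metis (no_types, lifting) UnI1 UnI2 complex.sel(2) imageI)+
  have ld: "deriv f (Complex \<sigma> t) / f (Complex \<sigma> t) = deriv q (Complex \<sigma> t) + (\<Sum>i\<in>A. 1 / (Complex \<sigma> t - a i)) - (\<Sum>j\<in>B. 1 / (Complex \<sigma> t - b j))"
    if "\<sigma> \<in> {x0..x1}" for \<sigma>
    using DERIV_imp_deriv[OF deriv_f[OF seg[OF that] nin]] nonzero[OF seg[OF that] nin] by simp
  have hc: "continuous_on {x0..x1} (\<lambda>\<sigma>. Complex \<sigma> t)"
    by (auto simp: Complex_eq intro!: continuous_intros)
  have dq: "deriv q holomorphic_on U" using q U by (rule holomorphic_deriv)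
  have "continuous_on {x0..x1} (\<lambda>\<sigma>. deriv q (Complex \<sigma> t) + (\<Sum>i\<in>A. 1 / (Complex \<sigma> t - a i)) - (\<Sum>j\<in>B. 1 / (Complex \<sigma> t - b j)))"
    using nin by (intro continuous_intros hc continuous_on_compose2[OF holomorphic_on_imp_continuous_on[OF dq] hc]) (use seg in auto)
  then show "continuous_on {x0..x1} (\<lambda>\<sigma>. deriv f (Complex \<sigma> t) / f (Complex \<sigma> t))"
    by (rule continuous_on_eq) (simp add: ld)
  have at1: "((\<lambda>\<sigma>. Im (1 / (Complex \<sigma> t - z))) has_integral - (arctan ((x1 - Re z) / (t - Im z)) - arctan ((x0 - Re z) / (t - Im z)))) {x0..x1}"
    if "t \<noteq> Im z" for z
  proof -
    define y where "y = t - Im z"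
    have y: "y \<noteq> 0" using that by (simp add: y_def)
    have "((\<lambda>\<sigma>. Im (1 / (Complex \<sigma> t - z))) has_integral (- arctan ((x1 - Re z) / y) - (- arctan ((x0 - Re z) / y)))) {x0..x1}"
    proof (rule fundamental_theorem_of_calculus[OF x])
      fix \<sigma> assume "\<sigma> \<in> {x0..x1}"
      have "((\<lambda>\<sigma>. (\<sigma> - Re z) / y) has_real_derivative 1 / y) (at \<sigma>)"
        using y by (auto intro!: derivative_eq_intros)
      from DERIV_minus[OF DERIV_chain2[OF DERIV_arctan this]]
      have "((\<lambda>\<sigma>. - arctan ((\<sigma> - Re z) / y)) has_real_derivative - (inverse (1 + ((\<sigma> - Re z) / y)\<^sup>2) * (1 / y))) (at \<sigma>)" .
      moreover have "- (inverse (1 + ((\<sigma> - Re z) / y)\<^sup>2) * (1 / y)) = Im (1 / (Complex \<sigma> t - z))"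
      proof -
        have "y\<^sup>2 + (\<sigma> - Re z)\<^sup>2 > 0" using y by (simp add: add_pos_nonneg)
        then have "inverse (1 + ((\<sigma> - Re z) / y)\<^sup>2) * (1 / y) = y / (y\<^sup>2 + (\<sigma> - Re z)\<^sup>2)"
          using y by (simp add: power_divide divide_simps) (simp add: power2_eq_square)
        moreover have "Im (1 / (Complex \<sigma> t - z)) = - (y / (y\<^sup>2 + (\<sigma> - Re z)\<^sup>2))"
          by (simp add: Im_divide y_def add.commute minus_divide_left)
        ultimately show ?thesis by (simp only:)
      qed
      ultimately show "((\<lambda>\<sigma>. - arctan ((\<sigma> - Re z) / y)) has_vector_derivative Im (1 / (Complex \<sigma> t - z))) (at \<sigma> within {x0..x1})"
        by (simp add: has_real_derivative_iff_has_vector_derivative[symmetric] has_field_derivative_at_within)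
    qed
    then show ?thesis by (simp add: y_def)
  qed
  have "((\<lambda>\<sigma>. Im (deriv q (Complex \<sigma> t))) has_integral (Im (q (Complex x1 t)) - Im (q (Complex x0 t)))) {x0..x1}"
  proof (rule fundamental_theorem_of_calculus[OF x])
    fix \<sigma> assume "\<sigma> \<in> {x0..x1}"
    then have "((\<lambda>\<sigma>. q (Complex \<sigma> t)) has_vector_derivative deriv q (Complex \<sigma> t)) (at \<sigma>)"
      by (intro deriv_horizontal holomorphic_derivI[OF q U] seg)
    then show "((\<lambda>\<sigma>. Im (q (Complex \<sigma> t))) has_vector_derivative Im (deriv q (Complex \<sigma> t))) (at \<sigma> within {x0..x1})"
      unfolding has_vector_derivative_complex_iff has_real_derivative_iff_has_vector_derivative[symmetric]
      by (auto intro: has_field_derivative_at_within)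
  qed
  then have "((\<lambda>\<sigma>. Im (deriv q (Complex \<sigma> t)) + (\<Sum>i\<in>A. Im (1 / (Complex \<sigma> t - a i))) - (\<Sum>j\<in>B. Im (1 / (Complex \<sigma> t - b j)))) has_integral
      (Im (q (Complex x1 t)) - Im (q (Complex x0 t))
     + (\<Sum>i\<in>A. - (arctan ((x1 - Re (a i)) / (t - Im (a i))) - arctan ((x0 - Re (a i)) / (t - Im (a i)))))
     - (\<Sum>j\<in>B. - (arctan ((x1 - Re (b j)) / (t - Im (b j))) - arctan ((x0 - Re (b j)) / (t - Im (b j))))))) {x0..x1}"
    using t by (intro has_integral_add has_integral_diff has_integral_sum fin at1) auto
  then have "((\<lambda>\<sigma>. Im (deriv q (Complex \<sigma> t)) + (\<Sum>i\<in>A. Im (1 / (Complex \<sigma> t - a i))) - (\<Sum>j\<in>B. Im (1 / (Complex \<sigma> t - b j)))) has_integral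
      (Im (q (Complex x1 t)) - Im (q (Complex x0 t))
     - (\<Sum>i\<in>A. arctan ((x1 - Re (a i)) / (t - Im (a i))) - arctan ((x0 - Re (a i)) / (t - Im (a i))))
     + (\<Sum>j\<in>B. arctan ((x1 - Re (b j)) / (t - Im (b j))) - arctan ((x0 - Re (b j)) / (t - Im (b j)))))) {x0..x1}"
    by (simp only: sum_negf diff_minus_eq_add add_uminus_conv_diff)
  then show "((\<lambda>\<sigma>. Im (deriv f (Complex \<sigma> t) / f (Complex \<sigma> t))) has_integral
      (Im (q (Complex x1 t)) - Im (q (Complex x0 t))
     - (\<Sum>i\<in>A. arctan ((x1 - Re (a i)) / (t - Im (a i))) - arctan ((x0 - Re (a i)) / (t - Im (a i))))
     + (\<Sum>j\<in>B. arctan ((x1 - Re (b j)) / (t - Im (b j))) - arctan ((x0 - Re (b j)) / (t - Im (b j)))))) {x0..x1}"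
    by (rule has_integral_eq[rotated]) (simp add: ld Im_sum)
qed

text \<open>The differentiated function is the value of \<open>ln_f_integral\<close>, the result
  minus the value of \<open>logderiv_integral\<close>. Since both integrals are explicit,
  Littlewood's lemma needs no contour: it is the Cauchy-Riemann equation for Q together with
  \<open>log_prim_deriv_y\<close> for each zero and pole.\<close>

lemma vertical_deriv:
  assumes Q: "\<And>s. s \<in> U \<Longrightarrow> (Q has_field_derivative q s) (at s)"
    and e: "Complex x0 t \<in> U" "Complex x1 t \<in> U" and t: "t \<notin> Im ` (a ` A \<union> b ` B)"
  shows "((\<lambda>t. Re (Q (Complex x1 t)) - Re (Q (Complex x0 t))
     + (\<Sum>i\<in>A. log_prim (t - Im (a i)) (x1 - Re (a i)) - log_prim (t - Im (a i)) (x0 - Re (a i)))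
     - (\<Sum>j\<in>B. log_prim (t - Im (b j)) (x1 - Re (b j)) - log_prim (t - Im (b j)) (x0 - Re (b j)))) has_real_derivative
      - (Im (q (Complex x1 t)) - Im (q (Complex x0 t))
     - (\<Sum>i\<in>A. arctan ((x1 - Re (a i)) / (t - Im (a i))) - arctan ((x0 - Re (a i)) / (t - Im (a i))))
     + (\<Sum>j\<in>B. arctan ((x1 - Re (b j)) / (t - Im (b j))) - arctan ((x0 - Re (b j)) / (t - Im (b j)))))) (at t)"
proof -
  have dQ: "((\<lambda>t. Re (Q (Complex x t))) has_real_derivative - Im (q (Complex x t))) (at t)" if "Complex x t \<in> U" for x
    using deriv_vertical[OF Q[OF that]] unfolding has_vector_derivative_complex_iff by simp
  have dp: "((\<lambda>t. log_prim (t - c) v) has_real_derivative arctan (v / (t - c))) (at t)" if "t \<noteq> c" for c v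
  proof -
    have "((\<lambda>t. t - c) has_real_derivative 1) (at t)" by (auto intro!: derivative_eq_intros)
    from DERIV_chain2[of "\<lambda>y. log_prim y v" "arctan (v / (t - c))" "\<lambda>t. t - c" t 1 UNIV, OF log_prim_deriv_y this]
    show ?thesis using that by simp
  qed
  have "((\<lambda>t. Re (Q (Complex x1 t)) - Re (Q (Complex x0 t))
     + (\<Sum>i\<in>A. log_prim (t - Im (a i)) (x1 - Re (a i)) - log_prim (t - Im (a i)) (x0 - Re (a i)))
     - (\<Sum>j\<in>B. log_prim (t - Im (b j)) (x1 - Re (b j)) - log_prim (t - Im (b j)) (x0 - Re (b j)))) has_real_derivative
      (- Im (q (Complex x1 t)) - (- Im (q (Complex x0 t)))
     + (\<Sum>i\<in>A. arctan ((x1 - Re (a i)) / (t - Im (a i))) - arctan ((x0 - Re (a i)) / (t - Im (a i))))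
     - (\<Sum>j\<in>B. arctan ((x1 - Re (b j)) / (t - Im (b j))) - arctan ((x0 - Re (b j)) / (t - Im (b j)))))) (at t)"
    using t by (intro DERIV_add DERIV_diff DERIV_sum dQ e dp) auto
  then show ?thesis by (rule DERIV_cong) simp
qed

text \<open>Continuity also at the ordinates excluded in \<open>vertical_deriv\<close>, so the
  derivative can be integrated across them.\<close>

lemma vertical_continuous:
  assumes Q: "\<And>s. s \<in> U \<Longrightarrow> (Q has_field_derivative q s) (at s)"
    and e: "\<And>t. t \<in> T \<Longrightarrow> Complex x0 t \<in> U" "\<And>t. t \<in> T \<Longrightarrow> Complex x1 t \<in> U"
  shows "continuous_on T (\<lambda>t. Re (Q (Complex x1 t)) - Re (Q (Complex x0 t))
     + (\<Sum>i\<in>A. log_prim (t - Im (a i)) (x1 - Re (a i)) - log_prim (t - Im (a i)) (x0 - Re (a i)))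
     - (\<Sum>j\<in>B. log_prim (t - Im (b j)) (x1 - Re (b j)) - log_prim (t - Im (b j)) (x0 - Re (b j))))"
proof -
  have cQ: "continuous_on T (\<lambda>t. Re (Q (Complex x t)))" if "\<And>t. t \<in> T \<Longrightarrow> Complex x t \<in> U" for x
  proof (rule continuous_at_imp_continuous_on, rule ballI)
    fix t assume "t \<in> T"
    have "((\<lambda>t. Re (Q (Complex x t))) has_real_derivative - Im (q (Complex x t))) (at t)"
      using deriv_vertical[OF Q[OF that[OF \<open>t \<in> T\<close>]]] unfolding has_vector_derivative_complex_iff by simp
    then show "isCont (\<lambda>t. Re (Q (Complex x t))) t" by (rule DERIV_isCont)
  qed
  have cp: "continuous_on T (\<lambda>t. log_prim (t - c) v)" for c v
    by (rule continuous_on_compose2[OF continuous_log_prim_y[of UNIV]]) (auto intro!: continuous_intros)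
  show ?thesis by (intro continuous_on_add continuous_on_diff continuous_on_sum cQ e cp)
qed

end

text \<open>On the disc of radius 1/2 the bound on |Re h| worsens only by sqrt 2 < 2.
  Borel-Caratheodory then controls h - h(s) by 8M on radius 1/4, and Cauchy's inequality multiplies
  by 4.\<close>

lemma deriv_decay_from_Re_decay:
  fixes h :: "complex \<Rightarrow> complex"
  assumes h: "h holomorphic_on {s. Re s > 1}" and K: "K > 0"
    and b: "\<And>s. Re s \<ge> 3/2 \<Longrightarrow> \<bar>Re (h s)\<bar> \<le> K * 2 powr (- Re s)"
    and s: "Re s \<ge> 2"
  shows "cmod (deriv h s) \<le> 32 * K * 2 powr (- Re s)"
proof -
  define M where "M = K * 2 powr (- Re s)"
  have M: "M > 0" using K by (simp add: M_def)
  have ReB: "Re z > Re s - 1/2" if "z \<in> ball s (1/2)" for z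
    using abs_Re_le_cmod[of "s - z"] that by (auto simp: dist_norm)
  have small: "\<bar>Re (h z)\<bar> < 2 * M" if z: "z \<in> ball s (1/2)" for z
  proof -
    have "\<bar>Re (h z)\<bar> \<le> K * 2 powr (- Re z)" using ReB[OF z] s by (intro b) auto
    also have "\<dots> \<le> K * (2 powr (1 / 2) * 2 powr (- Re s))"
      unfolding powr_add[symmetric] using ReB[OF z] K by (intro mult_left_mono powr_mono) auto
    also have "2 powr (1/2) * 2 powr (- Re s) < 2 powr 1 * 2 powr (- Re s)"
      by (intro mult_strict_right_mono powr_less_mono) auto
    finally show ?thesis using K by (simp add: M_def mult_ac)
  qed
  have "cmod (h z - h s) \<le> 2 * (4 * M)" if "cmod (z - s) \<le> 1/4" for z
  proof (rule Borel_Caratheodory[where h = h and c = s and z = z and r = "1/2"])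
    show "h holomorphic_on ball s (1/2)" using h by (rule holomorphic_on_subset) (use ReB s in fastforce)
    show "Re (h z) < Re (h s) + 4 * M" if "z \<in> ball s (1/2)" for z
      using small[OF that] small[of s] by auto
  qed (use that in auto)
  then have sb: "cmod (h z - h s) \<le> 8 * M" if "cmod (z - s) \<le> 1/4" for z using that by simp
  have sub: "cball s (1/4) \<subseteq> {s. Re s > 1}"
  proof
    fix z assume "z \<in> cball s (1/4)"
    then have "z \<in> ball s (1/2)" by auto
    from ReB[OF this] s show "z \<in> {s. Re s > 1}" by simp
  qed
  have "cmod ((deriv ^^ 1) (\<lambda>z. h z - h s) s) \<le> fact 1 * (8 * M) / (1/4) ^ 1"
  proof (rule Cauchy_inequality)
    show "(\<lambda>z. h z - h s) holomorphic_on ball s (1/4)"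
      by (intro holomorphic_intros holomorphic_on_subset[OF h] order_trans[OF ball_subset_cball sub])
    show "continuous_on (cball s (1/4)) (\<lambda>z. h z - h s)"
      by (intro continuous_intros holomorphic_on_imp_continuous_on holomorphic_on_subset[OF h] sub)
    show "cmod (h x - h s) \<le> 8 * M" if "cmod (s - x) = 1/4" for x
      using sb[of x] that by (simp add: norm_minus_commute)
  qed simp
  moreover have "deriv (\<lambda>z. h z - h s) s = deriv h s"
  proof -
    have "(h has_field_derivative deriv h s) (at s)"
      using holomorphic_derivI[OF h open_halfspace_Re_gt] s by simp
    then have "((\<lambda>z. h z - h s) has_field_derivative deriv h s) (at s)" by (auto intro!: derivative_eq_intros)
    then show ?thesis by (rule DERIV_imp_deriv)
  qed
  ultimately show ?thesis by (simp add: M_def)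
qed

section \<open>The far right half-line and the logarithm of L\<close>

lemma set_integrable_exp_tail: "set_integrable lborel {2<..} (\<lambda>\<sigma>. 2 powr (- \<sigma>) :: real)"
proof -
  have d: "((\<lambda>\<sigma>. - (2 powr (- \<sigma>) / ln 2)) has_real_derivative 2 powr (- x)) (at x)" for x :: real
    by (auto intro!: derivative_eq_intros)
  have "set_integrable lborel (einterval (ereal 2) \<infinity>) (\<lambda>\<sigma>. 2 powr (- \<sigma>) :: real)"
  proof (rule interval_integral_FTC_nonneg)
    show "DERIV (\<lambda>\<sigma>. - (2 powr (- \<sigma>) / ln 2)) x :> 2 powr (- x)" for x :: real by (rule d)
    show "isCont (\<lambda>\<sigma>. 2 powr (- \<sigma>) :: real) x" for x :: real by (intro continuous_intros) auto
    have "((\<lambda>\<sigma>. - (2 powr (- \<sigma>) / ln 2)) \<longlongrightarrow> - (2 powr (- 2) / ln 2)) (at_right (2::real))"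
      by (intro tendsto_intros) auto
    then show "(((\<lambda>\<sigma>. - (2 powr (- \<sigma>) / ln 2)) \<circ> real_of_ereal) \<longlongrightarrow> - (2 powr (- 2) / ln 2)) (at_right (ereal 2))"
      by (simp only: ereal_tendsto_simps)
    have "((\<lambda>\<sigma>::real. - (2 powr (- \<sigma>) / ln 2)) \<longlongrightarrow> 0) at_top" by real_asymp
    then show "(((\<lambda>\<sigma>. - (2 powr (- \<sigma>) / ln 2)) \<circ> real_of_ereal) \<longlongrightarrow> 0) (at_left \<infinity>)"
      by (simp only: ereal_tendsto_simps)
  qed auto
  then show ?thesis by simp
qed

lemma set_integrable_tail_bound:
  fixes f :: "real \<Rightarrow> 'a :: euclidean_space"
  assumes "continuous_on {2<..} f" "\<And>x. x > 2 \<Longrightarrow> norm (f x) \<le> C * 2 powr (- x)"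
  shows "set_integrable lborel {2<..} f"
proof (rule set_integrable_bound[of _ _ "\<lambda>\<sigma>. C * 2 powr (- \<sigma>)"])
  show "set_integrable lborel {2<..} (\<lambda>\<sigma>. C * 2 powr (- \<sigma>))"
    using set_integrable_exp_tail by (rule set_integrable_mult_right)
  show "set_borel_measurable lborel {2<..} f"
    using borel_measurable_continuous_on_indicator[OF _ assms(1)] by (simp add: set_borel_measurable_def)
  show "AE x in lborel. x \<in> {2<..} \<longrightarrow> norm (f x) \<le> norm (C * 2 powr (- x))"
    using assms(2) by (intro AE_I2) (force intro: order_trans)
qed

text \<open>Used twice: for a logarithm of L, whose derivative is L'/L, and for a primitive of that
  logarithm, whose derivative has real part ln |L|.\<close>

lemma horizontal_tail_FTC:
  fixes F :: "complex \<Rightarrow> complex"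
  assumes F: "F holomorphic_on {s. Re s > 1}"
    and b: "\<And>s. Re s \<ge> 2 \<Longrightarrow> cmod (deriv F s) \<le> C * 2 powr (- Re s)"
    and lim: "\<And>s. Re s \<ge> 2 \<Longrightarrow> cmod (F s - c) \<le> C' * 2 powr (- Re s)"
  shows "set_integrable lborel {2<..} (\<lambda>\<sigma>. deriv F (Complex \<sigma> t))"
    "(LBINT \<sigma>=ereal 2..\<infinity>. deriv F (Complex \<sigma> t)) = c - F (Complex 2 t)"
proof -
  have dF: "(F has_field_derivative deriv F s) (at s)" if "Re s > 1" for s
    using holomorphic_derivI[OF F open_halfspace_Re_gt] that by simp
  have ddF: "deriv F holomorphic_on {s. Re s > 1}" using F open_halfspace_Re_gt by (rule holomorphic_deriv)
  have hc: "continuous_on A (\<lambda>\<sigma>. Complex \<sigma> t)" for A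
    by (auto simp: Complex_eq intro!: continuous_intros)
  have cont: "continuous_on {1<..} (\<lambda>\<sigma>. deriv F (Complex \<sigma> t))"
    by (rule continuous_on_compose2[OF holomorphic_on_imp_continuous_on[OF ddF] hc]) auto
  show int: "set_integrable lborel {2<..} (\<lambda>\<sigma>. deriv F (Complex \<sigma> t))"
    by (rule set_integrable_tail_bound[of _ C])
      (use b[of "Complex _ t"] in \<open>auto intro: continuous_on_subset[OF cont]\<close>)
  have cF: "isCont (\<lambda>\<sigma>. F (Complex \<sigma> t)) 2"
    using deriv_horizontal[OF dF[of "Complex 2 t"]] by (auto intro: has_vector_derivative_continuous)
  show "(LBINT \<sigma>=ereal 2..\<infinity>. deriv F (Complex \<sigma> t)) = c - F (Complex 2 t)"
  proof (rule interval_integral_FTC_integrable)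
    show "((\<lambda>\<sigma>. F (Complex \<sigma> t)) has_vector_derivative deriv F (Complex x t)) (at x)" if "ereal 2 < ereal x" for x
      using that by (intro deriv_horizontal dF) auto
    show "isCont (\<lambda>\<sigma>. deriv F (Complex \<sigma> t)) x" if "ereal 2 < ereal x" for x
      using continuous_on_interior[OF cont, of x] that by (simp add: interior_open)
    show "set_integrable lborel (einterval (ereal 2) \<infinity>) (\<lambda>\<sigma>. deriv F (Complex \<sigma> t))" using int by simp
    have "((\<lambda>\<sigma>. F (Complex \<sigma> t)) \<longlongrightarrow> F (Complex 2 t)) (at_right 2)"
      using cF unfolding isCont_def by (rule tendsto_within_subset) simp
    then show "(((\<lambda>\<sigma>. F (Complex \<sigma> t)) \<circ> real_of_ereal) \<longlongrightarrow> F (Complex 2 t)) (at_right (ereal 2))"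
      by (simp only: ereal_tendsto_simps)
    have "((\<lambda>\<sigma>. F (Complex \<sigma> t) - c) \<longlongrightarrow> 0) at_top"
    proof (rule Lim_null_comparison)
      show "\<forall>\<^sub>F \<sigma> in at_top. cmod (F (Complex \<sigma> t) - c) \<le> C' * 2 powr (- \<sigma>)"
        using eventually_ge_at_top[of "2::real"] by eventually_elim (use lim[of "Complex _ t"] in simp)
      have "((\<lambda>\<sigma>::real. 2 powr (- \<sigma>)) \<longlongrightarrow> 0) at_top" by real_asymp
      then show "((\<lambda>\<sigma>::real. C' * 2 powr (- \<sigma>)) \<longlongrightarrow> 0) at_top" by (rule tendsto_mult_right_zero)
    qed
    then have "((\<lambda>\<sigma>. F (Complex \<sigma> t)) \<longlongrightarrow> c) at_top" by (simp add: LIM_zero_iff)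
    then show "(((\<lambda>\<sigma>. F (Complex \<sigma> t)) \<circ> real_of_ereal) \<longlongrightarrow> c) (at_left \<infinity>)"
      by (simp only: ereal_tendsto_simps)
  qed simp
qed

context L_function
begin

lemma ln_theta_decay:
  "\<exists>C\<ge>0. \<forall>\<sigma>\<ge>3/2. 0 \<le> ln (Z_theta \<theta> \<sigma>) \<and> ln (Z_theta \<theta> \<sigma>) \<le> C * 2 powr (- \<sigma>) \<and> - (C * 2 powr (- \<sigma>)) \<le> ln (z_theta \<theta> \<sigma>)"
proof (intro exI[of _ "2 powr (3/2) * zeta_real (3/2 - \<theta>)"] conjI allI impI)
  define x0 where "x0 = 3/2 - \<theta>"
  have x0: "x0 > 1" using theta_range by (simp add: x0_def)
  have z0: "zeta_real x0 \<ge> 1" by (rule zeta_ge_1[OF x0])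
  then show "0 \<le> 2 powr (3/2) * zeta_real (3/2 - \<theta>)" by (simp add: x0_def)
  fix \<sigma> :: real assume \<sigma>: "\<sigma> \<ge> 3/2"
  have g: "\<sigma> > 1 + \<theta>" using \<sigma> theta_range by simp
  show Z0: "0 \<le> ln (Z_theta \<theta> \<sigma>)" using z_theta_pos(2)[OF g] by simp
  have lz: "ln (zeta_real x) \<le> 2 powr (3/2) * zeta_real x0 * 2 powr (- \<sigma>)" if x: "x \<ge> \<sigma> - \<theta>" for x
  proof -
    have x1: "x0 \<le> x" using x \<sigma> by (simp add: x0_def)
    have "ln (zeta_real x) \<le> zeta_real x - 1" using zeta_ge_1[of x] x0 x1 by (intro ln_le_minus_one) auto
    also have "\<dots> \<le> 2 powr (x0 - x) * zeta_real x0" by (rule zeta_minus_1_bound[OF x0 x1])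
    also have "\<dots> \<le> 2 powr (3/2 - \<sigma>) * zeta_real x0" using x z0 theta_range by (intro mult_right_mono powr_mono) (auto simp: x0_def)
    also have "\<dots> = 2 powr (3/2) * zeta_real x0 * 2 powr (- \<sigma>)" by (simp add: powr_diff powr_minus_divide)
    finally show ?thesis .
  qed
  have x: "\<sigma> - \<theta> > 1" "\<sigma> + \<theta> > 1" "2 * \<sigma> - 2 * \<theta> > 1" "2 * \<sigma> + 2 * \<theta> > 1" using g theta_range by auto
  note z = x[THEN zeta_ge_1]
  have "ln (Z_theta \<theta> \<sigma>) = (ln (zeta_real (\<sigma> + \<theta>)) + ln (zeta_real (\<sigma> - \<theta>))) / 2"
    unfolding Z_theta_def using z by (simp add: ln_sqrt ln_mult)
  then show Z1: "ln (Z_theta \<theta> \<sigma>) \<le> 2 powr (3/2) * zeta_real (3/2 - \<theta>) * 2 powr (- \<sigma>)"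
    using lz[of "\<sigma> + \<theta>"] lz[of "\<sigma> - \<theta>"] theta_range by (simp add: x0_def)
  have "ln (z_theta \<theta> \<sigma>) = (ln (zeta_real (2 * \<sigma> + 2 * \<theta>)) + ln (zeta_real (2 * \<sigma> - 2 * \<theta>))) / 2 - ln (Z_theta \<theta> \<sigma>)"
    unfolding Z_theta_def z_theta_def using z by (simp add: ln_sqrt ln_mult ln_div diff_divide_distrib)
  moreover have gen: "- w \<le> a" if "a = (b + c) / 2 - v" "b \<ge> 0" "c \<ge> 0" "v \<le> w" for a b c v w :: real
  proof -
    have "(b + c) / 2 \<ge> 0" using that by simp
    then show ?thesis using that by linarith
  qed
  moreover have "ln (zeta_real (2 * \<sigma> + 2 * \<theta>)) \<ge> 0" "ln (zeta_real (2 * \<sigma> - 2 * \<theta>)) \<ge> 0" using z by auto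
  ultimately show "- (2 powr (3/2) * zeta_real (3/2 - \<theta>) * 2 powr (- \<sigma>)) \<le> ln (z_theta \<theta> \<sigma>)"
    using Z1 gen by blast
qed

lemma L_holo_right: "L holomorphic_on {s. Re s > 1}"
proof (rule analytic_imp_holomorphic, rule analytic_on_analytic_at[THEN iffD2], rule ballI)
  fix s assume "s \<in> {s. Re s > 1}"
  then show "L analytic_on {s}" using pole_L(3)[of s] by (intro L_analytic) auto
qed

text \<open>The Euler product bounds only ln |L|, the real part of a logarithm; its exponential
  decay passes to the derivative and gives a limit c. A logarithm is fixed only up to an imaginary
  constant, so just Re c = 0 is claimed.\<close>

lemma log_L:
  "\<exists>lg c C. lg holomorphic_on {s. Re s > 1} \<and> (\<forall>s. Re s > 1 \<longrightarrow> L s = exp (lg s)) \<and> C > 0 \<and> Re c = 0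
     \<and> (\<forall>s. Re s \<ge> 2 \<longrightarrow> cmod (deriv lg s) \<le> C * 2 powr (- Re s) \<and> cmod (lg s - c) \<le> C * 2 powr (- Re s))"
proof -
  have o: "open {s. Re s > 1}" by (rule open_halfspace_Re_gt)
  obtain lg where l: "lg holomorphic_on {s. Re s > 1}" "\<And>s. Re s > 1 \<Longrightarrow> L s = exp (lg s)"
  proof (rule holomorphic_logarithm_exists[of "{s. Re s > 1}" L 2])
    show "convex {s. Re s > 1}" by (rule convex_halfspace_Re_gt)
    show "L holomorphic_on {s. Re s > 1}" by (rule L_holo_right)
    show "\<And>z. z \<in> {s. Re s > 1} \<Longrightarrow> L z \<noteq> 0" using L_euler_lim(2) by auto
  qed (use o in auto)
  obtain C where C: "C \<ge> 0" "\<And>\<sigma>. \<sigma> \<ge> 3/2 \<Longrightarrow> ln (Z_theta \<theta> \<sigma>) \<le> C * 2 powr (- \<sigma>)"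
      "\<And>\<sigma>. \<sigma> \<ge> 3/2 \<Longrightarrow> - (C * 2 powr (- \<sigma>)) \<le> ln (z_theta \<theta> \<sigma>)"
    using ln_theta_decay by blast
  define K where "K = real r * C + 1"
  have K: "K > 0" using C by (simp add: K_def add_nonneg_pos)
  have Rel: "\<bar>Re (lg s)\<bar> \<le> K * 2 powr (- Re s)" if s: "Re s \<ge> 3/2" for s
  proof -
    have g: "Re s > 1 + \<theta>" "Re s > 1" using s theta_range by auto
    have e: "ln (cmod (L s)) = Re (lg s)" by (simp add: l(2)[OF g(2)])
    have r1: "real r * ln (Z_theta \<theta> (Re s)) \<le> real r * (C * 2 powr (- Re s))"
      using C(2)[OF s] by (intro mult_left_mono) auto
    have r2: "real r * (- (C * 2 powr (- Re s))) \<le> real r * ln (z_theta \<theta> (Re s))"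
      using C(3)[OF s] by (intro mult_left_mono) auto
    have "K * 2 powr (- Re s) = real r * (C * 2 powr (- Re s)) + 2 powr (- Re s)" by (simp add: K_def algebra_simps)
    moreover have "2 powr (- Re s) \<ge> 0" by simp
    ultimately show ?thesis using ln_L_bounds[OF g(1)] r1 r2 e unfolding abs_le_iff by linarith
  qed
  have d: "cmod (deriv lg s) \<le> 32 * K * 2 powr (- Re s)" if "Re s \<ge> 2" for s
    by (rule deriv_decay_from_Re_decay[OF l(1) K Rel that])
  obtain c where c: "\<And>s. Re s \<ge> 2 \<Longrightarrow> cmod (lg s - c) \<le> 2 * (32 * K) * 2 powr (- Re s)"
    using half_plane_limit[OF l(1) _ d] K by auto
  have "Re c = 0"
  proof -
    have "((\<lambda>x. K * 2 powr (- x) + 2 * (32 * K) * 2 powr (- x)) \<longlongrightarrow> 0) at_top" by real_asymp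
    moreover have "\<forall>\<^sub>F x in at_top. \<bar>Re c\<bar> \<le> K * 2 powr (- x) + 2 * (32 * K) * 2 powr (- x)"
      using eventually_ge_at_top[of 2]
    proof eventually_elim
      case (elim x)
      have "\<bar>Re (lg (of_real x) - c)\<bar> \<le> 2 * (32 * K) * 2 powr (- x)"
        using c[of "of_real x"] abs_Re_le_cmod[of "lg (of_real x) - c"] elim by auto
      moreover have "\<bar>Re (lg (of_real x))\<bar> \<le> K * 2 powr (- x)" using Rel[of "of_real x"] elim by simp
      ultimately show ?case by simp
    qed
    ultimately have "\<bar>Re c\<bar> \<le> 0" by (intro tendsto_lowerbound[of _ 0 at_top]) auto
    then show ?thesis by simp
  qed
  moreover have "cmod (deriv lg s) \<le> (64 * K) * 2 powr (- Re s)" if "Re s \<ge> 2" for s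
  proof -
    have "32 * K * 2 powr (- Re s) \<le> (64 * K) * 2 powr (- Re s)" using K by (intro mult_right_mono) auto
    then show ?thesis using d[OF that] by linarith
  qed
  moreover have "64 * K > 0" using K by simp
  ultimately show ?thesis using l c
    by (intro exI[of _ lg] exI[of _ c] exI[of _ "64 * K"]) (auto simp: mult.assoc[symmetric])
qed

end

section \<open>Littlewood's lemma for L\<close>

lemma set_integrable_sum:
  fixes f :: "'i \<Rightarrow> 'a \<Rightarrow> 'b :: {banach, second_countable_topology}"
  assumes "\<And>i. i \<in> I \<Longrightarrow> set_integrable M A (f i)"
  shows "set_integrable M A (\<lambda>x. \<Sum>i\<in>I. f i x)"
  using assms unfolding set_integrable_def scaleR_sum_right by (rule Bochner_Integration.integrable_sum)

lemma set_integrable_arctan_divide: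
  "set_integrable lborel {a..b::real} (\<lambda>t. arctan (v / (t - c)))"
proof (rule set_integrable_bound[of _ _ "\<lambda>_. pi / 2"])
  show "set_integrable lborel {a..b} (\<lambda>_. pi / 2)"
    by (rule borel_integrable_atLeastAtMost') (intro continuous_intros)
  show "set_borel_measurable lborel {a..b} (\<lambda>t. arctan (v / (t - c)))"
    unfolding set_borel_measurable_def by measurable
  show "AE t in lborel. t \<in> {a..b} \<longrightarrow> norm (arctan (v / (t - c))) \<le> norm (pi / 2)"
  proof (intro AE_I2 impI)
    fix t
    show "norm (arctan (v / (t - c))) \<le> norm (pi / 2)"
      using arctan_bounded[of "v / (t - c)"] by (auto simp: abs_if)
  qed
qed

lemma continuous_on_Complex_horizontal [continuous_intros]: "continuous_on A (\<lambda>\<sigma>. Complex \<sigma> t)"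
  by (auto simp: Complex_eq intro!: continuous_intros)

lemma continuous_on_Complex_vertical [continuous_intros]: "continuous_on A (\<lambda>t. Complex \<sigma> t)"
  by (auto simp: Complex_eq intro!: continuous_intros)

context L_function
begin

lemma log_gam: "\<exists>\<kappa>. \<kappa> holomorphic_on {s. Re s > \<theta>} \<and> (\<forall>s. Re s > \<theta> \<longrightarrow> gam s = exp (\<kappa> s))"
proof -
  obtain \<kappa> where "\<kappa> holomorphic_on {s. Re s > \<theta>}" "\<And>s. s \<in> {s. Re s > \<theta>} \<Longrightarrow> gam s = exp (\<kappa> s)"
  proof (rule holomorphic_logarithm_exists[of "{s. Re s > \<theta>}" gam 2])
    show "convex {s. Re s > \<theta>}" by (rule convex_halfspace_Re_gt)
    show "\<And>z. z \<in> {s. Re s > \<theta>} \<Longrightarrow> gam z \<noteq> 0" using gam_nz by auto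
  qed (use open_halfspace_Re_gt gam_holo theta_range in auto)
  then show ?thesis by auto
qed

text \<open>J(t) is the integral of ln |L| from 1/2 to 2 and W(t) that of Im (L'/L). Both become
  explicit because L is \<open>Xi\<close> divided by the gamma factor and P(s) P(s - 1), and one
  disc covers all heights up to T. E collects the ordinates of the listed zeros and of the zeros of
  P(s) P(s - 1).\<close>

lemma inner_segment:
  "\<exists>E J W. finite E \<and> continuous_on {-T..T} J \<and> set_integrable lborel {-T..T} W
     \<and> (\<forall>t\<in>{-T..T}. ((\<lambda>\<sigma>. ln (cmod (L (Complex \<sigma> t)))) has_integral J t) {1/2..2})
     \<and> (\<forall>t\<in>{-T..T}-E. (J has_real_derivative - W t) (at t)
          \<and> continuous_on {1/2..2} (\<lambda>\<sigma>. deriv L (Complex \<sigma> t) / L (Complex \<sigma> t))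
          \<and> ((\<lambda>\<sigma>. Im (deriv L (Complex \<sigma> t) / L (Complex \<sigma> t))) has_integral W t) {1/2..2})"
proof -
  define R where "R = \<bar>T\<bar> + 10"
  have R: "R > 0" by (simp add: R_def)
  have z2: "Xi 2 \<noteq> 0" by (rule Xi_right_nz) simp
  have a: "0 \<le> (3/2 :: real)" "(3/2 :: real) < 2" "0 < (1::real)" by auto
  obtain n :: nat and A k where "\<And>i. i < n \<Longrightarrow> Xi (A i) = 0" and k: "k holomorphic_on ball 2 R"
    "\<And>z. z \<in> ball 2 R \<Longrightarrow> Xi z = exp (k z) * (\<Prod>i<n. z - A i)"
    and "\<And>z w. z \<in> ball 2 R \<Longrightarrow> w \<in> ball 2 R \<Longrightarrow> cmod (deriv k z - deriv k w) \<le> 1 * cmod (z - w)"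
    using entire_local_factorization[OF Xi_holo z2 exp_growth_Xi a(1,2) R a(3)] by blast
  obtain \<kappa> where kp: "\<kappa> holomorphic_on {s. Re s > \<theta>}" "\<And>s. Re s > \<theta> \<Longrightarrow> gam s = exp (\<kappa> s)"
    using log_gam by blast
  define U where "U = ball 2 R \<inter> {s. Re s > \<theta>}"
  define q where "q = (\<lambda>s. k s - \<kappa> s)"
  \<comment> \<open>The pair (i, k) stands for the point i + \<open>lam k\<close>, so the product
    over B is P(s) P(s - 1) with multiplicities.\<close>
  define b where "b = (\<lambda>(i::nat, k). of_nat i + lam k :: complex)"
  define B where "B = {0::nat, 1} \<times> {1..m}"
  have U: "open U" "convex U"
    unfolding U_def by (auto intro!: open_Int open_halfspace_Re_gt convex_Int convex_halfspace_Re_gt)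
  have q: "q holomorphic_on U"
    unfolding q_def by (intro holomorphic_intros holomorphic_on_subset[OF k(1)] holomorphic_on_subset[OF kp(1)])
      (auto simp: U_def)
  have Bprod: "(\<Prod>j\<in>B. s - b j) = Ppoly s * Ppoly (s - 1)" for s
  proof -
    have "(\<Prod>j\<in>B. s - b j) = (\<Prod>i\<in>{0::nat, 1}. \<Prod>k\<in>{1..m}. s - (of_nat i + lam k))"
      unfolding B_def prod.cartesian_product by (intro prod.cong) (auto simp: b_def)
    then show ?thesis by (simp add: Ppoly_def diff_diff_eq)
  qed
  have eq: "L s * (\<Prod>j\<in>B. s - b j) = exp (q s) * (\<Prod>i<n. s - A i)" if s: "s \<in> U" "s \<notin> b ` B" for s
  proof -
    have np: "\<not> is_pole L s"
    proof
      assume "is_pole L s"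
      then obtain k where "k \<in> {1..m}" "s = 1 + lam k" using pole_L_iff by blast
      then have "s = b (1, k)" "(1, k) \<in> B" by (auto simp: b_def B_def)
      then show False using s(2) by blast
    qed
    have "exp (k s) * (\<Prod>i<n. s - A i) = Ppoly s * exp (\<kappa> s) * (Ppoly (s - 1) * L s)"
      using k(2)[of s] Xi_right[of s] kp(2)[of s] Lhat_eq(2)[OF np] s(1) by (simp add: U_def Xi0_def)
    then show ?thesis unfolding Bprod q_def exp_diff by (simp add: field_simps)
  qed
  interpret F: log_factor L q U "{..<n}" A B b
    by unfold_locales (use U q eq in \<open>auto simp: B_def\<close>)
  obtain Q where Q: "\<And>s. s \<in> U \<Longrightarrow> (Q has_field_derivative q s) (at s)"
    using holomorphic_convex_primitive'[OF U(2,1) q] at_within_open[OF _ U(1)] by metis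
  have seg: "Complex \<sigma> t \<in> U" if "t \<in> {-T..T}" "\<sigma> \<in> {1/2..2}" for \<sigma> t
  proof -
    have "cmod (2 - Complex \<sigma> t) \<le> \<bar>Re (2 - Complex \<sigma> t)\<bar> + \<bar>Im (2 - Complex \<sigma> t)\<bar>" by (rule cmod_le)
    also have "\<dots> < R" using that by (auto simp: R_def)
    finally show ?thesis using that theta_range by (auto simp: U_def dist_norm)
  qed
  define E where "E = Im ` (A ` {..<n} \<union> b ` B)"
  define J where "J = (\<lambda>t. Re (Q (Complex 2 t)) - Re (Q (Complex (1/2) t))
     + (\<Sum>i<n. log_prim (t - Im (A i)) (2 - Re (A i)) - log_prim (t - Im (A i)) (1/2 - Re (A i)))
     - (\<Sum>j\<in>B. log_prim (t - Im (b j)) (2 - Re (b j)) - log_prim (t - Im (b j)) (1/2 - Re (b j))))"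
  define W where "W = (\<lambda>t. Im (q (Complex 2 t)) - Im (q (Complex (1/2) t))
     - (\<Sum>i<n. arctan ((2 - Re (A i)) / (t - Im (A i))) - arctan ((1/2 - Re (A i)) / (t - Im (A i))))
     + (\<Sum>j\<in>B. arctan ((2 - Re (b j)) / (t - Im (b j))) - arctan ((1/2 - Re (b j)) / (t - Im (b j)))))"
  have "finite E" using F.fin by (simp add: E_def)
  moreover have "continuous_on {-T..T} J"
    unfolding J_def by (rule F.vertical_continuous[OF Q]) (auto intro!: seg)
  moreover have "set_integrable lborel {-T..T} W"
  proof -
    have cq: "set_integrable lborel {-T..T} (\<lambda>t. Im (q (Complex x t)))" if "x \<in> {1/2..2}" for x
    proof (rule borel_integrable_atLeastAtMost')
      have "continuous_on {-T..T} (\<lambda>t. q (Complex x t))"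
        by (rule continuous_on_compose2[OF holomorphic_on_imp_continuous_on[OF q]])
           (use seg that in \<open>auto intro!: continuous_intros\<close>)
      then show "continuous_on {-T..T} (\<lambda>t. Im (q (Complex x t)))" by (intro continuous_intros)
    qed
    show ?thesis unfolding W_def
      by (intro set_integral_add(1) set_integral_diff(1) set_integrable_sum set_integrable_arctan_divide cq) auto
  qed
  moreover have "((\<lambda>\<sigma>. ln (cmod (L (Complex \<sigma> t)))) has_integral J t) {1/2..2}" if "t \<in> {-T..T}" for t
    unfolding J_def by (rule F.ln_f_integral[OF Q]) (use seg that in auto)
  moreover have "(J has_real_derivative - W t) (at t)
          \<and> continuous_on {1/2..2} (\<lambda>\<sigma>. deriv L (Complex \<sigma> t) / L (Complex \<sigma> t))
          \<and> ((\<lambda>\<sigma>. Im (deriv L (Complex \<sigma> t) / L (Complex \<sigma> t))) has_integral W t) {1/2..2}" if t: "t \<in> {-T..T} - E" for t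
  proof (intro conjI)
    have tt: "t \<in> {-T..T}" "t \<notin> Im ` (A ` {..<n} \<union> b ` B)" using t by (auto simp: E_def)
    show "(J has_real_derivative - W t) (at t)"
      unfolding J_def W_def by (rule F.vertical_deriv[OF Q _ _ tt(2)]) (use seg tt in auto)
    show "continuous_on {1/2..2} (\<lambda>\<sigma>. deriv L (Complex \<sigma> t) / L (Complex \<sigma> t))"
      by (rule F.logderiv_integral(1)[OF _ _ tt(2)]) (use seg tt in auto)
    show "((\<lambda>\<sigma>. Im (deriv L (Complex \<sigma> t) / L (Complex \<sigma> t))) has_integral W t) {1/2..2}"
      unfolding W_def by (rule F.logderiv_integral(2)[OF _ _ tt(2)]) (use seg tt in auto)
  qed
  ultimately show ?thesis by blast
qed

lemma countable_Xi_zeros: "countable {z \<in> UNIV. Xi z = 0}"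
proof (cases "Xi constant_on UNIV")
  case True
  moreover have "Xi 2 \<noteq> 0" by (rule Xi_right_nz) simp
  ultimately have "{z \<in> UNIV. Xi z = 0} = {}" by (auto simp: constant_on_def)
  then show ?thesis by simp
next
  case False
  then show ?thesis by (intro holomorphic_countable_zeros Xi_holo fsigma_UNIV) auto
qed

text \<open>Away from the finitely many \<open>lam k\<close> and 1 + \<open>lam k\<close>, \<Lambda>
  is regular and its zeros are zeros of \<open>Xi\<close>. Hence the limits that define
  \<open>S_fun\<close> at singular ordinates never affect its integral.\<close>

lemma countable_singular: "countable {t. singular_ordinate Lam t}"
proof -
  define P where "P = lam ` {1..m} \<union> (\<lambda>k. 1 + lam k) ` {1..m}"
  have fP: "finite P" by (simp add: P_def)
  have "{t. singular_ordinate Lam t} \<subseteq> Im ` ({z \<in> UNIV. Xi z = 0} \<union> P)"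
  proof
    fix t assume "t \<in> {t. singular_ordinate Lam t}"
    then obtain z where z: "Im z = t" "Lam z = 0 \<or> is_pole Lam z" by (auto simp: singular_ordinate_def)
    have "Xi z = 0" if zP: "z \<notin> P"
    proof -
      have "\<not> is_pole Lam z"
      proof -
        have P0: "Ppoly w \<noteq> 0" if "w \<notin> lam ` {1..m}" for w
          using that by (auto simp: Ppoly_def)
        have nz: "Ppoly w * Ppoly (w - 1) \<noteq> 0" if "w \<notin> P" for w
        proof -
          have "w - 1 \<notin> lam ` {1..m}"
          proof
            assume "w - 1 \<in> lam ` {1..m}"
            then obtain k where "k \<in> {1..m}" "w = 1 + lam k" by (metis add.commute diff_add_cancel image_iff)
            then show False using that by (auto simp: P_def)
          qed
          then show ?thesis using P0[of w] P0[of "w - 1"] that by (simp add: P_def)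
        qed
        have o: "open (- P)" using fP by (intro open_Compl finite_imp_closed)
        have "(\<lambda>s. Xi s / (Ppoly s * Ppoly (s - 1))) holomorphic_on - P"
          by (intro holomorphic_intros holomorphic_on_subset[OF Xi_holo]) (use nz in auto)
        then have "Lam holomorphic_on - P"
        proof (rule holomorphic_transform)
          fix s assume "s \<in> - P"
          then show "Xi s / (Ppoly s * Ppoly (s - 1)) = Lam s"
            using nz[of s] Xi_Lam[of s] by (simp add: P_def)
        qed
        then show ?thesis using o zP by (intro not_is_pole_holomorphic) auto
      qed
      then have "Lam z = 0" using z by blast
      then show ?thesis using Xi_Lam[of z] zP by (simp add: P_def)
    qed
    then show "t \<in> Im ` ({z \<in> UNIV. Xi z = 0} \<union> P)" using z(1) by blast
  qed
  moreover have "countable (Im ` ({z \<in> UNIV. Xi z = 0} \<union> P))"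
    using countable_Xi_zeros fP by (intro countable_image countable_Un) (auto intro: countable_finite)
  ultimately show ?thesis by (rule countable_subset)
qed

text \<open>The segment from 1/2 to 2 is joined to the tail beyond 2, where the logarithm of L is
  available. The derivative of the total integral of ln |L| in t comes out as pi S(t), apart from
  finitely many t.\<close>

lemma littlewood_local:
  "\<exists>E F V. finite E \<and> continuous_on {-T..T} F \<and> set_integrable lborel {-T..T} V
     \<and> (\<forall>t\<in>{-T..T}. ((\<lambda>\<sigma>. ln (cmod (L (Complex \<sigma> t)))) has_integral F t) {1/2..})
     \<and> (\<forall>t\<in>{-T..T}-E. (F has_real_derivative V t) (at t) \<and> pi * S_regular L t = V t)"
proof -
  obtain E J W where E: "finite E" and J: "continuous_on {-T..T} J" and W: "set_integrable lborel {-T..T} W"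
    and JL: "\<And>t. t \<in> {-T..T} \<Longrightarrow> ((\<lambda>\<sigma>. ln (cmod (L (Complex \<sigma> t)))) has_integral J t) {1/2..2}"
    and JW: "\<And>t. t \<in> {-T..T}-E \<Longrightarrow> (J has_real_derivative - W t) (at t)"
    and cW: "\<And>t. t \<in> {-T..T}-E \<Longrightarrow> continuous_on {1/2..2} (\<lambda>\<sigma>. deriv L (Complex \<sigma> t) / L (Complex \<sigma> t))"
    and iW: "\<And>t. t \<in> {-T..T}-E \<Longrightarrow> ((\<lambda>\<sigma>. Im (deriv L (Complex \<sigma> t) / L (Complex \<sigma> t))) has_integral W t) {1/2..2}"
    using inner_segment[of T] by blast
  obtain lg c C where lg: "lg holomorphic_on {s. Re s > 1}" "\<And>s. Re s > 1 \<Longrightarrow> L s = exp (lg s)" and C: "C > 0"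
    and c: "Re c = 0" and dlg: "\<And>s. Re s \<ge> 2 \<Longrightarrow> cmod (deriv lg s) \<le> C * 2 powr (- Re s)"
    and llg: "\<And>s. Re s \<ge> 2 \<Longrightarrow> cmod (lg s - c) \<le> C * 2 powr (- Re s)"
    using log_L by blast
  have o: "open {s. Re s > 1}" by (rule open_halfspace_Re_gt)
  \<comment> \<open>Subtracting c makes the integrand decay, so the primitive has a limit d. Real
    parts are unaffected because Re c = 0.\<close>
  obtain K where K: "\<And>s. Re s > 1 \<Longrightarrow> (K has_field_derivative lg s - c) (at s)"
  proof (rule holomorphic_convex_primitive'[of "{s. Re s > 1}" "\<lambda>s. lg s - c"])
    show "convex {s. Re s > 1}" by (rule convex_halfspace_Re_gt)
    show "(\<lambda>s. lg s - c) holomorphic_on {s. 1 < Re s}" by (intro holomorphic_intros lg)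
  qed (use o at_within_open[OF _ o] in auto)
  have Kh: "K holomorphic_on {s. Re s > 1}"
    using K by (intro holomorphic_on_open[THEN iffD2] o) auto
  have dK: "deriv K s = lg s - c" if "Re s > 1" for s using K[OF that] by (rule DERIV_imp_deriv)
  have dKb: "cmod (deriv K s) \<le> C * 2 powr (- Re s)" if "Re s \<ge> 2" for s
    using llg[OF that] dK[of s] that by simp
  obtain d where d: "\<And>s. Re s \<ge> 2 \<Longrightarrow> cmod (K s - d) \<le> 2 * C * 2 powr (- Re s)"
    using half_plane_limit[OF Kh _ dKb] C by auto
  have lnL: "ln (cmod (L s)) = Re (lg s - c)" if "Re s > 1" for s
    using lg(2)[OF that] c by simp
  have dlL: "deriv lg s = deriv L s / L s" if s: "Re s > 1" for s
  proof -
    have "(lg has_field_derivative deriv lg s) (at s)" using holomorphic_derivI[OF lg(1) o] s by simp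
    from DERIV_chain2[OF DERIV_exp this]
    have "((\<lambda>s. exp (lg s)) has_field_derivative exp (lg s) * deriv lg s) (at s)" .
    then have "(L has_field_derivative exp (lg s) * deriv lg s) (at s)"
      by (rule has_field_derivative_transform_within_open[OF _ o]) (use lg(2) s in auto)
    then have "deriv L s = L s * deriv lg s" using lg(2)[OF s] by (simp add: DERIV_imp_deriv)
    then show ?thesis using L_euler_lim(2)[OF s] by simp
  qed
  define F where "F = (\<lambda>t. J t + (Re d - Re (K (Complex 2 t))))"
  \<comment> \<open>Minus the imaginary part of the integral of L'/L over the whole ray; the sign
    agrees with S, whose integral runs from infinity down to 1/2.\<close>
  define V where "V = (\<lambda>t. - W t + Im (lg (Complex 2 t) - c))"
  have sp: "{1/2..} = {1/2..2::real} \<union> {2<..}" by auto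
  have "continuous_on {-T..T} F"
  proof -
    have "continuous_on {-T..T} (\<lambda>t. K (Complex 2 t))"
      by (rule continuous_on_compose2[OF holomorphic_on_imp_continuous_on[OF Kh]])
         (auto intro!: continuous_intros)
    then show ?thesis unfolding F_def by (intro continuous_intros J)
  qed
  moreover have "set_integrable lborel {-T..T} V"
  proof -
    have "continuous_on {-T..T} (\<lambda>t. lg (Complex 2 t))"
      by (rule continuous_on_compose2[OF holomorphic_on_imp_continuous_on[OF lg(1)]])
         (auto intro!: continuous_intros)
    then have "set_integrable lborel {-T..T} (\<lambda>t. Im (lg (Complex 2 t) - c))"
      by (intro borel_integrable_atLeastAtMost' continuous_intros)
    then have "set_integrable lborel {-T..T} (\<lambda>t. Im (lg (Complex 2 t) - c) - W t)"
      by (intro set_integral_diff(1) W)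
    then show ?thesis unfolding V_def by simp
  qed
  moreover have "((\<lambda>\<sigma>. ln (cmod (L (Complex \<sigma> t)))) has_integral F t) {1/2..}" if t: "t \<in> {-T..T}" for t
  proof -
    note h = horizontal_tail_FTC[OF Kh dKb d, of t]
    have e: "(LBINT \<sigma>=ereal 2..\<infinity>. deriv K (Complex \<sigma> t)) = integral {2<..} (\<lambda>\<sigma>. deriv K (Complex \<sigma> t))"
      using interval_integral_eq_integral'[of "ereal 2" \<infinity> "\<lambda>\<sigma>. deriv K (Complex \<sigma> t)"] h(1) by simp
    have "((\<lambda>\<sigma>. deriv K (Complex \<sigma> t)) has_integral (d - K (Complex 2 t))) {2<..}"
      using set_borel_integral_eq_integral(1)[OF h(1)] h(2) unfolding e by (simp add: has_integral_iff)
    from has_integral_linear[OF this bounded_linear_Re]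
    have "((\<lambda>\<sigma>. Re (deriv K (Complex \<sigma> t))) has_integral (Re d - Re (K (Complex 2 t)))) {2<..}" by (simp add: o_def)
    then have "((\<lambda>\<sigma>. ln (cmod (L (Complex \<sigma> t)))) has_integral (Re d - Re (K (Complex 2 t)))) {2<..}"
      by (rule has_integral_eq[rotated]) (simp add: lnL dK)
    moreover have "{1/2..2} \<inter> {2<..} = ({} :: real set)" by auto
    ultimately show ?thesis unfolding F_def sp using has_integral_Un[OF JL[OF t]] by auto
  qed
  moreover have "(F has_real_derivative V t) (at t) \<and> pi * S_regular L t = V t" if t: "t \<in> {-T..T} - E" for t
  proof
    have "((\<lambda>t. Re (K (Complex 2 t))) has_real_derivative - Im (lg (Complex 2 t) - c)) (at t)"
      using deriv_vertical[OF K[of "Complex 2 t"]] unfolding has_vector_derivative_complex_iff by simp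
    then have "(F has_real_derivative - W t + (0 - - Im (lg (Complex 2 t) - c))) (at t)"
      unfolding F_def by (intro DERIV_add DERIV_diff DERIV_const JW t)
    then show "(F has_real_derivative V t) (at t)" by (simp add: V_def)
    define g where "g = (\<lambda>\<sigma>. deriv L (Complex \<sigma> t) / L (Complex \<sigma> t))"
    note h = horizontal_tail_FTC[OF lg(1) dlg llg, of t]
    have g2: "set_integrable lborel {2<..} g"
      using h(1) by (rule set_integrable_cong[THEN iffD1, rotated -1]) (auto simp: g_def dlL)
    have g1: "set_integrable lborel {1/2..2} g"
      unfolding g_def by (rule borel_integrable_atLeastAtMost'[OF cW[OF t]])
    have "set_integrable lborel ({1/2..2} \<union> {2<..}) g" by (intro set_integrable_Un g1 g2) auto
    then have g3: "set_integrable lborel {1/2<..} g" by (rule set_integrable_subset) auto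
    have "(LBINT \<sigma>=ereal (1/2)..ereal 2. g \<sigma>) + (LBINT \<sigma>=ereal 2..\<infinity>. g \<sigma>) = (LBINT \<sigma>=ereal (1/2)..\<infinity>. g \<sigma>)"
      using g3 by (intro interval_integral_sum) (simp add: interval_lebesgue_integrable_def)
    moreover have "(LBINT \<sigma>=ereal 2..\<infinity>. g \<sigma>) = c - lg (Complex 2 t)"
    proof -
      have "(LBINT \<sigma>=ereal 2..\<infinity>. g \<sigma>) = (LBINT \<sigma>=ereal 2..\<infinity>. deriv lg (Complex \<sigma> t))"
        by (rule interval_integral_cong) (auto simp: g_def dlL min_def)
      then show ?thesis using h(2) by simp
    qed
    moreover have "Im (LBINT \<sigma>=ereal (1/2)..ereal 2. g \<sigma>) = W t"
    proof -
      have "(LBINT \<sigma>=ereal (1/2)..ereal 2. g \<sigma>) = integral {1/2..2} g"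
        by (rule interval_integral_eq_integral[OF _ g1]) simp
      moreover have "(g has_integral integral {1/2..2} g) {1/2..2}"
        using set_borel_integral_eq_integral(1)[OF g1] by (rule integrable_integral)
      from has_integral_linear[OF this bounded_linear_Im]
      have "((\<lambda>\<sigma>. Im (g \<sigma>)) has_integral Im (integral {1/2..2} g)) {1/2..2}" by (simp add: o_def)
      then have "Im (integral {1/2..2} g) = W t"
        using iW[OF t] unfolding g_def by (rule has_integral_unique)
      ultimately show ?thesis by simp
    qed
    moreover have "pi * S_regular L t = - Im (LBINT \<sigma>=ereal (1/2)..\<infinity>. g \<sigma>)"
      unfolding S_regular_def g_def by (subst interval_integral_endpoints_reverse) simp
    ultimately have "pi * S_regular L t = - (W t + Im (c - lg (Complex 2 t)))"
      by (metis plus_complex.sel(2))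
    then show "pi * S_regular L t = V t" by (simp add: V_def)
  qed
  ultimately show ?thesis using E by blast
qed

text \<open>The local statement is applied on an interval containing both heights. It is proved for
  ordered endpoints and extended by reversing the orientation, so \<open>t1\<close> and
  \<open>t2\<close> may come in either order.\<close>

lemma littlewood:
  "(\<lambda>\<sigma>. ln (cmod (L (Complex \<sigma> t)))) integrable_on {1/2..}"
  "pi * (LBINT t=ereal t1..ereal t2. S_fun Lam L t)
     = integral {1/2..} (\<lambda>\<sigma>. ln (cmod (L (Complex \<sigma> t2)))) - integral {1/2..} (\<lambda>\<sigma>. ln (cmod (L (Complex \<sigma> t1))))"
proof -
  define G where "G = (\<lambda>t. integral {1/2..} (\<lambda>\<sigma>. ln (cmod (L (Complex \<sigma> t)))))"
  show "(\<lambda>\<sigma>. ln (cmod (L (Complex \<sigma> t)))) integrable_on {1/2..}"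
  proof -
    have "t \<in> {-\<bar>t\<bar>..\<bar>t\<bar>}" by auto
    then show ?thesis using littlewood_local[of "\<bar>t\<bar>"] unfolding integrable_on_def by blast
  qed
  have main: "pi * (LBINT t=ereal a..ereal b. S_fun Lam L t) = G b - G a" if ab: "a \<le> b" for a b
  proof -
    define T where "T = max \<bar>a\<bar> \<bar>b\<bar>"
    have sub: "{a..b} \<subseteq> {-T..T}" by (auto simp: T_def)
    obtain E F V where E: "finite E" and F: "continuous_on {-T..T} F" and V: "set_integrable lborel {-T..T} V"
      and FL: "\<And>t. t \<in> {-T..T} \<Longrightarrow> ((\<lambda>\<sigma>. ln (cmod (L (Complex \<sigma> t)))) has_integral F t) {1/2..}"
      and FV: "\<And>t. t \<in> {-T..T}-E \<Longrightarrow> (F has_real_derivative V t) (at t)"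
      and SV: "\<And>t. t \<in> {-T..T}-E \<Longrightarrow> pi * S_regular L t = V t"
      using littlewood_local[of T] by blast
    have GF: "G t = F t" if "t \<in> {a..b}" for t
      using FL[of t] that sub unfolding G_def by (auto intro: integral_unique)
    have V': "set_integrable lborel {a..b} (\<lambda>t. V t / pi)"
      using set_integrable_subset[OF V _ sub] by simp
    have "(LBINT t=ereal a..ereal b. S_fun Lam L t) = (LBINT t=ereal a..ereal b. V t / pi)"
    \<comment> \<open>The integrands differ only at singular ordinates and at the finitely many
      exceptions of the local statement.\<close>
    proof (rule interval_integral_discrete_difference[of "E \<union> {t. singular_ordinate Lam t}"])
      show "countable (E \<union> {t. singular_ordinate Lam t})"
        using E countable_singular by (intro countable_Un) (auto intro: countable_finite)
      show "S_fun Lam L x = V x / pi" if "ereal a < ereal x" "ereal x < ereal b" "x \<notin> E \<union> {t. singular_ordinate Lam t}" for x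
        using SV[of x] that sub by (auto simp: S_fun_def field_simps)
    qed (use ab in auto)
    also have "\<dots> = integral {a..b} (\<lambda>t. V t / pi)"
      by (rule interval_integral_eq_integral[OF ab V'])
    also have "(V has_integral (F b - F a)) {a..b}"
    proof (rule fundamental_theorem_of_calculus_interior_strong[OF E ab])
      show "continuous_on {a..b} F" using F sub by (rule continuous_on_subset)
      show "(F has_vector_derivative V x) (at x)" if "x \<in> {a<..<b} - E" for x
        using FV[of x] that sub by (auto simp: has_real_derivative_iff_has_vector_derivative)
    qed
    from has_integral_divide[OF this, of pi] have "integral {a..b} (\<lambda>t. V t / pi) = (F b - F a) / pi"
      by (rule integral_unique)
    finally show ?thesis using GF ab by simp
  qed
  have "pi * (LBINT t=ereal t1..ereal t2. S_fun Lam L t) = G t2 - G t1"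
  proof (cases "t1 \<le> t2")
    case False
    then have "pi * (LBINT t=ereal t2..ereal t1. S_fun Lam L t) = G t1 - G t2" by (intro main) simp
    then show ?thesis using interval_integral_endpoints_reverse[of "ereal t1" "ereal t2" "S_fun Lam L"] by simp
  qed (rule main)
  then show "pi * (LBINT t=ereal t1..ereal t2. S_fun Lam L t)
     = integral {1/2..} (\<lambda>\<sigma>. ln (cmod (L (Complex \<sigma> t2)))) - integral {1/2..} (\<lambda>\<sigma>. ln (cmod (L (Complex \<sigma> t1))))"
    by (simp only: G_def)
qed

end

section \<open>Bounds in the strip\<close>

context L_function
begin

lemma Re_mu_lower: "j \<in> {1..r} \<Longrightarrow> Re (\<mu> j) > -1/2"
  using mu_bound[of j] theta_range by simp

lemma ln_norm_Q:
  assumes "\<And>j. j \<in> {1..r} \<Longrightarrow> s + \<mu> j \<noteq> 0"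
  shows "cmod (Q_fun r N \<mu> s) > 0"
    "ln (cmod (Q_fun r N \<mu> s)) = ln (real N) + (\<Sum>j=1..r. ln (cmod (s + \<mu> j) / (2 * pi)))"
proof -
  have "cmod (Q_fun r N \<mu> s) = real N * (\<Prod>j=1..r. cmod (s + \<mu> j) / (2 * pi))"
    by (simp add: Q_fun_def norm_mult prod_norm[symmetric] norm_divide)
  moreover have "(\<Prod>j=1..r. cmod (s + \<mu> j) / (2 * pi)) > 0" using assms by (intro prod_pos) auto
  moreover have "ln (\<Prod>j=1..r. cmod (s + \<mu> j) / (2 * pi)) = (\<Sum>j=1..r. ln (cmod (s + \<mu> j) / (2 * pi)))"
    using assms by (intro ln_prod) auto
  ultimately show "cmod (Q_fun r N \<mu> s) > 0"
    "ln (cmod (Q_fun r N \<mu> s)) = ln (real N) + (\<Sum>j=1..r. ln (cmod (s + \<mu> j) / (2 * pi)))"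
    using conductor_pos by (auto simp: ln_mult_pos)
qed

text \<open>The functional equation reflects s to s + 2, on the line Re = 3/2. P(s + 1) and P(s)
  have equal modulus, their real offsets being 1/2 and -1/2, and cancel; the gamma factors give Q by
  \<open>gam_shift\<close>.\<close>

lemma Lhat_left_bound:
  assumes s: "Re s = -1/2"
  shows "cmod (Lhat s) = cmod (Ppoly (s + 2)) * cmod (L (s + 2)) * cmod (Q_fun r N \<mu> s)"
proof -
  have w: "1 - cnj s = s + 2" using s by (simp add: complex_eq_iff)
  have np: "\<not> is_pole L (s + 2)" using pole_L(3)[of "s + 2"] s by auto
  have "Re s < 1 - \<theta>" using s theta_range by simp
  from Xi_left[OF this] have "cmod (Xi s) = cmod (Xi0 (s + 2))" by (simp add: w)
  also have "\<dots> = cmod (Ppoly (s + 2)) * cmod (gam (s + 2)) * (cmod (Ppoly (s + 1)) * cmod (L (s + 2)))"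
    using Lhat_eq(2)[OF np] by (simp add: Xi0_def norm_mult add.commute)
  finally have "cmod (Lhat s) * cmod (Ppoly s) = cmod (Ppoly (s + 2)) * cmod (L (s + 2)) * (cmod (gam (s + 2)) * cmod (rgam s)) * cmod (Ppoly (s + 1))"
    using arg_cong[OF Lhat_Ppoly[of s], of cmod] by (simp add: norm_mult mult_ac)
  also have "cmod (gam (s + 2)) * cmod (rgam s) = cmod (Q_fun r N \<mu> s)" by (rule gam_shift[OF s])
  also have "cmod (Ppoly (s + 1)) = cmod (Ppoly s)"
    unfolding Ppoly_def prod_norm[symmetric]
    by (intro prod.cong refl) (simp add: cmod_def lambda_imaginary s)
  finally show ?thesis using Ppoly_nz[of s] s by simp
qed

lemma norm_L_le_Z: "Re s > 1 + \<theta> \<Longrightarrow> cmod (L s) \<le> Z_theta \<theta> (Re s) ^ r"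
proof -
  assume s: "Re s > 1 + \<theta>"
  have Z: "Z_theta \<theta> (Re s) \<ge> 1" by (rule z_theta_pos(2)[OF s])
  have L: "cmod (L s) > 0" using L_euler_lim(2)[of s] s theta_range by simp
  have "ln (cmod (L s)) \<le> ln (Z_theta \<theta> (Re s) ^ r)" using ln_L_bounds(1)[OF s] Z by (simp add: ln_realpow)
  then show ?thesis using L Z by (subst (asm) ln_le_cancel_iff) auto
qed

text \<open>Convexity for J = Lhat / P(s + 2) with H a logarithm of Q(s + 2). The shift by 2 keeps
  all arguments of the logarithms in the right half-plane, so that H is holomorphic with Re H' >
  0.\<close>

lemma Lhat_strip_bound:
  assumes s: "-1/2 \<le> Re s" "Re s \<le> 3/2"
  shows "cmod (Lhat s) \<le> cmod (Ppoly (s + 2)) * (Z_theta \<theta> (3/2) ^ r * exp ((3/2 - Re s) / 2 * ln (cmod (Q_fun r N \<mu> (s + 2)))))"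
proof -
  \<comment> \<open>P(s + 2) cancels exactly on the left edge, and on the right edge it dominates
    P(s - 1), with real offsets 7/2 and 1/2.\<close>
  define J where "J = (\<lambda>s. Lhat s / Ppoly (s + 2))"
  define H where "H = (\<lambda>s. of_real (ln (real N)) + (\<Sum>j=1..r. Ln ((s + 2 + \<mu> j) / (2 * of_real pi))))"
  define A where "A = Z_theta \<theta> (3/2) ^ r"
  have Z: "Z_theta \<theta> (3/2) \<ge> 1" using theta_range by (intro z_theta_pos(2)) auto
  have A: "A > 0" using Z by (simp add: A_def)
  have muj: "Re (s + 2 + \<mu> j) > 1/2" if "Re s > -1" "j \<in> {1..r}" for s j
    using Re_mu_lower[OF that(2)] that by simp
  have P2: "Ppoly (s + 2) \<noteq> 0" if "Re s > -1" for s using that by (intro Ppoly_nz) auto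
  have nn: "(s + 2 + \<mu> j) / (2 * of_real pi) \<notin> \<real>\<^sub>\<le>\<^sub>0" if "Re s > -1" "j \<in> {1..r}" for s j
  proof -
    have "Re ((s + 2 + \<mu> j) / (2 * of_real pi)) = Re (s + 2 + \<mu> j) / (2 * pi)"
      using Re_divide_of_real[of "s + 2 + \<mu> j" "2 * pi"] by simp
    also have "\<dots> > 0" using muj[OF that] by (intro divide_pos_pos) auto
    finally show ?thesis by (auto simp: complex_nonpos_Reals_iff)
  qed
  have ReH: "Re (H s) = ln (cmod (Q_fun r N \<mu> (s + 2)))" "cmod (Q_fun r N \<mu> (s + 2)) > 0" if r: "Re s > -1" for s
  proof -
    have n: "s + 2 + \<mu> j \<noteq> 0" if "j \<in> {1..r}" for j using muj[OF r that] by (auto simp del: plus_complex.sel)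
    have "Re (Ln ((s + 2 + \<mu> j) / (2 * of_real pi))) = ln (cmod (s + 2 + \<mu> j) / (2 * pi))" if "j \<in> {1..r}" for j
      using n[OF that] by (simp add: norm_divide)
    then show "Re (H s) = ln (cmod (Q_fun r N \<mu> (s + 2)))" "cmod (Q_fun r N \<mu> (s + 2)) > 0"
      using ln_norm_Q[of "s + 2"] n by (simp_all add: H_def)
  qed
  have dH: "(H has_field_derivative (\<Sum>j=1..r. 1 / (s + 2 + \<mu> j))) (at s)" if r: "Re s > -1" for s
  proof -
    have d1: "((\<lambda>s. Ln ((s + 2 + \<mu> j) / (2 * of_real pi))) has_field_derivative 1 / (s + 2 + \<mu> j)) (at s)" if j: "j \<in> {1..r}" for j
    proof -
      have "((\<lambda>s. (s + 2 + \<mu> j) / (2 * of_real pi)) has_field_derivative 1 / (2 * of_real pi)) (at s)"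
        by (auto intro!: derivative_eq_intros)
      from DERIV_chain2[OF has_field_derivative_Ln[OF nn[OF r j]] this] show ?thesis
        by (simp add: field_simps)
    qed
    have "(H has_field_derivative 0 + (\<Sum>j=1..r. 1 / (s + 2 + \<mu> j))) (at s)"
      unfolding H_def by (intro DERIV_add DERIV_const DERIV_sum d1)
    then show ?thesis by simp
  qed
  have "cmod (J s) \<le> A * exp ((3/2 - Re s) / 2 * Re (H s))" if "\<exists>C\<ge>0. \<exists>T1. \<forall>s. \<bar>Im s\<bar> \<ge> T1 \<longrightarrow> cmod (J s) \<le> exp (C * (1 + cmod s)\<^sup>2)"
  proof -
    obtain C T1 where C: "C \<ge> 0" "\<And>s. \<bar>Im s\<bar> \<ge> T1 \<Longrightarrow> cmod (J s) \<le> exp (C * (1 + cmod s)\<^sup>2)" using \<open>\<exists>C\<ge>0. _\<close> by blast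
    show ?thesis
    \<comment> \<open>The constant r ln (4 pi) arises from |s + 2 + \<mu> j| \<ge> 1/2, so that each
      quotient by 2 pi is at least 1 / (4 pi).\<close>
    proof (rule strip_convexity_bound[where K = "real r * ln (4 * pi)" and C = C and ?T1.0 = T1])
      show "J holomorphic_on {s. -1 < Re s}"
        unfolding J_def by (intro holomorphic_intros Lhat_holo) (use P2 in auto)
      show "H holomorphic_on {s. -1 < Re s}"
        unfolding holomorphic_on_def field_differentiable_def using dH by (auto intro: has_field_derivative_at_within)
      show "0 < Re (deriv H s)" if r: "-1 < Re s" for s
      proof -
        have "Re (1 / (s + 2 + \<mu> j)) > 0" if "j \<in> {1..r}" for j
        proof -
          have p: "0 < Re (s + 2 + \<mu> j)" using muj[OF r that] by simp
          then have "0 < (Re (s + 2 + \<mu> j))\<^sup>2" by simp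
          then have "0 < (Re (s + 2 + \<mu> j))\<^sup>2 + (Im (s + 2 + \<mu> j))\<^sup>2" by (rule add_pos_nonneg) simp
          then show ?thesis unfolding Re_divide using p by (simp only: one_complex.sel) (simp del: plus_complex.sel)
        qed
        then have "(\<Sum>j=1..r. Re (1 / (s + 2 + \<mu> j))) > 0" using degree_pos by (intro sum_pos) auto
        then show ?thesis using DERIV_imp_deriv[OF dH[OF r]] by (simp add: Re_sum)
      qed
      show "- (real r * ln (4 * pi)) \<le> Re (H s)" if r: "-1 < Re s" for s
      proof -
        have "- ln (4 * pi) \<le> Re (Ln ((s + 2 + \<mu> j) / (2 * of_real pi)))" if j: "j \<in> {1..r}" for j
        proof -
          have p: "1/2 \<le> cmod (s + 2 + \<mu> j)" using muj[OF r j] complex_Re_le_cmod[of "s + 2 + \<mu> j"] by linarith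
          have "- ln (4 * pi) = ln (1/2 / (2 * pi))" by (simp add: ln_div)
          also have "\<dots> \<le> ln (cmod (s + 2 + \<mu> j) / (2 * pi))" using p by (intro ln_mono divide_right_mono) auto
          also have "\<dots> = Re (Ln ((s + 2 + \<mu> j) / (2 * of_real pi)))"
          proof -
            have "s + 2 + \<mu> j \<noteq> 0" using p by auto
            then show ?thesis by (simp add: norm_divide)
          qed
          finally show ?thesis .
        qed
        then have "(\<Sum>j=1..r. - ln (4 * pi)) \<le> (\<Sum>j=1..r. Re (Ln ((s + 2 + \<mu> j) / (2 * of_real pi))))" by (rule sum_mono)
        moreover have "ln (real N) \<ge> 0" using conductor_pos by simp
        ultimately show ?thesis by (simp add: H_def)
      qed
      show "cmod (J s) \<le> A" if r: "Re s = 3/2" for s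
      proof -
        have np: "\<not> is_pole L s" using pole_L(3)[of s] r by auto
        have "cmod (Ppoly (s - 1)) \<le> cmod (Ppoly (s + 2))" unfolding Ppoly_def prod_norm[symmetric]
        proof (intro prod_mono conjI)
          fix k assume "k \<in> {1..m}"
          then show "cmod (s - 1 - lam k) \<le> cmod (s + 2 - lam k)" unfolding cmod_def by (simp add: lambda_imaginary r)
        qed simp
        moreover have "cmod (L s) \<le> A" using norm_L_le_Z[of s] r theta_range by (simp add: A_def)
        ultimately have "cmod (Lhat s) \<le> cmod (Ppoly (s + 2)) * A"
          unfolding Lhat_eq(2)[OF np] norm_mult by (intro mult_mono) auto
        then show ?thesis using P2[of s] r by (simp add: J_def norm_divide field_simps)
      qed
      show "cmod (J s) \<le> A * exp (Re (H s))" if r: "Re s = -1/2" for s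
      proof -
        have r1: "Re s > -1" using r by simp
        have "cmod (Q_fun r N \<mu> s) \<le> cmod (Q_fun r N \<mu> (s + 2))"
          unfolding Q_fun_def norm_mult prod_norm[symmetric] norm_divide
        proof (intro mult_left_mono prod_mono conjI divide_right_mono)
          fix j assume j: "j \<in> {1..r}"
          have "\<bar>Re (s + \<mu> j)\<bar> \<le> \<bar>Re (s + 2 + \<mu> j)\<bar>" using Re_mu_lower[OF j] r by simp
          then have "(Re (s + \<mu> j))\<^sup>2 \<le> (Re (s + 2 + \<mu> j))\<^sup>2" by (rule abs_le_square_iff[THEN iffD1])
          then show "cmod (s + \<mu> j) \<le> cmod (s + 2 + \<mu> j)" unfolding cmod_def by simp
        qed auto
        moreover have "cmod (L (s + 2)) \<le> A" using norm_L_le_Z[of "s + 2"] r theta_range by (simp add: A_def)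
        ultimately have "cmod (L (s + 2)) * cmod (Q_fun r N \<mu> s) \<le> A * cmod (Q_fun r N \<mu> (s + 2))"
          using A by (intro mult_mono) auto
        moreover have "exp (Re (H s)) = cmod (Q_fun r N \<mu> (s + 2))" using ReH[OF r1] by simp
        moreover have "cmod (J s) = cmod (L (s + 2)) * cmod (Q_fun r N \<mu> s)"
          using Lhat_left_bound[OF r] P2[OF r1] by (simp add: J_def norm_divide)
        ultimately show ?thesis by simp
      qed
    qed (use A C s in auto)
  qed
  \<comment> \<open>Beyond T1 both P(s) and P(s + 2) have modulus at least 1, so J is dominated by
    Lhat P = \<open>Xi\<close> \<open>rgam\<close>, whose growth is known.\<close>
  moreover have "\<exists>C\<ge>0. \<exists>T1. \<forall>s. \<bar>Im s\<bar> \<ge> T1 \<longrightarrow> cmod (J s) \<le> exp (C * (1 + cmod s)\<^sup>2)"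
  proof -
    have "exp_growth (\<lambda>s. Xi s * rgam s) 2"
      by (intro exp_growth_mult exp_growth_rgam exp_growth_mono[OF exp_growth_Xi]) simp
    then obtain C where C: "C \<ge> 0" "\<And>s. cmod (Xi s * rgam s) \<le> exp (C * (1 + cmod s) powr 2)"
      by (auto simp: exp_growth_def)
    define T1 where "T1 = 1 + (\<Sum>k=1..m. \<bar>Im (lam k)\<bar>)"
    have P: "cmod (Ppoly s) \<ge> 1" if "\<bar>Im s\<bar> \<ge> T1" for s
      unfolding Ppoly_def prod_norm[symmetric]
    proof (rule prod_ge_1)
      fix k assume k: "k \<in> {1..m}"
      have "\<bar>Im (lam k)\<bar> \<le> (\<Sum>k=1..m. \<bar>Im (lam k)\<bar>)" using k by (intro member_le_sum) auto
      then have "1 \<le> \<bar>Im (s - lam k)\<bar>" using that by (simp add: T1_def)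
      then show "1 \<le> cmod (s - lam k)" using abs_Im_le_cmod[of "s - lam k"] by linarith
    qed
    have "cmod (J s) \<le> exp (C * (1 + cmod s)\<^sup>2)" if s: "\<bar>Im s\<bar> \<ge> T1" for s
    proof -
      have "cmod (J s) \<le> cmod (Lhat s) / 1" unfolding J_def norm_divide using P[of "s + 2"] s
        by (intro divide_left_mono) auto
      also have "\<dots> \<le> cmod (Lhat s) * cmod (Ppoly s)" using P[OF s] by (simp add: mult_le_cancel_left1)
      also have "\<dots> = cmod (Xi s * rgam s)" using Lhat_Ppoly[of s] by (simp flip: norm_mult)
      also have "\<dots> \<le> exp (C * (1 + cmod s)\<^sup>2)" using C(2)[of s] by (simp add: powr_numeral)
      finally show ?thesis .
    qed
    then show ?thesis using C(1) by blast
  qed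
  ultimately have "cmod (J s) \<le> A * exp ((3/2 - Re s) / 2 * Re (H s))" by blast
  moreover have "Re s > -1" using s by simp
  ultimately show ?thesis using P2[of s] ReH[of s] by (simp add: J_def A_def norm_divide field_simps)
qed

lemma lam_high:
  assumes t: "\<And>j. j \<in> {1..r} \<Longrightarrow> (t + Im (\<mu> j))\<^sup>2 \<ge> (5/2 + Re (\<mu> j))\<^sup>2 + X\<^sup>2" and k: "k \<in> {1..m}"
  shows "(t - Im (lam k))\<^sup>2 \<ge> X\<^sup>2"
proof -
  obtain j where j: "j \<in> {1..r}" "\<mu> j = - lam k" using lam_matches_mu[OF k] by blast
  have "0 \<le> (5/2 + Re (\<mu> j))\<^sup>2" by simp
  then have "(t + Im (\<mu> j))\<^sup>2 \<ge> X\<^sup>2" using t[OF j(1)] by linarith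
  then show ?thesis by (simp add: j(2))
qed

lemma Xi_factors:
  assumes s: "Re s > \<theta>" "Xi s \<noteq> 0" and np: "\<not> is_pole L s"
  shows "L s \<noteq> 0" "Ppoly s \<noteq> 0" "Ppoly (s - 1) \<noteq> 0"
  using s(2) unfolding Xi_right[OF s(1)] Xi0_def Lhat_eq(2)[OF np] by auto

text \<open>Two corrections turn the bound for \<open>Lhat\<close> into one for L at a fixed height:
  the quotient of P(s + 2) by P(s - 1), and the replacement of Q(s + 2) by Q(3/2 + it). Both are
  small because t is at least X away from all \<open>lam k\<close> and - Im (\<mu> j).\<close>

lemma ln_L_strip_bound:
  assumes t: "\<And>j. j \<in> {1..r} \<Longrightarrow> (t + Im (\<mu> j))\<^sup>2 \<ge> (5/2 + Re (\<mu> j))\<^sup>2 + X\<^sup>2" and X: "X > 0"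
    and \<sigma>: "1/2 \<le> \<sigma>" "\<sigma> \<le> 3/2" and nz: "Xi (Complex \<sigma> t) \<noteq> 0"
  shows "ln (cmod (L (Complex \<sigma> t))) \<le> real r * ln (Z_theta \<theta> (3/2)) + real m * ((6 * \<sigma> + 3) / (2 * X\<^sup>2))
    + (3/2 - \<sigma>) / 2 * (ln (cmod (Q_fun r N \<mu> (Complex (3/2) t))) + real r * (1 / (sqrt 2 * X) + 2 / X\<^sup>2))"
proof -
  define s where "s = Complex \<sigma> t"
  have s: "Re s = \<sigma>" "Im s = t" by (simp_all add: s_def)
  have lt: "(t - Im (lam k))\<^sup>2 \<ge> X\<^sup>2" if "k \<in> {1..m}" for k by (rule lam_high[OF t that])
  have X2: "X\<^sup>2 > 0" using X by simp
  have np: "\<not> is_pole L s"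
  proof
    assume "is_pole L s"
    then obtain k where k: "k \<in> {1..m}" "s = 1 + lam k" using pole_L_iff by blast
    then have "t - Im (lam k) = 0" using s by simp
    then show False using lt[OF k(1)] X2 by simp
  qed
  note f = Xi_factors[OF _ nz[folded s_def] np]
  have f: "L s \<noteq> 0" "Ppoly (s - 1) \<noteq> 0" using f \<sigma> theta_range s by auto
  have P2: "Ppoly (s + 2) \<noteq> 0" using \<sigma> s by (intro Ppoly_nz) auto
  have Z: "Z_theta \<theta> (3/2) \<ge> 1" using theta_range by (intro z_theta_pos(2)) auto
  have "cmod (Ppoly (s - 1)) * cmod (L s) \<le> cmod (Ppoly (s + 2)) * (Z_theta \<theta> (3/2) ^ r * exp ((3/2 - \<sigma>) / 2 * ln (cmod (Q_fun r N \<mu> (s + 2)))))"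
    using Lhat_strip_bound[of s] \<sigma> unfolding Lhat_eq(2)[OF np] norm_mult by (simp add: s)
  then have "ln (cmod (Ppoly (s - 1)) * cmod (L s)) \<le> ln (cmod (Ppoly (s + 2)) * (Z_theta \<theta> (3/2) ^ r * exp ((3/2 - \<sigma>) / 2 * ln (cmod (Q_fun r N \<mu> (s + 2))))))"
    using f by (intro ln_mono) auto
  then have 1: "ln (cmod (Ppoly (s - 1))) + ln (cmod (L s)) \<le> ln (cmod (Ppoly (s + 2))) + (real r * ln (Z_theta \<theta> (3/2)) + (3/2 - \<sigma>) / 2 * ln (cmod (Q_fun r N \<mu> (s + 2))))"
    using f P2 Z by (simp add: ln_mult_pos ln_realpow)
  have lnP: "ln (cmod (Ppoly w)) = (\<Sum>k=1..m. ln (cmod (w - lam k)))" if "Ppoly w \<noteq> 0" for w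
    unfolding Ppoly_def prod_norm[symmetric] using that by (intro ln_prod) (auto simp: Ppoly_def)
  have "ln (cmod (Ppoly (s + 2))) - ln (cmod (Ppoly (s - 1))) = (\<Sum>k=1..m. ln (cmod (s + 2 - lam k)) - ln (cmod (s - 1 - lam k)))"
    unfolding lnP[OF P2] lnP[OF f(2)] by (simp add: sum_subtractf)
  also have "\<dots> \<le> (\<Sum>k=1..m. (6 * \<sigma> + 3) / (2 * X\<^sup>2))"
  proof (rule sum_mono)
    fix k assume k: "k \<in> {1..m}"
    define u where "u = (t - Im (lam k))\<^sup>2"
    have u: "u \<ge> X\<^sup>2" using lt[OF k] by (simp add: u_def)
    have n1: "(cmod (s + 2 - lam k))\<^sup>2 = (\<sigma> + 2)\<^sup>2 + u" "(cmod (s - 1 - lam k))\<^sup>2 = (\<sigma> - 1)\<^sup>2 + u"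
      by (simp_all add: cmod_power2 s lambda_imaginary[OF k] u_def)
    define a where "a = (\<sigma> - 1)\<^sup>2 + u"
    have "0 \<le> (\<sigma> - 1)\<^sup>2" by simp
    then have a: "a \<ge> X\<^sup>2" "a > 0" using u X2 unfolding a_def by linarith+
    \<comment> \<open>6 \<sigma> + 3 is (\<sigma> + 2)^2 - (\<sigma> - 1)^2.\<close>
    have b: "(\<sigma> + 2)\<^sup>2 + u = a + (6 * \<sigma> + 3)" by (simp add: a_def power2_eq_square algebra_simps)
    have pos: "cmod (s + 2 - lam k) > 0" "cmod (s - 1 - lam k) > 0"
    proof -
      have "(cmod (s + 2 - lam k))\<^sup>2 > 0" "(cmod (s - 1 - lam k))\<^sup>2 > 0"
        unfolding n1 b using a \<sigma> by (auto simp: a_def[symmetric])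
      then show "cmod (s + 2 - lam k) > 0" "cmod (s - 1 - lam k) > 0" by simp_all
    qed
    have "2 * (ln (cmod (s + 2 - lam k)) - ln (cmod (s - 1 - lam k))) = ln ((cmod (s + 2 - lam k))\<^sup>2) - ln ((cmod (s - 1 - lam k))\<^sup>2)"
      using pos by (simp add: ln_realpow)
    also have "\<dots> = ln (1 + (6 * \<sigma> + 3) / a)"
    proof -
      have "1 + (6 * \<sigma> + 3) / a = (a + (6 * \<sigma> + 3)) / a" using a by (simp add: add_divide_distrib)
      then show ?thesis unfolding n1 b using a \<sigma> by (simp add: a_def[symmetric] ln_div)
    qed
    also have "\<dots> \<le> (6 * \<sigma> + 3) / a" using a \<sigma> by (intro ln_add_one_self_le_self) auto
    also have "\<dots> \<le> (6 * \<sigma> + 3) / X\<^sup>2" using a X2 \<sigma> by (intro frac_le) auto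
    finally show "ln (cmod (s + 2 - lam k)) - ln (cmod (s - 1 - lam k)) \<le> (6 * \<sigma> + 3) / (2 * X\<^sup>2)" by simp
  qed
  finally have 2: "ln (cmod (Ppoly (s + 2))) - ln (cmod (Ppoly (s - 1))) \<le> real m * ((6 * \<sigma> + 3) / (2 * X\<^sup>2))" by simp
  have v1: "Re (Complex (3/2) t + \<mu> j) \<ge> 1" if "j \<in> {1..r}" for j using Re_mu_lower[OF that] by simp
  have n: "Complex (3/2) t + \<mu> j \<noteq> 0" "s + 2 + \<mu> j \<noteq> 0" if "j \<in> {1..r}" for j
    using Re_mu_lower[OF that] \<sigma> s by (auto simp: complex_eq_iff)
  have "ln (cmod (Q_fun r N \<mu> (s + 2))) - ln (cmod (Q_fun r N \<mu> (Complex (3/2) t)))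
      = (\<Sum>j=1..r. ln (cmod (s + 2 + \<mu> j) / (2 * pi)) - ln (cmod (Complex (3/2) t + \<mu> j) / (2 * pi)))"
    using ln_norm_Q(2)[of "s + 2"] ln_norm_Q(2)[of "Complex (3/2) t"] n by (simp add: sum_subtractf)
  also have "\<dots> \<le> (\<Sum>j=1..r. 1 / (sqrt 2 * X) + 2 / X\<^sup>2)"
  proof (rule sum_mono)
    fix j assume j: "j \<in> {1..r}"
    define v where "v = Complex (3/2) t + \<mu> j"
    \<comment> \<open>The horizontal distance from 3/2 + it to s + 2; it lies between 1 and 2 for
      \<sigma> in the segment.\<close>
    define d where "d = \<sigma> + 1/2"
    have d: "1 \<le> d" "d \<le> 2" using \<sigma> by (auto simp: d_def)
    have v: "Re v \<ge> 1" "v \<noteq> 0" using v1[OF j] n[OF j] by (auto simp: v_def)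
    have sv: "s + 2 + \<mu> j = v + of_real d" by (simp add: complex_eq_iff s v_def d_def)
    have R: "Re v / (cmod v)\<^sup>2 \<le> 1 / (2 * sqrt 2 * X)"
      by (rule Re_over_norm_bound[of v "5/2 + Re (\<mu> j)"]) (use v t[OF j] X in \<open>auto simp: v_def\<close>)
    have vX: "X\<^sup>2 \<le> (cmod v)\<^sup>2"
    proof -
      have "0 \<le> (5/2 + Re (\<mu> j))\<^sup>2" "0 \<le> (Re v)\<^sup>2" by simp_all
      moreover have "Im v = t + Im (\<mu> j)" by (simp add: v_def)
      ultimately have "X\<^sup>2 \<le> (Re v)\<^sup>2 + (Im v)\<^sup>2" using t[OF j] by (simp only:)
      then show ?thesis by (simp add: cmod_power2)
    qed
    have vp: "(cmod v)\<^sup>2 > 0" using v by simp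
    have nn: "(cmod (v + of_real d))\<^sup>2 = (cmod v)\<^sup>2 + (2 * d * Re v + d\<^sup>2)"
      unfolding cmod_power2 by (simp add: power2_eq_square algebra_simps)
    have vd: "cmod (v + of_real d) > 0" using n(2)[OF j] sv by simp
    have "2 * (ln (cmod (v + of_real d)) - ln (cmod v)) = ln ((cmod (v + of_real d))\<^sup>2) - ln ((cmod v)\<^sup>2)"
      using vd v by (simp add: ln_realpow)
    also have "\<dots> = ln (1 + (2 * d * Re v + d\<^sup>2) / (cmod v)\<^sup>2)"
    proof -
      have "(cmod v)\<^sup>2 + (2 * d * Re v + d\<^sup>2) > 0" using nn vd by (metis zero_less_power)
      moreover have "1 + (2 * d * Re v + d\<^sup>2) / (cmod v)\<^sup>2 = ((cmod v)\<^sup>2 + (2 * d * Re v + d\<^sup>2)) / (cmod v)\<^sup>2"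
        using vp by (simp add: add_divide_distrib)
      ultimately show ?thesis unfolding nn using vp by (simp add: ln_div)
    qed
    also have "\<dots> \<le> (2 * d * Re v + d\<^sup>2) / (cmod v)\<^sup>2"
      using d v by (intro ln_add_one_self_le_self) auto
    also have "\<dots> = 2 * d * (Re v / (cmod v)\<^sup>2) + d\<^sup>2 / (cmod v)\<^sup>2" by (simp add: add_divide_distrib)
    also have "\<dots> \<le> 4 * (1 / (2 * sqrt 2 * X)) + 4 / X\<^sup>2"
    proof (rule add_mono)
      show "2 * d * (Re v / (cmod v)\<^sup>2) \<le> 4 * (1 / (2 * sqrt 2 * X))" using d R v by (intro mult_mono) auto
      have "d\<^sup>2 \<le> 2\<^sup>2" using d by (intro power_mono) auto
      then show "d\<^sup>2 / (cmod v)\<^sup>2 \<le> 4 / X\<^sup>2" using vX X2 by (intro frac_le) auto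
    qed
    finally have "ln (cmod (v + of_real d)) - ln (cmod v) \<le> 1 / (sqrt 2 * X) + 2 / X\<^sup>2" by (simp add: field_simps)
    then show "ln (cmod (s + 2 + \<mu> j) / (2 * pi)) - ln (cmod (Complex (3/2) t + \<mu> j) / (2 * pi)) \<le> 1 / (sqrt 2 * X) + 2 / X\<^sup>2"
      unfolding sv v_def[symmetric] using vd v by (simp add: ln_div)
  qed
  finally have "ln (cmod (Q_fun r N \<mu> (s + 2))) \<le> ln (cmod (Q_fun r N \<mu> (Complex (3/2) t))) + real r * (1 / (sqrt 2 * X) + 2 / X\<^sup>2)"
    by simp
  then have "(3/2 - \<sigma>) / 2 * ln (cmod (Q_fun r N \<mu> (s + 2))) \<le> (3/2 - \<sigma>) / 2 * (ln (cmod (Q_fun r N \<mu> (Complex (3/2) t))) + real r * (1 / (sqrt 2 * X) + 2 / X\<^sup>2))"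
    using \<sigma> by (intro mult_left_mono) auto
  then show ?thesis using 1 2 unfolding s_def by linarith
qed

lemma negligible_Xi_zeros: "negligible {\<sigma>. Xi (Complex \<sigma> t) = 0}"
proof -
  have "countable {z \<in> UNIV. Xi z = 0}" by (rule countable_Xi_zeros)
  then have "countable (Re ` {z \<in> UNIV. Xi z = 0})" by (rule countable_image)
  moreover have "{\<sigma>. Xi (Complex \<sigma> t) = 0} \<subseteq> Re ` {z \<in> UNIV. Xi z = 0}"
  proof
    fix x assume "x \<in> {\<sigma>. Xi (Complex \<sigma> t) = 0}"
    then have "Complex x t \<in> {z \<in> UNIV. Xi z = 0}" by simp
    from imageI[OF this, of Re] show "x \<in> Re ` {z \<in> UNIV. Xi z = 0}" by simp
  qed
  ultimately have "countable {\<sigma>. Xi (Complex \<sigma> t) = 0}" by (rule countable_subset[rotated])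
  then show ?thesis by (simp add: negligible_iff_null_sets countable_imp_null_set_lborel null_sets_completionI)
qed

lemma ln_L_integrable: "(\<lambda>\<sigma>. ln (cmod (L (Complex \<sigma> t)))) integrable_on {1/2..3/2}"
  by (rule integrable_on_subinterval[OF littlewood(1)]) auto

text \<open>Over the segment (3/2 - \<sigma>) / 2 integrates to 1/4 and (6 \<sigma> + 3) / 2 to 9/2.
  With m \<le> r the errors in 1 / X^2 add up to 9/2 + 2/4 = 5.\<close>

lemma strip_integral_upper:
  assumes t: "\<And>j. j \<in> {1..r} \<Longrightarrow> (t + Im (\<mu> j))\<^sup>2 \<ge> (5/2 + Re (\<mu> j))\<^sup>2 + X\<^sup>2" and X: "X > 0"
  shows "integral {1/2..3/2} (\<lambda>\<sigma>. ln (cmod (L (Complex \<sigma> t)))) \<le> real r * ln (Z_theta \<theta> (3/2))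
    + 1/4 * ln (cmod (Q_fun r N \<mu> (Complex (3/2) t))) + real r * (1 / (4 * sqrt 2 * X) + 5 / X\<^sup>2)"
proof -
  define a where "a = real r * ln (Z_theta \<theta> (3/2))"
  define B where "B = ln (cmod (Q_fun r N \<mu> (Complex (3/2) t))) + real r * (1 / (sqrt 2 * X) + 2 / X\<^sup>2)"
  define f where "f = (\<lambda>\<sigma>. ln (cmod (L (Complex \<sigma> t))))"
  define g where "g = (\<lambda>\<sigma>. a + real m * ((6 * \<sigma> + 3) / (2 * X\<^sup>2)) + (3/2 - \<sigma>) / 2 * B)"
  have X2: "X\<^sup>2 > 0" using X by simp
  define G where "G = (\<lambda>\<sigma>. a * \<sigma> + real m * ((3 * \<sigma>\<^sup>2 + 3 * \<sigma>) / (2 * X\<^sup>2)) + (3 * \<sigma> - \<sigma>\<^sup>2) / 4 * B)"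
  have "(g has_integral (G (3/2) - G (1/2))) {1/2..3/2}"
  proof (rule fundamental_theorem_of_calculus)
    fix x :: real
    have "(G has_real_derivative g x) (at x within {1/2..3/2})"
      unfolding G_def g_def using X by (auto intro!: derivative_eq_intros simp: field_simps)
    then show "(G has_vector_derivative g x) (at x within {1/2..3/2})"
      by (simp add: has_real_derivative_iff_has_vector_derivative)
  qed simp
  moreover have "G (3/2) - G (1/2) = a + real m * (9 / (2 * X\<^sup>2)) + B / 4"
    unfolding G_def using X2 by (simp add: field_simps power2_eq_square)
  ultimately have g: "(g has_integral (a + real m * (9 / (2 * X\<^sup>2)) + B / 4)) {1/2..3/2}" by simp
  \<comment> \<open>At zeros on the segment ln 0 is a default value on which nothing is known, so
    the majorant is changed to f itself there.\<close>
  have g': "((\<lambda>\<sigma>. if \<sigma> \<in> {\<sigma>. Xi (Complex \<sigma> t) = 0} then f \<sigma> else g \<sigma>) has_integral (a + real m * (9 / (2 * X\<^sup>2)) + B / 4)) {1/2..3/2}"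
    by (rule has_integral_spike[OF negligible_Xi_zeros _ g, of t]) auto
  have f: "(f has_integral integral {1/2..3/2} f) {1/2..3/2}"
    using ln_L_integrable by (simp add: f_def integrable_integral)
  have "integral {1/2..3/2} f \<le> a + real m * (9 / (2 * X\<^sup>2)) + B / 4"
  proof (rule has_integral_le[OF f g'])
    fix x :: real assume "x \<in> {1/2..3/2}"
    then show "f x \<le> (if x \<in> {\<sigma>. Xi (Complex \<sigma> t) = 0} then f x else g x)"
      using ln_L_strip_bound[OF t X, of x] by (auto simp: f_def g_def a_def B_def)
  qed
  also have "real m * (9 / (2 * X\<^sup>2)) \<le> real r * (9 / (2 * X\<^sup>2))" using m_le_r by (intro mult_right_mono) auto
  finally have "integral {1/2..3/2} f \<le> a + real r * (9 / (2 * X\<^sup>2)) + B / 4" by simp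
  also have "\<dots> = a + 1/4 * ln (cmod (Q_fun r N \<mu> (Complex (3/2) t))) + real r * (1 / (4 * sqrt 2 * X) + 5 / X\<^sup>2)"
    unfolding B_def using X by (simp add: field_simps)
  finally show ?thesis unfolding f_def a_def .
qed

end

text \<open>The two ends of the integral contribute equal errors. Clearing denominators leaves (X/2
  + 10 sqrt 2)(X - 5) \<le> X^2; the term 1 / X^2 is absorbed by lowering X to X - 5.\<close>

lemma error_bound:
  fixes X :: real
  assumes X: "X > 5"
  shows "2 * (1 / (4 * sqrt 2 * X) + 5 / X\<^sup>2) \<le> 1 / (sqrt 2 * (X - 5))"
proof -
  have s2: "sqrt 2 \<le> 70711/50000" by (rule real_le_lsqrt) (auto simp: power2_eq_square)
  \<comment> \<open>With 70711/50000 as an upper bound for sqrt 2, the quadratic in X is completed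
    at 58211/5000, and the remaining constant is positive.\<close>
  have "X\<^sup>2 - (X / 2 + 10 * (70711/50000)) * (X - 5) = (X - 58211/5000)\<^sup>2 / 2 + (70711/1000 - (58211/5000)\<^sup>2 / 2)"
    by (simp add: power2_eq_square field_simps)
  moreover have "0 \<le> (X - 58211/5000)\<^sup>2 / 2" by simp
  moreover have "0 \<le> 70711/1000 - (58211/5000)\<^sup>2 / (2::real)" by (simp add: power2_eq_square)
  ultimately have "(X / 2 + 10 * (70711/50000)) * (X - 5) \<le> X\<^sup>2" by linarith
  moreover have "(X / 2 + 10 * sqrt 2) * (X - 5) \<le> (X / 2 + 10 * (70711/50000)) * (X - 5)"
    using s2 X by (intro mult_right_mono) auto
  ultimately have *: "(X / 2 + 10 * sqrt 2) * (X - 5) \<le> X\<^sup>2" by linarith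
  have "2 * (1 / (4 * sqrt 2 * X) + 5 / X\<^sup>2) = (X / 2 + 10 * sqrt 2) / (sqrt 2 * X\<^sup>2)"
    using X by (simp add: field_simps power2_eq_square)
  also have "\<dots> \<le> 1 / (sqrt 2 * (X - 5))"
  proof -
    have D: "sqrt 2 * X\<^sup>2 > 0" using X by auto
    have "X / 2 + 10 * sqrt 2 \<le> X\<^sup>2 / (X - 5)" using * X by (subst pos_le_divide_eq) auto
    then have "X / 2 + 10 * sqrt 2 \<le> 1 / (sqrt 2 * (X - 5)) * (sqrt 2 * X\<^sup>2)" by simp
    then show ?thesis using pos_divide_le_eq[OF D] by blast
  qed
  finally show ?thesis .
qed

section \<open>Lower bound on the segment at \<open>t1\<close>, and the conclusion\<close>

lemma ln_cmod_shift_deriv: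
  assumes "Complex \<sigma> t \<noteq> a"
  shows "((\<lambda>\<sigma>. ln (cmod (Complex \<sigma> t - a))) has_real_derivative Re (1 / (Complex \<sigma> t - a))) (at \<sigma>)"
proof -
  have d: "((\<lambda>s. s - a) has_field_derivative 1) (at (Complex \<sigma> t))" by (auto intro!: derivative_eq_intros)
  then have "(\<lambda>s. s - a) field_differentiable (at (Complex \<sigma> t))" by (auto simp: field_differentiable_def)
  from ln_cmod_deriv[OF this] show ?thesis using assms DERIV_imp_deriv[OF d] by simp
qed

context L_function
begin

lemma theta_factors_differentiable:
  assumes "\<sigma> > 1 + \<theta>"
  shows "z_theta \<theta> differentiable (at \<sigma>)" "Z_theta \<theta> differentiable (at \<sigma>)"
proof -
  have x: "\<sigma> - \<theta> > 1" "\<sigma> + \<theta> > 1" "2 * \<sigma> - 2 * \<theta> > 1" "2 * \<sigma> + 2 * \<theta> > 1" using assms theta_range by auto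
  have zd: "(\<lambda>\<sigma>. zeta_real (a * \<sigma> + b)) differentiable (at \<sigma>)" if ab: "a * \<sigma> + b > 1" for a b
  proof -
    obtain D where "(zeta_real has_real_derivative D) (at (a * \<sigma> + b))" using zeta_differentiable[OF ab] by blast
    moreover have "((\<lambda>\<sigma>. a * \<sigma> + b) has_real_derivative a) (at \<sigma>)" by (auto intro!: derivative_eq_intros)
    ultimately show ?thesis unfolding real_differentiable_def using DERIV_chain2[of zeta_real D "\<lambda>\<sigma>. a * \<sigma> + b" \<sigma> a UNIV] by blast
  qed
  note d = zd[of 1 \<theta>] zd[of 1 "-\<theta>"] zd[of 2 "2 * \<theta>"] zd[of 2 "- (2 * \<theta>)"]
  have d': "(\<lambda>\<sigma>. zeta_real (\<sigma> + \<theta>)) differentiable (at \<sigma>)" "(\<lambda>\<sigma>. zeta_real (\<sigma> - \<theta>)) differentiable (at \<sigma>)"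
    "(\<lambda>\<sigma>. zeta_real (2 * \<sigma> + 2 * \<theta>)) differentiable (at \<sigma>)" "(\<lambda>\<sigma>. zeta_real (2 * \<sigma> - 2 * \<theta>)) differentiable (at \<sigma>)"
    using d x by simp_all
  have p: "zeta_real (\<sigma> + \<theta>) > 0" "zeta_real (\<sigma> - \<theta>) > 0" "zeta_real (2 * \<sigma> + 2 * \<theta>) > 0" "zeta_real (2 * \<sigma> - 2 * \<theta>) > 0"
    using zeta_ge_1[OF x(1)] zeta_ge_1[OF x(2)] zeta_ge_1[OF x(3)] zeta_ge_1[OF x(4)] by linarith+
  have sq: "(\<lambda>\<sigma>. sqrt (f \<sigma>)) differentiable (at \<sigma>)" if "f differentiable (at \<sigma>)" "f \<sigma> > 0" for f :: "real \<Rightarrow> real"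
    using that DERIV_chain2[OF DERIV_real_sqrt] unfolding real_differentiable_def by blast
  show "Z_theta \<theta> differentiable (at \<sigma>)"
    unfolding Z_theta_def using p by (intro sq differentiable_mult d') auto
  show "z_theta \<theta> differentiable (at \<sigma>)"
    unfolding z_theta_def using p by (intro sq differentiable_mult differentiable_divide d') auto
qed

lemma continuous_ln_theta:
  "continuous_on {1 + \<theta><..} (\<lambda>\<sigma>. ln (Z_theta \<theta> \<sigma>))" "continuous_on {1 + \<theta><..} (\<lambda>\<sigma>. ln (z_theta \<theta> \<sigma>))"
proof -
  have "continuous_on {1 + \<theta><..} (Z_theta \<theta>)" "continuous_on {1 + \<theta><..} (z_theta \<theta>)"
    using theta_factors_differentiable by (auto intro!: continuous_at_imp_continuous_on differentiable_imp_continuous_within)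
  then show "continuous_on {1 + \<theta><..} (\<lambda>\<sigma>. ln (Z_theta \<theta> \<sigma>))" "continuous_on {1 + \<theta><..} (\<lambda>\<sigma>. ln (z_theta \<theta> \<sigma>))"
    using z_theta_pos by (force intro!: continuous_intros)+
qed

lemma set_integrable_ln_theta:
  "set_integrable lborel {3/2<..} (\<lambda>\<sigma>. ln (Z_theta \<theta> \<sigma>))" "set_integrable lborel {3/2<..} (\<lambda>\<sigma>. ln (z_theta \<theta> \<sigma>))"
proof -
  obtain C where C: "C \<ge> 0" "\<And>\<sigma>. \<sigma> \<ge> 3/2 \<Longrightarrow> 0 \<le> ln (Z_theta \<theta> \<sigma>)" "\<And>\<sigma>. \<sigma> \<ge> 3/2 \<Longrightarrow> ln (Z_theta \<theta> \<sigma>) \<le> C * 2 powr (- \<sigma>)"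
      "\<And>\<sigma>. \<sigma> \<ge> 3/2 \<Longrightarrow> - (C * 2 powr (- \<sigma>)) \<le> ln (z_theta \<theta> \<sigma>)"
    using ln_theta_decay by blast
  \<comment> \<open>Read off from the two bounds on ln |L|, which enclose the same number; r \<ge> 1
    permits division by r.\<close>
  have le: "ln (z_theta \<theta> \<sigma>) \<le> ln (Z_theta \<theta> \<sigma>)" if "\<sigma> \<ge> 3/2" for \<sigma>
  proof -
    have "1 + \<theta> < Re (of_real \<sigma>)" using that theta_range by simp
    from ln_L_bounds[OF this] have "real r * ln (z_theta \<theta> \<sigma>) \<le> real r * ln (Z_theta \<theta> \<sigma>)" by simp
    then show ?thesis using degree_pos by simp
  qed
  have gen: "set_integrable lborel {3/2<..} f"
    if c: "continuous_on {1 + \<theta><..} f" and b: "\<And>\<sigma>. \<sigma> \<ge> 3/2 \<Longrightarrow> \<bar>f \<sigma>\<bar> \<le> C * 2 powr (- \<sigma>)" for f :: "real \<Rightarrow> real"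
  proof -
    have 1: "set_integrable lborel {3/2..2} f"
      by (rule borel_integrable_atLeastAtMost'[OF continuous_on_subset[OF c]]) (use theta_range in auto)
    have 2: "set_integrable lborel {2<..} f"
      by (rule set_integrable_tail_bound[OF continuous_on_subset[OF c], where C = C]) (use theta_range b in auto)
    have "set_integrable lborel ({3/2..2} \<union> {2<..}) f" by (intro set_integrable_Un 1 2) auto
    then show ?thesis by (rule set_integrable_subset) auto
  qed
  show "set_integrable lborel {3/2<..} (\<lambda>\<sigma>. ln (Z_theta \<theta> \<sigma>))"
    using C by (intro gen continuous_ln_theta) (simp add: abs_le_iff)
  have "\<bar>ln (z_theta \<theta> \<sigma>)\<bar> \<le> C * 2 powr (- \<sigma>)" if "\<sigma> \<ge> 3/2" for \<sigma>
    using C(3,4)[OF that] le[OF that] unfolding abs_le_iff by linarith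
  then show "set_integrable lborel {3/2<..} (\<lambda>\<sigma>. ln (z_theta \<theta> \<sigma>))" by (intro gen continuous_ln_theta)
qed

text \<open>By \<open>ln_ratio_mono\<close> the function r ln z - ln |L| increases with \<sigma>,
  and its derivative at 3/2 is the difference of the two sides.\<close>

lemma logderiv_L_bound:
  "Re (deriv L (Complex (3/2) t) / L (Complex (3/2) t)) \<le> real r * (deriv (z_theta \<theta>) (3/2) / z_theta \<theta> (3/2))"
proof -
  have g: "3/2 > 1 + \<theta>" using theta_range by simp
  have zp: "z_theta \<theta> (3/2) > 0" by (rule z_theta_pos(1)[OF g])
  have dz: "(z_theta \<theta> has_real_derivative deriv (z_theta \<theta>) (3/2)) (at (3/2))"
    using theta_factors_differentiable(1)[OF g] by (metis DERIV_imp_deriv real_differentiable_def)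
  have "((\<lambda>\<sigma>. ln (z_theta \<theta> \<sigma>)) has_real_derivative 1 / z_theta \<theta> (3/2) * deriv (z_theta \<theta>) (3/2)) (at (3/2))"
    by (rule DERIV_chain2[OF _ dz]) (use zp in \<open>auto intro!: derivative_eq_intros\<close>)
  from DERIV_cmult[OF this, of "real r"]
  have 1: "((\<lambda>\<sigma>. real r * ln (z_theta \<theta> \<sigma>)) has_real_derivative real r * (deriv (z_theta \<theta>) (3/2) / z_theta \<theta> (3/2))) (at (3/2))"
    by simp
  have s1: "Re (Complex (3/2) t) > 1" by simp
  have "L field_differentiable (at (Complex (3/2) t))"
    using L_holo_right open_halfspace_Re_gt s1 by (intro holomorphic_on_imp_differentiable_at[of _ "{s. Re s > 1}"]) auto
  from ln_cmod_deriv[OF this L_euler_lim(2)[OF s1]]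
  have "((\<lambda>\<sigma>. real r * ln (z_theta \<theta> \<sigma>) - ln (cmod (L (Complex \<sigma> t)))) has_real_derivative
     real r * (deriv (z_theta \<theta>) (3/2) / z_theta \<theta> (3/2)) - Re (deriv L (Complex (3/2) t) / L (Complex (3/2) t))) (at (3/2))"
    by (rule DERIV_diff[OF 1])
  moreover have "mono_on {1 + \<theta><..} (\<lambda>\<sigma>. real r * ln (z_theta \<theta> \<sigma>) - ln (cmod (L (Complex \<sigma> t))))"
    by (rule mono_onI) (use ln_ratio_mono in auto)
  moreover have "3/2 \<in> interior {1 + \<theta><..}" using g by (simp add: interior_open)
  ultimately show ?thesis using mono_on_imp_deriv_nonneg by fastforce
qed

lemma ln_gam:
  assumes "Re s > \<theta>"
  shows "ln (cmod (gam s)) = (Re s - 1/2) / 2 * ln (real N) + (\<Sum>j=1..r. ln (cmod (Gamma_R (s + \<mu> j))))"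
proof -
  have nz: "Gamma_R (s + \<mu> j) \<noteq> 0" if "j \<in> {1..r}" for j
    using Gamma_R_deriv(1)[OF mu_pos[OF that assms]] .
  have "cmod (of_nat N powr ((s - 1/2) / 2)) = real N powr ((Re s - 1/2) / 2)"
    using norm_powr_real_powr[of "of_nat N" "(s - 1/2) / 2"] by simp
  then have "cmod (gam s) = real N powr ((Re s - 1/2) / 2) * (\<Prod>j=1..r. cmod (Gamma_R (s + \<mu> j)))"
    by (simp add: gamma_factor_def norm_mult epsilon_norm prod_norm)
  moreover have "(\<Prod>j=1..r. cmod (Gamma_R (s + \<mu> j))) > 0" using nz by (intro prod_pos) auto
  moreover have "ln (\<Prod>j=1..r. cmod (Gamma_R (s + \<mu> j))) = (\<Sum>j=1..r. ln (cmod (Gamma_R (s + \<mu> j))))"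
    using nz by (intro ln_prod) auto
  ultimately show ?thesis using conductor_pos by (simp add: ln_mult_pos ln_powr)
qed

lemma ln_Xi:
  assumes s: "Re s > \<theta>" "Xi s \<noteq> 0" and np: "\<not> is_pole L s"
  shows "ln (cmod (Xi s)) = (\<Sum>k=1..m. ln (cmod (s - lam k))) + (\<Sum>k=1..m. ln (cmod (s - (1 + lam k))))
    + ((Re s - 1/2) / 2 * ln (real N) + (\<Sum>j=1..r. ln (cmod (Gamma_R (s + \<mu> j))))) + ln (cmod (L s))"
proof -
  note f = Xi_factors[OF assms]
  have lnP: "ln (cmod (Ppoly w)) = (\<Sum>k=1..m. ln (cmod (w - lam k)))" if "Ppoly w \<noteq> 0" for w
    unfolding Ppoly_def prod_norm[symmetric] using that by (intro ln_prod) (auto simp: Ppoly_def)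
  have "cmod (Xi s) = cmod (Ppoly s) * cmod (gam s) * (cmod (Ppoly (s - 1)) * cmod (L s))"
    by (simp add: Xi_right[OF s(1)] Xi0_def Lhat_eq(2)[OF np] norm_mult)
  then have "ln (cmod (Xi s)) = ln (cmod (Ppoly s)) + ln (cmod (gam s)) + (ln (cmod (Ppoly (s - 1))) + ln (cmod (L s)))"
    using f gam_nz[OF s(1)] by (simp add: ln_mult_pos)
  then show ?thesis unfolding lnP[OF f(2)] lnP[OF f(3)] ln_gam[OF s(1)] by (simp add: diff_diff_eq)
qed

text \<open>The factors of \<open>Xi\<close> are differentiated one by one along the horizontal
  line. The linear factors of P(s) and P(s - 1) contribute at most (3/2 + 1/2) / X^2 for each k, and
  m \<le> r.\<close>

lemma logderiv_Xi_bound: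
  assumes t: "\<And>j. j \<in> {1..r} \<Longrightarrow> (t + Im (\<mu> j))\<^sup>2 \<ge> (5/2 + Re (\<mu> j))\<^sup>2 + X\<^sup>2" and X: "X > 0"
  shows "Re (deriv Xi (Complex (3/2) t) / Xi (Complex (3/2) t)) \<le> real r * (deriv (z_theta \<theta>) (3/2) / z_theta \<theta> (3/2))
    + 1/2 * ln (real N) + (\<Sum>j=1..r. (Re (Digamma ((Complex (3/2) t + \<mu> j) / 2)) - ln pi) / 2) + real r * (2 / X\<^sup>2)"
proof -
  define s where "s = Complex (3/2) t"
  have s1: "Re s > 1" by (simp add: s_def)
  have X2: "X\<^sup>2 > 0" using X by simp
  have nz: "Xi (Complex \<sigma> t) \<noteq> 0" if "\<sigma> > 1" for \<sigma> using that by (intro Xi_right_nz) simp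
  have "Xi field_differentiable (at s)"
    using Xi_holo by (rule holomorphic_on_imp_differentiable_at) auto
  from ln_cmod_deriv[OF this[unfolded s_def] nz]
  have dX: "((\<lambda>\<sigma>. ln (cmod (Xi (Complex \<sigma> t)))) has_real_derivative Re (deriv Xi s / Xi s)) (at (3/2))"
    by (simp add: s_def)
  have "L field_differentiable (at s)"
    using L_holo_right open_halfspace_Re_gt s1 by (intro holomorphic_on_imp_differentiable_at[of _ "{s. Re s > 1}"]) auto
  from ln_cmod_deriv[OF this[unfolded s_def] L_euler_lim(2)]
  have dL: "((\<lambda>\<sigma>. ln (cmod (L (Complex \<sigma> t)))) has_real_derivative Re (deriv L s / L s)) (at (3/2))"
    by (simp add: s_def)
  have lt: "(t - Im (lam k))\<^sup>2 \<ge> X\<^sup>2" if "k \<in> {1..m}" for k by (rule lam_high[OF t that])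
  have ne: "s \<noteq> lam k" "s \<noteq> 1 + lam k" if "k \<in> {1..m}" for k
    using lambda_imaginary[OF that] by (auto simp: s_def complex_eq_iff)
  have dG: "((\<lambda>\<sigma>. ln (cmod (Gamma_R (Complex \<sigma> t + \<mu> j)))) has_real_derivative (Re (Digamma ((s + \<mu> j) / 2)) - ln pi) / 2) (at (3/2))"
    if "j \<in> {1..r}" for j
    unfolding s_def by (rule ln_Gamma_R_deriv) (use Re_mu_lower[OF that] in simp)
  have dN: "((\<lambda>\<sigma>. (\<sigma> - 1/2) / 2 * ln (real N)) has_real_derivative 1/2 * ln (real N)) (at (3/2))"
    by (auto intro!: derivative_eq_intros)
  have "((\<lambda>\<sigma>. (\<Sum>k=1..m. ln (cmod (Complex \<sigma> t - lam k))) + (\<Sum>k=1..m. ln (cmod (Complex \<sigma> t - (1 + lam k))))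
    + ((\<sigma> - 1/2) / 2 * ln (real N) + (\<Sum>j=1..r. ln (cmod (Gamma_R (Complex \<sigma> t + \<mu> j))))) + ln (cmod (L (Complex \<sigma> t)))) has_real_derivative
    (\<Sum>k=1..m. Re (1 / (s - lam k))) + (\<Sum>k=1..m. Re (1 / (s - (1 + lam k))))
    + (1/2 * ln (real N) + (\<Sum>j=1..r. (Re (Digamma ((s + \<mu> j) / 2)) - ln pi) / 2)) + Re (deriv L s / L s)) (at (3/2))"
    unfolding s_def by (intro DERIV_add DERIV_sum ln_cmod_shift_deriv dG[unfolded s_def] dL[unfolded s_def] dN ne[unfolded s_def])
  moreover have "open ({1<..} :: real set)" by simp
  ultimately have "((\<lambda>\<sigma>. ln (cmod (Xi (Complex \<sigma> t)))) has_real_derivative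
    (\<Sum>k=1..m. Re (1 / (s - lam k))) + (\<Sum>k=1..m. Re (1 / (s - (1 + lam k))))
    + (1/2 * ln (real N) + (\<Sum>j=1..r. (Re (Digamma ((s + \<mu> j) / 2)) - ln pi) / 2)) + Re (deriv L s / L s)) (at (3/2))"
  proof (rule has_field_derivative_transform_within_open)
    fix \<sigma> :: real assume "\<sigma> \<in> {1<..}"
    then show "(\<Sum>k=1..m. ln (cmod (Complex \<sigma> t - lam k))) + (\<Sum>k=1..m. ln (cmod (Complex \<sigma> t - (1 + lam k))))
    + ((\<sigma> - 1/2) / 2 * ln (real N) + (\<Sum>j=1..r. ln (cmod (Gamma_R (Complex \<sigma> t + \<mu> j))))) + ln (cmod (L (Complex \<sigma> t)))
      = ln (cmod (Xi (Complex \<sigma> t)))"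
      using ln_Xi[of "Complex \<sigma> t"] nz[of \<sigma>] pole_L(3)[of "Complex \<sigma> t"] theta_range by fastforce
  qed simp
  from DERIV_unique[OF dX this]
  have e: "Re (deriv Xi s / Xi s) = (\<Sum>k=1..m. Re (1 / (s - lam k))) + (\<Sum>k=1..m. Re (1 / (s - (1 + lam k))))
    + (1/2 * ln (real N) + (\<Sum>j=1..r. (Re (Digamma ((s + \<mu> j) / 2)) - ln pi) / 2)) + Re (deriv L s / L s)" .
  have inv: "Re (1 / (s - w)) \<le> a / X\<^sup>2" if "a \<ge> 0" "Re (s - w) = a" "(t - Im w)\<^sup>2 \<ge> X\<^sup>2" for w a
  proof -
    have im: "Im (s - w) = t - Im w" by (simp add: s_def)
    have "Re (1 / (s - w)) = a / (a\<^sup>2 + (t - Im w)\<^sup>2)"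
      unfolding Re_divide that(2) im by simp
    also have "\<dots> \<le> a / X\<^sup>2"
    proof (rule frac_le)
      have "0 \<le> a\<^sup>2" by simp
      then show "X\<^sup>2 \<le> a\<^sup>2 + (t - Im w)\<^sup>2" using that(3) by linarith
    qed (use that X2 in auto)
    finally show ?thesis .
  qed
  have "(\<Sum>k=1..m. Re (1 / (s - lam k))) \<le> (\<Sum>k=1..m. (3/2) / X\<^sup>2)"
    by (intro sum_mono inv lt) (auto simp: s_def lambda_imaginary)
  moreover have "(\<Sum>k=1..m. Re (1 / (s - (1 + lam k)))) \<le> (\<Sum>k=1..m. (1/2) / X\<^sup>2)"
    by (intro sum_mono inv) (use lt in \<open>auto simp: s_def lambda_imaginary\<close>)
  moreover have "(\<Sum>k=1..m. (3/2) / X\<^sup>2) + (\<Sum>k=1..m. (1/2) / X\<^sup>2) = real m * (2 / X\<^sup>2)"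
    by (simp add: sum.distrib[symmetric] add_divide_distrib[symmetric] distrib_left[symmetric])
  moreover have "real m * (2 / X\<^sup>2) \<le> real r * (2 / X\<^sup>2)" using m_le_r by (intro mult_right_mono) auto
  moreover have "Re (deriv L s / L s) \<le> real r * (deriv (z_theta \<theta>) (3/2) / z_theta \<theta> (3/2))"
    unfolding s_def by (rule logderiv_L_bound)
  ultimately show ?thesis using e unfolding s_def by linarith
qed

text \<open>Expressing L through \<open>Xi\<close> at \<sigma> and at \<sigma> + 1 bounds ln |L|
  below by its shifted value, minus the increment of ln |\<open>Xi\<close>|, plus the gamma
  increments. The shifted value is bounded by \<open>z_theta\<close>, the \<open>Xi\<close>
  increment by ln 4 times the log-derivative at 3/2. The gamma parts of the last two are compared in
  \<open>Gamma_R_estimate\<close>.\<close>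

lemma strip_integral_lower:
  assumes t: "\<And>j. j \<in> {1..r} \<Longrightarrow> (t + Im (\<mu> j))\<^sup>2 \<ge> (5/2 + Re (\<mu> j))\<^sup>2 + X\<^sup>2" and X: "X > 5"
  shows "- integral {1/2..3/2} (\<lambda>\<sigma>. ln (cmod (L (Complex \<sigma> t)))) \<le> - real r * integral {3/2..5/2} (\<lambda>\<sigma>. ln (z_theta \<theta> \<sigma>))
    + real r * (ln 4 * (deriv (z_theta \<theta>) (3/2) / z_theta \<theta> (3/2)))
    + (ln 2 - 1/2) * ln (cmod (Q_fun r N \<mu> (Complex (3/2) t))) + real r * (1 / (4 * sqrt 2 * X) + 5 / X\<^sup>2)"
proof -
  have X0: "X > 0" "X\<^sup>2 > 0" using X by auto
  define f where "f = (\<lambda>\<sigma>. ln (cmod (L (Complex \<sigma> t))))"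
  define x where "x = (\<lambda>\<sigma>. ln (cmod (Xi (Complex \<sigma> t))))"
  define g where "g = (\<lambda>j \<sigma>. ln (cmod (Gamma_R (Complex \<sigma> t + \<mu> j))))"
  define g' where "g' = (\<lambda>j. (Re (Digamma ((Complex (3/2) t + \<mu> j) / 2)) - ln pi) / 2)"
  define lv where "lv = (\<lambda>j. ln (cmod (Complex (3/2) t + \<mu> j) / (2 * pi)))"
  define zd where "zd = deriv (z_theta \<theta>) (3/2) / z_theta \<theta> (3/2)"
  define n where "n = ln (real N)"
  obtain I where I: "((\<lambda>\<sigma>. x (\<sigma> + 1) - x \<sigma>) has_integral I) {1/2..3/2}"
    and Ib: "I \<le> ln 4 * Re (deriv Xi (Complex (3/2) t) / Xi (Complex (3/2) t))"
    using xi_log_integral[OF Xi_holo exp_growth_Xi _ _ Xi_sym Xi_zeros, of t] unfolding x_def by auto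
  have "\<forall>j\<in>{1..r}. \<exists>I. ((\<lambda>\<sigma>. g j (\<sigma> + 1) - g j \<sigma>) has_integral I) {1/2..3/2}
    \<and> ln 4 * g' j - I \<le> (ln 2 - 1/2) * lv j + 1 / (4 * sqrt 2 * X) + 11/5 / X\<^sup>2"
    unfolding g_def g'_def lv_def using Gamma_R_estimate[OF Re_mu_lower X t] by blast
  from bchoice[OF this] obtain G where GG: "\<forall>j\<in>{1..r}. ((\<lambda>\<sigma>. g j (\<sigma> + 1) - g j \<sigma>) has_integral G j) {1/2..3/2}
    \<and> ln 4 * g' j - G j \<le> (ln 2 - 1/2) * lv j + 1 / (4 * sqrt 2 * X) + 11/5 / X\<^sup>2" by blast
  have G: "((\<lambda>\<sigma>. g j (\<sigma> + 1) - g j \<sigma>) has_integral G j) {1/2..3/2}" if "j \<in> {1..r}" for j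
    using GG that by blast
  have Gb: "ln 4 * g' j - G j \<le> (ln 2 - 1/2) * lv j + 1 / (4 * sqrt 2 * X) + 11/5 / X\<^sup>2" if "j \<in> {1..r}" for j
    using GG that by blast
  have f1: "(f has_integral integral {1/2..3/2} f) {1/2..3/2}"
    using ln_L_integrable by (simp add: f_def integrable_integral)
  have lt: "(t - Im (lam k))\<^sup>2 \<ge> X\<^sup>2" if "k \<in> {1..m}" for k by (rule lam_high[OF t that])
  have np: "\<not> is_pole L (Complex \<sigma> t)" for \<sigma>
  proof
    assume "is_pole L (Complex \<sigma> t)"
    then obtain k where k: "k \<in> {1..m}" "Complex \<sigma> t = 1 + lam k" using pole_L_iff by blast
    then have "t - Im (lam k) = 0" by (simp add: complex_eq_iff)
    then show False using lt[OF k(1)] X0 by simp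
  qed
  define N0 where "N0 = {\<sigma>. Xi (Complex \<sigma> t) = 0}"
  \<comment> \<open>The summand n / 2 is the increment of the conductor factor over one unit of
    \<sigma>.\<close>
  define h where "h = (\<lambda>\<sigma>. - (x (\<sigma> + 1) - x \<sigma>) + n / 2 + (\<Sum>j=1..r. g j (\<sigma> + 1) - g j \<sigma>))"
  have hi: "(h has_integral (- I + n / 2 + (\<Sum>j=1..r. G j))) {1/2..3/2}"
  proof -
    have "((\<lambda>_. n / 2) has_integral n / 2) {1/2..3/2::real}"
      using has_integral_const_real[of "n / 2" "1/2" "3/2"] by simp
    then show ?thesis unfolding h_def by (intro has_integral_add has_integral_neg has_integral_sum I G) auto
  qed
  have low: "h \<sigma> + f (\<sigma> + 1) \<le> f \<sigma>" if \<sigma>: "\<sigma> \<in> {1/2..3/2}" "\<sigma> \<notin> N0" for \<sigma>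
  proof -
    have th: "Re (Complex \<sigma> t) > \<theta>" "Re (Complex (\<sigma> + 1) t) > \<theta>" using \<sigma> theta_range by auto
    have nz: "Xi (Complex \<sigma> t) \<noteq> 0" "Xi (Complex (\<sigma> + 1) t) \<noteq> 0"
      using \<sigma> Xi_right_nz[of "Complex (\<sigma> + 1) t"] by (auto simp: N0_def)
    note e = ln_Xi[OF th(1) nz(1) np] ln_Xi[OF th(2) nz(2) np]
    have s1: "Complex (\<sigma> + 1) t - (1 + w) = Complex \<sigma> t - w" for w by (simp add: complex_eq_iff)
    \<comment> \<open>The increment of P(s) P(s - 1) is P(s + 1) / P(s - 1), the common factor P(s)
      cancelling. Its modulus is at least 1, since \<sigma> + 1 \<ge> |\<sigma> - 1|, so the
      polynomial part helps.\<close>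
    have "(\<Sum>k=1..m. ln (cmod (Complex \<sigma> t - (1 + lam k)))) \<le> (\<Sum>k=1..m. ln (cmod (Complex (\<sigma> + 1) t - lam k)))"
    proof (rule sum_mono)
      fix k assume k: "k \<in> {1..m}"
      have "Im (Complex \<sigma> t - (1 + lam k)) \<noteq> 0" using lt[OF k] X0 by auto
      then have "Complex \<sigma> t - (1 + lam k) \<noteq> 0" by (metis zero_complex.sel(2))
      moreover have "(\<sigma> - 1)\<^sup>2 \<le> (\<sigma> + 1)\<^sup>2" using \<sigma> by (intro abs_le_square_iff[THEN iffD1]) auto
      then have "cmod (Complex \<sigma> t - (1 + lam k)) \<le> cmod (Complex (\<sigma> + 1) t - lam k)"
        unfolding cmod_def by (simp add: lambda_imaginary[OF k])
      ultimately show "ln (cmod (Complex \<sigma> t - (1 + lam k))) \<le> ln (cmod (Complex (\<sigma> + 1) t - lam k))"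
        by (intro ln_mono) auto
    qed
    moreover have "(\<Sum>j=1..r. g j (\<sigma> + 1) - g j \<sigma>) = (\<Sum>j=1..r. g j (\<sigma> + 1)) - (\<Sum>j=1..r. g j \<sigma>)"
      by (rule sum_subtractf)
    moreover have "((\<sigma> + 1) - 1/2) / 2 * n - (\<sigma> - 1/2) / 2 * n = n / 2" by (simp add: field_simps)
    ultimately show ?thesis using e unfolding s1 h_def f_def x_def g_def n_def complex.sel by linarith
  qed
  have zi: "((\<lambda>\<sigma>. ln (z_theta \<theta> (\<sigma> + 1))) has_integral integral {3/2..5/2} (\<lambda>\<sigma>. ln (z_theta \<theta> \<sigma>))) {1/2..3/2}"
  proof -
    have "continuous_on {1/2..3/2} (\<lambda>\<sigma>. ln (z_theta \<theta> (\<sigma> + 1)))"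
      by (rule continuous_on_compose2[OF continuous_ln_theta(2)]) (use theta_range in \<open>auto intro!: continuous_intros\<close>)
    then have "((\<lambda>\<sigma>. ln (z_theta \<theta> (\<sigma> + 1))) has_integral integral {1/2..3/2} (\<lambda>\<sigma>. ln (z_theta \<theta> (\<sigma> + 1)))) {1/2..3/2}"
      by (intro integrable_integral integrable_continuous_interval)
    then show ?thesis using integral_shift_real_ivl[of "3/2" 1 "5/2" "\<lambda>\<sigma>. ln (z_theta \<theta> \<sigma>)"] by simp
  qed
  define Iz where "Iz = integral {3/2..5/2} (\<lambda>\<sigma>. ln (z_theta \<theta> \<sigma>))"
  define k where "k = (\<lambda>\<sigma>. h \<sigma> + real r * ln (z_theta \<theta> (\<sigma> + 1)))"
  have k: "(k has_integral (- I + n / 2 + (\<Sum>j=1..r. G j) + real r * Iz)) {1/2..3/2}"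
    unfolding k_def Iz_def by (intro has_integral_add hi has_integral_mult_right zi)
  have k': "((\<lambda>\<sigma>. if \<sigma> \<in> N0 then f \<sigma> else k \<sigma>) has_integral (- I + n / 2 + (\<Sum>j=1..r. G j) + real r * Iz)) {1/2..3/2}"
    by (rule has_integral_spike[OF negligible_Xi_zeros _ k, of t]) (auto simp: N0_def)
  have "- I + n / 2 + (\<Sum>j=1..r. G j) + real r * Iz \<le> integral {1/2..3/2} f"
  proof (rule has_integral_le[OF k' f1])
    fix \<sigma> :: real assume \<sigma>: "\<sigma> \<in> {1/2..3/2}"
    show "(if \<sigma> \<in> N0 then f \<sigma> else k \<sigma>) \<le> f \<sigma>"
    proof (cases "\<sigma> \<in> N0")
      case False
      have "Re (Complex (\<sigma> + 1) t) > 1 + \<theta>" using \<sigma> theta_range by simp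
      from ln_L_bounds(2)[OF this] low[OF \<sigma> False] show ?thesis using False by (simp add: k_def f_def)
    qed simp
  qed
  then have 1: "- integral {1/2..3/2} f \<le> I - n / 2 - (\<Sum>j=1..r. G j) - real r * Iz" by linarith
  have l4: "ln 4 = 2 * ln (2::real)" using ln_realpow[of 2 2] by simp
  have "I \<le> ln 4 * (real r * zd + 1/2 * n + (\<Sum>j=1..r. g' j) + real r * (2 / X\<^sup>2))"
    using Ib mult_left_mono[OF logderiv_Xi_bound[OF t X0(1)], of "ln 4"] unfolding zd_def n_def g'_def
    by (rule order_trans) auto
  then have 2: "I \<le> ln 4 * (real r * zd) + ln 2 * n + (\<Sum>j=1..r. ln 4 * g' j) + ln 4 * (real r * (2 / X\<^sup>2))"
    by (simp only: distrib_left sum_distrib_left) (simp add: l4)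
  have "(\<Sum>j=1..r. ln 4 * g' j) - (\<Sum>j=1..r. G j) = (\<Sum>j=1..r. ln 4 * g' j - G j)" by (simp add: sum_subtractf)
  also have "\<dots> \<le> (\<Sum>j=1..r. (ln 2 - 1/2) * lv j + (1 / (4 * sqrt 2 * X) + 11/5 / X\<^sup>2))"
    using Gb by (intro sum_mono) (simp add: add.assoc)
  also have "\<dots> = (ln 2 - 1/2) * (\<Sum>j=1..r. lv j) + real r * (1 / (4 * sqrt 2 * X) + 11/5 / X\<^sup>2)"
    by (simp add: sum.distrib sum_distrib_left)
  finally have 3: "(\<Sum>j=1..r. ln 4 * g' j) - (\<Sum>j=1..r. G j) \<le> (ln 2 - 1/2) * (\<Sum>j=1..r. lv j) + real r * (1 / (4 * sqrt 2 * X) + 11/5 / X\<^sup>2)" .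
  have "ln (cmod (Q_fun r N \<mu> (Complex (3/2) t))) = n + (\<Sum>j=1..r. lv j)"
    unfolding n_def lv_def
  proof (rule ln_norm_Q(2))
    fix j assume "j \<in> {1..r}"
    then show "Complex (3/2) t + \<mu> j \<noteq> 0" using Re_mu_lower[of j] by (auto simp: complex_eq_iff)
  qed
  then have 4: "(ln 2 - 1/2) * ln (cmod (Q_fun r N \<mu> (Complex (3/2) t))) = ln 2 * n - n / 2 + (ln 2 - 1/2) * (\<Sum>j=1..r. lv j)"
    by (simp add: algebra_simps)
  have 5: "ln 4 * (real r * (2 / X\<^sup>2)) + real r * (1 / (4 * sqrt 2 * X) + 11/5 / X\<^sup>2) \<le> real r * (1 / (4 * sqrt 2 * X) + 5 / X\<^sup>2)"
  proof -
    \<comment> \<open>2 ln 4 \<le> 25/9 leaves just enough room below 5, the constant that also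
      arises at the other end.\<close>
    have "ln 4 * 2 + 11/5 \<le> (5::real)" using ln2_le_25_over_36 l4 by simp
    then have "real r * ((ln 4 * 2 + 11/5) / X\<^sup>2) \<le> real r * (5 / X\<^sup>2)" by (intro mult_left_mono divide_right_mono) auto
    then show ?thesis by (simp add: algebra_simps add_divide_distrib)
  qed
  have "- integral {1/2..3/2} f \<le> - (real r * Iz) + ln 4 * (real r * zd) + (ln 2 - 1/2) * ln (cmod (Q_fun r N \<mu> (Complex (3/2) t))) + real r * (1 / (4 * sqrt 2 * X) + 5 / X\<^sup>2)"
    using 1 2 3 4 5 by linarith
  moreover have "ln 4 * (real r * zd) = real r * (ln 4 * zd)" by (rule mult.left_commute)
  ultimately show ?thesis by (simp only: f_def Iz_def zd_def mult_minus_left)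
qed

text \<open>The upper estimate is used at \<open>t2\<close> and the lower at \<open>t1\<close>;
  their difference is r times the integral of ln (Z / z) in the constant.\<close>

lemma tail_integral_bounds:
  "integral {1/2..} (\<lambda>\<sigma>. ln (cmod (L (Complex \<sigma> t)))) - integral {1/2..3/2} (\<lambda>\<sigma>. ln (cmod (L (Complex \<sigma> t))))
     \<in> {real r * integral {3/2<..} (\<lambda>\<sigma>. ln (z_theta \<theta> \<sigma>)) .. real r * integral {3/2<..} (\<lambda>\<sigma>. ln (Z_theta \<theta> \<sigma>))}"
proof -
  define f where "f = (\<lambda>\<sigma>. ln (cmod (L (Complex \<sigma> t))))"
  have "(f has_integral integral {1/2..} f) {1/2..}" "(f has_integral integral {1/2..3/2} f) {1/2..3/2}"
    using littlewood(1) ln_L_integrable by (simp_all add: f_def integrable_integral)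
  then have "(f has_integral (integral {1/2..} f - integral {1/2..3/2} f)) ({1/2..} - {1/2..3/2})"
    by (rule has_integral_setdiff) (simp add: Diff_eq_empty_iff[THEN iffD2])
  moreover have "{1/2..} - {1/2..3/2} = ({3/2<..} :: real set)" by auto
  ultimately have f: "(f has_integral (integral {1/2..} f - integral {1/2..3/2} f)) {3/2<..}" by simp
  have Z: "((\<lambda>\<sigma>. real r * ln (Z_theta \<theta> \<sigma>)) has_integral real r * integral {3/2<..} (\<lambda>\<sigma>. ln (Z_theta \<theta> \<sigma>))) {3/2<..}"
    by (intro has_integral_mult_right integrable_integral set_borel_integral_eq_integral(1) set_integrable_ln_theta)
  have z: "((\<lambda>\<sigma>. real r * ln (z_theta \<theta> \<sigma>)) has_integral real r * integral {3/2<..} (\<lambda>\<sigma>. ln (z_theta \<theta> \<sigma>))) {3/2<..}"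
    by (intro has_integral_mult_right integrable_integral set_borel_integral_eq_integral(1) set_integrable_ln_theta)
  have b: "real r * ln (z_theta \<theta> \<sigma>) \<le> f \<sigma>" "f \<sigma> \<le> real r * ln (Z_theta \<theta> \<sigma>)" if "\<sigma> \<in> {3/2<..}" for \<sigma>
  proof -
    have "Re (Complex \<sigma> t) > 1 + \<theta>" using that theta_range by simp
    from ln_L_bounds[OF this] show "real r * ln (z_theta \<theta> \<sigma>) \<le> f \<sigma>" "f \<sigma> \<le> real r * ln (Z_theta \<theta> \<sigma>)" by (simp_all add: f_def)
  qed
  show ?thesis unfolding f_def[symmetric] using has_integral_le[OF z f b(1)] has_integral_le[OF f Z b(2)] by simp
qed

lemma c_theta_eq:
  "c_theta \<theta> = ln (Z_theta \<theta> (3/2)) + (integral {3/2<..} (\<lambda>\<sigma>. ln (Z_theta \<theta> \<sigma>)) - integral {3/2<..} (\<lambda>\<sigma>. ln (z_theta \<theta> \<sigma>)))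
    - integral {3/2..5/2} (\<lambda>\<sigma>. ln (z_theta \<theta> \<sigma>)) + ln 4 * (deriv (z_theta \<theta>) (3/2) / z_theta \<theta> (3/2))"
proof -
  have "(LBINT \<sigma>=ereal (3/2)..\<infinity>. ln (Z_theta \<theta> \<sigma> / z_theta \<theta> \<sigma>)) = (LBINT \<sigma>=ereal (3/2)..\<infinity>. ln (Z_theta \<theta> \<sigma>) - ln (z_theta \<theta> \<sigma>))"
  proof (rule interval_integral_cong)
    fix \<sigma> assume "\<sigma> \<in> einterval (min (ereal (3/2)) \<infinity>) (max (ereal (3/2)) \<infinity>)"
    then have "\<sigma> > 1 + \<theta>" using theta_range by (auto simp: min_def max_def)
    from z_theta_pos[OF this] show "ln (Z_theta \<theta> \<sigma> / z_theta \<theta> \<sigma>) = ln (Z_theta \<theta> \<sigma>) - ln (z_theta \<theta> \<sigma>)"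
      by (simp add: ln_div)
  qed
  also have "\<dots> = (LBINT \<sigma>:{3/2<..}. ln (Z_theta \<theta> \<sigma>) - ln (z_theta \<theta> \<sigma>))"
    by (simp add: interval_integral_Ioi)
  also have "\<dots> = (LBINT \<sigma>:{3/2<..}. ln (Z_theta \<theta> \<sigma>)) - (LBINT \<sigma>:{3/2<..}. ln (z_theta \<theta> \<sigma>))"
    by (intro set_integral_diff(2) set_integrable_ln_theta)
  also have "\<dots> = integral {3/2<..} (\<lambda>\<sigma>. ln (Z_theta \<theta> \<sigma>)) - integral {3/2<..} (\<lambda>\<sigma>. ln (z_theta \<theta> \<sigma>))"
    by (simp add: set_borel_integral_eq_integral(2) set_integrable_ln_theta)
  finally have 1: "(LBINT \<sigma>=ereal (3/2)..\<infinity>. ln (Z_theta \<theta> \<sigma> / z_theta \<theta> \<sigma>))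
    = integral {3/2<..} (\<lambda>\<sigma>. ln (Z_theta \<theta> \<sigma>)) - integral {3/2<..} (\<lambda>\<sigma>. ln (z_theta \<theta> \<sigma>))" .
  have "(LBINT \<sigma>=ereal (3/2)..ereal (5/2). ln (z_theta \<theta> \<sigma>)) = integral {3/2..5/2} (\<lambda>\<sigma>. ln (z_theta \<theta> \<sigma>))"
    by (intro interval_integral_eq_integral borel_integrable_atLeastAtMost' continuous_on_subset[OF continuous_ln_theta(2)])
       (use theta_range in auto)
  then show ?thesis unfolding c_theta_def 1 by simp
qed

end

theorem theorem4p5:
  fixes r N m :: nat
    and \<alpha> :: "nat \<Rightarrow> nat \<Rightarrow> complex"
    and \<epsilon> :: complex
    and \<mu> lam :: "nat \<Rightarrow> complex"
    and L :: "complex \<Rightarrow> complex"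
    and \<theta> X t\<^sub>1 t\<^sub>2 :: real
  assumes "L_function r \<alpha> \<epsilon> N \<mu> L m lam \<theta>"
    and "X > 5"
    and "\<And>j. j \<in> {1..r} \<Longrightarrow> (t\<^sub>1 + Im (\<mu> j))\<^sup>2 \<ge> (5/2 + Re (\<mu> j))\<^sup>2 + X\<^sup>2"
    and "\<And>j. j \<in> {1..r} \<Longrightarrow> (t\<^sub>2 + Im (\<mu> j))\<^sup>2 \<ge> (5/2 + Re (\<mu> j))\<^sup>2 + X\<^sup>2"
  shows "pi * (LBINT t=ereal t\<^sub>1..ereal t\<^sub>2. S_fun (completed_L r \<epsilon> N \<mu> L) L t)
         \<le> 1/4 * ln (norm (Q_fun r N \<mu> (Complex (3/2) t\<^sub>2)))
           + (ln 2 - 1/2) * ln (norm (Q_fun r N \<mu> (Complex (3/2) t\<^sub>1)))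
           + c_theta \<theta> * real r
           + real r / (sqrt 2 * (X - 5))"
proof -
  interpret L_function r \<alpha> \<epsilon> N \<mu> L m lam \<theta> by (rule assms(1))
  have X: "X > 0" using assms(2) by simp
  \<comment> \<open>Each of the two segments contributes r E, which is why
    \<open>error_bound\<close> carries a factor 2.\<close>
  define E where "E = 1 / (4 * sqrt 2 * X) + 5 / X\<^sup>2"
  have "real r * (2 * E) \<le> real r * (1 / (sqrt 2 * (X - 5)))"
    unfolding E_def using error_bound[OF assms(2)] by (intro mult_left_mono) auto
  then have e: "real r * E + real r * E \<le> real r / (sqrt 2 * (X - 5))" by (simp add: mult.left_commute mult.commute[of E])
  have c: "c_theta \<theta> * real r = real r * ln (Z_theta \<theta> (3/2))
    + (real r * integral {3/2<..} (\<lambda>\<sigma>. ln (Z_theta \<theta> \<sigma>)) - real r * integral {3/2<..} (\<lambda>\<sigma>. ln (z_theta \<theta> \<sigma>)))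
    - real r * integral {3/2..5/2} (\<lambda>\<sigma>. ln (z_theta \<theta> \<sigma>)) + real r * (ln 4 * (deriv (z_theta \<theta>) (3/2) / z_theta \<theta> (3/2)))"
    unfolding c_theta_eq by (subst mult.commute) (simp only: distrib_left right_diff_distrib)
  show ?thesis
    using strip_integral_upper[OF assms(4) X] strip_integral_lower[OF assms(3) assms(2)]
      tail_integral_bounds[of t\<^sub>1] tail_integral_bounds[of t\<^sub>2] e
    unfolding littlewood(2) c atLeastAtMost_iff E_def[symmetric] by linarith
qed

end
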